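(* Let $1\le d\le3$. Assume [H2] and [H3] (see context), let $f\in L^2(D)$, let $u_0=\mathcal Gf$ be continuous on $D$, and let $u_\varepsilon$ be the solution of the perturbed problem with the modified potential $q_\varepsilon$. Let $M_k\in L^2(D)$, $1\le k\le K$, be sufficiently smooth that the functions $$m_k(\mathbf y)=-\int_D M_k(\mathbf x)G(\mathbf x,\mathbf y)u_0(\mathbf y)\,d\mathbf x=-\mathcal GM_k(\mathbf y)\,u_0(\mathbf y)$$ are continuous, and set $$I_{k\varepsilon}(\omega)=\int_D m_k(\mathbf y)\,\frac1{\varepsilon^{d/2}}\,q\Big(\frac{\mathbf y}\varepsilon,\omega\Big)d\mathbf y .$$ Then, as $\varepsilon\to0$, the random variables $(I_{k\varepsilon})_{1\le k\le K}$ converge (jointly) in distribution to mean-zero Gaussian random variables $(I_k)_{1\le k\le K}$ with correlation matrix $$\Sigma_{jk}=\mathbb E\{I_jI_k\}=\sigma^2\int_D m_j(\mathbf y)m_k(\mathbf y)\,d\mathbf y,\qquad \sigma^2=\int_{\mathbb R^d}\mathbb E\{q(\mathbf 0)q(\mathbf y)\}\,d\mathbf y,\ \sigma\ge0.$$ Moreover one has the stochastic representation $I_k(\omega)=\int_D m_k(\mathbf y)\,\sigma\,dW_{\mathbf y}$, where $dW_{\mathbf y}$ is the standard multi-parameter Wiener process (white noise on $\mathbb{R}^d$). As a result, for every $M\in L^2(D)$ sufficiently smooth (so that $\mathcal GM\,u_0$ is continuous), $$\Big(\frac{u_\varepsilon-u_0}{\varepsilon^{d/2}},M\Big)\ \longrightarrow\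 -\sigma\int_D\mathcal GM(\mathbf y)\,\mathcal Gf(\mathbf y)\,dW_{\mathbf y}\qquad\text{in distribution as }\varepsilon\to0,$$ where $(\cdot,\cdot)$ is the $L^2(D)$ inner product.
   Context: $D\subset\mathbb R^d$ is a bounded open set with sufficiently smooth boundary; $\|\cdot\|$ denotes the $L^2(D)$ norm or the operator norm on $\mathcal L(L^2(D))$. $P(\mathbf x,\mathbf D)$ is a deterministic self-adjoint elliptic pseudo-differential operator such that $Pu=f$ in $D$, $u=0$ on $\partial D$, has a unique solution $u(\mathbf x)=\mathcal G f(\mathbf x)=\int_D G(\mathbf x,\mathbf y)f(\mathbf y)\,d\mathbf y$, where $G$ is real-valued, non-negative, symmetric, and $\sup_{\mathbf x\in D}\int_D |G|^{2+\eta}(\mathbf x,\mathbf y)\,d\mathbf y<\infty$ for some $\eta>0$. Random field: $q(\mathbf x,\omega)$, $\mathbf x\in\mathbb R^d$, is a real, mean-zero, strictly stationary process on a probability space $(\Omega,\mathcal F,\mathbb P)$, with integrable correlation function $R(\mathbf x)=\mathbb E\{q(\mathbf y)q(\mathbf y+\mathbf x)\}$. [H2]: $\mathbb E\{q^6\}<\infty$ and $q$ is strongly mixing: there is a bounded decreasing function $\varphi:[0,\infty)\to[0,\infty)$ with $r^{d-1}\varphi^{1/2}(r)$ integrable on $\mathbb R^+$ such that for all Borel sets $A,B\subset\mathbb R^d$ at Euclidean distance $d(A,B)$ and all real square-integrable random variables $\zeta,\xi$ measurable with respect to the $\sigma$-algebras generated by $q$ restricted to $A$ and $B$ respectively, $$\big|\mathbb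 E\{(\zeta-\mathbb E\zeta)(\xi-\mathbb E\xi)\}\big|\le \varphi(2\,d(A,B))\,(\mathbb E\{\zeta^2\}\mathbb E\{\xi^2\})^{1/2}.$$ Modified potential: $\tilde q_\varepsilon(\mathbf x,\omega)=q(\mathbf x/\varepsilon,\omega)$; fix $0<\rho<1$, let $\Omega_\varepsilon=\{\omega:\|\mathcal G\tilde q_\varepsilon\mathcal G\tilde q_\varepsilon\|>\rho\}$, and set $q_\varepsilon=\tilde q_\varepsilon$ on $\Omega\setminus\Omega_\varepsilon$, $q_\varepsilon=0$ on $\Omega_\varepsilon$ (potentials act as multiplication operators). [H3]: $\lim_{\varepsilon\to0}\mathbb E\big\{\chi_{\Omega_\varepsilon}(\omega)\,\|\varepsilon^{-d/2}q(\cdot/\varepsilon,\omega)\|\big\}=0$. The perturbed problem is $Pu_\varepsilon+q_\varepsilon u_\varepsilon=f$ in $D$, $u_\varepsilon=0$ on $\partial D$, understood through the equation $u_\varepsilon=\mathcal G f-\mathcal Gq_\varepsilon\mathcal Gf+\mathcal Gq_\varepsilon\mathcal Gq_\varepsilon u_\varepsilon$, which is uniquely solvable $\mathbb P$-a.s. *)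

theory Defs
  imports "HOL-Probability.Probability"
begin

section \<open>Smooth functions and domains\<close>

fun iter_deriv :: "'a list \<Rightarrow> ('a::euclidean_space \<Rightarrow> 'b::real_normed_vector) \<Rightarrow> 'a \<Rightarrow> 'b" where
  "iter_deriv [] f = f"
| "iter_deriv (v # vs) f = (\<lambda>x. frechet_derivative (iter_deriv vs f) (at x) v)"

text \<open>Meaningful for open \<open>S\<close>.\<close>

definition Ck_on :: "nat \<Rightarrow> 'a::euclidean_space set \<Rightarrow> ('a \<Rightarrow> 'b::real_normed_vector) \<Rightarrow> bool" where
  "Ck_on k S f \<longleftrightarrow> (\<forall>vs. set vs \<subseteq> Basis \<and> length vs \<le> k \<longrightarrow>
     continuous_on S (iter_deriv vs f) \<and>
     (length vs < k \<longrightarrow> iter_deriv vs f differentiable_on S))"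

definition smooth_on :: "'a::euclidean_space set \<Rightarrow> ('a \<Rightarrow> 'b::real_normed_vector) \<Rightarrow> bool" where
  "smooth_on S f \<longleftrightarrow> (\<forall>k. Ck_on k S f)"

definition Ck_boundary :: "nat \<Rightarrow> 'a::euclidean_space set \<Rightarrow> bool" where
  "Ck_boundary k D \<longleftrightarrow> (\<forall>x \<in> frontier D. \<exists>U (\<psi> :: 'a \<Rightarrow> real).
     open U \<and> x \<in> U \<and> Ck_on k U \<psi> \<and>
     (\<forall>z\<in>U. \<exists>v. frechet_derivative \<psi> (at z) v \<noteq> 0) \<and>
     D \<inter> U = {z \<in> U. \<psi> z < 0} \<and> frontier D \<inter> U = {z \<in> U. \<psi> z = 0})"

definition test_fun :: "'a::euclidean_space set \<Rightarrow> ('a \<Rightarrow> real) \<Rightarrow> bool" where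
  "test_fun D \<phi> \<longleftrightarrow> smooth_on UNIV \<phi> \<and>
     compact (closure {x. \<phi> x \<noteq> 0}) \<and> closure {x. \<phi> x \<noteq> 0} \<subseteq> D"

section \<open>The space L2(D)\<close>

text \<open>Elements of \<open>L\<^sup>2(D)\<close> are represented by functions that are Borel on \<open>D\<close>; equality in
  \<open>L\<^sup>2(D)\<close> is equality almost everywhere on \<open>D\<close>.\<close>

definition L2 :: "'a::euclidean_space set \<Rightarrow> ('a \<Rightarrow> real) set" where
  "L2 D = {u. set_borel_measurable lborel D u \<and> set_integrable lborel D (\<lambda>x. (u x)\<^sup>2)}"

definition ae_eq :: "'a::euclidean_space set \<Rightarrow> ('a \<Rightarrow> real) \<Rightarrow> ('a \<Rightarrow> real) \<Rightarrow> bool" where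
  "ae_eq D u v \<longleftrightarrow> (AE x\<in>D in lborel. u x = v x)"

definition inner_L2 :: "'a::euclidean_space set \<Rightarrow> ('a \<Rightarrow> real) \<Rightarrow> ('a \<Rightarrow> real) \<Rightarrow> real" where
  "inner_L2 D u v = (LINT x:D|lborel. u x * v x)"

text \<open>Norms take values in \<open>[0,\<infinity>]\<close>, so that functions outside \<open>L\<^sup>2(D)\<close> and unbounded operators
  get the norm \<open>\<infinity>\<close>.\<close>

definition norm_L2 :: "'a::euclidean_space set \<Rightarrow> ('a \<Rightarrow> real) \<Rightarrow> ennreal" where
  "norm_L2 D u = (let N = (\<integral>\<^sup>+x\<in>D. ennreal ((u x)\<^sup>2) \<partial>lborel)
     in if N = \<infinity> then \<infinity> else ennreal (sqrt (enn2real N)))"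

definition opnorm_L2 :: "'a::euclidean_space set \<Rightarrow> (('a \<Rightarrow> real) \<Rightarrow> ('a \<Rightarrow> real)) \<Rightarrow> ennreal" where
  "opnorm_L2 D T = (SUP u \<in> {u \<in> L2 D. norm_L2 D u \<le> 1}. norm_L2 D (T u))"

section \<open>The unperturbed problem\<close>

definition symbol_class :: "real \<Rightarrow> 'a::euclidean_space set \<Rightarrow> ('a \<times> 'a \<Rightarrow> complex) \<Rightarrow> bool" where
  "symbol_class m D p \<longleftrightarrow> smooth_on (D \<times> UNIV) p \<and>
     (\<forall>K as bs. compact K \<and> K \<subseteq> D \<and> set as \<subseteq> Basis \<and> set bs \<subseteq> Basis \<longrightarrow>
       (\<exists>C. \<forall>x\<in>K. \<forall>\<xi>. norm (iter_deriv (map (\<lambda>a. (a, 0)) as @ map (\<lambda>b. (0, b)) bs) p (x, \<xi>))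
          \<le> C * (1 + norm \<xi>) powr (m - real (length bs))))"

definition elliptic_symbol :: "real \<Rightarrow> 'a::euclidean_space set \<Rightarrow> ('a \<times> 'a \<Rightarrow> complex) \<Rightarrow> bool" where
  "elliptic_symbol m D p \<longleftrightarrow> (\<forall>K. compact K \<and> K \<subseteq> D \<longrightarrow>
     (\<exists>c>0. \<exists>r>0. \<forall>x\<in>K. \<forall>\<xi>. norm \<xi> \<ge> r \<longrightarrow> norm (p (x, \<xi>)) \<ge> c * norm \<xi> powr m))"

definition fourier :: "('a::euclidean_space \<Rightarrow> real) \<Rightarrow> 'a \<Rightarrow> complex" where
  "fourier \<phi> \<xi> = (LINT y|lborel. cis (- (y \<bullet> \<xi>)) * of_real (\<phi> y))"

definition Op :: "('a::euclidean_space \<times> 'a \<Rightarrow> complex) \<Rightarrow> ('a \<Rightarrow> real) \<Rightarrow> 'a \<Rightarrow> complex" where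
  "Op p \<phi> x =
     of_real (1 / (2 * pi) ^ DIM('a)) * (LINT \<xi>|lborel. cis (x \<bullet> \<xi>) * p (x, \<xi>) * fourier \<phi> \<xi>)"

text \<open>On test functions, \<open>P\<close> is the quantization of an elliptic symbol up to an operator with
  smooth kernel, which is the general form of a pseudo-differential operator on an open set.\<close>

definition elliptic_psido ::
  "'a::euclidean_space set \<Rightarrow> ('a \<Rightarrow> real) set \<Rightarrow> (('a \<Rightarrow> real) \<Rightarrow> ('a \<Rightarrow> real)) \<Rightarrow> bool" where
  "elliptic_psido D domP P \<longleftrightarrow> (\<exists>m p \<kappa>.
     symbol_class m D p \<and> elliptic_symbol m D p \<and> smooth_on (D \<times> D) \<kappa> \<and>
     (\<forall>\<phi>. test_fun D \<phi> \<longrightarrow> \<phi> \<in> domP \<and>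
       (AE x\<in>D in lborel.
          of_real (P \<phi> x) = Op p \<phi> x + (LINT y:D|lborel. \<kappa> (x, y) * of_real (\<phi> y)))))"

text \<open>The last conjunct says that \<open>P\<close> coincides with its adjoint, domains included. It entails
  that \<open>domP\<close> is a linear subspace closed under a.e. equality and that \<open>P\<close> is linear.\<close>

definition self_adjoint ::
  "'a::euclidean_space set \<Rightarrow> ('a \<Rightarrow> real) set \<Rightarrow> (('a \<Rightarrow> real) \<Rightarrow> ('a \<Rightarrow> real)) \<Rightarrow> bool" where
  "self_adjoint D domP P \<longleftrightarrow>
     domP \<subseteq> L2 D \<and> (\<forall>u\<in>domP. P u \<in> L2 D) \<and>
     (\<forall>v\<in>L2 D. \<forall>\<delta>>0. \<exists>u\<in>domP. norm_L2 D (\<lambda>x. v x - u x) < ennreal \<delta>) \<and>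
     (\<forall>v\<in>L2 D. \<forall>w\<in>L2 D.
        (v \<in> domP \<and> ae_eq D (P v) w) \<longleftrightarrow> (\<forall>u\<in>domP. inner_L2 D (P u) v = inner_L2 D u w))"

text \<open>The Dirichlet condition is part of the domain of \<open>P\<close>; it is required pointwise of those
  functions of the domain for which boundary values make classical sense.\<close>

definition dirichlet_domain :: "'a::euclidean_space set \<Rightarrow> ('a \<Rightarrow> real) set \<Rightarrow> bool" where
  "dirichlet_domain D domP \<longleftrightarrow>
     (\<forall>u\<in>domP. continuous_on (closure D) u \<longrightarrow> (\<forall>x\<in>frontier D. u x = 0))"

definition green :: "'a::euclidean_space set \<Rightarrow> ('a \<Rightarrow> 'a \<Rightarrow> real) \<Rightarrow> ('a \<Rightarrow> real) \<Rightarrow> 'a \<Rightarrow> real" where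
  "green D G f x = (LINT y:D|lborel. G x y * f y)"

definition green_function ::
  "'a::euclidean_space set \<Rightarrow> ('a \<Rightarrow> real) set \<Rightarrow> (('a \<Rightarrow> real) \<Rightarrow> ('a \<Rightarrow> real)) \<Rightarrow>
   ('a \<Rightarrow> 'a \<Rightarrow> real) \<Rightarrow> bool" where
  "green_function D domP P G \<longleftrightarrow>
     (\<forall>f\<in>L2 D. green D G f \<in> domP \<and> ae_eq D (P (green D G f)) f \<and>
        (\<forall>u\<in>domP. ae_eq D (P u) f \<longrightarrow> ae_eq D u (green D G f)))"

definition admissible_kernel :: "'a::euclidean_space set \<Rightarrow> ('a \<Rightarrow> 'a \<Rightarrow> real) \<Rightarrow> bool" where
  "admissible_kernel D G \<longleftrightarrow>
     set_borel_measurable (lborel \<Otimes>\<^sub>M lborel) (D \<times> D) (\<lambda>(x, y). G x y) \<and>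
     (\<forall>x\<in>D. \<forall>y\<in>D. G x y \<ge> 0 \<and> G x y = G y x) \<and>
     (\<exists>\<eta>>0. (SUP x\<in>D. \<integral>\<^sup>+y\<in>D. ennreal (\<bar>G x y\<bar> powr (2 + \<eta>)) \<partial>lborel) < \<infinity>)"

section \<open>The random field\<close>

definition strictly_stationary :: "'w measure \<Rightarrow> ('a::euclidean_space \<Rightarrow> 'w \<Rightarrow> real) \<Rightarrow> bool" where
  "strictly_stationary M q \<longleftrightarrow> (\<forall>J h. finite J \<longrightarrow>
     distr M (\<Pi>\<^sub>M x\<in>J. borel) (\<lambda>\<omega>. \<lambda>x\<in>J. q (x + h) \<omega>) =
     distr M (\<Pi>\<^sub>M x\<in>J. borel) (\<lambda>\<omega>. \<lambda>x\<in>J. q x \<omega>))"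

definition correlation :: "'w measure \<Rightarrow> ('a::euclidean_space \<Rightarrow> 'w \<Rightarrow> real) \<Rightarrow> 'a \<Rightarrow> real" where
  "correlation M q x = (LINT \<omega>|M. q 0 \<omega> * q x \<omega>)"

definition random_field :: "'w measure \<Rightarrow> ('a::euclidean_space \<Rightarrow> 'w \<Rightarrow> real) \<Rightarrow> bool" where
  "random_field M q \<longleftrightarrow> prob_space M \<and>
     (\<lambda>(x, \<omega>). q x \<omega>) \<in> borel_measurable (lborel \<Otimes>\<^sub>M M) \<and>
     (\<forall>x. integrable M (q x) \<and> (LINT \<omega>|M. q x \<omega>) = 0) \<and>
     strictly_stationary M q \<and>
     integrable lborel (correlation M q)"

definition field_sigma ::
  "'w measure \<Rightarrow> ('a::euclidean_space \<Rightarrow> 'w \<Rightarrow> real) \<Rightarrow> 'a set \<Rightarrow> 'w measure" where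
  "field_sigma M q A = sigma (space M) {q x -` S \<inter> space M | x S. x \<in> A \<and> S \<in> sets borel}"

definition strongly_mixing :: "'w measure \<Rightarrow> ('a::euclidean_space \<Rightarrow> 'w \<Rightarrow> real) \<Rightarrow> bool" where
  "strongly_mixing M q \<longleftrightarrow> (\<exists>\<phi> :: real \<Rightarrow> real.
     (\<forall>r\<ge>0. \<phi> r \<ge> 0) \<and> bounded (\<phi> ` {0..}) \<and> antimono_on {0..} \<phi> \<and>
     set_integrable lborel {0<..} (\<lambda>r. r ^ (DIM('a) - 1) * sqrt (\<phi> r)) \<and>
     (\<forall>A B \<zeta> \<xi>. A \<in> sets borel \<and> B \<in> sets borel \<and>
        \<zeta> \<in> borel_measurable (field_sigma M q A) \<and> integrable M (\<lambda>\<omega>. (\<zeta> \<omega>)\<^sup>2) \<and>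
        \<xi> \<in> borel_measurable (field_sigma M q B) \<and> integrable M (\<lambda>\<omega>. (\<xi> \<omega>)\<^sup>2) \<longrightarrow>
        \<bar>LINT \<omega>|M. (\<zeta> \<omega> - (LINT \<omega>'|M. \<zeta> \<omega>')) * (\<xi> \<omega> - (LINT \<omega>'|M. \<xi> \<omega>'))\<bar>
          \<le> \<phi> (2 * setdist A B) * sqrt ((LINT \<omega>|M. (\<zeta> \<omega>)\<^sup>2) * (LINT \<omega>|M. (\<xi> \<omega>)\<^sup>2))))"

definition H2 :: "'w measure \<Rightarrow> ('a::euclidean_space \<Rightarrow> 'w \<Rightarrow> real) \<Rightarrow> bool" where
  "H2 M q \<longleftrightarrow> (\<forall>x. integrable M (\<lambda>\<omega>. q x \<omega> ^ 6)) \<and> strongly_mixing M q"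

section \<open>The perturbed problem\<close>

definition q_scaled :: "('a::euclidean_space \<Rightarrow> 'w \<Rightarrow> real) \<Rightarrow> real \<Rightarrow> 'a \<Rightarrow> 'w \<Rightarrow> real" where
  "q_scaled q \<epsilon> x \<omega> = q (x /\<^sub>R \<epsilon>) \<omega>"

definition GqGq ::
  "'a::euclidean_space set \<Rightarrow> ('a \<Rightarrow> 'a \<Rightarrow> real) \<Rightarrow> ('a \<Rightarrow> real) \<Rightarrow> ('a \<Rightarrow> real) \<Rightarrow> 'a \<Rightarrow> real" where
  "GqGq D G V u = green D G (\<lambda>y. V y * green D G (\<lambda>z. V z * u z) y)"

definition bad_event ::
  "'w measure \<Rightarrow> 'a::euclidean_space set \<Rightarrow> ('a \<Rightarrow> 'a \<Rightarrow> real) \<Rightarrow>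
   ('a \<Rightarrow> 'w \<Rightarrow> real) \<Rightarrow> real \<Rightarrow> real \<Rightarrow> 'w set" where
  "bad_event M D G q \<rho> \<epsilon> =
     {\<omega> \<in> space M. opnorm_L2 D (GqGq D G (\<lambda>x. q_scaled q \<epsilon> x \<omega>)) > ennreal \<rho>}"

definition q_mod ::
  "'w measure \<Rightarrow> 'a::euclidean_space set \<Rightarrow> ('a \<Rightarrow> 'a \<Rightarrow> real) \<Rightarrow>
   ('a \<Rightarrow> 'w \<Rightarrow> real) \<Rightarrow> real \<Rightarrow> real \<Rightarrow> 'a \<Rightarrow> 'w \<Rightarrow> real" where
  "q_mod M D G q \<rho> \<epsilon> x \<omega> = (if \<omega> \<in> bad_event M D G q \<rho> \<epsilon> then 0 else q_scaled q \<epsilon> x \<omega>)"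

text \<open>The lower integral \<open>nn_integral\<close> is insensitive to null sets, hence is the expectation
  as soon as the integrand agrees almost surely with a measurable function.\<close>

definition H3 ::
  "'w measure \<Rightarrow> 'a::euclidean_space set \<Rightarrow> ('a \<Rightarrow> 'a \<Rightarrow> real) \<Rightarrow>
   ('a \<Rightarrow> 'w \<Rightarrow> real) \<Rightarrow> real \<Rightarrow> bool" where
  "H3 M D G q \<rho> \<longleftrightarrow>
     ((\<lambda>\<epsilon>. \<integral>\<^sup>+\<omega>. indicator (bad_event M D G q \<rho> \<epsilon>) \<omega> *
         norm_L2 D (\<lambda>x. q (x /\<^sub>R \<epsilon>) \<omega> / \<epsilon> powr (real DIM('a) / 2)) \<partial>M) \<longlongrightarrow> 0) (at_right 0)"

definition perturbed_solution ::
  "'w measure \<Rightarrow> 'a::euclidean_space set \<Rightarrow> ('a \<Rightarrow> 'a \<Rightarrow> real) \<Rightarrow> ('a \<Rightarrow> 'w \<Rightarrow> real) \<Rightarrow> real \<Rightarrow>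
   ('a \<Rightarrow> real) \<Rightarrow> real \<Rightarrow> ('a \<Rightarrow> 'w \<Rightarrow> real) \<Rightarrow> bool" where
  "perturbed_solution M D G q \<rho> f \<epsilon> u \<longleftrightarrow>
     set_borel_measurable (lborel \<Otimes>\<^sub>M M) (D \<times> space M) (\<lambda>(x, \<omega>). u x \<omega>) \<and>
     (AE \<omega> in M. (\<lambda>x. u x \<omega>) \<in> L2 D \<and>
        ae_eq D (\<lambda>x. u x \<omega>)
          (\<lambda>x. green D G f x
             - green D G (\<lambda>y. q_mod M D G q \<rho> \<epsilon> y \<omega> * green D G f y) x
             + GqGq D G (\<lambda>y. q_mod M D G q \<rho> \<epsilon> y \<omega>) (\<lambda>y. u y \<omega>) x))"

section \<open>Oscillatory integrals\<close>

definition m_fun ::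
  "'a::euclidean_space set \<Rightarrow> ('a \<Rightarrow> 'a \<Rightarrow> real) \<Rightarrow> ('a \<Rightarrow> real) \<Rightarrow> ('a \<Rightarrow> real) \<Rightarrow> 'a \<Rightarrow> real" where
  "m_fun D G u0 Mk y = - (LINT x:D|lborel. Mk x * G x y * u0 y)"

definition osc_integral ::
  "'a::euclidean_space set \<Rightarrow> ('a \<Rightarrow> 'w \<Rightarrow> real) \<Rightarrow> ('a \<Rightarrow> real) \<Rightarrow> real \<Rightarrow> 'w \<Rightarrow> real" where
  "osc_integral D q m \<epsilon> \<omega> =
     (LINT y:D|lborel. m y * (1 / \<epsilon> powr (real DIM('a) / 2)) * q (y /\<^sub>R \<epsilon>) \<omega>)"

section \<open>Convergence in distribution and Gaussian vectors\<close>

definition converges_in_distribution ::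
  "'i filter \<Rightarrow> 'w measure \<Rightarrow> ('i \<Rightarrow> 'w \<Rightarrow> 'b::topological_space) \<Rightarrow>
   'v measure \<Rightarrow> ('v \<Rightarrow> 'b) \<Rightarrow> bool" where
  "converges_in_distribution F M X N Y \<longleftrightarrow>
     (\<forall>\<^sub>F i in F. X i \<in> borel_measurable M) \<and> Y \<in> borel_measurable N \<and>
     (\<forall>g :: 'b \<Rightarrow> real. continuous_on UNIV g \<and> bounded (range g) \<longrightarrow>
        ((\<lambda>i. LINT \<omega>|M. g (X i \<omega>)) \<longlongrightarrow> (LINT \<omega>|N. g (Y \<omega>))) F)"

text \<open>Centered normal law with variance \<open>v\<close>, degenerate for \<open>v = 0\<close>.\<close>

definition normal_law :: "real \<Rightarrow> real measure" where
  "normal_law v = (if v = 0 then return borel 0 else density lborel (normal_density 0 (sqrt v)))"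

definition centered_gaussian :: "(real ^ 'k) measure \<Rightarrow> bool" where
  "centered_gaussian \<mu> \<longleftrightarrow> prob_space \<mu> \<and> sets \<mu> = sets borel \<and>
     (\<forall>t. \<exists>v\<ge>0. distr \<mu> borel (\<lambda>z. t \<bullet> z) = normal_law v)"

section \<open>White noise and the Wiener integral\<close>

definition finite_borel :: "'a::euclidean_space set set" where
  "finite_borel = {A \<in> sets lborel. emeasure lborel A < \<infinity>}"

text \<open>White noise as independently scattered Gaussian random measure with Lebesgue intensity;
  the multi-parameter Wiener process is \<open>y \<mapsto> W [0,y]\<close>.\<close>

definition white_noise :: "'v measure \<Rightarrow> ('a::euclidean_space set \<Rightarrow> 'v \<Rightarrow> real) \<Rightarrow> bool" where
  "white_noise N W \<longleftrightarrow> prob_space N \<and>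
     (\<forall>A\<in>finite_borel. W A \<in> borel_measurable N \<and>
        distr N borel (W A) = normal_law (measure lborel A)) \<and>
     (\<forall>\<A>. finite \<A> \<and> \<A> \<subseteq> finite_borel \<and> disjoint \<A> \<longrightarrow>
        prob_space.indep_vars N (\<lambda>_. borel) W \<A>) \<and>
     (\<forall>A\<in>finite_borel. \<forall>B\<in>finite_borel. A \<inter> B = {} \<longrightarrow>
        (AE \<omega> in N. W (A \<union> B) \<omega> = W A \<omega> + W B \<omega>))"

definition simple_L2 :: "('a::euclidean_space \<Rightarrow> real) \<Rightarrow> bool" where
  "simple_L2 s \<longleftrightarrow> simple_function lborel s \<and> emeasure lborel {x. s x \<noteq> 0} < \<infinity>"

definition simple_wiener_integral ::
  "('a::euclidean_space set \<Rightarrow> 'v \<Rightarrow> real) \<Rightarrow> ('a \<Rightarrow> real) \<Rightarrow> 'v \<Rightarrow> real" where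
  "simple_wiener_integral W s \<omega> = (\<Sum>c \<in> range s - {0}. c * W (s -` {c}) \<omega>)"

definition has_wiener_integral ::
  "'v measure \<Rightarrow> ('a::euclidean_space set \<Rightarrow> 'v \<Rightarrow> real) \<Rightarrow> ('a \<Rightarrow> real) \<Rightarrow> ('v \<Rightarrow> real) \<Rightarrow> bool" where
  "has_wiener_integral N W h X \<longleftrightarrow> X \<in> borel_measurable N \<and>
     (\<exists>s. (\<forall>n::nat. simple_L2 (s n)) \<and>
        (\<lambda>n. \<integral>\<^sup>+x. ennreal ((h x - s n x)\<^sup>2) \<partial>lborel) \<longlonglongrightarrow> 0 \<and>
        (\<lambda>n. \<integral>\<^sup>+\<omega>. ennreal ((X \<omega> - simple_wiener_integral W (s n) \<omega>)\<^sup>2) \<partial>N) \<longlonglongrightarrow> 0)"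

text \<open>The integral over \<open>D\<close>; it is determined up to a null set.\<close>

definition wiener_integral ::
  "'v measure \<Rightarrow> ('a::euclidean_space set \<Rightarrow> 'v \<Rightarrow> real) \<Rightarrow> 'a set \<Rightarrow> ('a \<Rightarrow> real) \<Rightarrow> 'v \<Rightarrow> real" where
  "wiener_integral N W D h = (SOME X. has_wiener_integral N W (\<lambda>x. indicator D x * h x) X)"

end

(* All limits in distribution are reduced to limits of characteristic functions and tightness.

   For X = int m q(./eps) eps^(-d/2), Stein's method shows that the characteristic function f of X
   satisfies f'(t) = - t V f(t) up to a small error, where V tends to sigma^2 int m^2: q at y/eps is
   correlated only with the part of X coming from a ball about y whose radius lies between eps and 1,
   and mixing makes the sum over y of these correlations almost deterministic.

   For the solution write Q = q(./eps) and w = u_eps - u_0. Mixing gives E ||G Q G Q||_HS^2 -> 0, so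
   Q is the modified potential with probability tending to 1, and then
   w = - G Q u_0 + G Q G Q (u_0 + w). Since G is symmetric,
   (w, M') + (Q u_0, G M') = (Q G M', G Q u_0) + (w, Q G Q G M').
   Here ||w|| is of order eps^(d/2) and ||Q G Q G M'|| tends to 0 by mixing. The double integral
   (Q G M', G Q u_0) is o(eps^(d/2)): approximating the kernel G in L^2(D x D) by linear combinations
   of rectangles turns it into products of two oscillatory integrals of order eps^(d/2). *)
theory Submission
  imports Defs "HOL-Real_Asymp.Real_Asymp"
begin

text \<open>The weight eps^(-d/2) diverges, so an error made at each point y must be o(eps^(d/2)).
  Cutting at a ball of radius r costs \<phi>(2 r / eps) at y. Integrability of r^(d-1) \<phi>^(1/2)
  yields l^(2d) \<phi>(l) -> 0, which is just enough for r = eps^(3/4). With this r the quadratic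
  error of the exponential, E |Q y| N^2 with N the part of X in the ball, is of the critical order
  if bounded trivially; mixing of three points supplies the missing factor, and its moments reach
  degree six, which is where E q^6 is spent.

  For the solution, symmetry moves every operator onto g = G M', which is bounded because the rows
  of G are bounded in L^2. The obstacle is (Q g, G Q u_0): since Q has norm of order one,
  Cauchy-Schwarz gives exactly eps^(d/2) and no better power, but with the L^2 norm of the kernel as
  a factor. Subtracting rectangles makes that norm small, and the rectangles contribute order
  eps^d.\<close>

abbreviation lborel2 :: "('a::euclidean_space \<times> 'a) measure" where "lborel2 \<equiv> lborel \<Otimes>\<^sub>M lborel"

abbreviation nn_sq :: "'x measure \<Rightarrow> ('x \<Rightarrow> real) \<Rightarrow> ennreal" where
  "nn_sq M f \<equiv> \<integral>\<^sup>+x. ennreal ((f x)\<^sup>2) \<partial>M"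

abbreviation eabs :: "real \<Rightarrow> ennreal" where "eabs x \<equiv> ennreal \<bar>x\<bar>"

section \<open>Characteristic functions and Gaussian measures\<close>

inductive trig_fun :: "('b::euclidean_space \<Rightarrow> real) \<Rightarrow> bool" where
  trig_cos: "trig_fun (\<lambda>x. cos (t \<bullet> x + c))"
| trig_add: "trig_fun p \<Longrightarrow> trig_fun q \<Longrightarrow> trig_fun (\<lambda>x. p x + q x)"
| trig_scale: "trig_fun p \<Longrightarrow> trig_fun (\<lambda>x. c * p x)"

lemma trig_const: "trig_fun (\<lambda>x::'b::euclidean_space. c)"
  using trig_scale[OF trig_cos[of 0 0], of c] by simp

lemma trig_sin: "trig_fun (\<lambda>x::'b::euclidean_space. sin (t \<bullet> x))"
proof -
  have "(\<lambda>x. sin (t \<bullet> x)) = (\<lambda>x. cos (t \<bullet> x + (- pi / 2)))"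
    by (auto simp: cos_diff)
  then show ?thesis by (simp only: trig_cos)
qed

lemma trig_sum: "(\<And>i. i \<in> A \<Longrightarrow> trig_fun (p i)) \<Longrightarrow> trig_fun (\<lambda>x::'b::euclidean_space. \<Sum>i\<in>A. p i x)"
proof (induction A rule: infinite_finite_induct)
  case (insert a A) then show ?case by (auto intro!: trig_add)
qed (auto intro: trig_const)

text \<open>Product-to-sum formula. The free phase \<open>c\<close> of the generators keeps the
  result in the class; it also turns sines into generators and constants into multiples of
  one.\<close>

lemma trig_mult_cos: "trig_fun q \<Longrightarrow> trig_fun (\<lambda>x::'b::euclidean_space. cos (t \<bullet> x + c) * q x)"
proof (induction rule: trig_fun.induct)
  case (trig_cos s d)
  have "(\<lambda>x. cos (t \<bullet> x + c) * cos (s \<bullet> x + d)) =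
     (\<lambda>x. (1/2) * (cos ((t - s) \<bullet> x + (c - d)) + cos ((t + s) \<bullet> x + (c + d))))"
    by (auto simp: cos_times_cos inner_diff_left inner_add_left algebra_simps)
  then show ?case by (simp only: trig_fun.intros)
next
  case (trig_add p q)
  then show ?case by (simp add: distrib_left trig_fun.trig_add)
next
  case (trig_scale p d)
  then show ?case using trig_fun.trig_scale[of "\<lambda>x. cos (t \<bullet> x + c) * p x" d] by (simp add: mult_ac)
qed

lemma trig_mult: "trig_fun p \<Longrightarrow> trig_fun q \<Longrightarrow> trig_fun (\<lambda>x::'b::euclidean_space. p x * q x)"
proof (induction rule: trig_fun.induct)
  case (trig_cos t c) then show ?case by (rule trig_mult_cos)
next
  case (trig_add p p') then show ?case by (simp add: distrib_right trig_fun.trig_add)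
next
  case (trig_scale p d) then show ?case using trig_fun.trig_scale[of "\<lambda>x. p x * q x" d] by (simp add: mult_ac)
qed

text \<open>Trigonometric functions form an algebra, so only linear polynomials need an argument,
  and there \<open>sin (a * (x \<bullet> b))\<close> is a sine with frequency vector
  \<open>a *\<^sub>R b\<close>.\<close>

lemma trig_fun_polynomial_sin:
  assumes "real_polynomial_function p"
  shows "trig_fun (\<lambda>x::'b::euclidean_space. p (\<Sum>b\<in>Basis. sin (a * (x \<bullet> b)) *\<^sub>R b))"
  using assms
proof (induction rule: real_polynomial_function.induct)
  case (linear f)
  interpret bounded_linear f by fact
  have "(\<lambda>x::'b. f (\<Sum>b\<in>Basis. sin (a * (x \<bullet> b)) *\<^sub>R b)) =
      (\<lambda>x. \<Sum>b\<in>Basis. f b * sin ((a *\<^sub>R b) \<bullet> x))"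
    by (auto simp: sum scale inner_commute mult_ac)
  then show ?case by (simp only:) (intro trig_sum trig_scale trig_sin)
next
  case (const c) show ?case by (rule trig_const)
next
  case (add f g) then show ?case by (intro trig_add)
next
  case (mult f g) then show ?case by (intro trig_mult)
qed

lemma trig_fun_measurable[measurable_dest]: "trig_fun p \<Longrightarrow> p \<in> borel_measurable borel"
  by (induction rule: trig_fun.induct) auto

lemma trig_fun_bounded: "trig_fun p \<Longrightarrow> \<exists>C. \<forall>x. \<bar>p x\<bar> \<le> C"
proof (induction rule: trig_fun.induct)
  case (trig_cos t c) then show ?case by (intro exI[of _ 1]) auto
next
  case (trig_add p q)
  then obtain C D where "\<And>x. \<bar>p x\<bar> \<le> C" "\<And>x. \<bar>q x\<bar> \<le> D" by auto
  then have "\<bar>p x + q x\<bar> \<le> C + D" for x by (rule order_trans[OF abs_triangle_ineq add_mono])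
  then show ?case by blast
next
  case (trig_scale p c)
  then obtain C where "\<And>x. \<bar>p x\<bar> \<le> C" by auto
  then have "\<bar>c * p x\<bar> \<le> \<bar>c\<bar> * C" for x by (simp add: abs_mult mult_left_mono)
  then show ?case by blast
qed

text \<open>With \<open>x\<close> replaced by \<open>(sin (\<pi> x\<^sub>b / 2L))\<^sub>b\<close> Stone-Weierstrass takes place on a compact
  cube, so the approximant stays bounded on the whole space.\<close>

lemma trig_fun_approx:
  fixes g :: "'b::euclidean_space \<Rightarrow> real"
  assumes g: "continuous_on UNIV g" and B: "\<And>x. \<bar>g x\<bar> \<le> B" and e: "e > 0" and L: "L > 0"
  shows "\<exists>p. trig_fun p \<and> (\<forall>x. norm x \<le> L \<longrightarrow> \<bar>g x - p x\<bar> \<le> e) \<and> (\<forall>x. \<bar>p x\<bar> \<le> B + e)"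
proof -
  define \<Phi> :: "'b \<Rightarrow> 'b" where "\<Phi> = (\<lambda>x. \<Sum>b\<in>Basis. sin (pi / (2 * L) * (x \<bullet> b)) *\<^sub>R b)"
  \<comment> \<open>The frequency pi / (2 L) sends |x \<bullet> b| \<le> L into [-pi/2, pi/2], where
    arcsin inverts sin. Hence \<open>\<Psi>\<close> is a left inverse of \<open>\<Phi>\<close> on
    the ball of radius \<open>L\<close>.\<close>
  define \<Psi> :: "'b \<Rightarrow> 'b" where "\<Psi> = (\<lambda>s. \<Sum>b\<in>Basis. (2 * L / pi * arcsin (s \<bullet> b)) *\<^sub>R b)"
  define S :: "'b set" where "S = cbox (- One) One"
  have "continuous_on S (\<lambda>s. g (\<Psi> s))"
  proof (rule continuous_on_compose2[OF g])
    show "continuous_on S \<Psi>"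
      unfolding \<Psi>_def S_def
      by (intro continuous_intros) (auto simp: mem_box)
  qed auto
  then obtain p where p: "real_polynomial_function p" and pe: "\<And>s. s \<in> S \<Longrightarrow> \<bar>g (\<Psi> s) - p s\<bar> < e"
    using Stone_Weierstrass_real_polynomial_function[of S "\<lambda>s. g (\<Psi> s)" e] e
    by (auto simp: S_def)
  have \<Phi>S: "\<Phi> x \<in> S" for x by (auto simp: S_def \<Phi>_def mem_box inner_sum_left_Basis)
  have inv: "\<Psi> (\<Phi> x) = x" if "norm x \<le> L" for x
  proof -
    have "\<bar>x \<bullet> b\<bar> \<le> L" if "b \<in> Basis" for b
      using Basis_le_norm[OF that, of x] \<open>norm x \<le> L\<close> by simp
    then have "\<bar>pi / (2 * L) * (x \<bullet> b)\<bar> \<le> pi / (2 * L) * L" if "b \<in> Basis" for b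
      using L that unfolding abs_mult by (intro mult_mono) auto
    then have "\<bar>pi / (2 * L) * (x \<bullet> b)\<bar> \<le> pi / 2" if "b \<in> Basis" for b
      using L that by simp
    then have "arcsin (sin (pi / (2 * L) * (x \<bullet> b))) = pi / (2 * L) * (x \<bullet> b)" if "b \<in> Basis" for b
      using that unfolding abs_le_iff by (intro arcsin_sin) (force simp: minus_le_iff)+
    then have "\<Psi> (\<Phi> x) = (\<Sum>b\<in>Basis. (x \<bullet> b) *\<^sub>R b)"
      using L by (auto simp: \<Psi>_def \<Phi>_def intro!: sum.cong)
    then show ?thesis by (simp add: euclidean_representation)
  qed
  show ?thesis
  proof (intro exI[of _ "\<lambda>x. p (\<Phi> x)"] conjI allI impI)
    show "trig_fun (\<lambda>x. p (\<Phi> x))" unfolding \<Phi>_def by (rule trig_fun_polynomial_sin[OF p])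
    show "\<bar>g x - p (\<Phi> x)\<bar> \<le> e" if "norm x \<le> L" for x using pe[OF \<Phi>S, of x] inv[OF that] by simp
    \<comment> \<open>\<open>\<Phi> x\<close> stays in the cube for every \<open>x\<close>, so
      \<open>p (\<Phi> x)\<close> is always within \<open>e\<close> of some value of
      \<open>g\<close>; only the identification of that value with \<open>g x\<close> requires
      \<open>norm x \<le> L\<close>.\<close>
    show "\<bar>p (\<Phi> x)\<bar> \<le> B + e" for x using pe[OF \<Phi>S, of x] B[of "\<Psi> (\<Phi> x)"] by linarith
  qed
qed

section \<open>From characteristic functions to convergence in distribution\<close>

lemma (in prob_space) integrable_bounded_real:
  fixes f :: "'a \<Rightarrow> real"
  assumes "f \<in> borel_measurable M" "\<And>x. \<bar>f x\<bar> \<le> C"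
  shows "integrable M f"
  using assms by (intro integrable_const_bound[of _ C]) auto

lemma trig_fun_tendsto:
  fixes X :: "'i \<Rightarrow> 'w \<Rightarrow> 'b::euclidean_space"
  assumes M: "prob_space M" and N: "prob_space N" and Y[measurable]: "Y \<in> borel_measurable N"
    and X: "\<forall>\<^sub>F i in F. X i \<in> borel_measurable M"
    and cf: "\<And>t. ((\<lambda>i. CLINT w|M. iexp (t \<bullet> X i w)) \<longlongrightarrow> (CLINT w|N. iexp (t \<bullet> Y w))) F"
    and p: "trig_fun p"
  shows "((\<lambda>i. LINT w|M. p (X i w)) \<longlongrightarrow> (LINT w|N. p (Y w))) F"
  using p
proof (induction rule: trig_fun.induct)
  case (trig_cos t c)
  have *: "(LINT w|M'. cos (t \<bullet> Z w + c)) = Re (iexp c * (CLINT w|M'. iexp (t \<bullet> Z w)))"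
    if "prob_space M'" and [measurable]: "Z \<in> borel_measurable M'" for M' :: "'z measure" and Z
  proof -
    interpret prob_space M' by fact
    have I: "integrable M' (\<lambda>w. iexp (t \<bullet> Z w))" by (rule integrable_const_bound[of _ 1]) auto
    have "Re (iexp c * (CLINT w|M'. iexp (t \<bullet> Z w))) = Re (CLINT w|M'. iexp c * iexp (t \<bullet> Z w))"
      by simp
    also have "\<dots> = (LINT w|M'. Re (iexp c * iexp (t \<bullet> Z w)))"
      using I by (intro integral_Re[symmetric]) auto
    also have "\<dots> = (LINT w|M'. cos (t \<bullet> Z w + c))"
      by (intro Bochner_Integration.integral_cong refl)
        (simp add: exp_add[symmetric] Re_exp algebra_simps)
    finally show ?thesis by simp
  qed
  have "((\<lambda>i. Re (iexp c * (CLINT w|M. iexp (t \<bullet> X i w)))) \<longlongrightarrow> Re (iexp c * (CLINT w|N. iexp (t \<bullet> Y w)))) F"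
    by (intro tendsto_intros cf)
  then show ?case
    unfolding *[OF N Y]
    by (rule Lim_transform_eventually) (use X in \<open>eventually_elim, simp add: *[OF M]\<close>)
next
  case (trig_add p q)
  have *: "(LINT w|M'. p (Z w) + q (Z w)) = (LINT w|M'. p (Z w)) + (LINT w|M'. q (Z w))"
    if "prob_space M'" and [measurable]: "Z \<in> borel_measurable M'" for M' :: "'z measure" and Z
  proof -
    interpret prob_space M' by fact
    have "integrable M' (\<lambda>w. r (Z w))" if "trig_fun r" for r
      using trig_fun_bounded[OF that] trig_fun_measurable[OF that]
      by (auto intro!: integrable_bounded_real)
    then show ?thesis using trig_add by (intro Bochner_Integration.integral_add) auto
  qed
  have "((\<lambda>i. (LINT w|M. p (X i w)) + (LINT w|M. q (X i w))) \<longlongrightarrow> (LINT w|N. p (Y w)) + (LINT w|N. q (Y w))) F"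
    by (intro tendsto_intros trig_add)
  then show ?case
    unfolding *[OF N Y]
    by (rule Lim_transform_eventually) (use X in \<open>eventually_elim, simp add: *[OF M]\<close>)
next
  case (trig_scale p c)
  then show ?case by (auto intro!: tendsto_intros)
qed

text \<open>A single random variable is tight: the events that its norm exceeds n decrease to the
  empty set.\<close>

lemma (in prob_space) prob_norm_gt_tendsto_0:
  fixes Y :: "'a \<Rightarrow> 'b::real_normed_vector"
  assumes [measurable]: "Y \<in> borel_measurable M" and e: "e > 0"
  shows "\<exists>L>0. \<P>(w in M. norm (Y w) > L) \<le> e"
proof -
  define A where "A n = {w\<in>space M. norm (Y w) > real n}" for n :: nat
  have "(\<lambda>n. prob (A n)) \<longlonglongrightarrow> prob (\<Inter>n. A n)"
    by (intro finite_Lim_measure_decseq) (auto simp: A_def decseq_def)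
  moreover have "(\<Inter>n. A n) = {}"
  proof -
    have False if "\<And>n. w \<in> A n" for w
      using that reals_Archimedean2[of "norm (Y w)"] unfolding A_def by (auto simp: not_less dest: less_asym)
    then show ?thesis by blast
  qed
  ultimately have "\<forall>\<^sub>F n in sequentially. prob (A n) < e"
    using e by (auto dest: order_tendstoD(2))
  then obtain n0 where "\<And>n. n \<ge> n0 \<Longrightarrow> prob (A n) < e" by (auto simp: eventually_sequentially)
  from this[of "Suc n0"] show ?thesis
    by (intro exI[of _ "real (Suc n0)"]) (auto simp: A_def intro: less_imp_le)
qed

text \<open>Inside the ball of radius \<open>L\<close> the two functions differ by at most
  \<open>e\<close>, outside by at most \<open>B + B'\<close>.\<close>

lemma (in prob_space) expectation_diff_le_tail:
  fixes Z :: "'a \<Rightarrow> 'b::real_normed_vector" and g p :: "'b \<Rightarrow> real"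
  assumes [measurable]: "Z \<in> borel_measurable M" "g \<in> borel_measurable borel" "p \<in> borel_measurable borel"
    and B: "\<And>x. \<bar>g x\<bar> \<le> B" "\<And>x. \<bar>p x\<bar> \<le> B'" and e: "\<And>x. norm x \<le> L \<Longrightarrow> \<bar>g x - p x\<bar> \<le> e"
    and e0: "0 \<le> e"
  shows "\<bar>(LINT w|M. g (Z w)) - (LINT w|M. p (Z w))\<bar> \<le> e + (B + B') * \<P>(w in M. norm (Z w) > L)"
proof -
  have I: "integrable M (\<lambda>w. g (Z w))" "integrable M (\<lambda>w. p (Z w))"
    using B by (auto intro!: integrable_bounded_real)
  have "\<bar>(LINT w|M. g (Z w)) - (LINT w|M. p (Z w))\<bar> = \<bar>LINT w|M. g (Z w) - p (Z w)\<bar>"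
    using I by simp
  also have "\<dots> \<le> (LINT w|M. \<bar>g (Z w) - p (Z w)\<bar>)"
    by (rule integral_abs_bound)
  also have "\<dots> \<le> (LINT w|M. e + (B + B') * indicator {w\<in>space M. norm (Z w) > L} w)"
  proof (rule integral_mono)
    show "integrable M (\<lambda>w. e + (B + B') * indicator {w\<in>space M. norm (Z w) > L} w)"
      by (intro Bochner_Integration.integrable_add integrable_const integrable_mult_right integrable_bounded_real[where f = "indicator _" and C = 1]) (auto simp: indicator_def)
  next
    fix w assume "w \<in> space M"
    then show "\<bar>g (Z w) - p (Z w)\<bar> \<le> e + (B + B') * indicator {w\<in>space M. norm (Z w) > L} w"
      using e[of "Z w"] B(1)[of "Z w"] B(2)[of "Z w"] e0 by (auto simp: indicator_def)
  qed (use I in auto)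
  also have "\<dots> = e + (B + B') * \<P>(w in M. norm (Z w) > L)"
    using integrable_bounded_real[of "indicator {w\<in>space M. norm (Z w) > L}" 1]
    by (simp add: prob_space)
  finally show ?thesis .
qed

text \<open>Characteristic functions settle the limit for trigonometric polynomials. A bounded
  continuous \<open>g\<close> is replaced by such a polynomial on a large ball; tightness and the
  global bound of the polynomial control what happens outside.\<close>

lemma converges_in_distributionI_char:
  fixes X :: "'i \<Rightarrow> 'w \<Rightarrow> 'b::euclidean_space"
  assumes M: "prob_space M" and N: "prob_space N" and Y[measurable]: "Y \<in> borel_measurable N"
    and X: "\<forall>\<^sub>F i in F. X i \<in> borel_measurable M"
    and cf: "\<And>t. ((\<lambda>i. CLINT w|M. iexp (t \<bullet> X i w)) \<longlongrightarrow> (CLINT w|N. iexp (t \<bullet> Y w))) F"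
    and tight: "\<And>e. e > 0 \<Longrightarrow> \<exists>L. \<forall>\<^sub>F i in F. \<P>(w in M. norm (X i w) > L) \<le> e"
  shows "converges_in_distribution F M X N Y"
  unfolding converges_in_distribution_def
proof (intro conjI allI impI X Y)
  fix g :: "'b \<Rightarrow> real" assume g: "continuous_on UNIV g \<and> bounded (range g)"
  interpret M: prob_space M by fact
  interpret N: prob_space N by fact
  from g obtain B where B: "\<And>x. \<bar>g x\<bar> \<le> B" by (auto simp: bounded_iff)
  have B0: "0 \<le> B" using B[of 0] by simp
  have gm[measurable]: "g \<in> borel_measurable borel" using g by (auto intro: borel_measurable_continuous_onI)
  show "((\<lambda>i. LINT w|M. g (X i w)) \<longlongrightarrow> (LINT w|N. g (Y w))) F"
  proof (rule tendstoI)
    fix e :: real assume e: "e > 0"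
    \<comment> \<open>\<open>d\<close> bounds the approximation error and the tail probability at
      once. The factor 2 B + 2 dominates both 1 and B + (B + d), so each replacement of
      \<open>g\<close> costs at most e / 4; with e / 4 for the limit of the polynomial the total
      stays below e.\<close>
    define d where "d = min 1 (e / (8 * (2 * B + 2)))"
    have d: "0 < d" "d \<le> 1" using e B0 by (auto simp: d_def)
    have "d * (2 * B + 2) \<le> e / (8 * (2 * B + 2)) * (2 * B + 2)"
      using B0 by (intro mult_right_mono) (auto simp: d_def)
    also have "\<dots> = e / 8" using B0 by (simp add: field_simps)
    finally have d3: "d * (2 * B + 2) \<le> e / 8" .
    obtain L1 where L1: "\<forall>\<^sub>F i in F. \<P>(w in M. norm (X i w) > L1) \<le> d" using tight[OF d(1)] by auto
    obtain L2 where L2: "L2 > 0" "\<P>(w in N. norm (Y w) > L2) \<le> d"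
      using N.prob_norm_gt_tendsto_0[OF Y d(1)] by auto
    define L where "L = max L1 L2"
    have L: "L > 0" "L \<ge> L1" "L \<ge> L2" using L2 by (auto simp: L_def)
    have PY: "\<P>(w in N. norm (Y w) > L) \<le> d"
      by (rule order_trans[OF N.finite_measure_mono L2(2)]) (use L in auto)
    have PX: "\<forall>\<^sub>F i in F. \<P>(w in M. norm (X i w) > L) \<le> d"
      using L1 X
    proof eventually_elim
      case (elim i)
      then have [measurable]: "X i \<in> borel_measurable M" by simp
      show ?case by (rule order_trans[OF M.finite_measure_mono elim(1)]) (use L in auto)
    qed
    obtain p where p: "trig_fun p" "\<And>x. norm x \<le> L \<Longrightarrow> \<bar>g x - p x\<bar> \<le> d" "\<And>x. \<bar>p x\<bar> \<le> B + d"
      using trig_fun_approx[of g B d L] g B d(1) L(1) by auto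
    have pm[measurable]: "p \<in> borel_measurable borel" using p(1) by (rule trig_fun_measurable)
    have bnd: "d + (B + (B + d)) * P \<le> e / 8 + e / 8" if "P \<le> d" "0 \<le> P" for P
    proof -
      have "(B + (B + d)) * P \<le> (2*B+2) * d" using that d B0 by (intro mult_mono) auto
      moreover have "d * 1 \<le> d * (2 * B + 2)" using d B0 by (intro mult_left_mono) auto
      ultimately show ?thesis using d3 by (simp add: mult.commute)
    qed
    have Yp: "\<bar>(LINT w|N. g (Y w)) - (LINT w|N. p (Y w))\<bar> \<le> e / 8 + e / 8"
      by (rule order_trans[OF N.expectation_diff_le_tail[OF Y gm pm B p(3) p(2)] bnd]) (use PY d in auto)
    have "\<forall>\<^sub>F i in F. dist (LINT w|M. p (X i w)) (LINT w|N. p (Y w)) < e / 4"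
      using trig_fun_tendsto[OF M N Y X cf p(1)] e by (intro tendstoD) auto
    then show "\<forall>\<^sub>F i in F. dist (LINT w|M. g (X i w)) (LINT w|N. g (Y w)) < e"
      using PX X
    proof eventually_elim
      case (elim i)
      have "\<bar>(LINT w|M. g (X i w)) - (LINT w|M. p (X i w))\<bar> \<le> e / 8 + e / 8"
        by (rule order_trans[OF M.expectation_diff_le_tail[OF elim(3) gm pm B p(3) p(2)] bnd]) (use elim(2) d in auto)
      then show ?case using elim(1) Yp unfolding dist_real_def by linarith
    qed
  qed
qed

text \<open>The functions max(0, 1 - n dist(x, U)) are continuous and converge boundedly to the
  indicator of a closed set U, and closed sets form a generating family stable under
  intersection.\<close>

lemma prob_measure_eqI_continuous:
  fixes \<mu> \<nu> :: "'b::euclidean_space measure"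
  assumes "prob_space \<mu>" "prob_space \<nu>" "sets \<mu> = sets borel" "sets \<nu> = sets borel"
    and eq: "\<And>g::'b \<Rightarrow> real. continuous_on UNIV g \<Longrightarrow> bounded (range g) \<Longrightarrow> (LINT x|\<mu>. g x) = (LINT x|\<nu>. g x)"
  shows "\<mu> = \<nu>"
proof -
  interpret \<mu>: prob_space \<mu> by fact
  interpret \<nu>: prob_space \<nu> by fact
  note [measurable_cong] = assms(3,4)
  have closed_eq: "measure \<mu> U = measure \<nu> U" if U: "closed U" "U \<noteq> {}" for U :: "'b set"
  proof -
    have [measurable]: "U \<in> sets borel" using U by auto
    define g where "g n x = max 0 (1 - real n * infdist x U)" for n x
    have gm: "continuous_on UNIV (g n)" for n unfolding g_def by (intro continuous_intros)
    have [measurable]: "g n \<in> borel_measurable borel" for n using gm by (rule borel_measurable_continuous_onI)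
    have gb: "\<bar>g n x\<bar> \<le> 1" for n x by (auto simp: g_def infdist_nonneg)
    have lim: "(\<lambda>n. LINT x|m. g n x) \<longlonglongrightarrow> measure m U" if m: "prob_space m" and [measurable_cong]: "sets m = sets borel" for m
    proof -
      interpret m: prob_space m by fact
      have "(\<lambda>n. LINT x|m. g n x) \<longlonglongrightarrow> (LINT x|m. indicator U x)"
      proof (rule integral_dominated_convergence[where w = "\<lambda>_. 1"])
        show "AE x in m. (\<lambda>n. g n x) \<longlonglongrightarrow> indicator U x"
        proof (rule AE_I2)
          fix x
          show "(\<lambda>n. g n x) \<longlonglongrightarrow> indicator U x"
          proof (cases "x \<in> U")
            case False
            then have "infdist x U > 0" using U by (simp add: infdist_pos_not_in_closed)
            then obtain n0 where n0: "real n0 * infdist x U > 1" using reals_Archimedean3 by blast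
            have "\<forall>\<^sub>F n in sequentially. g n x = 0"
              unfolding eventually_sequentially
            proof (intro exI[of _ n0] allI impI)
              fix n assume "n0 \<le> n"
              then have "real n0 * infdist x U \<le> real n * infdist x U" by (intro mult_right_mono) (auto simp: infdist_nonneg)
              then show "g n x = 0" using n0 by (simp add: g_def)
            qed
            then show ?thesis using False by (simp add: tendsto_eventually)
          qed (simp add: g_def)
        qed
      qed (use gb in auto)
      then show ?thesis by (simp add: \<open>sets m = sets borel\<close> sets_eq_imp_space_eq)
    qed
    have "(LINT x|\<mu>. g n x) = (LINT x|\<nu>. g n x)" for n
      using gb by (intro eq gm) (auto simp: bounded_iff)
    then show ?thesis
      using LIMSEQ_unique[OF lim[OF assms(1,3)]] lim[OF assms(2,4)] by auto
  qed
  show ?thesis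
  proof (rule measure_eqI_generator_eq[where E = "Collect closed" and \<Omega> = UNIV and A = "\<lambda>_. UNIV"])
    show "sets \<mu> = sigma_sets UNIV (Collect closed)" "sets \<nu> = sigma_sets UNIV (Collect closed)"
      using assms(3,4) by (simp_all add: borel_eq_closed)
    show "emeasure \<mu> X = emeasure \<nu> X" if "X \<in> Collect closed" for X
      using closed_eq[of X] that by (cases "X = {}") (auto simp: \<mu>.emeasure_eq_measure \<nu>.emeasure_eq_measure)
  qed (auto simp: Int_stable_def)
qed

text \<open>The constant sequence with law \<mu> converges in distribution to \<nu> by the
  characteristic function criterion, and a constant sequence equals its limit.\<close>

lemma prob_measure_eqI_char:
  fixes \<mu> \<nu> :: "'b::euclidean_space measure"
  assumes "prob_space \<mu>" "prob_space \<nu>" and s: "sets \<mu> = sets borel" "sets \<nu> = sets borel"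
    and eq: "\<And>t. (CLINT x|\<mu>. iexp (t \<bullet> x)) = (CLINT x|\<nu>. iexp (t \<bullet> x))"
  shows "\<mu> = \<nu>"
proof (rule prob_measure_eqI_continuous[OF assms(1-4)])
  interpret \<mu>: prob_space \<mu> by fact
  interpret \<nu>: prob_space \<nu> by fact
  note [measurable_cong] = s
  fix g :: "'b \<Rightarrow> real" assume g: "continuous_on UNIV g" "bounded (range g)"
  have "converges_in_distribution sequentially \<mu> (\<lambda>_. \<lambda>x. x) \<nu> (\<lambda>x. x)"
  proof (rule converges_in_distributionI_char[OF assms(1,2)])
    show "\<exists>L. \<forall>\<^sub>F i in sequentially. \<P>(w in \<mu>. norm w > L) \<le> e" if "e > 0" for e
      using \<mu>.prob_norm_gt_tendsto_0[of "\<lambda>x. x" e] that by auto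
  qed (use eq in auto)
  then have "(\<lambda>i::nat. LINT x|\<mu>. g x) \<longlonglongrightarrow> (LINT x|\<nu>. g x)"
    using g unfolding converges_in_distribution_def by blast
  then show "(LINT x|\<mu>. g x) = (LINT x|\<nu>. g x)" by (simp add: LIMSEQ_const_iff)
qed
lemma normal_law_props:
  assumes "v \<ge> 0"
  shows prob_space_normal_law: "prob_space (normal_law v)"
    and sets_normal_law[measurable_cong, simp]: "sets (normal_law v) = sets borel"
    and char_normal_law: "char (normal_law v) t = of_real (exp (- (v * t\<^sup>2 / 2)))"
    and integrable_square_normal_law: "integrable (normal_law v) (\<lambda>x. x\<^sup>2)"
    and integral_square_normal_law: "(LINT x|normal_law v. x\<^sup>2) = v"
proof -
  have "prob_space (normal_law v) \<and> sets (normal_law v) = sets borel \<and>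
    char (normal_law v) t = of_real (exp (- (v * t\<^sup>2 / 2))) \<and>
    integrable (normal_law v) (\<lambda>x. x\<^sup>2) \<and> (LINT x|normal_law v. x\<^sup>2) = v"
  proof (cases "v = 0")
    case True
    have "integrable (return borel (0::real)) (\<lambda>x. x\<^sup>2)"
      by (rule integrableI_bounded) (auto simp: nn_integral_return)
    then show ?thesis using True
      by (auto simp: normal_law_def char_def integral_return intro: prob_space_return)
  next
    case False
    define s where "s = sqrt v"
    have s: "s > 0" "s\<^sup>2 = v" using assms False by (auto simp: s_def)
    have N: "normal_law v = density lborel (normal_density 0 s)" using False by (simp add: normal_law_def s_def)
    \<comment> \<open>A nondegenerate law is the image of the standard one under x -> s x;
      characteristic function and second moment are transported along this map.\<close>
    have "distributed std_normal_distribution lborel (\<lambda>x. x) std_normal_density"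
      by (auto simp: distributed_def distr_id2)
    then have "distributed std_normal_distribution lborel (\<lambda>x. 0 + s * x) (normal_density (0 + s * 0) (\<bar>s\<bar> * 1))"
      using prob_space.normal_density_affine[OF prob_space_normal_density[OF zero_less_one], of 0 "\<lambda>x. x" 0 1 s 0] s
      by simp
    then have D: "distr std_normal_distribution borel (\<lambda>x. s * x) = normal_law v"
      using s N by (auto simp: distributed_def cong: distr_cong)
    have int2: "integrable std_normal_distribution (\<lambda>x. x\<^sup>2)" "(LINT x|std_normal_distribution. x\<^sup>2) = 1"
      using integrable_std_normal_distribution_moment[of 2] std_normal_distribution_even_moments[of 1]
      by (auto simp: fact_numeral)
    have "char (normal_law v) t = char std_normal_distribution (s * t)"
      unfolding char_def D[symmetric] by (subst integral_distr) (auto simp: mult_ac)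
    also have "\<dots> = of_real (exp (- (v * t\<^sup>2 / 2)))"
      by (simp add: char_std_normal_distribution s(2)[symmetric] power_mult_distrib)
    finally have 1: "char (normal_law v) t = of_real (exp (- (v * t\<^sup>2 / 2)))" .
    have 2: "integrable (normal_law v) (\<lambda>x. x\<^sup>2)" "(LINT x|normal_law v. x\<^sup>2) = v"
      unfolding D[symmetric] using int2 s
      by (auto simp: integrable_distr_eq integral_distr power_mult_distrib)
    have 3: "prob_space (normal_law v)" using s(1) by (simp add: N prob_space_normal_density)
    show ?thesis using 1 2 3 by (simp add: N)
  qed
  then show "prob_space (normal_law v)" "sets (normal_law v) = sets borel"
    "char (normal_law v) t = of_real (exp (- (v * t\<^sup>2 / 2)))"
    "integrable (normal_law v) (\<lambda>x. x\<^sup>2)" "(LINT x|normal_law v. x\<^sup>2) = v" by auto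
qed

lemma eq_normal_lawI:
  assumes "prob_space \<mu>" "sets \<mu> = sets borel" "v \<ge> 0"
    and "\<And>t. char \<mu> t = of_real (exp (- (v * t\<^sup>2 / 2)))"
  shows "\<mu> = normal_law v"
proof (rule Levy_uniqueness)
  show "real_distribution \<mu>" using assms(1,2)
    by (simp add: real_distribution_def real_distribution_axioms_def sets_eq_imp_space_eq[OF assms(2)])
  show "real_distribution (normal_law v)" using prob_space_normal_law[OF assms(3)] sets_normal_law[OF assms(3)]
    by (simp add: real_distribution_def real_distribution_axioms_def)
  show "char \<mu> = char (normal_law v)" using assms(4) char_normal_law[OF assms(3)] by auto
qed

section \<open>Gaussian vectors with a prescribed covariance matrix\<close>

definition quad_form :: "('k::finite \<Rightarrow> 'k \<Rightarrow> real) \<Rightarrow> real ^ 'k \<Rightarrow> real ^ 'k \<Rightarrow> real" where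
  "quad_form S s t = (\<Sum>j\<in>UNIV. \<Sum>k\<in>UNIV. s $ j * t $ k * S j k)"

definition psd :: "('k::finite \<Rightarrow> 'k \<Rightarrow> real) \<Rightarrow> bool" where
  "psd S \<longleftrightarrow> (\<forall>j k. S j k = S k j) \<and> (\<forall>t. 0 \<le> quad_form S t t)"

lemma quad_form_axis: "quad_form S (axis j 1) (axis k 1) = S j k"
  by (simp add: quad_form_def axis_def if_distrib[of "\<lambda>x. x * _"] if_distrib[of "\<lambda>x. _ * x"] cong: if_cong)

lemma quad_form_axis_left: "quad_form S (axis k 1) t = (\<Sum>j\<in>UNIV. t $ j * S k j)"
proof -
  have "quad_form S (axis k 1) t = (\<Sum>i\<in>UNIV. axis k 1 $ i * (\<Sum>j\<in>UNIV. t $ j * S i j))"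
    by (simp add: quad_form_def sum_distrib_left mult_ac)
  then show ?thesis by (simp add: axis_def if_distrib[of "\<lambda>x. x * _"] cong: if_cong)
qed

lemma quad_form_linear:
  "quad_form S (s + s') t = quad_form S s t + quad_form S s' t"
  "quad_form S s (t + t') = quad_form S s t + quad_form S s t'"
  "quad_form S (c *\<^sub>R s) t = c * quad_form S s t"
  "quad_form S s (c *\<^sub>R t) = c * quad_form S s t"
  by (simp_all add: quad_form_def sum.distrib sum_distrib_left algebra_simps)

lemma quad_form_commute: "psd S \<Longrightarrow> quad_form S s t = quad_form S t s"
  unfolding quad_form_def by (subst sum.swap) (auto simp: psd_def mult_ac intro!: sum.cong)

text \<open>Nonnegativity of the quadratic x -> a + 2 x b + x^2 c at its minimum x = - b / c. A
  semidefinite form allows c = 0; the quadratic is then affine and must be constant.\<close>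

lemma psd_Cauchy_Schwarz:
  assumes "psd S" shows "(quad_form S s t)\<^sup>2 \<le> quad_form S s s * quad_form S t t"
proof -
  define a b c where "a = quad_form S s s" and "b = quad_form S s t" and "c = quad_form S t t"
  have *: "0 \<le> a + 2 * x * b + x\<^sup>2 * c" for x
  proof -
    have "0 \<le> quad_form S (s + x *\<^sub>R t) (s + x *\<^sub>R t)" using assms by (simp add: psd_def)
    also have "\<dots> = a + 2 * x * b + x\<^sup>2 * c"
      using quad_form_commute[OF assms, of t s]
      by (simp add: quad_form_linear a_def b_def c_def power2_eq_square algebra_simps)
    finally show ?thesis .
  qed
  have c0: "0 \<le> c" using assms by (simp add: psd_def c_def)
  have "b\<^sup>2 \<le> a * c"
  proof (cases "c = 0")
    case True
    have "b = 0"
    proof (rule ccontr)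
      assume "b \<noteq> 0"
      \<comment> \<open>At this argument the affine function takes the value -1.\<close>
      with *[of "- (a + 1) / (2 * b)"] True show False by (simp add: field_simps)
    qed
    then show ?thesis using True by simp
  next
    case False
    then have "0 \<le> (a + 2 * (- b / c) * b + (- b / c)\<^sup>2 * c) * c"
      using *[of "- b / c"] c0 by (intro mult_nonneg_nonneg) auto
    also have "\<dots> = a * c - b\<^sup>2" using False by (simp add: field_simps power2_eq_square)
    finally show ?thesis by simp
  qed
  then show ?thesis by (simp add: a_def b_def c_def)
qed

text \<open>Induction on the number of nonzero diagonal entries, one Cholesky step at a time. The
  rank one matrix of the vector \<open>a\<close> is split off; the remainder \<open>T\<close> is a
  Schur complement whose k-th diagonal entry vanishes. A sample for \<open>T\<close> plus an
  independent standard normal multiple of \<open>a\<close> has covariance \<open>S\<close>.\<close>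

lemma gaussian_measure_exists:
  fixes S :: "'k::finite \<Rightarrow> 'k \<Rightarrow> real"
  assumes "psd S"
  shows "\<exists>\<mu> :: (real ^ 'k) measure. prob_space \<mu> \<and> sets \<mu> = sets borel \<and>
    (\<forall>t. (CLINT z|\<mu>. iexp (t \<bullet> z)) = of_real (exp (- (quad_form S t t / 2))))"
  using assms
proof (induction "card {k. S k k \<noteq> 0}" arbitrary: S rule: less_induct)
  case less
  note S = less.prems
  have CS: "(S j k)\<^sup>2 \<le> S j j * S k k" for j k
    using psd_Cauchy_Schwarz[OF S, of "axis j 1" "axis k 1"] by (simp add: quad_form_axis)
  show ?case
  proof (cases "\<exists>k. S k k \<noteq> 0")
    case False
    \<comment> \<open>A semidefinite matrix with zero diagonal is zero, by Cauchy-Schwarz on the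
      axis vectors.\<close>
    then have "S j k = 0" for j k using CS[of j k] by auto
    then have "quad_form S t t = 0" for t by (simp add: quad_form_def)
    then show ?thesis
      by (intro exI[of _ "return borel 0"]) (auto intro: prob_space_return simp: integral_return)
  next
    case True
    then obtain k where k: "S k k \<noteq> 0" by auto
    have "S k k \<ge> 0" using S quad_form_axis[of S k k] unfolding psd_def by metis
    with k have kp: "S k k > 0" by simp
    define a :: "real ^ 'k" where "a = (\<chi> j. S k j / sqrt (S k k))"
    define T where "T i j = S i j - a $ i * a $ j" for i j
    have qa: "t \<bullet> a = quad_form S (axis k 1) t / sqrt (S k k)" for t
      by (simp add: quad_form_axis_left a_def inner_vec_def sum_divide_distrib)
    have qT: "quad_form T t t = quad_form S t t - (t \<bullet> a)\<^sup>2" for t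
    proof -
      have "(t \<bullet> a)\<^sup>2 = (\<Sum>j\<in>UNIV. \<Sum>k\<in>UNIV. t $ j * t $ k * (a $ j * a $ k))"
        unfolding power2_eq_square inner_vec_def sum_product by (simp add: mult_ac)
      then show ?thesis by (simp add: quad_form_def T_def right_diff_distrib sum_subtractf)
    qed
    \<comment> \<open>Semidefiniteness of the Schur complement is Cauchy-Schwarz for
      \<open>S\<close> between the k-th axis and \<open>t\<close>.\<close>
    have T: "psd T"
      unfolding psd_def
    proof (intro conjI allI)
      show "T i j = T j i" for i j using S by (simp add: T_def psd_def mult.commute)
      show "0 \<le> quad_form T t t" for t
        using psd_Cauchy_Schwarz[OF S, of "axis k 1" t] kp
        by (simp add: qT qa quad_form_axis power_divide divide_le_eq mult.commute)
    qed
    have "{i. T i i \<noteq> 0} \<subset> {i. S i i \<noteq> 0}"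
    proof
      have "T i i = 0" if "S i i = 0" for i
        using CS[of k i] that by (auto simp: T_def a_def)
      then show "{i. T i i \<noteq> 0} \<subseteq> {i. S i i \<noteq> 0}" by auto
      have "T k k = 0" using kp by (simp add: T_def a_def)
      then show "{i. T i i \<noteq> 0} \<noteq> {i. S i i \<noteq> 0}" using k by auto
    qed
    then have "card {i. T i i \<noteq> 0} < card {i. S i i \<noteq> 0}" by (intro psubset_card_mono) auto
    from less.hyps[OF this T] obtain \<nu> :: "(real ^ 'k) measure" where
      \<nu>: "prob_space \<nu>" and s[measurable_cong]: "sets \<nu> = sets borel" and
      ch: "\<And>t. (CLINT z|\<nu>. iexp (t \<bullet> z)) = of_real (exp (- (quad_form T t t / 2)))" by blast
    interpret \<nu>: prob_space \<nu> by fact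
    define N where "N = normal_law 1"
    interpret N: prob_space N unfolding N_def by (rule prob_space_normal_law) simp
    have sN[measurable_cong]: "sets N = sets borel" by (simp add: N_def)
    interpret P: pair_prob_space \<nu> N ..
    define \<mu> where "\<mu> = distr (\<nu> \<Otimes>\<^sub>M N) borel (\<lambda>(z, x). z + x *\<^sub>R a)"
    have [measurable]: "(\<lambda>(z, x). z + x *\<^sub>R a) \<in> borel_measurable (\<nu> \<Otimes>\<^sub>M N)" by measurable
    show ?thesis
    proof (intro exI[of _ \<mu>] conjI allI)
      show "prob_space \<mu>" unfolding \<mu>_def by (rule P.prob_space_distr) measurable
      show "sets \<mu> = sets borel" by (simp add: \<mu>_def)
      fix t
      have "(CLINT z|\<mu>. iexp (t \<bullet> z)) = (CLINT p|(\<nu> \<Otimes>\<^sub>M N). iexp (t \<bullet> fst p) * iexp ((t \<bullet> a) * snd p))"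
        unfolding \<mu>_def by (subst integral_distr)
          (auto simp: inner_add_right exp_add[symmetric] algebra_simps split_beta intro!: Bochner_Integration.integral_cong)
      also have "\<dots> = (CLINT z|\<nu>. CLINT x|N. iexp (t \<bullet> z) * iexp ((t \<bullet> a) * x))"
        by (subst P.integral_fst'[symmetric])
          (auto intro!: P.integrable_const_bound[of _ 1] simp: norm_mult)
      also have "\<dots> = (CLINT z|\<nu>. iexp (t \<bullet> z)) * char N (t \<bullet> a)"
        by (simp add: char_def)
      also have "\<dots> = of_real (exp (- (quad_form S t t / 2)))"
        by (simp add: ch N_def char_normal_law qT exp_of_real[symmetric] of_real_mult[symmetric] exp_add[symmetric] diff_divide_distrib del: of_real_mult)
      finally show "(CLINT z|\<mu>. iexp (t \<bullet> z)) = of_real (exp (- (quad_form S t t / 2)))" .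
    qed
  qed
qed

text \<open>The characteristic function along a line determines the law of each projection, hence
  its variance; the mixed moments follow by polarization.\<close>

lemma gaussian_measure_moments:
  fixes S :: "'k::finite \<Rightarrow> 'k \<Rightarrow> real" and \<mu> :: "(real ^ 'k) measure"
  assumes S: "psd S" and \<mu>: "prob_space \<mu>" and s[measurable_cong]: "sets \<mu> = sets borel"
    and ch: "\<And>t. (CLINT z|\<mu>. iexp (t \<bullet> z)) = of_real (exp (- (quad_form S t t / 2)))"
  shows "centered_gaussian \<mu>" and "(LINT z|\<mu>. z $ j * z $ k) = S j k"
proof -
  interpret \<mu>: prob_space \<mu> by fact
  have q0: "quad_form S t t \<ge> 0" for t using S by (simp add: psd_def)
  have law: "distr \<mu> borel (\<lambda>z. t \<bullet> z) = normal_law (quad_form S t t)" for t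
  proof (rule eq_normal_lawI[OF _ _ q0])
    show "prob_space (distr \<mu> borel (\<lambda>z. t \<bullet> z))" by (rule \<mu>.prob_space_distr) measurable
    fix x
    have "char (distr \<mu> borel (\<lambda>z. t \<bullet> z)) x = (CLINT z|\<mu>. iexp ((x *\<^sub>R t) \<bullet> z))"
      unfolding char_def by (subst integral_distr) (auto simp: mult_ac)
    then show "char (distr \<mu> borel (\<lambda>z. t \<bullet> z)) x = of_real (exp (- (quad_form S t t * x\<^sup>2 / 2)))"
      unfolding ch by (simp add: quad_form_linear power2_eq_square mult_ac)
  qed simp
  show "centered_gaussian \<mu>"
    unfolding centered_gaussian_def using \<mu> s law q0 by blast
  have sq: "integrable \<mu> (\<lambda>z. (t \<bullet> z)\<^sup>2)" "(LINT z|\<mu>. (t \<bullet> z)\<^sup>2) = quad_form S t t" for t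
    using integrable_square_normal_law[OF q0[of t]] integral_square_normal_law[OF q0[of t]]
    by (simp_all add: law[symmetric] integrable_distr_eq integral_distr)
  \<comment> \<open>Polarization writes the product of two coordinates through squares of
    projections, whose means are known.\<close>
  have p: "z $ j * z $ k = (((axis j 1 + axis k 1) \<bullet> z)\<^sup>2 - (axis j 1 \<bullet> z)\<^sup>2 - (axis k 1 \<bullet> z)\<^sup>2) / 2" for z :: "real ^ 'k"
    by (simp add: inner_add_left inner_axis' power2_eq_square algebra_simps)
  have "(LINT z|\<mu>. z $ j * z $ k) = (quad_form S (axis j 1 + axis k 1) (axis j 1 + axis k 1)
      - quad_form S (axis j 1) (axis j 1) - quad_form S (axis k 1) (axis k 1)) / 2"
    unfolding p by (simp add: sq)
  also have "\<dots> = S j k" using S by (simp add: quad_form_linear quad_form_axis psd_def)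
  finally show "(LINT z|\<mu>. z $ j * z $ k) = S j k" .
qed

section \<open>Square integrable functions and the Wiener integral\<close>

definition square_integrable :: "'x measure \<Rightarrow> ('x \<Rightarrow> real) \<Rightarrow> bool" where
  "square_integrable M f \<longleftrightarrow> f \<in> borel_measurable M \<and> integrable M (\<lambda>x. (f x)\<^sup>2)"

lemma square_integrableD[measurable_dest]: "square_integrable M f \<Longrightarrow> f \<in> borel_measurable M"
  by (simp add: square_integrable_def)

lemma square_integrable_mult:
  assumes f: "square_integrable M f" and g: "square_integrable M g"
  shows "integrable M (\<lambda>x. f x * g x)"
proof (rule Bochner_Integration.integrable_bound)
  show "integrable M (\<lambda>x. (f x)\<^sup>2 + (g x)\<^sup>2)" using f g by (auto simp: square_integrable_def)
  show "(\<lambda>x. f x * g x) \<in> borel_measurable M" using f g by (auto simp: square_integrable_def)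
  show "AE x in M. norm (f x * g x) \<le> norm ((f x)\<^sup>2 + (g x)\<^sup>2)"
  proof (rule AE_I2)
    fix x
    have "2 * (\<bar>f x\<bar> * \<bar>g x\<bar>) \<le> (f x)\<^sup>2 + (g x)\<^sup>2"
      using sum_squares_bound[of "\<bar>f x\<bar>" "\<bar>g x\<bar>"] by simp
    moreover have "0 \<le> \<bar>f x\<bar> * \<bar>g x\<bar>" by simp
    ultimately show "norm (f x * g x) \<le> norm ((f x)\<^sup>2 + (g x)\<^sup>2)" unfolding real_norm_def abs_mult by linarith
  qed
qed

lemma square_integrable_add:
  assumes f: "square_integrable M f" and g: "square_integrable M g"
  shows "square_integrable M (\<lambda>x. f x + g x)"
  unfolding square_integrable_def
proof
  show "(\<lambda>x. f x + g x) \<in> borel_measurable M" using f g by (auto simp: square_integrable_def)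
  have "(\<lambda>x. (f x + g x)\<^sup>2) = (\<lambda>x. (f x)\<^sup>2 + (g x)\<^sup>2 + 2 * (f x * g x))"
    by (auto simp: power2_eq_square algebra_simps)
  then show "integrable M (\<lambda>x. (f x + g x)\<^sup>2)"
    using square_integrable_mult[OF f g] f g by (simp add: square_integrable_def)
qed

lemma square_integrable_scale: "square_integrable M f \<Longrightarrow> square_integrable M (\<lambda>x. c * f x)"
  by (auto simp: square_integrable_def power_mult_distrib)

lemma square_integrable_diff:
  assumes f: "square_integrable M f" and g: "square_integrable M g"
  shows "square_integrable M (\<lambda>x. f x - g x)"
  using square_integrable_add[OF f square_integrable_scale[OF g, of "-1"]] by simp

lemma square_integrable_zero: "square_integrable M (\<lambda>x. 0)"
  by (simp add: square_integrable_def)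

lemma square_integrable_sum:
  "(\<And>i. i \<in> I \<Longrightarrow> square_integrable M (f i)) \<Longrightarrow> square_integrable M (\<lambda>x. \<Sum>i\<in>I. f i x)"
  by (induction I rule: infinite_finite_induct) (auto intro: square_integrable_zero square_integrable_add)

lemma Cauchy_Schwarz_integral:
  assumes f: "square_integrable M f" and g: "square_integrable M g"
  shows "(LINT x|M. \<bar>f x * g x\<bar>)\<^sup>2 \<le> (LINT x|M. (f x)\<^sup>2) * (LINT x|M. (g x)\<^sup>2)"
proof -
  have [measurable]: "f \<in> borel_measurable M" "g \<in> borel_measurable M" using f g by (auto simp: square_integrable_def)
  have i: "integrable M (\<lambda>x. \<bar>f x * g x\<bar>)" using square_integrable_mult[OF f g] by simp
  have *: "(\<integral>\<^sup>+x. eabs (f x) * eabs (g x) \<partial>M) = ennreal (LINT x|M. \<bar>f x * g x\<bar>)"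
    by (subst nn_integral_eq_integral[OF i, symmetric]) (auto simp: ennreal_mult[symmetric] abs_mult)
  have sq: "(\<integral>\<^sup>+x. (eabs (h x))\<^sup>2 \<partial>M) = ennreal (LINT x|M. (h x)\<^sup>2)" if "square_integrable M h" for h
    using that by (subst nn_integral_eq_integral[symmetric]) (auto simp: ennreal_power square_integrable_def)
  have "(\<integral>\<^sup>+x. eabs (f x) * eabs (g x) \<partial>M)\<^sup>2 \<le> (\<integral>\<^sup>+x. (eabs (f x))\<^sup>2 \<partial>M) * (\<integral>\<^sup>+x. (eabs (g x))\<^sup>2 \<partial>M)"
    by (rule Cauchy_Schwarz_nn_integral) auto
  then show ?thesis unfolding * sq[OF f] sq[OF g]
    by (simp add: ennreal_power ennreal_mult[symmetric] integral_nonneg_AE)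
qed

lemma Cauchy_Schwarz_integral_sqrt:
  assumes f: "square_integrable M f" and g: "square_integrable M g"
  shows "(LINT x|M. \<bar>f x * g x\<bar>) \<le> sqrt (LINT x|M. (f x)\<^sup>2) * sqrt (LINT x|M. (g x)\<^sup>2)"
  using real_sqrt_le_mono[OF Cauchy_Schwarz_integral[OF f g]] by (simp add: real_sqrt_mult)

lemma (in prob_space) square_integrable_const: "square_integrable M (\<lambda>_. c)"
  by (simp add: square_integrable_def)

lemma (in prob_space) square_integrable_imp_integrable:
  "square_integrable M f \<Longrightarrow> integrable M f"
  using square_integrable_mult[OF _ square_integrable_const[of 1]] by simp

lemma (in prob_space) L1_le_L2:
  assumes "square_integrable M f"
  shows "(LINT x|M. \<bar>f x\<bar>)\<^sup>2 \<le> (LINT x|M. (f x)\<^sup>2)"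
  using Cauchy_Schwarz_integral[OF assms square_integrable_const[of 1]] by (simp add: prob_space)

lemma norm_iexp_diff: "cmod (iexp a - iexp b) \<le> \<bar>a - b\<bar>"
proof -
  have "iexp a - iexp b = iexp b * (iexp (a - b) - 1)"
    by (simp add: algebra_simps exp_add[symmetric])
  then have "cmod (iexp a - iexp b) = cmod (iexp (a - b) - 1)" by (simp add: norm_mult)
  also have "\<dots> \<le> \<bar>a - b\<bar>" using iexp_approx1[of "a - b" 0] by simp
  finally show ?thesis .
qed

lemma (in prob_space) char_diff_le:
  assumes [measurable]: "X \<in> borel_measurable M" "Y \<in> borel_measurable M" and i: "integrable M (\<lambda>w. X w - Y w)"
  shows "cmod ((CLINT w|M. iexp (X w)) - (CLINT w|M. iexp (Y w))) \<le> (LINT w|M. \<bar>X w - Y w\<bar>)"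
proof -
  have I: "integrable M (\<lambda>w. iexp (X w))" "integrable M (\<lambda>w. iexp (Y w))"
    by (auto intro!: integrable_const_bound[of _ 1])
  have "cmod ((CLINT w|M. iexp (X w)) - (CLINT w|M. iexp (Y w))) = cmod (CLINT w|M. iexp (X w) - iexp (Y w))"
    using I by simp
  also have "\<dots> \<le> (LINT w|M. cmod (iexp (X w) - iexp (Y w)))" by (rule integral_norm_bound)
  also have "\<dots> \<le> (LINT w|M. \<bar>X w - Y w\<bar>)"
    by (rule integral_mono) (use I i norm_iexp_diff in auto)
  finally show ?thesis .
qed

text \<open>The nonnegative integral matches the definition of \<open>has_wiener_integral\<close>
  and is meaningful before square integrability of the limit is known.\<close>

definition L2_tendsto :: "'x measure \<Rightarrow> (nat \<Rightarrow> 'x \<Rightarrow> real) \<Rightarrow> ('x \<Rightarrow> real) \<Rightarrow> bool" where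
  "L2_tendsto M fs f \<longleftrightarrow> (\<lambda>n. \<integral>\<^sup>+x. ennreal ((f x - fs n x)\<^sup>2) \<partial>M) \<longlonglongrightarrow> 0"

text \<open>Some error has finite square integral, so the limit is the sum of two square integrable
  functions.\<close>

lemma L2_tendsto_square_integrable:
  assumes c: "L2_tendsto M fs f" and fs: "\<And>n. square_integrable M (fs n)" and [measurable]: "f \<in> borel_measurable M"
  shows "square_integrable M f" "(\<lambda>n. LINT x|M. (f x - fs n x)\<^sup>2) \<longlonglongrightarrow> 0"
proof -
  have [measurable]: "\<And>n. fs n \<in> borel_measurable M" using fs by (auto simp: square_integrable_def)
  have "\<forall>\<^sub>F n in sequentially. nn_sq M (\<lambda>x. f x - fs n x) < 1"
    using c unfolding L2_tendsto_def by (rule order_tendstoD) simp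
  then obtain n0 where n0: "nn_sq M (\<lambda>x. f x - fs n0 x) < 1" by (auto simp: eventually_sequentially)
  then have "square_integrable M (\<lambda>x. f x - fs n0 x)"
    unfolding square_integrable_def by (auto intro!: integrableI_bounded dest: less_trans[OF _ ennreal_one_less_top])
  from square_integrable_add[OF this fs[of n0]] show f: "square_integrable M f" by simp
  have *: "(\<integral>\<^sup>+x. ennreal ((f x - fs n x)\<^sup>2) \<partial>M) = ennreal (LINT x|M. (f x - fs n x)\<^sup>2)" for n
    using square_integrable_diff[OF f fs[of n]] by (intro nn_integral_eq_integral) (auto simp: square_integrable_def)
  then have "(\<lambda>n. ennreal (LINT x|M. (f x - fs n x)\<^sup>2)) \<longlonglongrightarrow> ennreal 0"
    using c by (simp add: L2_tendsto_def)
  then show "(\<lambda>n. LINT x|M. (f x - fs n x)\<^sup>2) \<longlonglongrightarrow> 0"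
    by (subst (asm) tendsto_ennreal_iff) auto
qed

lemma sum_square_le:
  fixes a :: "'k \<Rightarrow> real"
  shows "(\<Sum>i\<in>I. a i)\<^sup>2 \<le> real (card I) * (\<Sum>i\<in>I. (a i)\<^sup>2)"
  using Cauchy_Schwarz_ineq_sum[of "\<lambda>_. 1" a I] by simp

lemma L2_tendsto_sum:
  fixes fs :: "'k::finite \<Rightarrow> nat \<Rightarrow> 'x \<Rightarrow> real"
  assumes c: "\<And>k. L2_tendsto M (fs k) (f k)" and fs: "\<And>k n. fs k n \<in> borel_measurable M" and f: "\<And>k. f k \<in> borel_measurable M"
  shows "L2_tendsto M (\<lambda>n x. \<Sum>k\<in>UNIV. t k * fs k n x) (\<lambda>x. \<Sum>k\<in>UNIV. t k * f k x)"
  unfolding L2_tendsto_def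
proof (rule tendsto_sandwich[OF always_eventually always_eventually tendsto_const])
  note [measurable] = fs f
  let ?U = "\<lambda>n. \<Sum>k\<in>UNIV. ennreal (real CARD('k) * (t k)\<^sup>2) * nn_sq M (\<lambda>x. f k x - fs k n x)"
  show "\<forall>n. nn_sq M (\<lambda>x. (\<Sum>k\<in>UNIV. t k * f k x) - (\<Sum>k\<in>UNIV. t k * fs k n x)) \<le> ?U n"
  proof
    fix n
    have "(\<integral>\<^sup>+x. ennreal (((\<Sum>k\<in>UNIV. t k * f k x) - (\<Sum>k\<in>UNIV. t k * fs k n x))\<^sup>2) \<partial>M)
       \<le> (\<integral>\<^sup>+x. (\<Sum>k\<in>UNIV. ennreal (real CARD('k) * (t k)\<^sup>2) * ennreal ((f k x - fs k n x)\<^sup>2)) \<partial>M)"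
    proof (rule nn_integral_mono)
      fix x
      have "((\<Sum>k\<in>UNIV. t k * f k x) - (\<Sum>k\<in>UNIV. t k * fs k n x))\<^sup>2 = (\<Sum>k\<in>UNIV. t k * (f k x - fs k n x))\<^sup>2"
        by (simp add: right_diff_distrib sum_subtractf)
      also have "\<dots> \<le> (\<Sum>k\<in>UNIV. (real CARD('k) * (t k)\<^sup>2) * (f k x - fs k n x)\<^sup>2)"
        using sum_square_le[of "\<lambda>k. t k * (f k x - fs k n x)" UNIV] by (simp add: power_mult_distrib sum_distrib_left mult_ac)
      finally show "ennreal (((\<Sum>k\<in>UNIV. t k * f k x) - (\<Sum>k\<in>UNIV. t k * fs k n x))\<^sup>2)
        \<le> (\<Sum>k\<in>UNIV. ennreal (real CARD('k) * (t k)\<^sup>2) * ennreal ((f k x - fs k n x)\<^sup>2))"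
        by (simp add: ennreal_mult[symmetric] sum_ennreal ennreal_leI del: ennreal_mult')
    qed
    also have "\<dots> = ?U n" by (simp add: nn_integral_sum nn_integral_cmult)
    finally show "nn_sq M (\<lambda>x. (\<Sum>k\<in>UNIV. t k * f k x) - (\<Sum>k\<in>UNIV. t k * fs k n x)) \<le> ?U n" .
  qed
  have "?U \<longlonglongrightarrow> (\<Sum>k\<in>(UNIV::'k set). ennreal (real CARD('k) * (t k)\<^sup>2) * 0)"
    by (intro tendsto_sum ennreal_tendsto_cmult) (use c in \<open>auto simp: L2_tendsto_def\<close>)
  then show "?U \<longlonglongrightarrow> 0" by simp
qed simp

lemma L2_tendsto_integral_square:
  assumes c: "L2_tendsto M fs f" and fs: "\<And>n. square_integrable M (fs n)" and m[measurable]: "f \<in> borel_measurable M"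
  shows "(\<lambda>n. LINT x|M. (fs n x)\<^sup>2) \<longlonglongrightarrow> (LINT x|M. (f x)\<^sup>2)"
proof -
  note f = L2_tendsto_square_integrable[OF c fs m]
  define a where "a n = (LINT x|M. (f x - fs n x)\<^sup>2)" for n
  have a0: "0 \<le> a n" for n by (simp add: a_def)
  have eq: "(LINT x|M. (fs n x)\<^sup>2) = (LINT x|M. (f x)\<^sup>2) - 2 * (LINT x|M. (f x - fs n x) * f x) + a n" for n
  proof -
    have d: "square_integrable M (\<lambda>x. f x - fs n x)" by (rule square_integrable_diff[OF f(1) fs])
    have "(\<lambda>x. (fs n x)\<^sup>2) = (\<lambda>x. (f x)\<^sup>2 - 2 * ((f x - fs n x) * f x) + (f x - fs n x)\<^sup>2)"
      by (auto simp: power2_eq_square algebra_simps)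
    then show ?thesis
      using square_integrable_mult[OF d f(1)] d f(1) by (simp add: square_integrable_def a_def)
  qed
  have "\<bar>LINT x|M. (f x - fs n x) * f x\<bar> \<le> sqrt (a n) * sqrt (LINT x|M. (f x)\<^sup>2)" for n
    using order_trans[OF integral_abs_bound Cauchy_Schwarz_integral_sqrt[OF square_integrable_diff[OF f(1) fs[of n]] f(1)]]
    by (simp add: a_def)
  moreover have "(\<lambda>n. sqrt (a n) * sqrt (LINT x|M. (f x)\<^sup>2)) \<longlonglongrightarrow> sqrt 0 * sqrt (LINT x|M. (f x)\<^sup>2)"
    using f(2) by (intro tendsto_intros) (simp add: a_def)
  ultimately have "(\<lambda>n. LINT x|M. (f x - fs n x) * f x) \<longlonglongrightarrow> 0"
    by - (rule Lim_null_comparison[of _ "\<lambda>n. sqrt (a n) * sqrt (LINT x|M. (f x)\<^sup>2)"], auto simp: always_eventually)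
  then have "(\<lambda>n. (LINT x|M. (f x)\<^sup>2) - 2 * (LINT x|M. (f x - fs n x) * f x) + a n) \<longlonglongrightarrow> (LINT x|M. (f x)\<^sup>2) - 2 * 0 + 0"
    using f(2) by (intro tendsto_intros) (auto simp: a_def)
  then show ?thesis by (simp add: eq)
qed

text \<open>The map X -> E exp(i X) is Lipschitz for the L^1 norm, which the L^2 norm dominates on a
  probability space.\<close>

lemma (in prob_space) L2_tendsto_char:
  assumes c: "L2_tendsto M Xs X" and Xs: "\<And>n. square_integrable M (Xs n)" and m[measurable]: "X \<in> borel_measurable M"
  shows "(\<lambda>n. CLINT w|M. iexp (Xs n w)) \<longlonglongrightarrow> (CLINT w|M. iexp (X w))"
proof -
  note f = L2_tendsto_square_integrable[OF c Xs m]
  have [measurable]: "\<And>n. Xs n \<in> borel_measurable M" using Xs by (auto simp: square_integrable_def)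
  have "cmod ((CLINT w|M. iexp (Xs n w)) - (CLINT w|M. iexp (X w))) \<le> sqrt (LINT w|M. (X w - Xs n w)\<^sup>2)" for n
  proof -
    have d: "square_integrable M (\<lambda>x. X x - Xs n x)" by (rule square_integrable_diff[OF f(1) Xs])
    have "cmod ((CLINT w|M. iexp (X w)) - (CLINT w|M. iexp (Xs n w))) \<le> (LINT w|M. \<bar>X w - Xs n w\<bar>)"
      by (rule char_diff_le) (use square_integrable_imp_integrable[OF d] in auto)
    also have "\<dots> \<le> sqrt (LINT w|M. (X w - Xs n w)\<^sup>2)" using L1_le_L2[OF d] by (rule real_le_rsqrt)
    finally show ?thesis by (simp add: norm_minus_commute)
  qed
  moreover have "(\<lambda>n. sqrt (LINT w|M. (X w - Xs n w)\<^sup>2)) \<longlonglongrightarrow> sqrt 0" using f(2) by (intro tendsto_intros)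
  ultimately have "(\<lambda>n. (CLINT w|M. iexp (Xs n w)) - (CLINT w|M. iexp (X w))) \<longlonglongrightarrow> 0"
    by - (rule Lim_null_comparison[of _ "\<lambda>n. sqrt (LINT w|M. (X w - Xs n w)\<^sup>2)"], auto simp: always_eventually)
  then show ?thesis by (simp add: LIM_zero_iff)
qed

lemma integral_double_sum:
  fixes F :: "'c \<Rightarrow> 'd \<Rightarrow> 'x \<Rightarrow> real"
  assumes "\<And>c d. c \<in> S \<Longrightarrow> d \<in> R \<Longrightarrow> integrable M (F c d)"
  shows "(LINT x|M. (\<Sum>c\<in>S. \<Sum>d\<in>R. F c d x)) = (\<Sum>c\<in>S. \<Sum>d\<in>R. LINT x|M. F c d x)"
proof -
  have "(LINT x|M. (\<Sum>c\<in>S. \<Sum>d\<in>R. F c d x)) = (\<Sum>c\<in>S. LINT x|M. (\<Sum>d\<in>R. F c d x))"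
    using assms by (intro Bochner_Integration.integral_sum Bochner_Integration.integrable_sum)
  also have "\<dots> = (\<Sum>c\<in>S. \<Sum>d\<in>R. LINT x|M. F c d x)"
    using assms by (intro sum.cong refl Bochner_Integration.integral_sum)
  finally show ?thesis .
qed

section \<open>White noise, its isometry, and the Wiener integral\<close>

locale white_noise_space =
  fixes N :: "'v measure" and W :: "'a::euclidean_space set \<Rightarrow> 'v \<Rightarrow> real"
  assumes wn: "white_noise N W"
begin

sublocale prob_space N using wn by (simp add: white_noise_def)

lemma W_measurable[measurable]: "A \<in> finite_borel \<Longrightarrow> W A \<in> borel_measurable N"
  using wn by (auto simp: white_noise_def)

lemma W_law: "A \<in> finite_borel \<Longrightarrow> distr N borel (W A) = normal_law (measure lborel A)"
  using wn by (auto simp: white_noise_def)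

lemma W_indep: "finite \<A> \<Longrightarrow> \<A> \<subseteq> finite_borel \<Longrightarrow> disjoint \<A> \<Longrightarrow> indep_vars (\<lambda>_. borel) W \<A>"
  using wn unfolding white_noise_def by blast

lemma W_square:
  assumes "A \<in> finite_borel"
  shows "square_integrable N (W A)" "(LINT w|N. (W A w)\<^sup>2) = measure lborel A"
  using integrable_square_normal_law[of "measure lborel A"] integral_square_normal_law[of "measure lborel A"] assms
  by (simp_all add: W_law[symmetric] integrable_distr_eq integral_distr square_integrable_def)

lemma finite_borel_ops:
  assumes "A \<in> finite_borel" "B \<in> finite_borel"
  shows "A \<inter> B \<in> finite_borel" "A - B \<in> finite_borel" "A \<union> B \<in> finite_borel"
proof -
  have [measurable]: "A \<in> sets borel" "B \<in> sets borel" and f: "emeasure lborel A < \<infinity>" "emeasure lborel B < \<infinity>"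
    using assms by (auto simp: finite_borel_def)
  have "emeasure lborel (A \<inter> B) \<le> emeasure lborel A" "emeasure lborel (A - B) \<le> emeasure lborel A"
    by (auto intro: emeasure_mono)
  moreover have "emeasure lborel (A \<union> B) \<le> emeasure lborel A + emeasure lborel B"
    by (intro emeasure_subadditive) auto
  ultimately show "A \<inter> B \<in> finite_borel" "A - B \<in> finite_borel" "A \<union> B \<in> finite_borel"
    using f by (auto simp: finite_borel_def intro: le_less_trans)
qed

lemma W_add:
  assumes "A \<in> finite_borel" "B \<in> finite_borel" "A \<inter> B = {}"
  shows "AE w in N. W (A \<union> B) w = W A w + W B w"
  using wn assms by (auto simp: white_noise_def)

text \<open>The variances of A, B and their union are the three volumes; additivity of both W and
  volume leaves nothing for the cross term.\<close>

lemma W_orthogonal: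
  assumes A: "A \<in> finite_borel" and B: "B \<in> finite_borel" and d: "A \<inter> B = {}"
  shows "(LINT w|N. W A w * W B w) = 0"
proof -
  note [measurable] = W_measurable[OF A] W_measurable[OF B] W_measurable[OF finite_borel_ops(3)[OF A B]]
  have "measure lborel (A \<union> B) = (LINT w|N. (W A w + W B w)\<^sup>2)"
    unfolding W_square(2)[OF finite_borel_ops(3)[OF A B], symmetric]
    by (rule integral_cong_AE) (use W_add[OF A B d] in \<open>auto elim: eventually_mono\<close>)
  also have "\<dots> = (LINT w|N. (W A w)\<^sup>2 + (W B w)\<^sup>2 + 2 * (W A w * W B w))"
    by (rule Bochner_Integration.integral_cong) (auto simp: power2_eq_square algebra_simps)
  also have "\<dots> = measure lborel A + measure lborel B + 2 * (LINT w|N. W A w * W B w)"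
    using W_square(1)[OF A] W_square(1)[OF B] square_integrable_mult[OF W_square(1)[OF A] W_square(1)[OF B]]
    by (simp add: W_square(2)[OF A] W_square(2)[OF B] square_integrable_def)
  finally show ?thesis using A B d by (subst (asm) measure_Union) (auto simp: finite_borel_def)
qed

lemma W_covariance:
  assumes A: "A \<in> finite_borel" and B: "B \<in> finite_borel"
  shows "(LINT w|N. W A w * W B w) = measure lborel (A \<inter> B)"
proof -
  let ?C = "A \<inter> B" and ?A = "A - B" and ?B = "B - A"
  have f: "?C \<in> finite_borel" "?A \<in> finite_borel" "?B \<in> finite_borel" using finite_borel_ops A B by auto
  note [measurable] = W_measurable[OF A] W_measurable[OF B] W_measurable[OF f(1)] W_measurable[OF f(2)] W_measurable[OF f(3)]
  have eq: "?C \<union> ?A = A" "?C \<union> ?B = B" by auto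
  have "AE w in N. W A w = W ?C w + W ?A w" "AE w in N. W B w = W ?C w + W ?B w"
    using W_add[OF f(1,2)] W_add[OF f(1,3)] unfolding eq by auto
  then have "(LINT w|N. W A w * W B w) = (LINT w|N. (W ?C w + W ?A w) * (W ?C w + W ?B w))"
    by (intro integral_cong_AE) auto
  also have "\<dots> = (LINT w|N. (W ?C w)\<^sup>2 + W ?C w * W ?B w + W ?A w * W ?C w + W ?A w * W ?B w)"
    by (rule Bochner_Integration.integral_cong) (auto simp: power2_eq_square algebra_simps)
  also have "\<dots> = measure lborel ?C + (LINT w|N. W ?C w * W ?B w) + (LINT w|N. W ?A w * W ?C w) + (LINT w|N. W ?A w * W ?B w)"
    using W_square(1)[OF f(1)] square_integrable_mult[OF W_square(1)[OF f(1)] W_square(1)[OF f(3)]]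
      square_integrable_mult[OF W_square(1)[OF f(2)] W_square(1)[OF f(1)]] square_integrable_mult[OF W_square(1)[OF f(2)] W_square(1)[OF f(3)]]
    by (simp add: W_square(2)[OF f(1)] square_integrable_def)
  also have "\<dots> = measure lborel ?C"
  proof -
    have "?C \<inter> ?B = {}" "?A \<inter> ?C = {}" "?A \<inter> ?B = {}" by auto
    then show ?thesis using W_orthogonal[OF f(1,3)] W_orthogonal[OF f(2,1)] W_orthogonal[OF f(2,3)] by simp
  qed
  finally show ?thesis .
qed

lemma simple_L2D:
  assumes "simple_L2 s"
  shows "finite (range s)" "s \<in> borel_measurable borel" "c \<noteq> 0 \<Longrightarrow> s -` {c} \<in> finite_borel"
    "square_integrable lborel s"
proof -
  show r: "finite (range s)" using assms by (auto simp: simple_L2_def simple_function_def)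
  have "s \<in> borel_measurable lborel" using assms unfolding simple_L2_def by (blast intro: borel_measurable_simple_function)
  then show s[measurable]: "s \<in> borel_measurable borel" by simp
  have *: "emeasure lborel {x. s x \<noteq> 0} < \<infinity>" using assms by (auto simp: simple_L2_def)
  show "s -` {c} \<in> finite_borel" if "c \<noteq> 0"
  proof -
    have [measurable]: "s -` {c} \<in> sets borel" using measurable_sets[OF s, of "{c}"] by simp
    have "emeasure lborel (s -` {c}) \<le> emeasure lborel {x. s x \<noteq> 0}" using that by (intro emeasure_mono) auto
    then show ?thesis using * by (auto simp: finite_borel_def intro: le_less_trans)
  qed
  have "finite ((\<lambda>y. y\<^sup>2) ` range s)" using r by simp
  then have B: "(s x)\<^sup>2 \<le> Max ((\<lambda>y. y\<^sup>2) ` range s)" for x by (intro Max_ge) auto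
  define B where "B = Max ((\<lambda>y. y\<^sup>2) ` range s)"
  note B = B[folded B_def]
  have "integrable lborel (\<lambda>x. B * indicator {x. s x \<noteq> 0} x)"
    using * by (intro integrable_mult_right integrable_real_indicator) auto
  then have "integrable lborel (\<lambda>x. (s x)\<^sup>2)"
    by (rule Bochner_Integration.integrable_bound) (use B in \<open>auto simp: indicator_def intro: order_trans[OF _ abs_ge_self]\<close>)
  then show "square_integrable lborel s" by (simp add: square_integrable_def)
qed

lemma simple_L2_expand:
  assumes "simple_L2 s"
  shows "s x = (\<Sum>c\<in>range s - {0}. c * indicator (s -` {c}) x)"
proof -
  have "(\<Sum>c\<in>range s - {0}. c * indicator (s -` {c}) x) = (\<Sum>c\<in>range s - {0}. if c = s x then c else 0)"
    by (intro sum.cong) (auto simp: indicator_def)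
  also have "\<dots> = s x" using simple_L2D(1)[OF assms] by (auto simp: sum.delta)
  finally show ?thesis ..
qed

lemma simple_wiener_square_integrable:
  assumes "simple_L2 s" shows "square_integrable N (simple_wiener_integral W s)"
  unfolding simple_wiener_integral_def[abs_def]
  by (intro square_integrable_sum square_integrable_scale W_square simple_L2D[OF assms]) auto

text \<open>The two step functions have unrelated level sets, so the covariance of W on
  intersections is summed over all pairs of levels.\<close>

lemma simple_wiener_isometry:
  assumes s: "simple_L2 s" and r: "simple_L2 r"
  shows "(LINT w|N. simple_wiener_integral W s w * simple_wiener_integral W r w) = (LINT x|lborel. s x * r x)"
proof -
  let ?S = "range s - {0}" and ?R = "range r - {0}"
  have fs: "c \<in> ?S \<Longrightarrow> s -` {c} \<in> finite_borel" for c using simple_L2D(3)[OF s] by auto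
  have fr: "c \<in> ?R \<Longrightarrow> r -` {c} \<in> finite_borel" for c using simple_L2D(3)[OF r] by auto
  have "(LINT w|N. simple_wiener_integral W s w * simple_wiener_integral W r w) =
      (LINT w|N. (\<Sum>c\<in>?S. \<Sum>d\<in>?R. (c * d) * (W (s -` {c}) w * W (r -` {d}) w)))"
    unfolding simple_wiener_integral_def sum_product
    by (intro Bochner_Integration.integral_cong sum.cong refl) simp
  also have "\<dots> = (\<Sum>c\<in>?S. \<Sum>d\<in>?R. (LINT w|N. (c * d) * (W (s -` {c}) w * W (r -` {d}) w)))"
    by (intro integral_double_sum integrable_mult_right square_integrable_mult W_square fs fr)
  also have "\<dots> = (\<Sum>c\<in>?S. \<Sum>d\<in>?R. (LINT x|lborel. (c * d) * indicator (s -` {c} \<inter> r -` {d}) x))"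
    using fs fr by (intro sum.cong refl) (simp add: W_covariance)
  also have "\<dots> = (LINT x|lborel. (\<Sum>c\<in>?S. \<Sum>d\<in>?R. (c * d) * indicator (s -` {c} \<inter> r -` {d}) x))"
  proof -
    have i: "integrable lborel (indicator (s -` {c} \<inter> r -` {d}) :: _ \<Rightarrow> real)" if "c \<in> ?S" "d \<in> ?R" for c d
      using finite_borel_ops(1)[OF fs[OF that(1)] fr[OF that(2)]] by (intro integrable_real_indicator) (auto simp: finite_borel_def)
    show ?thesis
      by (intro integral_double_sum[symmetric] integrable_mult_right i)
  qed
  also have "\<dots> = (LINT x|lborel. s x * r x)"
  proof (rule Bochner_Integration.integral_cong[OF refl])
    fix x
    have "s x * r x = (\<Sum>c\<in>?S. c * indicator (s -` {c}) x) * (\<Sum>c\<in>?R. c * indicator (r -` {c}) x)"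
      by (rule arg_cong2[OF simple_L2_expand[OF s] simple_L2_expand[OF r]])
    also have "\<dots> = (\<Sum>c\<in>?S. \<Sum>d\<in>?R. (c * d) * indicator (s -` {c} \<inter> r -` {d}) x)"
      unfolding sum_product by (intro sum.cong refl) (simp add: indicator_inter_arith)
    finally show "(\<Sum>c\<in>?S. \<Sum>d\<in>?R. (c * d) * indicator (s -` {c} \<inter> r -` {d}) x) = s x * r x" ..
  qed
  finally show ?thesis .
qed

text \<open>The simple integral is defined through level sets, and those of a linear combination
  differ from those of its terms. Linearity is therefore deduced from the isometry: the difference
  of the two sides has mean square zero.\<close>

lemma simple_wiener_sum_AE:
  fixes s :: "'k::finite \<Rightarrow> 'a \<Rightarrow> real"
  assumes s: "\<And>k. simple_L2 (s k)" and r: "simple_L2 (\<lambda>x. \<Sum>k\<in>UNIV. t k * s k x)"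
  shows "AE w in N. (\<Sum>k\<in>UNIV. t k * simple_wiener_integral W (s k) w)
    = simple_wiener_integral W (\<lambda>x. \<Sum>k\<in>UNIV. t k * s k x) w"
proof -
  let ?r = "\<lambda>x. \<Sum>k\<in>UNIV. t k * s k x"
  define a where "a k = simple_wiener_integral W (s k)" for k
  define b where "b = simple_wiener_integral W ?r"
  have a: "square_integrable N (a k)" for k unfolding a_def by (rule simple_wiener_square_integrable[OF s])
  have b: "square_integrable N b" unfolding b_def by (rule simple_wiener_square_integrable[OF r])
  have sk: "square_integrable lborel (s k)" for k by (rule simple_L2D(4)[OF s])
  have d: "square_integrable N (\<lambda>w. (\<Sum>k\<in>UNIV. t k * a k w) - b w)"
    by (intro square_integrable_diff square_integrable_sum square_integrable_scale a b)
  have ab: "(LINT w|N. a k w * b w) = (LINT x|lborel. s k x * ?r x)" for k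
    unfolding a_def b_def by (rule simple_wiener_isometry[OF s r])
  have aa: "(LINT w|N. a j w * a k w) = (LINT x|lborel. s j x * s k x)" for j k
    unfolding a_def by (rule simple_wiener_isometry[OF s s])
  have bb: "(LINT w|N. b w * b w) = (LINT x|lborel. ?r x * ?r x)"
    unfolding b_def by (rule simple_wiener_isometry[OF r r])
  have skr: "(LINT x|lborel. s j x * ?r x) = (\<Sum>k\<in>UNIV. t k * (LINT x|lborel. s j x * s k x))" for j
    by (simp add: sum_distrib_left mult.left_commute[of _ "t _"] square_integrable_mult[OF sk sk])
  have rr: "(LINT x|lborel. ?r x * ?r x) = (\<Sum>j\<in>UNIV. t j * (LINT x|lborel. s j x * ?r x))"
  proof -
    have "(LINT x|lborel. ?r x * ?r x) = (LINT x|lborel. (\<Sum>j\<in>UNIV. t j * (s j x * ?r x)))"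
      by (simp add: sum_distrib_right mult.assoc)
    also have "\<dots> = (\<Sum>j\<in>UNIV. t j * (LINT x|lborel. s j x * ?r x))"
      by (simp add: square_integrable_mult[OF sk simple_L2D(4)[OF r]])
    finally show ?thesis .
  qed
  have "(LINT w|N. ((\<Sum>k\<in>UNIV. t k * a k w) - b w)\<^sup>2)
     = (LINT w|N. (\<Sum>j\<in>UNIV. \<Sum>k\<in>UNIV. t j * t k * (a j w * a k w)) - 2 * (\<Sum>k\<in>UNIV. t k * (a k w * b w)) + b w * b w)"
    by (intro Bochner_Integration.integral_cong refl)
       (simp add: power2_eq_square algebra_simps sum_product sum_distrib_left sum_distrib_right)
  also have "\<dots> = (\<Sum>j\<in>UNIV. \<Sum>k\<in>UNIV. t j * t k * (LINT x|lborel. s j x * s k x)) - 2 * (\<Sum>k\<in>UNIV. t k * (LINT x|lborel. s k x * ?r x)) + (LINT x|lborel. ?r x * ?r x)"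
    using square_integrable_mult[OF a a] square_integrable_mult[OF a b] square_integrable_mult[OF b b]
    by (simp add: aa ab bb)
  also have "\<dots> = 0"
    unfolding rr skr by (simp add: sum_distrib_left mult.assoc)
  finally have z: "(LINT w|N. ((\<Sum>k\<in>UNIV. t k * a k w) - b w)\<^sup>2) = 0" .
  have "AE w in N. ((\<Sum>k\<in>UNIV. t k * a k w) - b w)\<^sup>2 = 0"
    using z d by (subst (asm) integral_nonneg_eq_0_iff_AE) (auto simp: square_integrable_def)
  then show ?thesis unfolding a_def b_def by eventually_elim simp
qed

text \<open>W is independent over the disjoint level sets, so the characteristic function is a
  product of normal ones, and the exponents add up to the integral of s^2.\<close>

lemma simple_wiener_char:
  assumes s: "simple_L2 s"
  shows "(CLINT w|N. iexp (simple_wiener_integral W s w)) = of_real (exp (- ((LINT x|lborel. (s x)\<^sup>2) / 2)))"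
proof -
  let ?S = "range s - {0}"
  define f where "f c = s -` {c}" for c
  have inj: "inj_on f ?S" by (auto simp: inj_on_def f_def)
  have fin: "finite ?S" using simple_L2D(1)[OF s] by simp
  have fb: "c \<in> ?S \<Longrightarrow> f c \<in> finite_borel" for c using simple_L2D(3)[OF s] by (auto simp: f_def)
  have "indep_vars (\<lambda>_. borel) W (f ` ?S)"
    by (rule W_indep) (use fin fb in \<open>auto simp: f_def disjoint_def\<close>)
  \<comment> \<open>Independence of W is indexed by sets; \<open>g\<close> recovers from a level set
    the value taken on it, so that the sum over values becomes a sum over independent terms.\<close>
  define g where "g A = the_inv_into ?S f A" for A
  have gf: "c \<in> ?S \<Longrightarrow> g (f c) = c" for c using the_inv_into_f_f[OF inj] by (simp add: g_def)
  have iv: "indep_vars (\<lambda>_. borel) (\<lambda>A w. g A * W A w) (f ` ?S)"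
    using indep_vars_compose[OF \<open>indep_vars (\<lambda>_. borel) W (f ` ?S)\<close>, of "\<lambda>A x. g A * x" "\<lambda>_. borel"] by (simp add: comp_def)
  have "simple_wiener_integral W s w = (\<Sum>A\<in>f ` ?S. g A * W A w)" for w
    unfolding simple_wiener_integral_def by (subst sum.reindex[OF inj]) (auto simp: gf f_def[symmetric] intro!: sum.cong)
  then have "(CLINT w|N. iexp (simple_wiener_integral W s w)) = (CLINT w|N. iexp (\<Sum>A\<in>f ` ?S. g A * W A w))"
    by simp
  also have "\<dots> = char (distr N borel (\<lambda>w. \<Sum>A\<in>f ` ?S. g A * W A w)) 1"
    using fb unfolding char_def by (subst integral_distr) (auto simp del: of_real_sum intro!: borel_measurable_sum borel_measurable_times W_measurable)
  also have "\<dots> = (\<Prod>A\<in>f ` ?S. char (distr N borel (\<lambda>w. g A * W A w)) 1)" by (rule char_distr_sum[OF iv])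
  also have "\<dots> = (\<Prod>c\<in>?S. char (distr N borel (\<lambda>w. c * W (f c) w)) 1)"
    by (subst prod.reindex[OF inj]) (auto simp: gf intro!: prod.cong)
  also have "\<dots> = (\<Prod>c\<in>?S. of_real (exp (- (c\<^sup>2 * measure lborel (f c) / 2))))"
  proof (rule prod.cong[OF refl])
    fix c assume c: "c \<in> ?S"
    have "char (distr N borel (\<lambda>w. c * W (f c) w)) 1 = char (distr N borel (W (f c))) c"
      using fb[OF c] unfolding char_def by (subst (1 2) integral_distr) auto
    also have "\<dots> = of_real (exp (- (measure lborel (f c) * c\<^sup>2 / 2)))"
      by (simp add: W_law[OF fb[OF c]] char_normal_law)
    finally show "char (distr N borel (\<lambda>w. c * W (f c) w)) 1 = of_real (exp (- (c\<^sup>2 * measure lborel (f c) / 2)))"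
      by (simp add: mult.commute)
  qed
  also have "\<dots> = of_real (exp (\<Sum>c\<in>?S. - (c\<^sup>2 * measure lborel (f c) / 2)))"
    using fin by (simp add: exp_sum)
  also have "(\<Sum>c\<in>?S. - (c\<^sup>2 * measure lborel (f c) / 2)) = - ((LINT x|lborel. (s x)\<^sup>2) / 2)"
  proof -
    have "(s x)\<^sup>2 = (\<Sum>c\<in>?S. c\<^sup>2 * indicator (f c) x)" for x
    proof -
      have "(\<Sum>c\<in>?S. c\<^sup>2 * indicator (f c) x) = (\<Sum>c\<in>?S. if c = s x then c\<^sup>2 else 0)"
        by (intro sum.cong) (auto simp: indicator_def f_def)
      also have "\<dots> = (s x)\<^sup>2" using fin by (auto simp: sum.delta)
      finally show ?thesis ..
    qed
    then have "(LINT x|lborel. (s x)\<^sup>2) = (LINT x|lborel. (\<Sum>c\<in>?S. c\<^sup>2 * indicator (f c) x))" by simp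
    also have "\<dots> = (\<Sum>c\<in>?S. (LINT x|lborel. c\<^sup>2 * indicator (f c) x))"
      using fb by (intro Bochner_Integration.integral_sum integrable_mult_right integrable_real_indicator) (auto simp: finite_borel_def)
    finally show ?thesis by (simp add: sum_negf sum_divide_distrib)
  qed
  finally show ?thesis .
qed

lemma simple_L2_sum:
  fixes s :: "'k::finite \<Rightarrow> 'a \<Rightarrow> real"
  assumes s: "\<And>k. simple_L2 (s k)" shows "simple_L2 (\<lambda>x. \<Sum>k\<in>UNIV. t k * s k x)"
  unfolding simple_L2_def
proof
  show "simple_function lborel (\<lambda>x. \<Sum>k\<in>UNIV. t k * s k x)"
    using s by (intro simple_function_sum simple_function_mult simple_function_const) (simp add: simple_L2_def)
  note [measurable] = simple_L2D(2)[OF s]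
  have "emeasure lborel {x. (\<Sum>k\<in>UNIV. t k * s k x) \<noteq> 0} \<le> emeasure lborel (\<Union>k. {x. s k x \<noteq> 0})"
  proof (rule emeasure_mono)
    have "(\<Sum>k\<in>UNIV. t k * s k x) = 0" if "\<And>k. s k x = 0" for x using that by simp
    then show "{x. (\<Sum>k\<in>UNIV. t k * s k x) \<noteq> 0} \<subseteq> (\<Union>k. {x. s k x \<noteq> 0})" by blast
  qed simp
  also have "\<dots> \<le> (\<Sum>k\<in>UNIV. emeasure lborel {x. s k x \<noteq> 0})"
    by (intro emeasure_subadditive_finite) auto
  also have "\<dots> < \<infinity>" using s by (auto simp: simple_L2_def)
  finally show "emeasure lborel {x. (\<Sum>k\<in>UNIV. t k * s k x) \<noteq> 0} < \<infinity>" .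
qed

text \<open>The approximating sequences come from the definition, one for each index. Their
  combination is again simple, so both sides of \<open>simple_wiener_char\<close> pass to the limit
  in mean square.\<close>

lemma wiener_char:
  fixes h :: "'k::finite \<Rightarrow> 'a \<Rightarrow> real"
  assumes X: "\<And>k. has_wiener_integral N W (h k) (X k)" and h[measurable]: "\<And>k. h k \<in> borel_measurable borel"
  shows "(CLINT w|N. iexp (\<Sum>k\<in>UNIV. t k * X k w)) = of_real (exp (- ((LINT x|lborel. (\<Sum>k\<in>UNIV. t k * h k x)\<^sup>2) / 2)))"
proof -
  have "\<forall>k. \<exists>s. (\<forall>n::nat. simple_L2 (s n)) \<and> L2_tendsto lborel s (h k) \<and>
     L2_tendsto N (\<lambda>n. simple_wiener_integral W (s n)) (X k)"
    using X unfolding has_wiener_integral_def L2_tendsto_def by blast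
  then obtain s where s: "\<And>k n. simple_L2 (s k n)" and sh: "\<And>k. L2_tendsto lborel (s k) (h k)"
     and sX: "\<And>k. L2_tendsto N (\<lambda>n. simple_wiener_integral W (s k n)) (X k)"
    by metis
  have [measurable]: "X k \<in> borel_measurable N" for k using X by (simp add: has_wiener_integral_def)
  have [measurable]: "s k n \<in> borel_measurable borel" for k n by (rule simple_L2D(2)[OF s])
  define r where "r n x = (\<Sum>k\<in>UNIV. t k * s k n x)" for n x
  have r: "simple_L2 (r n)" for n unfolding r_def[abs_def] by (rule simple_L2_sum[OF s])
  have "(\<lambda>n. CLINT w|N. iexp (\<Sum>k\<in>UNIV. t k * simple_wiener_integral W (s k n) w)) \<longlonglongrightarrow> (CLINT w|N. iexp (\<Sum>k\<in>UNIV. t k * X k w))"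
    by (intro L2_tendsto_char L2_tendsto_sum sX square_integrable_sum square_integrable_scale simple_wiener_square_integrable s
        square_integrableD[OF simple_wiener_square_integrable]) auto
  moreover have "(CLINT w|N. iexp (\<Sum>k\<in>UNIV. t k * simple_wiener_integral W (s k n) w)) = of_real (exp (- ((LINT x|lborel. (r n x)\<^sup>2) / 2)))" for n
  proof -
    note [measurable] = square_integrableD[OF simple_wiener_square_integrable[OF s]] square_integrableD[OF simple_wiener_square_integrable[OF r]]
    have "AE w in N. (\<Sum>k\<in>UNIV. t k * simple_wiener_integral W (s k n) w) = simple_wiener_integral W (r n) w"
      unfolding r_def[abs_def] by (rule simple_wiener_sum_AE) (use s r in \<open>auto simp: r_def[abs_def]\<close>)
    then have "(CLINT w|N. iexp (\<Sum>k\<in>UNIV. t k * simple_wiener_integral W (s k n) w)) = (CLINT w|N. iexp (simple_wiener_integral W (r n) w))"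
      by (intro integral_cong_AE) (auto elim!: eventually_mono simp del: of_real_sum)
    then show ?thesis by (simp add: simple_wiener_char[OF r])
  qed
  moreover have "(\<lambda>n. LINT x|lborel. (r n x)\<^sup>2) \<longlonglongrightarrow> (LINT x|lborel. (\<Sum>k\<in>UNIV. t k * h k x)\<^sup>2)"
  proof (rule L2_tendsto_integral_square)
    show "L2_tendsto lborel r (\<lambda>x. \<Sum>k\<in>UNIV. t k * h k x)"
      unfolding r_def[abs_def] by (rule L2_tendsto_sum[OF sh]) auto
  qed (use simple_L2D(4)[OF r] in auto)
  then have "(\<lambda>n. complex_of_real (exp (- ((LINT x|lborel. (r n x)\<^sup>2) / 2)))) \<longlonglongrightarrow> of_real (exp (- ((LINT x|lborel. (\<Sum>k\<in>UNIV. t k * h k x)\<^sup>2) / 2)))"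
    by (intro tendsto_intros) auto
  ultimately show ?thesis by (metis (no_types, lifting) LIMSEQ_unique ext)
qed

text \<open>Completeness of L^2 made explicit: dyadic step functions converge to \<open>h\<close> at
  rate 2^(-n), the isometry transfers this rate to their integrals, and a geometric rate gives an
  almost sure limit.\<close>

lemma has_wiener_integral_exists:
  assumes h[measurable]: "h \<in> borel_measurable borel" and B: "\<And>x. \<bar>h x\<bar> \<le> B"
    and D: "D \<in> finite_borel" and z: "\<And>x. x \<notin> D \<Longrightarrow> h x = 0"
  shows "\<exists>X. has_wiener_integral N W h X"
proof -
  define V where "V = measure lborel D"
  have [measurable]: "D \<in> sets borel" and eD: "emeasure lborel D < \<infinity>" using D by (auto simp: finite_borel_def)
  have V: "emeasure lborel D = ennreal V" using eD by (simp add: V_def emeasure_eq_ennreal_measure less_top)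
  have V0: "0 \<le> V" by (simp add: V_def)
  \<comment> \<open>Rounding down to the grid of mesh 2^(-n): the error is uniform, only finitely
    many values occur since \<open>h\<close> is bounded, and zeros of \<open>h\<close> stay zeros,
    so the support remains in \<open>D\<close>.\<close>
  define s where "s n x = real_of_int \<lfloor>2 ^ n * h x\<rfloor> / 2 ^ n" for n :: nat and x
  have [measurable]: "s n \<in> borel_measurable borel" for n unfolding s_def by measurable
  have s0: "s n x = 0" if "x \<notin> D" for n x using z[OF that] by (simp add: s_def)
  have err: "\<bar>h x - s n x\<bar> \<le> (1/2) ^ n" for n x
  proof -
    have "\<bar>2 ^ n * h x - real_of_int \<lfloor>2 ^ n * h x\<rfloor>\<bar> \<le> 1" by linarith
    then have "\<bar>2 ^ n * h x - real_of_int \<lfloor>2 ^ n * h x\<rfloor>\<bar> / 2 ^ n \<le> 1 / 2 ^ n" by (intro divide_right_mono) auto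
    moreover have "h x - s n x = (2 ^ n * h x - real_of_int \<lfloor>2 ^ n * h x\<rfloor>) / 2 ^ n"
      by (simp add: s_def diff_divide_distrib)
    then have "\<bar>2 ^ n * h x - real_of_int \<lfloor>2 ^ n * h x\<rfloor>\<bar> / 2 ^ n = \<bar>h x - s n x\<bar>"
      by (simp only: abs_divide) simp
    ultimately show ?thesis by (simp add: power_one_over)
  qed
  have simple: "simple_L2 (s n)" for n
    unfolding simple_L2_def
  proof
    have "range (s n) \<subseteq> (\<lambda>i. real_of_int i / 2 ^ n) ` {- \<lceil>2 ^ n * B\<rceil> - 1..\<lceil>2 ^ n * B\<rceil>}"
    proof
      fix y assume "y \<in> range (s n)"
      then obtain x where y: "y = s n x" by auto
      have "\<bar>2 ^ n * h x\<bar> \<le> 2 ^ n * B" using B[of x] by (simp add: abs_mult)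
      then have "2 ^ n * h x \<le> 2 ^ n * B" "- (2 ^ n * h x) \<le> 2 ^ n * B" unfolding abs_le_iff by blast+
      then have "\<lfloor>2 ^ n * h x\<rfloor> \<in> {- \<lceil>2 ^ n * B\<rceil> - 1..\<lceil>2 ^ n * B\<rceil>}"
        unfolding atLeastAtMost_iff by linarith
      then show "y \<in> (\<lambda>i. real_of_int i / 2 ^ n) ` {- \<lceil>2 ^ n * B\<rceil> - 1..\<lceil>2 ^ n * B\<rceil>}"
        unfolding y s_def by blast
    qed
    then have "finite (range (s n))" by (rule finite_subset) auto
    then show "simple_function lborel (s n)" by (intro simple_function_borel_measurable) auto
    have "emeasure lborel {x. s n x \<noteq> 0} \<le> emeasure lborel D" using s0[of _ n] by (intro emeasure_mono) auto
    then show "emeasure lborel {x. s n x \<noteq> 0} < \<infinity>" using eD by (rule le_less_trans)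
  qed
  define S where "S n = simple_wiener_integral W (s n)" for n
  have Sq: "square_integrable N (S n)" for n unfolding S_def by (rule simple_wiener_square_integrable[OF simple])
  then have [measurable]: "S n \<in> borel_measurable N" for n by (auto simp: square_integrable_def)
  have ssq: "square_integrable lborel (s n)" for n by (rule simple_L2D(4)[OF simple])
  \<comment> \<open>Both errors are at most 2^(-n) when n \<le> m, hence the factor 2; the square is
    integrated over \<open>D\<close> alone.\<close>
  have iso: "(\<integral>\<^sup>+w. ennreal ((S m w - S n w)\<^sup>2) \<partial>N) \<le> ennreal ((2 * (1/2)^n)\<^sup>2 * V)" if "n \<le> m" for m n
  proof -
    have eq: "(S m w - S n w)\<^sup>2 = S m w * S m w - 2 * (S m w * S n w) + S n w * S n w" for w
      by (simp add: power2_eq_square algebra_simps)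
    have eq': "(s m x - s n x)\<^sup>2 = s m x * s m x - 2 * (s m x * s n x) + s n x * s n x" for x
      by (simp add: power2_eq_square algebra_simps)
    have "(LINT w|N. (S m w - S n w)\<^sup>2) = (LINT x|lborel. (s m x - s n x)\<^sup>2)"
      unfolding eq eq' using square_integrable_mult[OF Sq Sq] square_integrable_mult[OF ssq ssq]
      by (simp add: S_def simple_wiener_isometry[OF simple simple])
    also have "\<dots> \<le> (LINT x|lborel. (2 * (1/2)^n)\<^sup>2 * indicator D x)"
    proof (rule integral_mono)
      show "integrable lborel (\<lambda>x. (s m x - s n x)\<^sup>2)" using square_integrable_diff[OF ssq ssq] by (simp add: square_integrable_def)
      show "integrable lborel (\<lambda>x. (2 * (1/2)^n)\<^sup>2 * indicator D x :: real)" using eD by (intro integrable_mult_right integrable_real_indicator) auto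
      fix x
      have "(1/2::real)^m \<le> (1/2)^n" using that by (intro power_decreasing) auto
      then have "\<bar>s m x - s n x\<bar> \<le> 2 * (1/2)^n" using err[of x m] err[of x n] by linarith
      then have "\<bar>s m x - s n x\<bar>\<^sup>2 \<le> (2 * (1/2)^n)\<^sup>2" by (intro power_mono) auto
      then show "(s m x - s n x)\<^sup>2 \<le> (2 * (1/2)^n)\<^sup>2 * indicator D x"
        using s0[of x m] s0[of x n] by (cases "x \<in> D") auto
    qed
    also have "\<dots> = (2 * (1/2)^n)\<^sup>2 * V" by (simp add: V_def)
    finally have le: "(LINT w|N. (S m w - S n w)\<^sup>2) \<le> (2 * (1/2)^n)\<^sup>2 * V" .
    have "(\<integral>\<^sup>+w. ennreal ((S m w - S n w)\<^sup>2) \<partial>N) = ennreal (LINT w|N. (S m w - S n w)\<^sup>2)"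
      using square_integrable_diff[OF Sq Sq] by (intro nn_integral_eq_integral) (auto simp: square_integrable_def)
    then show ?thesis using le by (simp add: ennreal_leI)
  qed
  \<comment> \<open>Summable mean increments make the series of increments absolutely convergent
    almost surely.\<close>
  have L1: "(\<integral>\<^sup>+w. eabs (S (Suc n) w - S n w) \<partial>N) \<le> ennreal (2 * (1/2)^n * sqrt V)" for n
  proof -
    have d: "square_integrable N (\<lambda>w. S (Suc n) w - S n w)" by (rule square_integrable_diff[OF Sq Sq])
    have "ennreal (LINT w|N. (S (Suc n) w - S n w)\<^sup>2) \<le> ennreal ((2 * (1/2)^n)\<^sup>2 * V)"
      using iso[of n "Suc n"] d by (simp add: nn_integral_eq_integral square_integrable_def)
    then have "(LINT w|N. (S (Suc n) w - S n w)\<^sup>2) \<le> (2 * (1/2)^n * sqrt V)\<^sup>2"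
      using V0 by (subst (asm) ennreal_le_iff) (auto simp: power_mult_distrib)
    then have "(LINT w|N. \<bar>S (Suc n) w - S n w\<bar>) \<le> 2 * (1/2)^n * sqrt V"
      by (rule power2_le_imp_le[OF order_trans[OF L1_le_L2[OF d]]]) (use V0 in auto)
    then show ?thesis using square_integrable_imp_integrable[OF d]
      by (subst nn_integral_eq_integral) (auto intro: ennreal_leI)
  qed
  have "(\<integral>\<^sup>+w. (\<Sum>n. eabs (S (Suc n) w - S n w)) \<partial>N) = (\<Sum>n. \<integral>\<^sup>+w. eabs (S (Suc n) w - S n w) \<partial>N)"
    by (rule nn_integral_suminf) measurable
  also have "\<dots> \<le> (\<Sum>n. ennreal (2 * (1/2)^n * sqrt V))" by (intro suminf_le L1) auto
  also have "\<dots> < \<infinity>"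
    using V0 by (subst suminf_ennreal2) (auto intro!: summable_mult summable_mult2 summable_geometric)
  finally have fin: "(\<integral>\<^sup>+w. (\<Sum>n. eabs (S (Suc n) w - S n w)) \<partial>N) \<noteq> \<infinity>" by simp
  define X where "X w = lim (\<lambda>n. S n w)" for w
  have [measurable]: "X \<in> borel_measurable N" unfolding X_def[abs_def] by measurable
  have conv: "AE w in N. (\<lambda>n. S n w) \<longlonglongrightarrow> X w"
  proof -
    have "AE w in N. (\<Sum>n. eabs (S (Suc n) w - S n w)) \<noteq> \<infinity>"
      by (rule nn_integral_PInf_AE[OF _ fin]) measurable
    then show ?thesis
    proof eventually_elim
      case (elim w)
      have "summable (\<lambda>n. norm (S (Suc n) w - S n w))"
        using elim by (intro summable_suminf_not_top) auto
      then have "convergent (\<lambda>n. \<Sum>i<n. S (Suc i) w - S i w)"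
        by (intro summable_norm_cancel[THEN summable_iff_convergent[THEN iffD1]])
      moreover have "(\<Sum>i<n. S (Suc i) w - S i w) = S n w - S 0 w" for n by (induction n) auto
      ultimately have "convergent (\<lambda>n. S n w - S 0 w)" by simp
      then have "convergent (\<lambda>n. S n w)" by (simp add: convergent_diff_const_right_iff)
      then show ?case unfolding X_def by (simp add: convergent_LIMSEQ_iff)
    qed
  qed
  \<comment> \<open>Fatou's lemma for m -> \<infinity> in the Cauchy estimate carries the same rate
    over to the limit.\<close>
  have XS: "(\<integral>\<^sup>+w. ennreal ((X w - S n w)\<^sup>2) \<partial>N) \<le> ennreal ((2 * (1/2)^n)\<^sup>2 * V)" for n
  proof -
    have "(\<integral>\<^sup>+w. ennreal ((X w - S n w)\<^sup>2) \<partial>N) = (\<integral>\<^sup>+w. liminf (\<lambda>m. ennreal ((S m w - S n w)\<^sup>2)) \<partial>N)"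
      by (rule nn_integral_cong_AE, use conv in eventually_elim)
         (intro lim_imp_Liminf[symmetric] tendsto_ennrealI tendsto_intros, auto)
    also have "\<dots> \<le> liminf (\<lambda>m. \<integral>\<^sup>+w. ennreal ((S m w - S n w)\<^sup>2) \<partial>N)"
      by (rule nn_integral_liminf) measurable
    also have "\<dots> \<le> ennreal ((2 * (1/2)^n)\<^sup>2 * V)"
      by (intro Liminf_le) (use iso[of n] in \<open>auto simp: eventually_sequentially\<close>)
    finally show ?thesis .
  qed
  have lim0: "(\<lambda>n. ennreal ((2 * (1/2)^n)\<^sup>2 * V)) \<longlonglongrightarrow> 0"
  proof -
    have "(\<lambda>n. (2 * (1/2::real)^n)\<^sup>2 * V) \<longlonglongrightarrow> (2 * 0)\<^sup>2 * V"
      by (intro tendsto_intros LIMSEQ_power_zero) auto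
    then show ?thesis using tendsto_ennrealI by fastforce
  qed
  have "(\<lambda>n. \<integral>\<^sup>+x. ennreal ((h x - s n x)\<^sup>2) \<partial>lborel) \<longlonglongrightarrow> 0"
  proof (rule tendsto_sandwich[OF always_eventually always_eventually tendsto_const lim0], simp, rule allI)
    fix n
    have "(\<integral>\<^sup>+x. ennreal ((h x - s n x)\<^sup>2) \<partial>lborel) \<le> (\<integral>\<^sup>+x. ennreal ((2 * (1/2)^n)\<^sup>2) * indicator D x \<partial>lborel)"
    proof (rule nn_integral_mono)
      fix x
      have "\<bar>h x - s n x\<bar> \<le> 2 * (1/2)^n" using err[of x n] by simp
      then have "\<bar>h x - s n x\<bar>\<^sup>2 \<le> (2 * (1/2)^n)\<^sup>2" by (intro power_mono) auto
      then show "ennreal ((h x - s n x)\<^sup>2) \<le> ennreal ((2 * (1/2)^n)\<^sup>2) * indicator D x"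
        using s0[of x n] z[of x] by (cases "x \<in> D") (auto intro: ennreal_leI)
    qed
    also have "\<dots> = ennreal ((2 * (1/2)^n)\<^sup>2 * V)" using V0 by (simp add: nn_integral_cmult V ennreal_mult')
    finally show "nn_sq lborel (\<lambda>x. h x - s n x) \<le> ennreal ((2 * (1/2)^n)\<^sup>2 * V)" .
  qed
  moreover have "(\<lambda>n. \<integral>\<^sup>+w. ennreal ((X w - S n w)\<^sup>2) \<partial>N) \<longlonglongrightarrow> 0"
    by (rule tendsto_sandwich[OF always_eventually always_eventually tendsto_const lim0]) (use XS in auto)
  ultimately have "has_wiener_integral N W h X"
    unfolding has_wiener_integral_def using simple by (auto simp: S_def[symmetric] intro!: exI[of _ s])
  then show ?thesis by (intro exI[of _ X])
qed

lemma wiener_integral_char: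
  fixes h :: "'k::finite \<Rightarrow> 'a \<Rightarrow> real"
  assumes h: "\<And>k. (\<lambda>x. indicator D x * h k x) \<in> borel_measurable borel" and B: "\<And>k x. x \<in> D \<Longrightarrow> \<bar>h k x\<bar> \<le> B"
    and D: "D \<in> finite_borel"
  shows "wiener_integral N W D (h k) \<in> borel_measurable N"
    and "(CLINT w|N. iexp (\<Sum>k\<in>UNIV. t k * wiener_integral N W D (h k) w))
      = of_real (exp (- ((LINT x:D|lborel. (\<Sum>k\<in>UNIV. t k * h k x)\<^sup>2) / 2)))"
proof -
  \<comment> \<open>\<open>wiener_integral\<close> is a choice; existence is what makes the chosen
    variable a Wiener integral.\<close>
  have X: "has_wiener_integral N W (\<lambda>x. indicator D x * h k x) (wiener_integral N W D (h k))" for k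
  proof -
    have "\<exists>X. has_wiener_integral N W (\<lambda>x. indicator D x * h k x) X"
      by (rule has_wiener_integral_exists[where B = "\<bar>B\<bar>" and D = D])
        (use h B[of _ k] D in \<open>auto simp: indicator_def intro: order_trans[OF _ abs_ge_self]\<close>)
    then show ?thesis unfolding wiener_integral_def by (rule someI_ex)
  qed
  show "wiener_integral N W D (h k) \<in> borel_measurable N" using X by (simp add: has_wiener_integral_def)
  have eq: "(\<Sum>k\<in>UNIV. t k * (indicator D x * h k x))\<^sup>2 = indicator D x *\<^sub>R (\<Sum>k\<in>UNIV. t k * h k x)\<^sup>2" for x
    by (auto simp: indicator_def)
  show "(CLINT w|N. iexp (\<Sum>k\<in>UNIV. t k * wiener_integral N W D (h k) w))
      = of_real (exp (- ((LINT x:D|lborel. (\<Sum>k\<in>UNIV. t k * h k x)\<^sup>2) / 2)))"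
    using wiener_char[OF X h, of t] by (simp only: eq set_lebesgue_integral_def)
qed

end

section \<open>Mixing fields\<close>

lemma norm_integral_le_nn_integral:
  fixes f :: "'x \<Rightarrow> 'b::{banach, second_countable_topology}"
  shows "ennreal (norm (integral\<^sup>L M f)) \<le> (\<integral>\<^sup>+x. ennreal (norm (f x)) \<partial>M)"
  \<comment> \<open>For a function that is not integrable the left side is the default value
    0.\<close>
  by (cases "integrable M f") (auto simp: not_integrable_integral_eq intro: integral_norm_bound_ennreal)

lemma double_integral_le_nn:
  fixes g :: "'x \<Rightarrow> 'y \<Rightarrow> real"
  shows "eabs (LINT x|M. LINT y|N. g x y) \<le> (\<integral>\<^sup>+x. \<integral>\<^sup>+y. eabs (g x y) \<partial>N \<partial>M)"
proof -
  have "eabs (LINT x|M. LINT y|N. g x y) \<le> (\<integral>\<^sup>+x. eabs (LINT y|N. g x y) \<partial>M)"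
    using norm_integral_le_nn_integral[of M "\<lambda>x. LINT y|N. g x y"] by simp
  also have "\<dots> \<le> (\<integral>\<^sup>+x. \<integral>\<^sup>+y. eabs (g x y) \<partial>N \<partial>M)"
  proof (rule nn_integral_mono)
    show "eabs (LINT y|N. g x y) \<le> (\<integral>\<^sup>+y. eabs (g x y) \<partial>N)" for x
      using norm_integral_le_nn_integral[of N "g x"] by simp
  qed
  finally show ?thesis .
qed

lemma double_integral_le:
  fixes g :: "'x \<Rightarrow> 'y \<Rightarrow> real"
  assumes h: "\<And>x y. x \<in> space M \<Longrightarrow> y \<in> space N \<Longrightarrow> eabs (g x y) \<le> h x y"
    and C: "(\<integral>\<^sup>+x. \<integral>\<^sup>+y. h x y \<partial>N \<partial>M) \<le> ennreal C" "0 \<le> C"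
  shows "\<bar>LINT x|M. LINT y|N. g x y\<bar> \<le> C"
proof -
  have "(\<integral>\<^sup>+x. \<integral>\<^sup>+y. eabs (g x y) \<partial>N \<partial>M) \<le> (\<integral>\<^sup>+x. \<integral>\<^sup>+y. h x y \<partial>N \<partial>M)"
    by (intro nn_integral_mono h)
  then have "eabs (LINT x|M. LINT y|N. g x y) \<le> ennreal C"
    using double_integral_le_nn[of M N g] C(1) by (meson order_trans)
  then show ?thesis using C(2) by simp
qed

text \<open>The integrable majorant \<open>c\<close> of the norms in L^2(M) is what Fubini's theorem
  needs, both against bounded or square integrable factors and for products at two parameters, where
  E |F p F p'| \<le> c p * c p'. Single and double Lebesgue integrals of the field are both
  instances.\<close>

locale L2_field = M: prob_space M + L: sigma_finite_measure L
  for M :: "'w measure" and L :: "'p measure" +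
  fixes F :: "'p \<Rightarrow> 'w \<Rightarrow> real" and c :: "'p \<Rightarrow> real"
  assumes F_measurable[measurable]: "(\<lambda>(p, w). F p w) \<in> borel_measurable (L \<Otimes>\<^sub>M M)"
    and F_square: "\<And>p. p \<in> space L \<Longrightarrow> integrable M (\<lambda>w. (F p w)\<^sup>2)"
    and F_bound: "\<And>p. p \<in> space L \<Longrightarrow> (LINT w|M. (F p w)\<^sup>2) \<le> (c p)\<^sup>2"
    and c_integrable: "integrable L c" and c_nonneg: "\<And>p. 0 \<le> c p"
begin

sublocale P: pair_sigma_finite L M ..
sublocale LL: pair_sigma_finite L L ..

lemma F_sq: "p \<in> space L \<Longrightarrow> square_integrable M (F p)"
  using F_square measurable_compose[OF measurable_Pair1', of p L "\<lambda>(p, w). F p w" M borel] F_measurable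
  by (simp add: square_integrable_def)

lemma F_L1: "p \<in> space L \<Longrightarrow> (LINT w|M. \<bar>F p w\<bar>) \<le> c p"
  by (rule power2_le_imp_le[OF order_trans[OF M.L1_le_L2[OF F_sq] F_bound] c_nonneg])

lemma F_product:
  assumes p: "p \<in> space L" "p' \<in> space L"
  shows "(LINT w|M. \<bar>F p w * F p' w\<bar>) \<le> c p * c p'"
proof -
  have "(LINT w|M. \<bar>F p w * F p' w\<bar>) \<le> sqrt (LINT w|M. (F p w)\<^sup>2) * sqrt (LINT w|M. (F p' w)\<^sup>2)"
    by (intro Cauchy_Schwarz_integral_sqrt F_sq p)
  also have "\<dots> \<le> c p * c p'"
    using F_bound[OF p(1)] F_bound[OF p(2)] c_nonneg by (intro mult_mono real_le_lsqrt) auto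
  finally show ?thesis .
qed

lemma integrable_pair: "integrable (L \<Otimes>\<^sub>M M) (\<lambda>(p, w). F p w)"
proof (rule P.Fubini_integrable)
  show "integrable L (\<lambda>x. LINT y|M. norm (case (x, y) of (p, w) \<Rightarrow> F p w))"
    by (rule Bochner_Integration.integrable_bound[OF c_integrable])
       (use F_L1 c_nonneg in \<open>auto intro!: AE_I2 simp: abs_of_nonneg\<close>)
  show "AE x in L. integrable M (\<lambda>y. case (x, y) of (p, w) \<Rightarrow> F p w)"
    using M.square_integrable_imp_integrable[OF F_sq] by (auto intro!: AE_I2)
qed simp

lemma AE_integrable: "AE w in M. integrable L (\<lambda>p. F p w)"
  using P.AE_integrable_snd[OF integrable_pair] .

lemma integral_measurable[measurable]: "(\<lambda>w. LINT p|L. F p w) \<in> borel_measurable M"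
  by (intro L.borel_measurable_lebesgue_integral) measurable

lemma integral_mult_bounded:
  fixes \<xi> :: "'w \<Rightarrow> complex"
  assumes [measurable]: "\<xi> \<in> borel_measurable M" and b: "\<And>w. cmod (\<xi> w) \<le> 1"
  shows "(CLINT w|M. of_real (LINT p|L. F p w) * \<xi> w) = (CLINT p|L. CLINT w|M. of_real (F p w) * \<xi> w)"
    and "integrable L (\<lambda>p. CLINT w|M. of_real (F p w) * \<xi> w)"
proof -
  have "integrable (L \<Otimes>\<^sub>M M) (\<lambda>x. complex_of_real (F (fst x) (snd x)) * \<xi> (snd x))"
  proof (rule Bochner_Integration.integrable_bound[OF integrable_pair])
    show "AE x in L \<Otimes>\<^sub>M M. cmod (complex_of_real (F (fst x) (snd x)) * \<xi> (snd x)) \<le> norm (case x of (p, w) \<Rightarrow> F p w)"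
      using mult_left_mono[OF b] by (auto simp: norm_mult split_beta mult_left_le)
  qed measurable
  then have i: "integrable (L \<Otimes>\<^sub>M M) (\<lambda>(p, w). complex_of_real (F p w) * \<xi> w)" by (simp only: case_prod_unfold)
  have "(CLINT w|M. of_real (LINT p|L. F p w) * \<xi> w) = (CLINT w|M. CLINT p|L. of_real (F p w) * \<xi> w)"
    by (intro Bochner_Integration.integral_cong refl) simp
  also have "\<dots> = (CLINT p|L. CLINT w|M. of_real (F p w) * \<xi> w)"
    by (rule P.Fubini_integral[OF i])
  finally show "(CLINT w|M. of_real (LINT p|L. F p w) * \<xi> w) = (CLINT p|L. CLINT w|M. of_real (F p w) * \<xi> w)" .
  show "integrable L (\<lambda>p. CLINT w|M. of_real (F p w) * \<xi> w)" using P.integrable_fst[OF i] .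
qed

lemma integral_mult_square_integrable:
  assumes \<xi>: "square_integrable M \<xi>"
  shows "(LINT w|M. (LINT p|L. F p w) * \<xi> w) = (LINT p|L. LINT w|M. F p w * \<xi> w)"
proof -
  have [measurable]: "\<xi> \<in> borel_measurable M" using \<xi> by (simp add: square_integrable_def)
  define d where "d = sqrt (LINT w|M. (\<xi> w)\<^sup>2)"
  have "integrable (L \<Otimes>\<^sub>M M) (\<lambda>(p, w). F p w * \<xi> w)"
  proof (rule P.Fubini_integrable)
    show "integrable L (\<lambda>x. LINT y|M. norm (case (x, y) of (p, w) \<Rightarrow> F p w * \<xi> w))"
    proof (rule Bochner_Integration.integrable_bound[OF integrable_mult_left[OF c_integrable, of d]])
      show "AE x in L. norm (LINT y|M. norm (case (x, y) of (p, w) \<Rightarrow> F p w * \<xi> w)) \<le> norm (c x * d)"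
      proof (rule AE_I2)
        fix p assume p: "p \<in> space L"
        have "(LINT w|M. \<bar>F p w * \<xi> w\<bar>) \<le> sqrt (LINT w|M. (F p w)\<^sup>2) * d"
          unfolding d_def by (intro Cauchy_Schwarz_integral_sqrt F_sq p \<xi>)
        also have "\<dots> \<le> c p * d"
          using F_bound[OF p] c_nonneg by (intro mult_right_mono real_le_lsqrt) (auto simp: d_def)
        finally show "norm (LINT y|M. norm (case (p, y) of (p, w) \<Rightarrow> F p w * \<xi> w)) \<le> norm (c p * d)"
          by (simp add: order_trans[OF _ abs_ge_self])
      qed
    qed measurable
    show "AE x in L. integrable M (\<lambda>y. case (x, y) of (p, w) \<Rightarrow> F p w * \<xi> w)"
      using square_integrable_mult[OF F_sq \<xi>] by (auto intro!: AE_I2)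
  qed measurable
  from P.Fubini_integral[OF this] show ?thesis by simp
qed

lemma
  shows integral_square_integrable: "square_integrable M (\<lambda>w. LINT p|L. F p w)"
    and integral_square_eq: "(LINT w|M. (LINT p|L. F p w)\<^sup>2) = (LINT p|L. LINT p'|L. LINT w|M. F p w * F p' w)"
proof -
  interpret LLs: sigma_finite_measure "L \<Otimes>\<^sub>M L" by (rule sigma_finite_pair_measure) unfold_locales
  interpret T: pair_sigma_finite "L \<Otimes>\<^sub>M L" M ..
  have cm[measurable]: "c \<in> borel_measurable L" using c_integrable by auto
  \<comment> \<open>The square of an integral is an integral over pairs of parameters, with this
    majorant on the product space.\<close>
  have cc: "integrable (L \<Otimes>\<^sub>M L) (\<lambda>(p, p'). c p * c p')"
    by (rule LL.Fubini_integrable) (use c_integrable in \<open>auto simp: abs_mult\<close>)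
  have i: "integrable ((L \<Otimes>\<^sub>M L) \<Otimes>\<^sub>M M) (\<lambda>(s, w). F (fst s) w * F (snd s) w)"
  proof (rule T.Fubini_integrable)
    show "integrable (L \<Otimes>\<^sub>M L) (\<lambda>x. LINT y|M. norm (case (x, y) of (s, w) \<Rightarrow> F (fst s) w * F (snd s) w))"
      by (rule Bochner_Integration.integrable_bound[OF cc])
         (use F_product c_nonneg in \<open>auto intro!: AE_I2 simp: space_pair_measure\<close>)
    show "AE x in L \<Otimes>\<^sub>M L. integrable M (\<lambda>y. case (x, y) of (s, w) \<Rightarrow> F (fst s) w * F (snd s) w)"
      using square_integrable_mult[OF F_sq F_sq] by (auto intro!: AE_I2 simp: space_pair_measure)
  qed measurable
  have sm: "integrable (L \<Otimes>\<^sub>M L) (\<lambda>s. LINT w|M. F (fst s) w * F (snd s) w)"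
    using T.integrable_fst[OF i] by simp
  have ae: "AE w in M. (LINT s|(L \<Otimes>\<^sub>M L). F (fst s) w * F (snd s) w) = (LINT p|L. F p w)\<^sup>2"
    using T.AE_integrable_snd[OF i] AE_integrable
  proof eventually_elim
    case (elim w)
    have "(LINT s|(L \<Otimes>\<^sub>M L). F (fst s) w * F (snd s) w) = (LINT p|L. LINT p'|L. F p w * F p' w)"
      using LL.integral_fst'[OF elim(1)] by simp
    also have "\<dots> = (LINT p|L. F p w)\<^sup>2" by (simp add: power2_eq_square)
    finally show ?case .
  qed
  have im: "integrable M (\<lambda>w. LINT s|(L \<Otimes>\<^sub>M L). F (fst s) w * F (snd s) w)"
    using T.integrable_snd[OF i] .
  have "integrable M (\<lambda>w. (LINT p|L. F p w)\<^sup>2)"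
    by (rule integrable_cong_AE_imp[OF im _ ae]) measurable
  then show "square_integrable M (\<lambda>w. LINT p|L. F p w)" by (simp add: square_integrable_def)
  have "(LINT w|M. (LINT p|L. F p w)\<^sup>2) = (LINT w|M. LINT s|(L \<Otimes>\<^sub>M L). F (fst s) w * F (snd s) w)"
    using ae im by (intro integral_cong_AE) (auto elim: eventually_mono)
  also have "\<dots> = (LINT s|(L \<Otimes>\<^sub>M L). LINT w|M. F (fst s) w * F (snd s) w)"
    using T.Fubini_integral[OF i] .
  also have "\<dots> = (LINT p|L. LINT p'|L. LINT w|M. F p w * F p' w)"
    using LL.integral_fst'[OF sm] by simp
  finally show "(LINT w|M. (LINT p|L. F p w)\<^sup>2) = (LINT p|L. LINT p'|L. LINT w|M. F p w * F p' w)" .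
qed

end

text \<open>The field at a fixed scale: a bound \<open>K\<close> on sixth moments that is uniform in
  the point, and a rate in terms of the distance itself. The factor 2 of the original mixing
  inequality and the scale eps are both absorbed into \<phi> when the rescaled field is interpreted
  here.\<close>

locale mixing_field = prob_space M for M :: "'w measure" +
  fixes Q :: "'a::euclidean_space \<Rightarrow> 'w \<Rightarrow> real" and \<phi> :: "real \<Rightarrow> real" and K :: real
  assumes Q_measurable[measurable]: "(\<lambda>(x, w). Q x w) \<in> borel_measurable (lborel \<Otimes>\<^sub>M M)"
    and Q_six: "\<And>x. integrable M (\<lambda>w. Q x w ^ 6)" and Q_six_le: "\<And>x. (LINT w|M. Q x w ^ 6) \<le> K"
    and K1: "1 \<le> K"
    and Q_mean: "\<And>x. (LINT w|M. Q x w) = 0"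
    and \<phi>_nonneg: "\<And>r. 0 \<le> r \<Longrightarrow> 0 \<le> \<phi> r"
    and \<phi>_antimono: "\<And>r s. 0 \<le> r \<Longrightarrow> r \<le> s \<Longrightarrow> \<phi> s \<le> \<phi> r"
    and mixing: "\<And>A B \<zeta> \<xi>. A \<in> sets borel \<Longrightarrow> B \<in> sets borel \<Longrightarrow>
        \<zeta> \<in> borel_measurable (field_sigma M Q A) \<Longrightarrow> integrable M (\<lambda>w. (\<zeta> w)\<^sup>2) \<Longrightarrow>
        \<xi> \<in> borel_measurable (field_sigma M Q B) \<Longrightarrow> integrable M (\<lambda>w. (\<xi> w)\<^sup>2) \<Longrightarrow>
        \<bar>LINT w|M. (\<zeta> w - (LINT w'|M. \<zeta> w')) * (\<xi> w - (LINT w'|M. \<xi> w'))\<bar>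
          \<le> \<phi> (setdist A B) * sqrt ((LINT w|M. (\<zeta> w)\<^sup>2) * (LINT w|M. (\<xi> w)\<^sup>2))"
begin

lemma Q_measurable1[measurable]: "Q x \<in> borel_measurable M"
  using measurable_compose[OF measurable_Pair1', of x lborel "\<lambda>(x, w). Q x w" M borel] Q_measurable
  by simp

lemma subalgebra_field_sigma: "subalgebra M (field_sigma M Q A)"
proof -
  let ?E = "{Q x -` S \<inter> space M |x S. x \<in> A \<and> S \<in> sets borel}"
  have sub: "?E \<subseteq> sets M" by auto
  have pow: "?E \<subseteq> Pow (space M)" by auto
  have "sets (sigma (space M) ?E) = sigma_sets (space M) ?E" by (rule sets_measure_of[OF pow])
  then show ?thesis
    unfolding subalgebra_def field_sigma_def
    using sets.sigma_sets_subset[OF sub] by (simp add: space_measure_of_conv)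
qed

lemma Q_field_measurable: "x \<in> A \<Longrightarrow> Q x \<in> borel_measurable (field_sigma M Q A)"
proof (rule measurableI)
  fix S :: "real set" assume x: "x \<in> A" and S: "S \<in> sets borel"
  have sp: "space (field_sigma M Q A) = space M" using subalgebra_field_sigma by (auto simp: subalgebra_def)
  let ?E = "{Q x -` S \<inter> space M |x S. x \<in> A \<and> S \<in> sets borel}"
  have pow: "?E \<subseteq> Pow (space M)" by auto
  have "sets (field_sigma M Q A) = sigma_sets (space M) ?E"
    unfolding field_sigma_def by (rule sets_measure_of[OF pow])
  moreover have "Q x -` S \<inter> space M \<in> ?E" using x S by blast
  ultimately show "Q x -` S \<inter> space (field_sigma M Q A) \<in> sets (field_sigma M Q A)"
    unfolding sp by (simp only: sigma_sets.Basic)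
qed simp

text \<open>Every moment that occurs has total degree at most six, so a constant plus sixth powers
  at two points dominates it.\<close>

lemma moments:
  fixes g :: "'w \<Rightarrow> real"
  assumes [measurable]: "g \<in> borel_measurable M" and b: "\<And>w. \<bar>g w\<bar> \<le> a + b * Q x w ^ 6 + b' * Q y w ^ 6" and c: "0 \<le> b" "0 \<le> b'"
  shows "integrable M g" "(LINT w|M. \<bar>g w\<bar>) \<le> a + b * K + b' * K"
proof -
  have i: "integrable M (\<lambda>w. a + b * Q x w ^ 6 + b' * Q y w ^ 6)" using Q_six by auto
  show g: "integrable M g"
    by (rule Bochner_Integration.integrable_bound[OF i]) (use b in \<open>auto intro: order_trans[OF _ abs_ge_self]\<close>)
  have "(LINT w|M. \<bar>g w\<bar>) \<le> (LINT w|M. a + b * Q x w ^ 6 + b' * Q y w ^ 6)"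
    by (rule integral_mono) (use g i b in auto)
  also have "\<dots> = a + b * (LINT w|M. Q x w ^ 6) + b' * (LINT w|M. Q y w ^ 6)"
    using Q_six by (simp add: prob_space)
  also have "\<dots> \<le> a + b * K + b' * K" using Q_six_le c by (intro add_mono mult_left_mono) auto
  finally show "(LINT w|M. \<bar>g w\<bar>) \<le> a + b * K + b' * K" .
qed

lemma pow_le_six:
  fixes x :: real shows "x\<^sup>2 \<le> 1 + x ^ 6" "x ^ 4 \<le> 1 + x ^ 6"
proof -
  have eq: "x ^ 6 = (x\<^sup>2) ^ 3" "x ^ 4 = (x\<^sup>2)\<^sup>2" by (simp_all add: power_mult[symmetric])
  have "t \<le> 1 + t ^ 3 \<and> t\<^sup>2 \<le> 1 + t ^ 3" if "t \<ge> 0" for t :: real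
  proof (cases "t \<le> 1")
    case True
    then have "t\<^sup>2 \<le> 1" using that by (simp add: power_le_one)
    then show ?thesis using True that by (smt (verit) zero_le_power)
  next
    case False
    then have "t ^ 1 \<le> t ^ 3" "t\<^sup>2 \<le> t ^ 3" by (intro power_increasing; simp)+
    then show ?thesis by simp
  qed
  from this[of "x\<^sup>2"] show "x\<^sup>2 \<le> 1 + x ^ 6" "x ^ 4 \<le> 1 + x ^ 6" unfolding eq by auto
qed

lemma four_two_le:
  fixes x y :: real shows "x ^ 4 * y\<^sup>2 \<le> x ^ 6 + y ^ 6"
proof (cases "\<bar>x\<bar> \<le> \<bar>y\<bar>")
  case True
  then have "\<bar>x\<bar> ^ 4 * \<bar>y\<bar>\<^sup>2 \<le> \<bar>y\<bar> ^ 4 * \<bar>y\<bar>\<^sup>2" by (intro mult_right_mono power_mono) auto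
  also have "\<dots> = y ^ 6" by (simp add: power_add[symmetric])
  finally show ?thesis by (simp add: power_even_abs add_increasing)
next
  case False
  then have "\<bar>x\<bar> ^ 4 * \<bar>y\<bar>\<^sup>2 \<le> \<bar>x\<bar> ^ 4 * \<bar>x\<bar>\<^sup>2" by (intro mult_left_mono power_mono) auto
  also have "\<dots> = x ^ 6" by (simp add: power_add[symmetric])
  finally show ?thesis by (simp add: power_even_abs add_increasing2)
qed

lemma Q_square: "square_integrable M (Q x)" "(LINT w|M. (Q x w)\<^sup>2) \<le> 2 * K"
proof -
  have "\<bar>(Q x w)\<^sup>2\<bar> \<le> 1 + 1 * Q x w ^ 6 + 0 * Q x w ^ 6" for w using pow_le_six(1) by simp
  note m = moments[OF _ this]
  show "square_integrable M (Q x)" using m(1) by (simp add: square_integrable_def)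
  show "(LINT w|M. (Q x w)\<^sup>2) \<le> 2 * K" using m(2) K1 by simp
qed

lemma Q_pair_square: "square_integrable M (\<lambda>w. Q x w * Q y w)" "(LINT w|M. (Q x w * Q y w)\<^sup>2) \<le> 2 * K"
proof -
  have "(u * v)\<^sup>2 \<le> 1 + 1 / 2 * u ^ 6 + 1 / 2 * v ^ 6" for u v :: real
  proof -
    have "2 * (u\<^sup>2 * v\<^sup>2) \<le> (u\<^sup>2)\<^sup>2 + (v\<^sup>2)\<^sup>2" using sum_squares_bound[of "u\<^sup>2" "v\<^sup>2"] by simp
    then have "(u * v)\<^sup>2 \<le> (u ^ 4 + v ^ 4) / 2" by (simp add: power_mult_distrib power_mult[symmetric])
    then show ?thesis using pow_le_six(2)[of u] pow_le_six(2)[of v] by simp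
  qed
  note b = this
  have "\<bar>(Q x w * Q y w)\<^sup>2\<bar> \<le> 1 + 1 / 2 * Q x w ^ 6 + 1 / 2 * Q y w ^ 6" for w using b by simp
  note m = moments[OF _ this]
  show "square_integrable M (\<lambda>w. Q x w * Q y w)" using m(1) by (simp add: square_integrable_def)
  show "(LINT w|M. (Q x w * Q y w)\<^sup>2) \<le> 2 * K" using m(2) K1 by simp
qed

text \<open>This is where sixth moments are used up: the square of h(Q x) Q y is of degree four in Q
  x and two in Q y. The growth bound 1 + s^2 admits the root of the modulus, the modulus and the
  square, the three choices made later.\<close>

lemma w_pair_square:
  assumes h[measurable]: "h \<in> borel_measurable borel" and wb: "\<And>s. \<bar>h s\<bar> \<le> 1 + s\<^sup>2"
  shows "square_integrable M (\<lambda>w. h (Q x w) * Q y w)" "(LINT w|M. (h (Q x w) * Q y w)\<^sup>2) \<le> 8 * K"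
proof -
  have b: "(h u * v)\<^sup>2 \<le> 2 + 2 * u ^ 6 + 4 * v ^ 6" for u v :: real
  proof -
    have "\<bar>h u\<bar>\<^sup>2 \<le> (1 + u\<^sup>2)\<^sup>2" using wb by (intro power_mono) auto
    also have "\<dots> \<le> 2 * (1 + u ^ 4)" using sum_squares_bound[of 1 "u\<^sup>2"] by (simp add: power2_sum power_mult[symmetric])
    finally have "(h u * v)\<^sup>2 \<le> 2 * (1 + u ^ 4) * v\<^sup>2" unfolding power_mult_distrib by (intro mult_right_mono) auto
    also have "\<dots> = 2 * v\<^sup>2 + 2 * (u ^ 4 * v\<^sup>2)" by (simp add: algebra_simps)
    finally show ?thesis using four_two_le[of u v] pow_le_six(1)[of v] by simp
  qed
  have "\<bar>(h (Q x w) * Q y w)\<^sup>2\<bar> \<le> 2 + 2 * Q x w ^ 6 + 4 * Q y w ^ 6" for w using b by simp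
  note m = moments[OF _ this]
  show "square_integrable M (\<lambda>w. h (Q x w) * Q y w)" using m(1) by (simp add: square_integrable_def)
  show "(LINT w|M. (h (Q x w) * Q y w)\<^sup>2) \<le> 8 * K" using m(2) K1 by simp
qed

lemma covariance_le:
  assumes "A \<in> sets borel" "B \<in> sets borel" and m: "\<zeta> \<in> borel_measurable (field_sigma M Q A)" "\<xi> \<in> borel_measurable (field_sigma M Q B)"
    and z: "square_integrable M \<zeta>" and x: "square_integrable M \<xi>" and d: "0 \<le> d" "d \<le> setdist A B"
    and b: "(LINT w|M. (\<zeta> w)\<^sup>2) \<le> a" "(LINT w|M. (\<xi> w)\<^sup>2) \<le> b"
  shows "\<bar>(LINT w|M. \<zeta> w * \<xi> w) - (LINT w|M. \<zeta> w) * (LINT w|M. \<xi> w)\<bar> \<le> \<phi> d * sqrt (a * b)"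
proof -
  have zi: "integrable M \<zeta>" "integrable M \<xi>" "integrable M (\<lambda>w. \<zeta> w * \<xi> w)"
    using square_integrable_imp_integrable z x square_integrable_mult by auto
  have eq: "(\<zeta> w - e) * (\<xi> w - e') = \<zeta> w * \<xi> w - e * \<xi> w - e' * \<zeta> w + e * e'" for w e e'
    by (simp add: algebra_simps)
  have "(LINT w|M. \<zeta> w * \<xi> w) - (LINT w|M. \<zeta> w) * (LINT w|M. \<xi> w)
      = (LINT w|M. (\<zeta> w - (LINT w'|M. \<zeta> w')) * (\<xi> w - (LINT w'|M. \<xi> w')))"
    unfolding eq using zi by (simp add: prob_space algebra_simps)
  also have "\<bar>\<dots>\<bar> \<le> \<phi> (setdist A B) * sqrt ((LINT w|M. (\<zeta> w)\<^sup>2) * (LINT w|M. (\<xi> w)\<^sup>2))"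
    using z x by (intro mixing assms) (auto simp: square_integrable_def)
  also have "\<dots> \<le> \<phi> d * sqrt (a * b)"
    using b by (intro mult_mono \<phi>_antimono d \<phi>_nonneg real_sqrt_le_mono order_trans[OF _ b(1)]) auto
  finally show ?thesis .
qed

text \<open>By the triangle inequality one of x and y is at distance at least |x - y| / 2 from z,
  and trivially that far from the other one. It is thus separated from the remaining pair, and since
  its mean vanishes the expectation is a covariance.\<close>

lemma three_point:
  assumes h[measurable]: "h \<in> borel_measurable borel" and wb: "\<And>s. \<bar>h s\<bar> \<le> 1 + s\<^sup>2"
  shows "\<bar>LINT w|M. h (Q z w) * (Q x w * Q y w)\<bar> \<le> 4 * K * \<phi> (dist x y / 2)"
proof -
  have K0: "0 \<le> K" using K1 by simp
  have *: "\<bar>LINT w|M. Q x w * (h (Q z w) * Q y w)\<bar> \<le> 4 * K * \<phi> (dist x y / 2)"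
    if "dist x y / 2 \<le> dist x z" for x y
  proof -
    have "\<bar>(LINT w|M. Q x w * (h (Q z w) * Q y w)) - (LINT w|M. Q x w) * (LINT w|M. h (Q z w) * Q y w)\<bar>
      \<le> \<phi> (dist x y / 2) * sqrt ((2 * K) * (8 * K))"
    proof (rule covariance_le[where A = "{x}" and B = "{z, y}"])
      show "Q x \<in> borel_measurable (field_sigma M Q {x})" by (rule Q_field_measurable) simp
      have [measurable]: "Q z \<in> borel_measurable (field_sigma M Q {z, y})" "Q y \<in> borel_measurable (field_sigma M Q {z, y})"
        by (rule Q_field_measurable, simp)+
      show "(\<lambda>w. h (Q z w) * Q y w) \<in> borel_measurable (field_sigma M Q {z, y})" by measurable
      show "dist x y / 2 \<le> setdist {x} {z, y}" using that by (auto simp: le_setdist_iff)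
    qed (use w_pair_square[OF h wb] Q_square in auto)
    moreover have "sqrt ((2 * K) * (8 * K)) = 4 * K" using K0 by (simp add: real_sqrt_mult[symmetric] power2_eq_square[symmetric] real_sqrt_unique)
    ultimately show ?thesis by (simp add: Q_mean mult_ac)
  qed
  have "dist x y / 2 \<le> dist x z \<or> dist y x / 2 \<le> dist y z"
    using dist_triangle2[of x y z] by (simp add: dist_commute) linarith
  then show ?thesis
  proof
    assume "dist x y / 2 \<le> dist x z" from *[OF this] show ?thesis by (simp add: mult_ac)
  next
    assume "dist y x / 2 \<le> dist y z" from *[OF this] show ?thesis by (simp add: mult_ac dist_commute)
  qed
qed

lemma pair_pair:
  assumes d: "0 \<le> d" "d \<le> dist x x'" "d \<le> dist x y'" "d \<le> dist y x'" "d \<le> dist y y'"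
  shows "\<bar>(LINT w|M. (Q x w * Q y w) * (Q x' w * Q y' w)) - (LINT w|M. Q x w * Q y w) * (LINT w|M. Q x' w * Q y' w)\<bar>
    \<le> 2 * K * \<phi> d"
proof -
  have "\<bar>(LINT w|M. (Q x w * Q y w) * (Q x' w * Q y' w)) - (LINT w|M. Q x w * Q y w) * (LINT w|M. Q x' w * Q y' w)\<bar>
    \<le> \<phi> d * sqrt ((2 * K) * (2 * K))"
  proof (rule covariance_le[where A = "{x, y}" and B = "{x', y'}"])
    have [measurable]: "Q x \<in> borel_measurable (field_sigma M Q {x, y})" "Q y \<in> borel_measurable (field_sigma M Q {x, y})"
      "Q x' \<in> borel_measurable (field_sigma M Q {x', y'})" "Q y' \<in> borel_measurable (field_sigma M Q {x', y'})"
        by (rule Q_field_measurable, simp)+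
    show "(\<lambda>w. Q x w * Q y w) \<in> borel_measurable (field_sigma M Q {x, y})"
      "(\<lambda>w. Q x' w * Q y' w) \<in> borel_measurable (field_sigma M Q {x', y'})" by measurable
    show "d \<le> setdist {x, y} {x', y'}" using d by (auto simp: le_setdist_iff)
  qed (use Q_pair_square d in auto)
  then show ?thesis using K1 unfolding real_sqrt_abs2 by (simp add: mult.commute)
qed

lemma L2_field_weight:
  assumes [measurable]: "h \<in> borel_measurable borel" and "integrable lborel h"
  shows "L2_field M lborel (\<lambda>y w. h y * Q y w) (\<lambda>y. \<bar>h y\<bar> * sqrt (2 * K))"
proof (intro_locales, unfold_locales)
  show "(\<lambda>(p, w). h p * Q p w) \<in> borel_measurable (lborel \<Otimes>\<^sub>M M)" by measurable
  show "integrable M (\<lambda>w. (h p * Q p w)\<^sup>2)" for p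
    using Q_square(1)[of p] by (simp add: power_mult_distrib square_integrable_def)
  show "(LINT w|M. (h p * Q p w)\<^sup>2) \<le> (\<bar>h p\<bar> * sqrt (2 * K))\<^sup>2" for p
    using Q_square(2)[of p] K1 by (simp add: power_mult_distrib mult_left_mono)
  show "integrable lborel (\<lambda>y. \<bar>h y\<bar> * sqrt (2 * K))" using assms by simp
qed (use K1 in auto)

text \<open>Integrals of the field over \<open>A\<close> need not be measurable for the uncompleted
  \<sigma>-algebra; the conditional expectation is a version that is.\<close>

lemma field_integral_version:
  assumes k[measurable]: "k \<in> borel_measurable borel" and ki: "integrable lborel k" and A: "\<And>x. x \<notin> A \<Longrightarrow> k x = 0"
  shows "\<exists>Y \<in> borel_measurable (field_sigma M Q A). AE w in M. (LINT y|lborel. k y * Q y w) = Y w"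
proof -
  interpret F: L2_field M lborel "\<lambda>y w. k y * Q y w" "\<lambda>y. \<bar>k y\<bar> * sqrt (2 * K)"
    by (rule L2_field_weight[OF k ki])
  let ?G = "field_sigma M Q A"
  interpret S: finite_measure_subalgebra M ?G
    by unfold_locales (rule subalgebra_field_sigma)
  define X where "X w = (LINT y|lborel. k y * Q y w)" for w
  have X: "square_integrable M X" using F.integral_square_integrable by (simp add: X_def[abs_def])
  then have [measurable]: "X \<in> borel_measurable M" by (simp add: square_integrable_def)
  define Y where "Y = real_cond_exp M ?G X"
  have YG[measurable]: "Y \<in> borel_measurable ?G" by (simp add: Y_def)
  have YM[measurable]: "Y \<in> borel_measurable M" by (rule measurable_from_subalg[OF subalgebra_field_sigma YG])
  have Y: "square_integrable M Y"
    unfolding square_integrable_def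
  proof
    show "integrable M (\<lambda>w. (Y w)\<^sup>2)"
      unfolding Y_def
      by (rule S.integrable_convex_cond_exp[where I = UNIV and q = "\<lambda>x. x\<^sup>2"])
        (use square_integrable_imp_integrable[OF X] X in \<open>auto simp: square_integrable_def convex_power2\<close>)
  qed simp
  have XY: "square_integrable M (\<lambda>w. X w - Y w)" by (rule square_integrable_diff[OF X Y])
  have orth: "(LINT w|M. g w * (X w - Y w)) = 0" if [measurable]: "g \<in> borel_measurable ?G" and g: "square_integrable M g" for g
  proof -
    have "(LINT w|M. g w * Y w) = (LINT w|M. g w * X w)"
      unfolding Y_def by (rule S.real_cond_exp_intg(2)) (use square_integrable_mult[OF g X] in auto)
    then show ?thesis using square_integrable_mult[OF g X] square_integrable_mult[OF g Y] by (simp add: right_diff_distrib)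
  qed
  \<comment> \<open>\<open>X - Y\<close> is orthogonal to everything measurable for the points of
    \<open>A\<close>, in particular to each \<open>Q y\<close> that has nonzero weight. Integrating
    over \<open>y\<close> shows it orthogonal to \<open>X\<close> too, hence to itself.\<close>
  have "(LINT w|M. X w * (X w - Y w)) = (LINT y|lborel. LINT w|M. (k y * Q y w) * (X w - Y w))"
    using F.integral_mult_square_integrable[OF XY] by (simp only: X_def)
  also have "\<dots> = (LINT y|(lborel :: 'a measure). 0)"
  proof (rule Bochner_Integration.integral_cong[OF refl])
    fix y
    show "(LINT w|M. (k y * Q y w) * (X w - Y w)) = 0"
      using orth[OF Q_field_measurable Q_square(1), of y] A[of y] by (cases "y \<in> A") (auto simp: mult.assoc)
  qed
  finally have 1: "(LINT w|M. X w * (X w - Y w)) = 0" by simp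
  have "(LINT w|M. (X w - Y w)\<^sup>2) = (LINT w|M. X w * (X w - Y w) - Y w * (X w - Y w))"
    by (intro Bochner_Integration.integral_cong refl) (simp add: power2_eq_square algebra_simps)
  also have "\<dots> = 0" using 1 orth[OF YG Y] square_integrable_mult[OF X XY] square_integrable_mult[OF Y XY] by simp
  finally have "AE w in M. (X w - Y w)\<^sup>2 = 0"
    using XY by (subst (asm) integral_nonneg_eq_0_iff_AE) (auto simp: square_integrable_def)
  then have "AE w in M. X w = Y w" by eventually_elim simp
  then show ?thesis using YG unfolding X_def by blast
qed

end

section \<open>Normal approximation by Stein's method\<close>

lemma has_vector_derivative_quadratic:
  fixes f :: "real \<Rightarrow> 'b::real_normed_vector"
  assumes "\<And>y. norm (f y - f x - (y - x) *\<^sub>R d) \<le> C * (y - x)\<^sup>2"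
  shows "(f has_vector_derivative d) (at x)"
  unfolding has_vector_derivative_def has_derivative_iff_norm
proof
  show "bounded_linear (\<lambda>h. h *\<^sub>R d)" by (rule bounded_linear_scaleR_left)
  have "((\<lambda>y. C * \<bar>y - x\<bar>) \<longlongrightarrow> C * \<bar>x - x\<bar>) (at x)" by (intro tendsto_intros)
  then have lim: "((\<lambda>y. C * \<bar>y - x\<bar>) \<longlongrightarrow> 0) (at x)" by simp
  show "((\<lambda>y. norm (f y - f x - (y - x) *\<^sub>R d) / norm (y - x)) \<longlongrightarrow> 0) (at x)"
  proof (rule Lim_null_comparison[OF _ lim])
    show "\<forall>\<^sub>F y in at x. norm (norm (f y - f x - (y - x) *\<^sub>R d) / norm (y - x)) \<le> C * \<bar>y - x\<bar>"
      unfolding eventually_at_topological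
    proof (intro exI[of _ UNIV] conjI ballI impI)
      fix y :: real assume "y \<noteq> x"
      then have p: "\<bar>y - x\<bar> > 0" by simp
      have "norm (f y - f x - (y - x) *\<^sub>R d) / \<bar>y - x\<bar> \<le> (C * (y - x)\<^sup>2) / \<bar>y - x\<bar>"
        using assms p by (intro divide_right_mono) auto
      also have "\<dots> = C * \<bar>y - x\<bar>"
      proof -
        have "(y - x)\<^sup>2 = \<bar>y - x\<bar> * \<bar>y - x\<bar>" by (simp add: power2_eq_square)
        then show ?thesis using p by (simp del: abs_mult_self_eq)
      qed
      finally show "norm (norm (f y - f x - (y - x) *\<^sub>R d) / norm (y - x)) \<le> C * \<bar>y - x\<bar>"
        using p by simp
    qed auto
  qed
qed

text \<open>Integrating factor exp(V \<theta>^2 / 2): the product with f has derivative bounded by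
  exp(V / 2) e on the unit interval. Dividing by exp(V / 2) at \<theta> = 1 returns the error e
  without loss.\<close>

lemma gaussian_ode_stability:
  fixes f f' :: "real \<Rightarrow> complex"
  assumes f0: "f 0 = 1" and d: "\<And>\<theta>. (f has_vector_derivative f' \<theta>) (at \<theta>)" and V: "0 \<le> V"
    and e: "\<And>\<theta>. 0 \<le> \<theta> \<Longrightarrow> \<theta> \<le> 1 \<Longrightarrow> cmod (f' \<theta> + of_real (\<theta> * V) * f \<theta>) \<le> e"
  shows "cmod (f 1 - of_real (exp (- (V / 2)))) \<le> e"
proof -
  define g where "g \<theta> = exp (V * \<theta>\<^sup>2 / 2) *\<^sub>R f \<theta>" for \<theta>
  define g' where "g' \<theta> = exp (V * \<theta>\<^sup>2 / 2) *\<^sub>R (f' \<theta> + of_real (\<theta> * V) * f \<theta>)" for \<theta>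
  have e0: "0 \<le> e" using order_trans[OF norm_ge_zero e[of 0]] by simp
  have gd: "(g has_vector_derivative g' \<theta>) (at \<theta>)" for \<theta>
  proof -
    have "((\<lambda>\<theta>. exp (V * \<theta>\<^sup>2 / 2)) has_vector_derivative (exp (V * \<theta>\<^sup>2 / 2) * (V * \<theta>))) (at \<theta>)"
      unfolding has_real_derivative_iff_has_vector_derivative[symmetric]
      by (auto intro!: derivative_eq_intros)
    from has_vector_derivative_scaleR[OF this[folded has_real_derivative_iff_has_vector_derivative] d[of \<theta>]] show ?thesis
      unfolding g_def[abs_def] g'_def by (simp add: scaleR_conv_of_real algebra_simps)
  qed
  have "norm (g 1 - g 0) \<le> (exp (V / 2) * e) * 1 - (exp (V / 2) * e) * 0"
  proof (rule differentiable_bound_general[where f' = g' and \<phi>' = "\<lambda>_. exp (V / 2) * e"])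
    show "continuous_on {0..1} g"
      using gd by (auto intro!: continuous_at_imp_continuous_on has_vector_derivative_continuous)
    show "((*) (exp (V / 2) * e) has_vector_derivative exp (V / 2) * e) (at x)" for x
      unfolding has_real_derivative_iff_has_vector_derivative[symmetric]
      by (auto intro!: derivative_eq_intros)
    fix x :: real assume x: "0 < x" "x < 1"
    have "V * x\<^sup>2 \<le> V * 1" using x V by (intro mult_left_mono) (auto simp: power_le_one)
    then show "norm (g' x) \<le> exp (V / 2) * e"
      using e[of x] x by (auto simp: g'_def intro!: mult_mono)
  qed (auto intro!: continuous_intros gd)
  then have "cmod (exp (V / 2) *\<^sub>R f 1 - 1) \<le> exp (V / 2) * e" by (simp add: g_def f0)
  moreover have "exp (V / 2) *\<^sub>R f 1 - 1 = exp (V / 2) *\<^sub>R (f 1 - of_real (exp (- (V / 2))))"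
  proof -
    have "exp (V / 2) * exp (- (V / 2)) = 1" by (simp add: exp_add[symmetric])
    then have "complex_of_real (exp (V / 2)) * of_real (exp (- (V / 2))) = 1"
      by (metis of_real_1 of_real_mult)
    then show ?thesis by (simp add: scaleR_conv_of_real right_diff_distrib)
  qed
  ultimately show ?thesis by simp
qed

lemma iexp_taylor: "cmod (iexp x - 1) \<le> \<bar>x\<bar>" "cmod (iexp x - 1 - \<i> * x) \<le> x\<^sup>2 / 2"
  using iexp_approx1[of x 0] iexp_approx1[of x 1] by (simp_all add: numeral_2_eq_2 diff_diff_eq)

locale field_functional = mixing_field M Q \<phi> K
  for M :: "'w measure" and Q :: "'a::euclidean_space \<Rightarrow> 'w \<Rightarrow> real" and \<phi> K +
  fixes k :: "'a \<Rightarrow> real" and D :: "'a set" and B r :: real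
  assumes k_measurable[measurable]: "k \<in> borel_measurable borel" and k_bound: "\<And>x. \<bar>k x\<bar> \<le> B"
    and k_support: "\<And>x. x \<notin> D \<Longrightarrow> k x = 0" and D_finite: "D \<in> finite_borel" and r: "0 < r"
begin

text \<open>A Stein decomposition of \<open>X = \<integral> k Q\<close>: \<open>Q\<close> at \<open>y\<close> is almost independent of the part of \<open>X\<close>
  outside the ball of radius \<open>r\<close> about \<open>y\<close>, and the part inside is small enough to linearize the
  exponential.\<close>

definition near :: "'a \<Rightarrow> 'a \<Rightarrow> real" where "near y p = (if dist y p < r then k p else 0)"
definition far :: "'a \<Rightarrow> 'a \<Rightarrow> real" where "far y p = (if dist y p < r then 0 else k p)"
definition vol :: "real \<Rightarrow> real" where "vol s = unit_ball_vol (real DIM('a)) * s ^ DIM('a)"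
definition volD :: real where "volD = measure lborel D"

lemma near_measurable[measurable]: "(\<lambda>s. near (fst s) (snd s)) \<in> borel_measurable lborel2"
  unfolding near_def by measurable
lemma near_measurable1[measurable]: "near y \<in> borel_measurable borel" unfolding near_def[abs_def] by measurable
lemma far_measurable1[measurable]: "far y \<in> borel_measurable borel" unfolding far_def[abs_def] by measurable

lemma D_measurable[measurable]: "D \<in> sets borel" and emeasure_D: "emeasure lborel D = ennreal volD"
  using D_finite by (auto simp: finite_borel_def volD_def emeasure_eq_ennreal_measure less_top)

lemma nonneg: "0 \<le> B" "0 \<le> K" "0 \<le> volD" "0 \<le> s \<Longrightarrow> 0 \<le> vol s" "0 \<le> \<phi> 0"
  using k_bound[of 0] K1 by (auto simp: volD_def vol_def \<phi>_nonneg)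

lemma emeasure_ball_vol: "0 \<le> s \<Longrightarrow> emeasure lborel (ball (y::'a) s) = ennreal (vol s)"
  unfolding vol_def by (rule emeasure_ball)

lemma k_le: "\<bar>k x\<bar> \<le> B * indicator D x"
  using k_bound[of x] k_support[of x] by (auto simp: indicator_def)

lemma near_le: "\<bar>near y p\<bar> \<le> B * indicator D p" "\<bar>near y p\<bar> \<le> B * indicator (ball y r) p"
  using k_le[of p] k_bound[of p] nonneg(1) by (auto simp: near_def indicator_def)

lemma integrable_D: "integrable lborel (\<lambda>x. B * indicator D x)"
  using emeasure_D by (intro integrable_mult_right integrable_real_indicator) auto

lemma
  shows k_integrable: "integrable lborel k" and near_integrable: "integrable lborel (near y)"
    and far_integrable: "integrable lborel (far y)"
proof -
  have *: "integrable lborel h" if [measurable]: "h \<in> borel_measurable borel" and "\<And>x. \<bar>h x\<bar> \<le> \<bar>k x\<bar>" for h :: "'a \<Rightarrow> real"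
    by (rule Bochner_Integration.integrable_bound[OF integrable_D])
      (use that(2) k_le nonneg(1) in \<open>auto intro!: AE_I2 intro: order_trans\<close>)
  show "integrable lborel k" "integrable lborel (near y)" "integrable lborel (far y)"
    by (intro *; simp add: near_def far_def)+
qed

sublocale FX: L2_field M lborel "\<lambda>y w. k y * Q y w" "\<lambda>y. \<bar>k y\<bar> * sqrt (2 * K)"
  by (rule L2_field_weight[OF k_measurable k_integrable])

definition X :: "'w \<Rightarrow> real" where "X w = (LINT y|lborel. k y * Q y w)"
definition Nr :: "'a \<Rightarrow> 'w \<Rightarrow> real" where "Nr y w = (LINT p|lborel. near y p * Q p w)"
definition Fr :: "'a \<Rightarrow> 'w \<Rightarrow> real" where "Fr y w = (LINT p|lborel. far y p * Q p w)"

lemma X_square: "square_integrable M X"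
  using FX.integral_square_integrable unfolding X_def[abs_def] .
lemma Nr_square: "square_integrable M (Nr y)"
  using L2_field.integral_square_integrable[OF L2_field_weight[OF near_measurable1 near_integrable]] unfolding Nr_def[abs_def] .
lemma Fr_square: "square_integrable M (Fr y)"
  using L2_field.integral_square_integrable[OF L2_field_weight[OF far_measurable1 far_integrable]] unfolding Fr_def[abs_def] .

lemma X_measurable[measurable]: "X \<in> borel_measurable M" "Nr y \<in> borel_measurable M" "Fr y \<in> borel_measurable M"
  using X_square Nr_square Fr_square by (auto simp: square_integrable_def)

lemma X_split: "AE w in M. X w = Nr y w + Fr y w"
  using L2_field.AE_integrable[OF L2_field_weight[OF near_measurable1 near_integrable], of y]
    L2_field.AE_integrable[OF L2_field_weight[OF far_measurable1 far_integrable], of y]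
proof eventually_elim
  case (elim w)
  have "X w = (LINT p|lborel. near y p * Q p w + far y p * Q p w)"
    unfolding X_def by (intro Bochner_Integration.integral_cong refl) (auto simp: near_def far_def)
  then show ?case using elim by (simp add: Nr_def Fr_def)
qed

text \<open>\<open>Q y\<close> has mean zero, so its product with a bounded function of the far part
  is a covariance over distance \<open>r\<close>. Real and imaginary part contribute 2 K \<phi>(r)
  each.\<close>

lemma decoupled_bound: "cmod (CLINT w|M. of_real (Q y w) * iexp (\<theta> * Fr y w)) \<le> 4 * K * \<phi> r"
proof -
  \<comment> \<open>The far integral is replaced by an almost surely equal variable that is
    measurable for the field outside the ball, as the mixing inequality demands.\<close>
  obtain Y where Y: "Y \<in> borel_measurable (field_sigma M Q (- ball y r))" "AE w in M. Fr y w = Y w"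
    using field_integral_version[OF far_measurable1 far_integrable, of "- ball y r" y] unfolding Fr_def
    by (auto simp: far_def)
  have YM[measurable]: "Y \<in> borel_measurable M" by (rule measurable_from_subalg[OF subalgebra_field_sigma Y(1)])
  have b: "\<bar>LINT w|M. Q y w * c (\<theta> * Y w)\<bar> \<le> 2 * K * \<phi> r" "integrable M (\<lambda>w. Q y w * c (\<theta> * Y w))"
    if [measurable]: "c \<in> borel_measurable borel" and c: "\<And>x. \<bar>c x\<bar> \<le> 1" for c :: "real \<Rightarrow> real"
  proof -
    have c2: "(c x)\<^sup>2 \<le> 1" for x using c[of x] by (simp add: abs_square_le_1)
    have s: "square_integrable M (\<lambda>w. c (\<theta> * Y w))"
      unfolding square_integrable_def using c2 by (auto intro!: integrable_bounded_real[where C = 1])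
    then show "integrable M (\<lambda>w. Q y w * c (\<theta> * Y w))" by (rule square_integrable_mult[OF Q_square(1)])
    have "(LINT w|M. (c (\<theta> * Y w))\<^sup>2) \<le> (LINT w|M. 1)"
      using s c2 by (intro integral_mono) (auto simp: square_integrable_def)
    then have s1: "(LINT w|M. (c (\<theta> * Y w))\<^sup>2) \<le> 1" by (simp add: prob_space)
    have "\<bar>(LINT w|M. Q y w * c (\<theta> * Y w)) - (LINT w|M. Q y w) * (LINT w|M. c (\<theta> * Y w))\<bar> \<le> \<phi> r * sqrt (2 * K * 1)"
    proof (rule covariance_le[where A = "{y}" and B = "- ball y r"])
      show "Q y \<in> borel_measurable (field_sigma M Q {y})" by (rule Q_field_measurable) simp
      note [measurable] = Y(1)
      show "(\<lambda>w. c (\<theta> * Y w)) \<in> borel_measurable (field_sigma M Q (- ball y r))" by measurable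
      \<comment> \<open>\<open>setdist\<close> to an empty set is 0, so the lower bound
        \<open>r\<close> requires that the complement of the ball has points.\<close>
      have "- ball y r \<noteq> {}" using not_bounded_UNIV bounded_ball[of y r] by (metis double_compl Compl_empty_eq)
      then show "r \<le> setdist {y} (- ball y r)" by (auto simp: le_setdist_iff)
    qed (use s s1 Q_square r in auto)
    moreover have "sqrt (2 * K * 1) \<le> 2 * K"
      using K1 by (intro real_le_lsqrt) (auto simp: power2_eq_square)
    then have "\<phi> r * sqrt (2 * K * 1) \<le> \<phi> r * (2 * K)" using \<phi>_nonneg[of r] r by (intro mult_left_mono) auto
    ultimately show "\<bar>LINT w|M. Q y w * c (\<theta> * Y w)\<bar> \<le> 2 * K * \<phi> r" by (simp add: Q_mean mult_ac)
  qed
  have "(CLINT w|M. of_real (Q y w) * iexp (\<theta> * Fr y w)) = (CLINT w|M. of_real (Q y w * cos (\<theta> * Y w)) + \<i> * of_real (Q y w * sin (\<theta> * Y w)))"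
    by (intro integral_cong_AE, measurable, use Y(2) in eventually_elim) (simp add: complex_eq_iff Re_exp Im_exp)
  also have "\<dots> = of_real (LINT w|M. Q y w * cos (\<theta> * Y w)) + \<i> * of_real (LINT w|M. Q y w * sin (\<theta> * Y w))"
    using b(2)[of cos] b(2)[of sin] by (simp del: of_real_mult)
  finally have "cmod (CLINT w|M. of_real (Q y w) * iexp (\<theta> * Fr y w)) \<le> \<bar>LINT w|M. Q y w * cos (\<theta> * Y w)\<bar> + \<bar>LINT w|M. Q y w * sin (\<theta> * Y w)\<bar>"
    by (simp del: of_real_mult, intro order_trans[OF norm_triangle_ineq]) (simp add: norm_mult)
  also have "\<dots> \<le> 4 * K * \<phi> r" using b(1)[of cos] b(1)[of sin] by simp
  finally show ?thesis .
qed

definition I :: "real \<Rightarrow> 'a \<Rightarrow> 'a \<Rightarrow> ennreal" where "I c y p = (if dist y p < c then 1 else 0)"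

lemma I_measurable[measurable]: "(\<lambda>s. I c (fst s) (snd s)) \<in> borel_measurable lborel2" "I c y \<in> borel_measurable borel"
  unfolding I_def[abs_def] by measurable

lemma I_integral: "0 \<le> c \<Longrightarrow> (\<integral>\<^sup>+p. I c y p \<partial>lborel) = ennreal (vol c)"
proof -
  assume c: "0 \<le> c"
  have "I c y = indicator (ball y c)" by (auto simp: I_def indicator_def)
  then show ?thesis using emeasure_ball_vol[OF c] by simp
qed

text \<open>Pairs of points in the ball at distance at least \<open>s\<close> contribute \<open>\<phi> (s / 2)\<close>, the other ones the
  volume of a ball of radius \<open>s\<close>.\<close>

definition b1 :: "real \<Rightarrow> real" where "b1 s = B\<^sup>2 * (4 * K) * (vol r * (vol r * \<phi> (s / 2) + vol s * \<phi> 0))"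

text \<open>Putting the root of |Q y| under the integral makes |Q y| N^2 the square of a field
  integral. Its expectation is then a double integral of three-point correlations with |Q y| as the
  third factor.\<close>

lemma near_third_moment:
  assumes s: "0 < s"
  shows "integrable M (\<lambda>w. \<bar>Q y w\<bar> * (Nr y w)\<^sup>2)" "(LINT w|M. \<bar>Q y w\<bar> * (Nr y w)\<^sup>2) \<le> b1 s"
proof -
  let ?F = "\<lambda>p w. near y p * (sqrt \<bar>Q y w\<bar> * Q p w)"
  have w: "\<bar>sqrt \<bar>u\<bar>\<bar> \<le> 1 + u\<^sup>2" for u :: real
  proof -
    have "\<bar>u\<bar> \<le> (1 + u\<^sup>2)\<^sup>2"
    proof -
      have 1: "2 * \<bar>u\<bar> \<le> 1 + u\<^sup>2" using sum_squares_bound[of 1 "\<bar>u\<bar>"] by simp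
      have "(1 + u\<^sup>2) * 1 \<le> (1 + u\<^sup>2) * (1 + u\<^sup>2)" by (intro mult_left_mono) auto
      then have "1 + u\<^sup>2 \<le> (1 + u\<^sup>2)\<^sup>2" by (simp add: power2_eq_square)
      with 1 show ?thesis by linarith
    qed
    then show ?thesis by (simp add: real_le_lsqrt)
  qed
  note wp = w_pair_square[of "\<lambda>u. sqrt \<bar>u\<bar>", OF _ w, simplified]
  interpret F: L2_field M lborel ?F "\<lambda>p. \<bar>near y p\<bar> * sqrt (8 * K)"
  proof (intro_locales, unfold_locales)
    show "(\<lambda>(p, w). ?F p w) \<in> borel_measurable (lborel \<Otimes>\<^sub>M M)" by measurable
    show "integrable M (\<lambda>w. (?F p w)\<^sup>2)" for p
      using wp(1)[of y p] unfolding power_mult_distrib[of "near y p"] by (simp add: square_integrable_def)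
    show "(LINT w|M. (?F p w)\<^sup>2) \<le> (\<bar>near y p\<bar> * sqrt (8 * K))\<^sup>2" for p
      using wp(2)[of y p] K1 unfolding power_mult_distrib[of "near y p"] by (simp add: power_mult_distrib mult_left_mono)
    show "integrable lborel (\<lambda>p. \<bar>near y p\<bar> * sqrt (8 * K))" using near_integrable by simp
  qed (use K1 in auto)
  have eq: "(LINT p|lborel. ?F p w)\<^sup>2 = \<bar>Q y w\<bar> * (Nr y w)\<^sup>2" for w
  proof -
    have "(LINT p|lborel. ?F p w) = (LINT p|lborel. sqrt \<bar>Q y w\<bar> * (near y p * Q p w))" by (simp add: mult_ac)
    also have "\<dots> = sqrt \<bar>Q y w\<bar> * Nr y w" unfolding Nr_def by (rule integral_mult_right_zero)
    finally show ?thesis by (simp add: power_mult_distrib)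
  qed
  show "integrable M (\<lambda>w. \<bar>Q y w\<bar> * (Nr y w)\<^sup>2)"
    using F.integral_square_integrable by (simp add: square_integrable_def eq)
  have c: "(LINT w|M. ?F p w * ?F p' w) = near y p * near y p' * (LINT w|M. \<bar>Q y w\<bar> * (Q p w * Q p' w))" for p p'
  proof -
    have "?F p w * ?F p' w = near y p * near y p' * (\<bar>Q y w\<bar> * (Q p w * Q p' w))" for w
    proof -
      have "?F p w * ?F p' w = near y p * near y p' * ((sqrt \<bar>Q y w\<bar> * sqrt \<bar>Q y w\<bar>) * (Q p w * Q p' w))"
        by (simp only: mult_ac)
      then show ?thesis by simp
    qed
    then show ?thesis by (simp only: integral_mult_right_zero)
  qed
  have "\<bar>LINT p|lborel. LINT p'|lborel. LINT w|M. ?F p w * ?F p' w\<bar> \<le> b1 s"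
  proof (rule double_integral_le)
    fix p p' :: 'a
    let ?h = "ennreal (B\<^sup>2 * (4 * K)) * (I r y p * (I r y p' * (ennreal (\<phi> (s / 2))) + ennreal (\<phi> 0) * I s p p'))"
    have tp: "\<bar>LINT w|M. \<bar>Q y w\<bar> * (Q p w * Q p' w)\<bar> \<le> 4 * K * \<phi> (dist p p' / 2)"
    proof (rule three_point[of "\<lambda>u. \<bar>u\<bar>"])
      show "\<bar>\<bar>u\<bar>\<bar> \<le> 1 + u\<^sup>2" for u :: real using sum_squares_bound[of 1 "\<bar>u\<bar>"] by simp
    qed simp
    have ph: "\<phi> (dist p p' / 2) \<le> \<phi> (s / 2) + \<phi> 0 * indicator (ball p s) p'"
      using \<phi>_antimono[of "s / 2" "dist p p' / 2"] \<phi>_antimono[of 0 "dist p p' / 2"] s \<phi>_nonneg[of "s / 2"]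
      by (cases "dist p p' < s") auto
    have "\<bar>LINT w|M. ?F p w * ?F p' w\<bar> \<le> (B * indicator (ball y r) p) * (B * indicator (ball y r) p') * (4 * K * (\<phi> (s / 2) + \<phi> 0 * indicator (ball p s) p'))"
      unfolding c abs_mult
      by (rule mult_mono[OF mult_mono[OF near_le(2) near_le(2)] order_trans[OF tp mult_left_mono[OF ph]]])
        (use nonneg in auto)
    \<comment> \<open>For p' close to p the indicator of the ball about y is dropped in p', so that
      the p' integral of that term is the volume of the ball of radius s.\<close>
    also have "\<dots> \<le> (B\<^sup>2 * (4 * K)) * (indicator (ball y r) p * (indicator (ball y r) p' * \<phi> (s / 2) + \<phi> 0 * indicator (ball p s) p'))"
      using nonneg by (auto simp: indicator_def power2_eq_square algebra_simps)
    finally have "eabs (LINT w|M. ?F p w * ?F p' w) \<le> ennreal ((B\<^sup>2 * (4 * K)) * (indicator (ball y r) p * (indicator (ball y r) p' * \<phi> (s / 2) + \<phi> 0 * indicator (ball p s) p')))"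
      by (rule ennreal_leI)
    also have "\<dots> = ?h"
      using nonneg \<phi>_nonneg[of "s / 2"] s
      by (cases "p \<in> ball y r"; cases "p' \<in> ball y r"; cases "p' \<in> ball p s")
        (simp_all add: I_def ennreal_mult[symmetric] ennreal_plus[symmetric] del: ennreal_plus)
    finally show "eabs (LINT w|M. ?F p w * ?F p' w) \<le> ?h" .
  next
    have in1: "(\<integral>\<^sup>+p'. ennreal (B\<^sup>2 * (4 * K)) * (I r y p * (I r y p' * (ennreal (\<phi> (s / 2))) + ennreal (\<phi> 0) * I s p p')) \<partial>lborel)
      = ennreal (B\<^sup>2 * (4 * K)) * (I r y p * (ennreal (vol r) * ennreal (\<phi> (s / 2)) + ennreal (\<phi> 0) * ennreal (vol s)))" for p
    proof -
      have "(\<integral>\<^sup>+p'. I r y p' * ennreal (\<phi> (s / 2)) + ennreal (\<phi> 0) * I s p p' \<partial>lborel)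
        = ennreal (vol r) * ennreal (\<phi> (s / 2)) + ennreal (\<phi> 0) * ennreal (vol s)"
        using s r by (simp add: nn_integral_add nn_integral_cmult nn_integral_multc I_integral)
      then show ?thesis by (simp add: nn_integral_cmult)
    qed
    have "(\<integral>\<^sup>+p. \<integral>\<^sup>+p'. ennreal (B\<^sup>2 * (4 * K)) * (I r y p * (I r y p' * (ennreal (\<phi> (s / 2))) + ennreal (\<phi> 0) * I s p p')) \<partial>lborel \<partial>lborel)
      = ennreal (B\<^sup>2 * (4 * K)) * (ennreal (vol r) * (ennreal (vol r) * ennreal (\<phi> (s / 2)) + ennreal (\<phi> 0) * ennreal (vol s)))"
      unfolding in1 using s r by (simp add: nn_integral_cmult nn_integral_multc I_integral)
    also have "\<dots> = ennreal (b1 s)"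
      using nonneg \<phi>_nonneg[of "s / 2"] s r by (simp add: b1_def ennreal_mult[symmetric] ennreal_plus[symmetric] mult_ac del: ennreal_plus)
    finally show "(\<integral>\<^sup>+p. \<integral>\<^sup>+p'. ennreal (B\<^sup>2 * (4 * K)) * (I r y p * (I r y p' * (ennreal (\<phi> (s / 2))) + ennreal (\<phi> 0) * I s p p')) \<partial>lborel \<partial>lborel) \<le> ennreal (b1 s)" by simp
    show "0 \<le> b1 s" using nonneg \<phi>_nonneg[of "s / 2"] s r by (simp add: b1_def)
  qed
  then show "(LINT w|M. \<bar>Q y w\<bar> * (Nr y w)\<^sup>2) \<le> b1 s"
    using F.integral_square_eq unfolding eq by simp
qed

lemma near_field: "L2_field M lborel (\<lambda>p w. near y p * (Q y w * Q p w)) (\<lambda>p. \<bar>near y p\<bar> * sqrt (2 * K))"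
proof (intro_locales, unfold_locales)
  show "(\<lambda>(p, w). near y p * (Q y w * Q p w)) \<in> borel_measurable (lborel \<Otimes>\<^sub>M M)" by measurable
  show "integrable M (\<lambda>w. (near y p * (Q y w * Q p w))\<^sup>2)" for p
    using Q_pair_square(1)[of y p] unfolding power_mult_distrib[of "near y p"] by (simp add: square_integrable_def)
  show "(LINT w|M. (near y p * (Q y w * Q p w))\<^sup>2) \<le> (\<bar>near y p\<bar> * sqrt (2 * K))\<^sup>2" for p
    using Q_pair_square(2)[of y p] K1 unfolding power_mult_distrib[of "near y p"] by (simp add: power_mult_distrib mult_left_mono)
  show "integrable lborel (\<lambda>p. \<bar>near y p\<bar> * sqrt (2 * K))" using near_integrable by simp
qed (use K1 in auto)

lemma near_field_integral: "(LINT p|lborel. near y p * (Q y w * Q p w)) = Q y w * Nr y w"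
proof -
  have "(LINT p|lborel. near y p * (Q y w * Q p w)) = (LINT p|lborel. Q y w * (near y p * Q p w))" by (simp add: mult_ac)
  also have "\<dots> = Q y w * Nr y w" unfolding Nr_def by (rule integral_mult_right_zero)
  finally show ?thesis .
qed

lemma QN_square: "square_integrable M (\<lambda>w. Q y w * Nr y w)"
  using L2_field.integral_square_integrable[OF near_field, of y] unfolding near_field_integral .

text \<open>Writing X = N + F with N the near part, exp(i \<theta> F) is a small decoupled term, and
  the rest is linear in N up to order N^2. The linear term is multiplied by exp(i \<theta> X) rather
  than exp(i \<theta> F), so that after integration over y a single random variable times exp(i
  \<theta> X) remains.\<close>

lemma local_expansion:
  assumes s: "0 < s"
  shows "cmod ((CLINT w|M. of_real (Q y w) * iexp (\<theta> * X w)) - \<i> * of_real \<theta> * (CLINT w|M. of_real (Q y w * Nr y w) * iexp (\<theta> * X w)))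
    \<le> 4 * K * \<phi> r + 3 / 2 * \<theta>\<^sup>2 * b1 s"
proof -
  let ?q = "\<lambda>w. complex_of_real (Q y w)" and ?n = "\<lambda>w. complex_of_real (Nr y w)"
  have iq: "integrable M (\<lambda>w. ?q w * iexp (\<theta> * Y w))" if [measurable]: "Y \<in> borel_measurable M" for Y
    by (rule Bochner_Integration.integrable_bound[OF square_integrable_imp_integrable[OF Q_square(1)[of y]]])
      (auto simp: norm_mult)
  have iqn: "integrable M (\<lambda>w. of_real (Q y w * Nr y w) * iexp (\<theta> * X w))"
    by (rule Bochner_Integration.integrable_bound[OF square_integrable_imp_integrable[OF QN_square[of y]]])
      (auto simp: norm_mult)
  define e where "e w = ?q w * iexp (\<theta> * X w) - \<i> * of_real \<theta> * (of_real (Q y w * Nr y w) * iexp (\<theta> * X w)) - ?q w * iexp (\<theta> * Fr y w)" for w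
  have [measurable]: "e \<in> borel_measurable M" unfolding e_def[abs_def] by measurable
  have ie: "integrable M e" unfolding e_def[abs_def] using iq[of X] iq[of "Fr y"] iqn
    by (intro Bochner_Integration.integrable_diff integrable_mult_right) auto
  have eb: "AE w in M. cmod (e w) \<le> 3 / 2 * \<theta>\<^sup>2 * (\<bar>Q y w\<bar> * (Nr y w)\<^sup>2)"
    using X_split[of y]
  proof eventually_elim
    case (elim w)
    define a where "a = \<theta> * Nr y w"
    have x: "iexp (\<theta> * X w) = iexp (\<theta> * Fr y w) * iexp a"
      unfolding elim a_def by (simp add: exp_add[symmetric] algebra_simps)
    have a': "iexp a * iexp (- a) = 1" by (simp add: exp_add[symmetric])
    have "e w = ?q w * iexp (\<theta> * Fr y w) * ((iexp a - 1 - \<i> * a) - \<i> * a * (iexp a - 1))"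
      unfolding e_def x by (simp add: a_def algebra_simps)
    then have "cmod (e w) = \<bar>Q y w\<bar> * cmod ((iexp a - 1 - \<i> * a) - \<i> * a * (iexp a - 1))"
      by (simp add: norm_mult)
    \<comment> \<open>The first remainder is the second order Taylor error a^2 / 2; the second one,
      at most a^2, is the price of using exp(i \<theta> X) in the linear term.\<close>
    also have "\<dots> \<le> \<bar>Q y w\<bar> * (a\<^sup>2 / 2 + \<bar>a\<bar> * \<bar>a\<bar>)"
    proof (rule mult_left_mono)
      have "cmod (\<i> * a * (iexp a - 1)) \<le> \<bar>a\<bar> * \<bar>a\<bar>"
        unfolding norm_mult using mult_left_mono[OF iexp_taylor(1)[of a] abs_ge_zero[of a]] by simp
      with iexp_taylor(2)[of a] show "cmod ((iexp a - 1 - \<i> * a) - \<i> * a * (iexp a - 1)) \<le> a\<^sup>2 / 2 + \<bar>a\<bar> * \<bar>a\<bar>"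
        using norm_triangle_ineq4[of "iexp a - 1 - \<i> * a" "\<i> * a * (iexp a - 1)"] by linarith
    qed simp
    also have "\<dots> = 3 / 2 * \<theta>\<^sup>2 * (\<bar>Q y w\<bar> * (Nr y w)\<^sup>2)"
      by (simp add: a_def power_mult_distrib power2_eq_square)
    finally show ?case .
  qed
  have "cmod (CLINT w|M. e w) \<le> (LINT w|M. cmod (e w))" by (rule integral_norm_bound)
  also have "\<dots> \<le> (LINT w|M. 3 / 2 * \<theta>\<^sup>2 * (\<bar>Q y w\<bar> * (Nr y w)\<^sup>2))"
    using ie near_third_moment(1)[OF s, of y] eb by (intro integral_mono_AE) auto
  also have "\<dots> \<le> 3 / 2 * \<theta>\<^sup>2 * b1 s"
    using near_third_moment(2)[OF s, of y] unfolding integral_mult_right_zero by (intro mult_left_mono) auto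
  finally have E: "cmod (CLINT w|M. e w) \<le> 3 / 2 * \<theta>\<^sup>2 * b1 s" .
  have "(CLINT w|M. ?q w * iexp (\<theta> * X w)) - \<i> * of_real \<theta> * (CLINT w|M. of_real (Q y w * Nr y w) * iexp (\<theta> * X w))
     = (CLINT w|M. e w) + (CLINT w|M. ?q w * iexp (\<theta> * Fr y w))"
  proof -
    have "(CLINT w|M. e w) = (CLINT w|M. ?q w * iexp (\<theta> * X w)) - (CLINT w|M. \<i> * of_real \<theta> * (of_real (Q y w * Nr y w) * iexp (\<theta> * X w))) - (CLINT w|M. ?q w * iexp (\<theta> * Fr y w))"
      unfolding e_def using iq[of X] iq[of "Fr y"] integrable_mult_right[OF iqn, of "\<i> * of_real \<theta>"]
      by (subst Bochner_Integration.integral_diff | intro Bochner_Integration.integrable_diff | simp only: X_measurable)+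
    then show ?thesis by (simp only: integral_mult_right_zero) simp
  qed
  then show ?thesis using norm_triangle_le[OF add_mono[OF E decoupled_bound[of y \<theta>]]] by (simp add: add.commute)
qed

section \<open>The random variance of the field functional\<close>

abbreviation "LL \<equiv> lborel \<Otimes>\<^sub>M (lborel :: 'a measure)"

definition \<kappa> :: "'a \<times> 'a \<Rightarrow> real" where "\<kappa> s = k (fst s) * near (fst s) (snd s)"
definition q2 :: "'a \<times> 'a \<Rightarrow> 'w \<Rightarrow> real" where "q2 s w = Q (fst s) w * Q (snd s) w"

lemma \<kappa>_measurable[measurable]: "\<kappa> \<in> borel_measurable LL" unfolding \<kappa>_def[abs_def] by measurable
lemma q2_measurable[measurable]: "(\<lambda>(s, w). q2 s w) \<in> borel_measurable (LL \<Otimes>\<^sub>M M)" unfolding q2_def by measurable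

lemma q2_square: "square_integrable M (q2 s)" "(LINT w|M. (q2 s w)\<^sup>2) \<le> 2 * K"
  using Q_pair_square[of "fst s" "snd s"] by (simp_all add: q2_def[abs_def])

lemma \<kappa>_le: "\<bar>\<kappa> s\<bar> \<le> (B * indicator D (fst s)) * (B * indicator D (snd s))"
    "\<bar>\<kappa> s\<bar> \<le> (B * indicator D (fst s)) * (B * indicator (ball (fst s) r) (snd s))"
  unfolding \<kappa>_def abs_mult using nonneg(1) by (intro mult_mono k_le near_le; simp)+

lemma \<kappa>_integrable: "integrable LL \<kappa>"
proof -
  have i: "integrable LL (\<lambda>(x, y). (B * indicator D x) * (B * indicator D y))"
  proof (rule lborel_pair.Fubini_integrable)
    show "integrable lborel (\<lambda>x. LINT y|lborel. norm (case (x, y) of (x, y) \<Rightarrow> (B * indicator D x) * (B * indicator D y)))"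
      using integrable_D by (simp add: abs_mult)
    show "AE x in lborel. integrable lborel (\<lambda>y. case (x, y) of (x, y) \<Rightarrow> (B * indicator D x) * (B * indicator D y))"
      using integrable_D by simp
  qed measurable
  show ?thesis
  proof (rule Bochner_Integration.integrable_bound[OF i _ AE_I2])
    fix s show "norm (\<kappa> s) \<le> norm (case s of (x, y) \<Rightarrow> (B * indicator D x) * (B * indicator D y))"
      using \<kappa>_le(1)[of s] by (simp add: case_prod_unfold)
  qed measurable
qed

text \<open>A pair of points is treated as one parameter, so the results on integrals of fields
  apply verbatim to quadratic expressions in the field.\<close>

lemma LL_field:
  assumes [measurable]: "(\<lambda>(s, w). h s w) \<in> borel_measurable (LL \<Otimes>\<^sub>M M)"
    and "\<And>s. square_integrable M (h s)" "\<And>s. (LINT w|M. (h s w)\<^sup>2) \<le> C" "0 \<le> C"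
  shows "L2_field M LL (\<lambda>s w. \<kappa> s * h s w) (\<lambda>s. \<bar>\<kappa> s\<bar> * sqrt C)"
proof -
  interpret LLs: sigma_finite_measure LL by (rule sigma_finite_pair_measure) unfold_locales
  show ?thesis
  proof unfold_locales
    show "(\<lambda>(p, w). \<kappa> p * h p w) \<in> borel_measurable (LL \<Otimes>\<^sub>M M)" by measurable
    show "integrable M (\<lambda>w. (\<kappa> p * h p w)\<^sup>2)" for p
      using assms(2)[of p] by (simp add: square_integrable_def power_mult_distrib)
    show "(LINT w|M. (\<kappa> p * h p w)\<^sup>2) \<le> (\<bar>\<kappa> p\<bar> * sqrt C)\<^sup>2" for p
      using assms(3)[of p] assms(4) by (simp add: power_mult_distrib mult_left_mono)
    show "integrable LL (\<lambda>s. \<bar>\<kappa> s\<bar> * sqrt C)" using \<kappa>_integrable by simp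
  qed (use assms in auto)
qed

sublocale FZ: L2_field M LL "\<lambda>s w. \<kappa> s * q2 s w" "\<lambda>s. \<bar>\<kappa> s\<bar> * sqrt (2 * K)"
  by (rule LL_field) (use q2_square nonneg in auto)

definition Z :: "'w \<Rightarrow> real" where "Z w = (LINT s|LL. \<kappa> s * q2 s w)"
definition EZ :: real where "EZ = (LINT s|LL. \<kappa> s * (LINT w|M. q2 s w))"

lemma Z_square: "square_integrable M Z"
  using FZ.integral_square_integrable unfolding Z_def[abs_def] .

lemma Z_measurable[measurable]: "Z \<in> borel_measurable M"
  using Z_square by (simp add: square_integrable_def)

lemma EZ_integrable: "integrable LL (\<lambda>s. \<kappa> s * (LINT w|M. q2 s w))"
proof (rule Bochner_Integration.integrable_bound[OF FZ.c_integrable _ AE_I2])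
  show "(\<lambda>s. \<kappa> s * (LINT w|M. q2 s w)) \<in> borel_measurable LL"
    by (intro borel_measurable_times borel_measurable_lebesgue_integral) measurable
  fix s
  have "\<bar>LINT w|M. q2 s w\<bar> \<le> sqrt (2 * K)"
    using order_trans[OF power_mono[OF integral_abs_bound[of M "q2 s"], of 2] order_trans[OF L1_le_L2[OF q2_square(1)] q2_square(2)]]
    by (intro real_le_rsqrt) simp
  then show "norm (\<kappa> s * (LINT w|M. q2 s w)) \<le> norm (\<bar>\<kappa> s\<bar> * sqrt (2 * K))"
    using nonneg(2) by (simp add: abs_mult mult_left_mono)
qed

text \<open>Integrating over the partner point first produces \<open>Q y * Nr y\<close>, the linear
  term left by \<open>local_expansion\<close>.\<close>

lemma Z_slices:
  fixes \<xi> :: "'w \<Rightarrow> complex"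
  assumes [measurable]: "\<xi> \<in> borel_measurable M" and b: "\<And>w. cmod (\<xi> w) \<le> 1"
  shows "(CLINT w|M. of_real (Z w) * \<xi> w) = (CLINT y|lborel. of_real (k y) * (CLINT w|M. of_real (Q y w * Nr y w) * \<xi> w))"
    and "integrable lborel (\<lambda>y. of_real (k y) * (CLINT w|M. of_real (Q y w * Nr y w) * \<xi> w))"
proof -
  have *: "(CLINT p|lborel. CLINT w|M. of_real (\<kappa> (y, p) * q2 (y, p) w) * \<xi> w)
      = of_real (k y) * (CLINT w|M. of_real (Q y w * Nr y w) * \<xi> w)" for y
  proof -
    have "(CLINT w|M. of_real (\<kappa> (y, p) * q2 (y, p) w) * \<xi> w) = of_real (k y) * (CLINT w|M. of_real (near y p * (Q y w * Q p w)) * \<xi> w)" for p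
      unfolding integral_mult_right_zero[symmetric] by (intro Bochner_Integration.integral_cong refl) (simp add: \<kappa>_def q2_def)
    then show ?thesis
      using L2_field.integral_mult_bounded(1)[OF near_field assms, of y] unfolding near_field_integral by simp
  qed
  have "(CLINT w|M. of_real (Z w) * \<xi> w) = (CLINT s|LL. CLINT w|M. of_real (\<kappa> s * q2 s w) * \<xi> w)"
    unfolding Z_def by (rule FZ.integral_mult_bounded(1)[OF assms])
  also have "\<dots> = (CLINT y|lborel. CLINT p|lborel. CLINT w|M. of_real (\<kappa> (y, p) * q2 (y, p) w) * \<xi> w)"
    by (rule lborel_pair.integral_fst'[OF FZ.integral_mult_bounded(2)[OF assms], symmetric])
  finally show "(CLINT w|M. of_real (Z w) * \<xi> w) = (CLINT y|lborel. of_real (k y) * (CLINT w|M. of_real (Q y w * Nr y w) * \<xi> w))"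
    unfolding * .
  show "integrable lborel (\<lambda>y. of_real (k y) * (CLINT w|M. of_real (Q y w * Nr y w) * \<xi> w))"
    using lborel_pair.integrable_fst'[OF FZ.integral_mult_bounded(2)[OF assms]] unfolding * .
qed

text \<open>By mixing of pairs, the random variance \<open>Z\<close> concentrates around its mean \<open>EZ\<close>.\<close>

definition b2 :: real where
  "b2 = B ^ 4 * (2 * K) * (volD * vol r * (vol r * (volD * \<phi> (2 * r) + vol (4 * r) * \<phi> 0)))"

text \<open>The variance is a double integral over pairs of points of the covariance of the two
  products. Each base point carries a partner in a ball of radius r; the second base point
  contributes \<phi>(2 r) over all of D, or \<phi>(0) over a ball of radius 4 r about the
  first.\<close>

lemma Z_variance: "(LINT w|M. (Z w - EZ)\<^sup>2) \<le> b2"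
proof -
  define m where "m s = (LINT w|M. q2 s w)" for s
  have m_meas[measurable]: "m \<in> borel_measurable LL" unfolding m_def[abs_def] by (intro borel_measurable_lebesgue_integral) measurable
  define h where "h s w = q2 s w - m s" for s w
  have [measurable]: "(\<lambda>(s, w). h s w) \<in> borel_measurable (LL \<Otimes>\<^sub>M M)" unfolding h_def by measurable
  have hs: "square_integrable M (h s)" for s
    unfolding h_def[abs_def] by (intro square_integrable_diff q2_square square_integrable_const)
  have qi: "integrable M (q2 s)" for s by (rule square_integrable_imp_integrable[OF q2_square(1)])
  have cov: "(LINT w|M. h s w * h t w) = (LINT w|M. q2 s w * q2 t w) - m s * m t" for s t
  proof -
    have eq: "h s w * h t w = q2 s w * q2 t w - m t * q2 s w - m s * q2 t w + m s * m t" for w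
      by (simp add: h_def algebra_simps)
    show ?thesis unfolding eq using qi[of s] qi[of t] square_integrable_mult[OF q2_square(1) q2_square(1), of s t]
      by (simp add: prob_space m_def[symmetric])
  qed
  have "(LINT w|M. (h s w)\<^sup>2) \<le> 2 * K" for s
    using cov[of s s] q2_square(2)[of s] zero_le_square[of "m s"] unfolding power2_eq_square[symmetric] by linarith
  then interpret H: L2_field M LL "\<lambda>s w. \<kappa> s * h s w" "\<lambda>s. \<bar>\<kappa> s\<bar> * sqrt (2 * K)"
    by (intro LL_field) (use hs nonneg in auto)
  have im: "integrable LL (\<lambda>s. \<kappa> s * m s)" unfolding m_def by (rule EZ_integrable)
  have ae: "AE w in M. (LINT s|LL. \<kappa> s * h s w) = Z w - EZ"
    using FZ.AE_integrable
  proof eventually_elim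
    case (elim w)
    then show ?case using im by (simp add: h_def right_diff_distrib Z_def EZ_def m_def[symmetric])
  qed
  have "(LINT w|M. (Z w - EZ)\<^sup>2) = (LINT w|M. (LINT s|LL. \<kappa> s * h s w)\<^sup>2)"
    using ae by (intro integral_cong_AE) (auto elim: eventually_mono)
  also have "\<dots> = (LINT s|LL. LINT t|LL. LINT w|M. \<kappa> s * h s w * (\<kappa> t * h t w))"
    by (rule H.integral_square_eq)
  also have "\<dots> \<le> b2"
  proof (rule order_trans[OF abs_ge_self], rule double_integral_le)
    fix s t :: "'a \<times> 'a"
    let ?h = "ennreal (B ^ 4 * (2 * K)) * (indicator D (fst s) * (I r (fst s) (snd s) *
       ((indicator D (fst t) * ennreal (\<phi> (2 * r)) + ennreal (\<phi> 0) * I (4 * r) (fst s) (fst t)) * I r (fst t) (snd t))))"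
    have eq: "(LINT w|M. \<kappa> s * h s w * (\<kappa> t * h t w)) = \<kappa> s * \<kappa> t * (LINT w|M. h s w * h t w)"
      unfolding integral_mult_right_zero[symmetric] by (simp add: mult_ac)
    show "eabs (LINT w|M. \<kappa> s * h s w * (\<kappa> t * h t w)) \<le> ?h"
    proof (cases "fst s \<in> D \<and> dist (fst s) (snd s) < r \<and> fst t \<in> D \<and> dist (fst t) (snd t) < r")
      case False
      then have "\<kappa> s = 0 \<or> \<kappa> t = 0" using k_support by (auto simp: \<kappa>_def near_def)
      then show ?thesis unfolding eq by auto
    next
      case True
      \<comment> \<open>Base points at least 4 r apart, with partners within r of them, leave all
        four cross distances at least 2 r. Otherwise nothing is known and the rate at 0 is
        used.\<close>
      define d where "d = (if dist (fst s) (fst t) < 4 * r then 0 else 2 * r)"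
      have tri: "dist (fst s) (fst t) \<le> dist (fst s) a + dist a b + dist b (fst t)" for a b
        using dist_triangle[of "fst s" "fst t" a] dist_triangle[of a "fst t" b] by linarith
      have "\<bar>(LINT w|M. q2 s w * q2 t w) - m s * m t\<bar> \<le> 2 * K * \<phi> d"
        unfolding q2_def m_def
      proof (rule pair_pair)
        show "0 \<le> d" "d \<le> dist (fst s) (fst t)" "d \<le> dist (fst s) (snd t)" "d \<le> dist (snd s) (fst t)" "d \<le> dist (snd s) (snd t)"
          using r True tri[of "fst s" "fst t"] tri[of "fst s" "snd t"] tri[of "snd s" "fst t"] tri[of "snd s" "snd t"]
          by (auto simp: d_def dist_commute)
      qed
      moreover have "\<bar>\<kappa> s * \<kappa> t\<bar> \<le> (B * B) * (B * B)"
        unfolding abs_mult using \<kappa>_le(1)[of s] \<kappa>_le(1)[of t] nonneg(1)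
        by (intro mult_mono) (auto simp: indicator_def intro: order_trans split: if_splits)
      ultimately have "\<bar>\<kappa> s * \<kappa> t * (LINT w|M. h s w * h t w)\<bar> \<le> (B * B) * (B * B) * (2 * K * \<phi> d)"
        unfolding cov abs_mult[of "_ * _" "_ - _"] using nonneg(1) by (intro mult_mono) auto
      also have "\<dots> = (B ^ 4 * (2 * K)) * \<phi> d" by (simp add: power4_eq_xxxx)
      also have "ennreal \<dots> = ennreal (B ^ 4 * (2 * K)) * ennreal (\<phi> d)" using nonneg by (simp add: ennreal_mult')
      also have "\<dots> \<le> ?h" using True by (auto simp: d_def indicator_def I_def dist_commute intro!: mult_left_mono)
      finally show ?thesis unfolding eq by (meson ennreal_leI order_trans)
    qed
  next
    let ?g = "\<lambda>y p y' p'. ennreal (B ^ 4 * (2 * K)) * (indicator D y * (I r y p *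
       ((indicator D y' * ennreal (\<phi> (2 * r)) + ennreal (\<phi> 0) * I (4 * r) y y') * I r y' p')))"
    have in1: "(\<integral>\<^sup>+t. ?g y p (fst t) (snd t) \<partial>LL) = ennreal (B ^ 4 * (2 * K)) * (indicator D y * (I r y p *
       (ennreal volD * ennreal (\<phi> (2 * r)) + ennreal (\<phi> 0) * ennreal (vol (4 * r))) * ennreal (vol r)))" for y p
    proof -
      have "(\<integral>\<^sup>+t. ?g y p (fst t) (snd t) \<partial>LL) = (\<integral>\<^sup>+y'. \<integral>\<^sup>+p'. ?g y p y' p' \<partial>lborel \<partial>lborel)"
        by (subst lborel.nn_integral_fst[symmetric]) (simp_all, measurable)
      also have "\<dots> = ennreal (B ^ 4 * (2 * K)) * (indicator D y * (I r y p *
       (ennreal volD * ennreal (\<phi> (2 * r)) + ennreal (\<phi> 0) * ennreal (vol (4 * r))) * ennreal (vol r)))"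
        using r by (simp add: nn_integral_cmult nn_integral_multc nn_integral_add I_integral emeasure_D mult.assoc)
      finally show ?thesis .
    qed
    have "(\<integral>\<^sup>+s. \<integral>\<^sup>+t. ?g (fst s) (snd s) (fst t) (snd t) \<partial>LL \<partial>LL)
      = (\<integral>\<^sup>+y. \<integral>\<^sup>+p. ennreal (B ^ 4 * (2 * K)) * (indicator D y * (I r y p *
       (ennreal volD * ennreal (\<phi> (2 * r)) + ennreal (\<phi> 0) * ennreal (vol (4 * r))) * ennreal (vol r))) \<partial>lborel \<partial>lborel)"
      unfolding in1 by (subst lborel.nn_integral_fst[symmetric]) (simp_all, measurable)
    also have "\<dots> = ennreal (B ^ 4 * (2 * K)) * (ennreal volD * (ennreal (vol r) *
       (ennreal volD * ennreal (\<phi> (2 * r)) + ennreal (\<phi> 0) * ennreal (vol (4 * r))) * ennreal (vol r)))"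
      using r by (simp add: nn_integral_cmult nn_integral_multc I_integral emeasure_D mult.assoc)
    also have "\<dots> = ennreal b2"
      using nonneg \<phi>_nonneg[of "2 * r"] r
      by (simp add: b2_def ennreal_mult[symmetric] ennreal_plus[symmetric] mult_ac del: ennreal_plus)
    finally show "(\<integral>\<^sup>+s. \<integral>\<^sup>+t. ?g (fst s) (snd s) (fst t) (snd t) \<partial>LL \<partial>LL) \<le> ennreal b2" by simp
    show "0 \<le> b2" using nonneg \<phi>_nonneg[of "2 * r"] r by (simp add: b2_def)
  qed
  finally show ?thesis .
qed

definition cf :: "real \<Rightarrow> complex" where "cf \<theta> = (CLINT w|M. iexp (\<theta> * X w))"
definition cf' :: "real \<Rightarrow> complex" where "cf' \<theta> = \<i> * (CLINT w|M. of_real (X w) * iexp (\<theta> * X w))"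

lemma cf_derivative: "(cf has_vector_derivative cf' \<theta>) (at \<theta>)"
proof (rule has_vector_derivative_quadratic)
  fix \<eta> :: real
  have i: "integrable M (\<lambda>w. iexp (\<theta> * X w))" for \<theta> by (intro integrable_const_bound[of _ 1]) auto
  have ix: "integrable M (\<lambda>w. of_real (X w) * iexp (\<theta> * X w))"
    by (rule Bochner_Integration.integrable_bound[OF square_integrable_imp_integrable[OF X_square]]) (auto simp: norm_mult)
  have x2: "integrable M (\<lambda>w. (X w)\<^sup>2)" using X_square by (simp add: square_integrable_def)
  define g where "g w = iexp (\<eta> * X w) - iexp (\<theta> * X w) - (\<eta> - \<theta>) *\<^sub>R (\<i> * (of_real (X w) * iexp (\<theta> * X w)))" for w
  have ig: "integrable M g" unfolding g_def[abs_def]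
    by (intro Bochner_Integration.integrable_diff i integrable_scaleR_right integrable_mult_right ix)
  have "(CLINT w|M. g w) = cf \<eta> - cf \<theta> - (\<eta> - \<theta>) *\<^sub>R cf' \<theta>"
    unfolding g_def cf_def cf'_def using i[of \<eta>] i[of \<theta>] integrable_scaleR_right[OF integrable_mult_right[OF ix, of \<i>], of "\<eta> - \<theta>"]
    by (simp only: Bochner_Integration.integral_diff Bochner_Integration.integrable_diff integral_scaleR_right integral_mult_right_zero)
  moreover have "cmod (CLINT w|M. g w) \<le> (LINT w|M. (\<eta> - \<theta>)\<^sup>2 * ((X w)\<^sup>2 / 2))"
  proof (rule order_trans[OF integral_norm_bound], rule integral_mono)
    fix w
    define a where "a = (\<eta> - \<theta>) * X w"
    have "iexp (\<eta> * X w) = iexp (\<theta> * X w) * iexp a"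
      by (simp add: a_def exp_add[symmetric] algebra_simps)
    then have "g w = iexp (\<theta> * X w) * (iexp a - 1 - \<i> * a)"
      by (simp add: g_def a_def scaleR_conv_of_real algebra_simps)
    then have "cmod (g w) = cmod (iexp a - 1 - \<i> * a)" by (simp add: norm_mult)
    also have "\<dots> \<le> a\<^sup>2 / 2" by (rule iexp_taylor)
    finally show "cmod (g w) \<le> (\<eta> - \<theta>)\<^sup>2 * ((X w)\<^sup>2 / 2)" by (simp add: a_def power_mult_distrib)
  qed (use ig x2 in auto)
  ultimately show "cmod (cf \<eta> - cf \<theta> - (\<eta> - \<theta>) *\<^sub>R cf' \<theta>) \<le> (LINT w|M. (X w)\<^sup>2) / 2 * (\<eta> - \<theta>)\<^sup>2"
    by (simp add: mult.commute)
qed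

text \<open>Three replacements in the derivative of the characteristic function: each slice by its
  local expansion, the random variance by its mean, and the mean by the target \<open>V\<close>.
  They account for the three summands of the bound.\<close>

lemma stein_bound:
  assumes s: "0 < s" and \<theta>: "0 \<le> \<theta>" "\<theta> \<le> 1"
  shows "cmod (cf' \<theta> + of_real (\<theta> * V) * cf \<theta>) \<le> B * volD * (4 * K * \<phi> r + 3 / 2 * b1 s) + sqrt b2 + \<bar>EZ - V\<bar>"
proof -
  let ?\<xi> = "\<lambda>w. iexp (\<theta> * X w)"
  let ?e = "4 * K * \<phi> r + 3 / 2 * b1 s"
  have \<xi>: "?\<xi> \<in> borel_measurable M" "\<And>w. cmod (?\<xi> w) \<le> 1" by simp_all
  have b10: "0 \<le> b1 s" using nonneg \<phi>_nonneg[of "s / 2"] s r by (simp add: b1_def)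
  have e0: "0 \<le> ?e" using nonneg b10 \<phi>_nonneg[of r] r by simp
  define a where "a y = (CLINT w|M. of_real (k y * Q y w) * ?\<xi> w)" for y
  define b where "b y = of_real (k y) * (CLINT w|M. of_real (Q y w * Nr y w) * ?\<xi> w)" for y
  have a: "integrable lborel a" "cf' \<theta> = \<i> * (CLINT y|lborel. a y)"
    using FX.integral_mult_bounded[OF \<xi>] by (auto simp: a_def[abs_def] cf'_def X_def)
  have b: "integrable lborel b" "(CLINT w|M. of_real (Z w) * ?\<xi> w) = (CLINT y|lborel. b y)"
    using Z_slices[OF \<xi>] by (auto simp: b_def[abs_def])
  have "cmod (CLINT y|lborel. a y - \<i> * of_real \<theta> * b y) \<le> (LINT y|lborel. B * indicator D y * ?e)"
  proof (rule order_trans[OF integral_norm_bound], rule integral_mono)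
    show "integrable lborel (\<lambda>y. cmod (a y - \<i> * of_real \<theta> * b y))" using a(1) b(1) by simp
    show "integrable lborel (\<lambda>y. B * indicator D y * ?e)" using integrable_D by (rule integrable_mult_left)
    fix y
    have "a y = of_real (k y) * (CLINT w|M. of_real (Q y w) * ?\<xi> w)"
      unfolding a_def integral_mult_right_zero[symmetric] by (simp add: mult_ac)
    then have "cmod (a y - \<i> * of_real \<theta> * b y) = \<bar>k y\<bar> * cmod ((CLINT w|M. of_real (Q y w) * ?\<xi> w) - \<i> * of_real \<theta> * (CLINT w|M. of_real (Q y w * Nr y w) * ?\<xi> w))"
      unfolding b_def norm_of_real[symmetric, where 'a = complex] norm_mult[symmetric] by (simp only: right_diff_distrib mult_ac)
    also have "\<dots> \<le> (B * indicator D y) * (4 * K * \<phi> r + 3 / 2 * \<theta>\<^sup>2 * b1 s)"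
      using nonneg(1) by (intro mult_mono k_le local_expansion s) auto
    also have "\<dots> \<le> (B * indicator D y) * ?e"
    proof (rule mult_left_mono)
      have "\<theta>\<^sup>2 * b1 s \<le> 1 * b1 s" using \<theta> b10 by (intro mult_right_mono power_le_one) auto
      then show "4 * K * \<phi> r + 3 / 2 * \<theta>\<^sup>2 * b1 s \<le> ?e" by simp
    qed (use nonneg(1) in simp)
    finally show "cmod (a y - \<i> * of_real \<theta> * b y) \<le> B * indicator D y * ?e" .
  qed
  also have "\<dots> = B * volD * ?e"
    by (simp only: integral_mult_left_zero integral_mult_right_zero) (simp add: volD_def)
  finally have 1: "cmod ((CLINT y|lborel. a y) - \<i> * of_real \<theta> * (CLINT y|lborel. b y)) \<le> B * volD * ?e"
    using a(1) b(1) by (simp add: Bochner_Integration.integral_diff)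
  have iZ: "integrable M (\<lambda>w. of_real (Z w) * ?\<xi> w)"
    by (rule Bochner_Integration.integrable_bound[OF square_integrable_imp_integrable[OF Z_square]]) (auto simp: norm_mult)
  have i\<xi>: "integrable M ?\<xi>" by (rule integrable_const_bound[of _ 1]) auto
  have dZ: "square_integrable M (\<lambda>w. Z w - EZ)" by (intro square_integrable_diff Z_square square_integrable_const)
  have "cmod ((CLINT w|M. of_real (Z w) * ?\<xi> w) - of_real EZ * cf \<theta>) = cmod (CLINT w|M. of_real (Z w - EZ) * ?\<xi> w)"
    unfolding cf_def integral_mult_right_zero[symmetric] using iZ i\<xi>
    by (subst Bochner_Integration.integral_diff[symmetric]) (auto simp: algebra_simps)
  also have "\<dots> \<le> (LINT w|M. \<bar>Z w - EZ\<bar>)"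
    by (rule order_trans[OF integral_norm_bound]) (simp add: norm_mult del: of_real_diff)
  also have "\<dots> \<le> sqrt b2"
    using order_trans[OF L1_le_L2[OF dZ] Z_variance] by (rule real_le_rsqrt)
  finally have 2: "cmod ((CLINT w|M. of_real (Z w) * ?\<xi> w) - of_real EZ * cf \<theta>) \<le> sqrt b2" .
  have 3: "cmod (cf \<theta>) \<le> 1"
    unfolding cf_def by (rule order_trans[OF integral_norm_bound]) (simp add: prob_space)
  let ?A = "CLINT y|lborel. a y" and ?Bi = "CLINT y|lborel. b y"
  \<comment> \<open>In the first bracket i * i = -1 turns the linear terms of the slices into
    -\<theta> E(Z exp(i \<theta> X)); the other two brackets move this to -\<theta> V times the
    characteristic function.\<close>
  have "cf' \<theta> + of_real (\<theta> * V) * cf \<theta> = \<i> * (?A - \<i> * of_real \<theta> * ?Bi) - of_real \<theta> * (?Bi - of_real EZ * cf \<theta>) - of_real \<theta> * (of_real (EZ - V) * cf \<theta>)"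
    unfolding a(2) by (simp add: algebra_simps)
  also have "cmod \<dots> \<le> cmod (\<i> * (?A - \<i> * of_real \<theta> * ?Bi)) + cmod (of_real \<theta> * (?Bi - of_real EZ * cf \<theta>)) + cmod (of_real \<theta> * (of_real (EZ - V) * cf \<theta>))"
    by (intro order_trans[OF norm_triangle_ineq4] add_right_mono norm_triangle_ineq4)
  also have "\<dots> \<le> B * volD * ?e + 1 * sqrt b2 + 1 * (\<bar>EZ - V\<bar> * 1)"
  proof (intro add_mono)
    show "cmod (\<i> * (?A - \<i> * of_real \<theta> * ?Bi)) \<le> B * volD * ?e" using 1 by (simp add: norm_mult)
    show "cmod (of_real \<theta> * (?Bi - of_real EZ * cf \<theta>)) \<le> 1 * sqrt b2"
      unfolding norm_mult using 2[unfolded b(2)] \<theta> by (intro mult_mono) auto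
    show "cmod (of_real \<theta> * (of_real (EZ - V) * cf \<theta>)) \<le> 1 * (\<bar>EZ - V\<bar> * 1)"
      unfolding norm_mult using 3 \<theta> by (intro mult_mono) (auto simp del: of_real_diff)
  qed
  finally show ?thesis by simp
qed

lemma normal_approximation:
  assumes s: "0 < s" and V: "0 \<le> V"
  shows "cmod ((CLINT w|M. iexp (X w)) - of_real (exp (- (V / 2))))
    \<le> B * volD * (4 * K * \<phi> r + 3 / 2 * b1 s) + sqrt b2 + \<bar>EZ - V\<bar>"
  using gaussian_ode_stability[OF _ cf_derivative V stein_bound[OF s]] by (simp add: cf_def prob_space)

end

section \<open>Oscillatory integrals of a stationary field\<close>

lemma lborel_integral_affine:
  fixes f :: "'a::euclidean_space \<Rightarrow> 'b::{banach, second_countable_topology}"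
  assumes [measurable]: "f \<in> borel_measurable borel" and c: "c > 0"
  shows "(LINT p|lborel. f p) = c ^ DIM('a) *\<^sub>R (LINT z|lborel. f (y + c *\<^sub>R z))"
proof -
  have "(LINT p|lborel. f p) = (LINT p|density (distr lborel borel (\<lambda>x. y + c *\<^sub>R x)) (\<lambda>_. ennreal (c ^ DIM('a))). f p)"
    using lborel_affine[of c y] c by (simp add: ennreal_power)
  also have "\<dots> = (LINT p|distr lborel borel (\<lambda>x. y + c *\<^sub>R x). (c ^ DIM('a)) *\<^sub>R f p)"
    using c by (subst integral_density) auto
  also have "\<dots> = c ^ DIM('a) *\<^sub>R (LINT z|lborel. f (y + c *\<^sub>R z))"
    by (subst integral_distr) auto
  finally show ?thesis .
qed

lemma lborel_nn_integral_affine: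
  fixes f :: "'a::euclidean_space \<Rightarrow> ennreal"
  assumes [measurable]: "f \<in> borel_measurable borel" and c: "c > 0"
  shows "(\<integral>\<^sup>+p. f p \<partial>lborel) = ennreal (c ^ DIM('a)) * (\<integral>\<^sup>+z. f (y + c *\<^sub>R z) \<partial>lborel)"
proof -
  have "(\<integral>\<^sup>+p. f p \<partial>lborel) = (\<integral>\<^sup>+p. f p \<partial>density (distr lborel borel (\<lambda>x. y + c *\<^sub>R x)) (\<lambda>_. ennreal (c ^ DIM('a))))"
    using lborel_affine[of c y] c by (simp add: ennreal_power)
  also have "\<dots> = (\<integral>\<^sup>+p. ennreal (c ^ DIM('a)) * f p \<partial>distr lborel borel (\<lambda>x. y + c *\<^sub>R x))"
    by (subst nn_integral_density) auto
  also have "\<dots> = ennreal (c ^ DIM('a)) * (\<integral>\<^sup>+z. f (y + c *\<^sub>R z) \<partial>lborel)"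
    by (subst nn_integral_distr) (auto simp: nn_integral_cmult)
  finally show ?thesis .
qed

text \<open>Since \<phi> decreases, (l/2)^d \<phi>(l)^(1/2) is at most the integral of r^(d-1)
  \<phi>(r)^(1/2) over (l/2, l], hence at most a tail of a convergent integral. Squaring gives the
  exponent 2 d.\<close>

lemma mixing_rate_decay:
  fixes \<phi> :: "real \<Rightarrow> real"
  assumes nn: "\<And>r. 0 \<le> r \<Longrightarrow> 0 \<le> \<phi> r" and anti: "\<And>r s. 0 \<le> r \<Longrightarrow> r \<le> s \<Longrightarrow> \<phi> s \<le> \<phi> r"
    and int: "set_integrable lborel {0<..} (\<lambda>r. r ^ (d - 1) * sqrt (\<phi> r))" and d: "1 \<le> d"
  shows "((\<lambda>l. l ^ (2 * d) * \<phi> l) \<longlongrightarrow> 0) at_top"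
proof -
  let ?g = "\<lambda>r. indicator {0<..} r * (r ^ (d - 1) * sqrt (\<phi> r))"
  have gi: "integrable lborel ?g" using int by (simp add: set_integrable_def)
  have gm[measurable]: "?g \<in> borel_measurable borel" using borel_measurable_integrable[OF gi] by simp
  have g0: "0 \<le> ?g r" for r using nn[of r] by (auto simp: indicator_def)
  have tail: "((\<lambda>l. LINT r|lborel. indicator {l / 2<..} r * ?g r) \<longlongrightarrow> (LINT r|(lborel :: real measure). (0::real))) at_top"
  proof (rule integral_dominated_convergence_at_top[where w = ?g])
    show "\<forall>\<^sub>F l in at_top. AE r in lborel. norm (indicator {l / 2<..} r * ?g r) \<le> ?g r"
      using nn by (auto simp: indicator_def intro!: always_eventually)
    show "AE r in lborel. ((\<lambda>l. indicator {l / 2<..} r * ?g r) \<longlongrightarrow> 0) at_top"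
    proof (rule AE_I2)
      fix r :: real
      have "\<forall>\<^sub>F l in at_top. indicator {l / 2<..} r * ?g r = 0"
        using eventually_ge_at_top[of "2 * r"] by eventually_elim (auto simp: indicator_def)
      then show "((\<lambda>l. indicator {l / 2<..} r * ?g r) \<longlongrightarrow> 0) at_top" by (rule tendsto_eventually)
    qed
  qed (use gi in auto)
  have low: "(l / 2) ^ d * sqrt (\<phi> l) \<le> (LINT r|lborel. indicator {l / 2<..} r * ?g r)" if l: "l > 0" for l
  proof -
    \<comment> \<open>The length l / 2 of the interval supplies the last of the d powers.\<close>
    have "(l / 2) ^ d * sqrt (\<phi> l) = (LINT r|lborel. ((l / 2) ^ (d - 1) * sqrt (\<phi> l)) * indicator {l / 2<..l} r)"
      using l d by (cases d) simp_all
    also have "\<dots> \<le> (LINT r|lborel. indicator {l / 2<..} r * ?g r)"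
    proof (rule integral_mono)
      show "integrable lborel (\<lambda>r. ((l / 2) ^ (d - 1) * sqrt (\<phi> l)) * indicator {l / 2<..l} r)"
        using l by (intro integrable_mult_right integrable_real_indicator) auto
      show "integrable lborel (\<lambda>r. indicator {l / 2<..} r * ?g r)"
      proof (rule Bochner_Integration.integrable_bound[OF gi _ AE_I2])
        show "(\<lambda>r. indicator {l / 2<..} r * ?g r) \<in> borel_measurable lborel"
          by (rule borel_measurable_times) (use gm in simp_all)
      qed (auto simp: indicator_def)
      fix r
      show "((l / 2) ^ (d - 1) * sqrt (\<phi> l)) * indicator {l / 2<..l} r \<le> indicator {l / 2<..} r * ?g r"
      proof (cases "r \<in> {l / 2<..l}")
        case True
        then have "(l / 2) ^ (d - 1) * sqrt (\<phi> l) \<le> r ^ (d - 1) * sqrt (\<phi> r)"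
          using l nn[of l] anti[of r l] by (intro mult_mono power_mono) auto
        then show ?thesis using True l by simp
      next
        case False
        then show ?thesis using g0[of r] by (auto simp: indicator_def)
      qed
    qed
    finally show ?thesis .
  qed
  have "((\<lambda>l. (2 ^ d * (LINT r|lborel. indicator {l / 2<..} r * ?g r))\<^sup>2) \<longlongrightarrow> (2 ^ d * 0)\<^sup>2) at_top"
    using tail by (intro tendsto_intros) simp
  then have lim: "((\<lambda>l. (2 ^ d * (LINT r|lborel. indicator {l / 2<..} r * ?g r))\<^sup>2) \<longlongrightarrow> 0) at_top" by simp
  show ?thesis
  proof (rule Lim_null_comparison[OF _ lim])
    show "\<forall>\<^sub>F l in at_top. norm (l ^ (2 * d) * \<phi> l) \<le> (2 ^ d * (LINT r|lborel. indicator {l / 2<..} r * ?g r))\<^sup>2"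
      using eventually_gt_at_top[of 0]
    proof eventually_elim
      case (elim l)
      have "l ^ (2 * d) * \<phi> l = (2 ^ d * ((l / 2) ^ d * sqrt (\<phi> l)))\<^sup>2"
        using nn[of l] elim by (simp add: power_mult_distrib power_divide power_mult[symmetric] mult.commute)
      also have "\<dots> \<le> (2 ^ d * (LINT r|lborel. indicator {l / 2<..} r * ?g r))\<^sup>2"
        using low[OF elim] nn[of l] elim by (intro power_mono mult_left_mono) auto
      finally show ?case using nn[of l] elim by simp
    qed
  qed
qed

locale stationary_field = prob_space M for M :: "'w measure" +
  fixes q :: "'a::euclidean_space \<Rightarrow> 'w \<Rightarrow> real" and \<phi> :: "real \<Rightarrow> real"
  assumes field: "random_field M q" and six: "\<And>x. integrable M (\<lambda>w. q x w ^ 6)"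
    and \<phi>_nonneg: "\<And>r. 0 \<le> r \<Longrightarrow> 0 \<le> \<phi> r" and \<phi>_anti: "\<And>r s. 0 \<le> r \<Longrightarrow> r \<le> s \<Longrightarrow> \<phi> s \<le> \<phi> r"
    and \<phi>_int: "set_integrable lborel {0<..} (\<lambda>r. r ^ (DIM('a) - 1) * sqrt (\<phi> r))"
    and mix: "\<And>A B \<zeta> \<xi>. A \<in> sets borel \<Longrightarrow> B \<in> sets borel \<Longrightarrow>
        \<zeta> \<in> borel_measurable (field_sigma M q A) \<Longrightarrow> integrable M (\<lambda>w. (\<zeta> w)\<^sup>2) \<Longrightarrow>
        \<xi> \<in> borel_measurable (field_sigma M q B) \<Longrightarrow> integrable M (\<lambda>w. (\<xi> w)\<^sup>2) \<Longrightarrow>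
        \<bar>LINT w|M. (\<zeta> w - (LINT w'|M. \<zeta> w')) * (\<xi> w - (LINT w'|M. \<xi> w'))\<bar>
          \<le> \<phi> (2 * setdist A B) * sqrt ((LINT w|M. (\<zeta> w)\<^sup>2) * (LINT w|M. (\<xi> w)\<^sup>2))"

lemma stationary_field_exists:
  fixes q :: "'a::euclidean_space \<Rightarrow> 'w \<Rightarrow> real"
  assumes rf: "random_field M q" and h: "H2 M q"
  shows "\<exists>\<phi>. stationary_field M q \<phi>"
proof -
  have six: "\<And>x. integrable M (\<lambda>w. q x w ^ 6)" and sm: "strongly_mixing M q"
    using h unfolding H2_def by blast+
  obtain \<phi> where \<phi>: "\<forall>r\<ge>0. \<phi> r \<ge> 0" "antimono_on {0..} \<phi>"
     "set_integrable lborel {0<..} (\<lambda>r. r ^ (DIM('a) - 1) * sqrt (\<phi> r))"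
     "\<forall>A B \<zeta> \<xi>. A \<in> sets borel \<and> B \<in> sets borel \<and>
        \<zeta> \<in> borel_measurable (field_sigma M q A) \<and> integrable M (\<lambda>w. (\<zeta> w)\<^sup>2) \<and>
        \<xi> \<in> borel_measurable (field_sigma M q B) \<and> integrable M (\<lambda>w. (\<xi> w)\<^sup>2) \<longrightarrow>
        \<bar>LINT w|M. (\<zeta> w - (LINT w'|M. \<zeta> w')) * (\<xi> w - (LINT w'|M. \<xi> w'))\<bar>
          \<le> \<phi> (2 * setdist A B) * sqrt ((LINT w|M. (\<zeta> w)\<^sup>2) * (LINT w|M. (\<xi> w)\<^sup>2))"
    using sm unfolding strongly_mixing_def by blast
  have "prob_space M" using rf by (simp add: random_field_def)
  then have "stationary_field M q \<phi>"
    unfolding stationary_field_def stationary_field_axioms_def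
    using rf six \<phi> by (auto simp: monotone_on_def)
  then show ?thesis by blast
qed

context stationary_field
begin

lemma q_measurable[measurable]: "(\<lambda>(x, w). q x w) \<in> borel_measurable (lborel \<Otimes>\<^sub>M M)"
  using field by (simp add: random_field_def)

lemma q_measurable1[measurable]: "q x \<in> borel_measurable M"
  using measurable_compose[OF measurable_Pair1', of x lborel "\<lambda>(x, w). q x w" M borel] q_measurable
  by simp

definition R :: "'a \<Rightarrow> real" where "R = correlation M q"

lemma R_integrable: "integrable lborel R" using field by (simp add: random_field_def R_def)

lemma R_measurable[measurable]: "R \<in> borel_measurable borel"
  using borel_measurable_integrable[OF R_integrable] by simp

lemma stationary_integral:
  fixes g :: "('a \<Rightarrow> real) \<Rightarrow> real"
  assumes J: "finite J" and g: "g \<in> borel_measurable (\<Pi>\<^sub>M x\<in>J. borel)"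
  shows "(LINT w|M. g (\<lambda>x\<in>J. q (x + h) w)) = (LINT w|M. g (\<lambda>x\<in>J. q x w))"
proof -
  have m: "(\<lambda>w. \<lambda>x\<in>J. q (x + h) w) \<in> measurable M (\<Pi>\<^sub>M x\<in>J. borel)" for h
    by (rule measurable_restrict) simp
  have "(LINT w|M. g (\<lambda>x\<in>J. q (x + h) w)) = (LINT f|distr M (\<Pi>\<^sub>M x\<in>J. borel) (\<lambda>w. \<lambda>x\<in>J. q (x + h) w). g f)"
    by (rule integral_distr[OF m g, symmetric])
  also have "distr M (\<Pi>\<^sub>M x\<in>J. borel) (\<lambda>w. \<lambda>x\<in>J. q (x + h) w) = distr M (\<Pi>\<^sub>M x\<in>J. borel) (\<lambda>w. \<lambda>x\<in>J. q x w)"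
    using field J by (simp add: random_field_def strictly_stationary_def)
  also have "(LINT f|distr M (\<Pi>\<^sub>M x\<in>J. borel) (\<lambda>w. \<lambda>x\<in>J. q x w). g f) = (LINT w|M. g (\<lambda>x\<in>J. q x w))"
    using m[of 0] by (intro integral_distr g) simp
  finally show ?thesis .
qed

lemma six_eq: "(LINT w|M. q x w ^ 6) = (LINT w|M. q 0 w ^ 6)"
  using stationary_integral[of "{0}" "\<lambda>f. f 0 ^ 6" x] by simp

lemma second_moment_eq: "(LINT w|M. q x w * q y w) = R (y - x)"
  using stationary_integral[of "{0, y - x}" "\<lambda>f. f 0 * f (y - x)" x] by (simp add: R_def correlation_def)

text \<open>The summand 1 gives 1 \<le> K, so that K absorbs the additive constants in the moment
  bounds.\<close>

definition K :: real where "K = 1 + (LINT w|M. q 0 w ^ 6)"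

definition qs :: "real \<Rightarrow> 'a \<Rightarrow> 'w \<Rightarrow> real" where "qs ep x w = q (x /\<^sub>R ep) w"
text \<open>The 2 comes from the mixing inequality and the division by \<open>ep\<close> from the
  rescaling, which multiplies distances by 1 / ep.\<close>

definition \<phi>s :: "real \<Rightarrow> real \<Rightarrow> real" where "\<phi>s ep r = \<phi> (2 * r / ep)"

lemma scaled_mixing_field:
  assumes ep: "ep > 0"
  shows "mixing_field M (qs ep) (\<phi>s ep) K"
proof unfold_locales
  show "(\<lambda>(x, w). qs ep x w) \<in> borel_measurable (lborel \<Otimes>\<^sub>M M)" unfolding qs_def by measurable
  show "integrable M (\<lambda>w. qs ep x w ^ 6)" for x unfolding qs_def by (rule six)
  show "(LINT w|M. qs ep x w ^ 6) \<le> K" for x unfolding qs_def six_eq[of "x /\<^sub>R ep"] by (simp add: K_def)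
  show "1 \<le> K" by (simp add: K_def)
  show "(LINT w|M. qs ep x w) = 0" for x using field by (simp add: random_field_def qs_def)
  show "0 \<le> r \<Longrightarrow> 0 \<le> \<phi>s ep r" for r using ep by (simp add: \<phi>s_def \<phi>_nonneg)
  show "0 \<le> r \<Longrightarrow> r \<le> s \<Longrightarrow> \<phi>s ep s \<le> \<phi>s ep r" for r s
    using ep unfolding \<phi>s_def by (intro \<phi>_anti) (auto intro: divide_right_mono)
  fix A B :: "'a set" and \<zeta> \<xi> :: "'w \<Rightarrow> real"
  assume A: "A \<in> sets borel" and B: "B \<in> sets borel" and \<zeta>: "\<zeta> \<in> borel_measurable (field_sigma M (qs ep) A)" "integrable M (\<lambda>w. (\<zeta> w)\<^sup>2)"
    and \<xi>: "\<xi> \<in> borel_measurable (field_sigma M (qs ep) B)" "integrable M (\<lambda>w. (\<xi> w)\<^sup>2)"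
  define S where "S C = (\<lambda>x. x /\<^sub>R ep) ` C" for C :: "'a set"
  have fs: "field_sigma M (qs ep) C = field_sigma M q (S C)" for C
    unfolding field_sigma_def S_def qs_def by (rule arg_cong[where f = "sigma (space M)"]) blast
  have Sb: "S C \<in> sets borel" if "C \<in> sets borel" for C
  proof -
    have "S C = (\<lambda>x. ep *\<^sub>R x) -` C"
      using ep by (force simp: S_def image_iff intro: bexI[of _ "ep *\<^sub>R _"])
    moreover have "(\<lambda>x. ep *\<^sub>R x) -` C \<inter> space borel \<in> sets borel"
      by (rule measurable_sets[OF _ that]) simp
    ultimately show ?thesis by simp
  qed
  have sd: "setdist A B / ep \<le> setdist (S A) (S B)"
  proof (cases "A = {} \<or> B = {}")
    case False
    show ?thesis
    proof (rule le_setdistI)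
      fix x y assume "x \<in> S A" "y \<in> S B"
      then obtain a b where ab: "a \<in> A" "b \<in> B" "x = a /\<^sub>R ep" "y = b /\<^sub>R ep" by (auto simp: S_def)
      have "dist x y = dist a b / ep"
        using ep unfolding ab dist_norm scaleR_diff_right[symmetric] by (simp add: divide_inverse mult.commute)
      then show "setdist A B / ep \<le> dist x y" using setdist_le_dist[OF ab(1,2)] ep by (simp add: divide_right_mono)
    qed (use False in \<open>auto simp: S_def\<close>)
  qed (auto simp: S_def)
  have "\<bar>LINT w|M. (\<zeta> w - (LINT w'|M. \<zeta> w')) * (\<xi> w - (LINT w'|M. \<xi> w'))\<bar>
     \<le> \<phi> (2 * setdist (S A) (S B)) * sqrt ((LINT w|M. (\<zeta> w)\<^sup>2) * (LINT w|M. (\<xi> w)\<^sup>2))"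
    by (rule mix[OF Sb[OF A] Sb[OF B]]) (use \<zeta> \<xi> fs in auto)
  also have "\<dots> \<le> \<phi>s ep (setdist A B) * sqrt ((LINT w|M. (\<zeta> w)\<^sup>2) * (LINT w|M. (\<xi> w)\<^sup>2))"
    unfolding \<phi>s_def using sd ep by (intro mult_right_mono \<phi>_anti) auto
  finally show "\<bar>LINT w|M. (\<zeta> w - (LINT w'|M. \<zeta> w')) * (\<xi> w - (LINT w'|M. \<xi> w'))\<bar>
     \<le> \<phi>s ep (setdist A B) * sqrt ((LINT w|M. (\<zeta> w)\<^sup>2) * (LINT w|M. (\<xi> w)\<^sup>2))" .
qed

lemma scaled_second_moment: "(LINT w|M. qs ep x w * qs ep y w) = R ((y - x) /\<^sub>R ep)"
  unfolding qs_def second_moment_eq by (simp add: scaleR_diff_right)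

lemma R_scaled_nn_integral:
  assumes ep: "ep > 0"
  shows "(\<integral>\<^sup>+y. eabs (R ((y - x) /\<^sub>R ep)) \<partial>lborel) = ennreal (ep ^ DIM('a) * (LINT z|lborel. \<bar>R z\<bar>))"
proof -
  have "(\<integral>\<^sup>+y. eabs (R ((y - x) /\<^sub>R ep)) \<partial>lborel) = ennreal (ep ^ DIM('a)) * (\<integral>\<^sup>+z. eabs (R z) \<partial>lborel)"
    using ep by (subst lborel_nn_integral_affine[OF _ ep, of _ x]) auto
  also have "(\<integral>\<^sup>+z. eabs (R z) \<partial>lborel) = ennreal (LINT z|lborel. \<bar>R z\<bar>)"
    using R_integrable by (intro nn_integral_eq_integral) auto
  finally show ?thesis using ep by (simp add: ennreal_mult)
qed

lemma R_scaled_nn_integral':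
  assumes ep: "ep > 0"
  shows "(\<integral>\<^sup>+y. eabs (R ((x - y) /\<^sub>R ep)) \<partial>lborel) = ennreal (ep ^ DIM('a) * (LINT z|lborel. \<bar>R z\<bar>))"
proof -
  have "R (- z) = R z" for z
    using second_moment_eq[of z 0] second_moment_eq[of 0 z] by (simp add: mult.commute)
  then have "R ((x - y) /\<^sub>R ep) = R ((y - x) /\<^sub>R ep)" for y
    by (metis minus_diff_eq scaleR_minus_right)
  then show ?thesis using R_scaled_nn_integral[OF ep] by simp
qed

text \<open>Schur test for the kernel \<open>R\<close>.\<close>

lemma weighted_integral_variance:
  assumes ep: "ep > 0" and h[measurable]: "h \<in> borel_measurable borel" and hi: "integrable lborel h"
    and h2: "nn_sq lborel h \<le> ennreal C" "0 \<le> C"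
  shows "square_integrable M (\<lambda>w. LINT y|lborel. h y * qs ep y w)"
    and "(LINT w|M. (LINT y|lborel. h y * qs ep y w)\<^sup>2) \<le> C * (ep ^ DIM('a) * (LINT z|lborel. \<bar>R z\<bar>))"
proof -
  interpret mf: mixing_field M "qs ep" "\<phi>s ep" K by (rule scaled_mixing_field[OF ep])
  interpret F: L2_field M lborel "\<lambda>y w. h y * qs ep y w" "\<lambda>y. \<bar>h y\<bar> * sqrt (2 * K)"
    by (rule mf.L2_field_weight[OF h hi])
  let ?I = "ep ^ DIM('a) * (LINT z|lborel. \<bar>R z\<bar>)"
  have I0: "0 \<le> ?I" using ep by simp
  define hf :: real where "hf = 1 / 2"
  have hf: "0 \<le> hf" "hf + hf = 1" by (simp_all add: hf_def)
  show "square_integrable M (\<lambda>w. LINT y|lborel. h y * qs ep y w)" by (rule F.integral_square_integrable)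
  have c: "(LINT w|M. h y * qs ep y w * (h y' * qs ep y' w)) = h y * h y' * R ((y' - y) /\<^sub>R ep)" for y y'
    unfolding scaled_second_moment[symmetric] integral_mult_right_zero[symmetric] by (simp only: mult_ac)
  have "\<bar>LINT y|lborel. LINT y'|lborel. LINT w|M. h y * qs ep y w * (h y' * qs ep y' w)\<bar> \<le> C * ?I"
  proof (rule double_integral_le)
    fix y y'
    \<comment> \<open>The arithmetic-geometric mean splits the form into two halves, each of which
      has one variable occurring in R alone; integrating that variable leaves the L^1 norm of R at
      scale \<open>ep\<close>.\<close>
    have "\<bar>h y * h y'\<bar> \<le> hf * (h y)\<^sup>2 + hf * (h y')\<^sup>2"
      using sum_squares_bound[of "\<bar>h y\<bar>" "\<bar>h y'\<bar>"] by (simp add: abs_mult hf_def)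
    then have "\<bar>h y * h y' * R ((y' - y) /\<^sub>R ep)\<bar> \<le> (hf * (h y)\<^sup>2 + hf * (h y')\<^sup>2) * \<bar>R ((y' - y) /\<^sub>R ep)\<bar>"
      unfolding abs_mult[of "h y * h y'"] by (intro mult_right_mono) auto
    also have "\<dots> = hf * ((h y)\<^sup>2 * \<bar>R ((y' - y) /\<^sub>R ep)\<bar>) + hf * ((h y')\<^sup>2 * \<bar>R ((y' - y) /\<^sub>R ep)\<bar>)"
      by (simp add: algebra_simps)
    finally have "eabs (h y * h y' * R ((y' - y) /\<^sub>R ep)) \<le> ennreal (hf * ((h y)\<^sup>2 * \<bar>R ((y' - y) /\<^sub>R ep)\<bar>) + hf * ((h y')\<^sup>2 * \<bar>R ((y' - y) /\<^sub>R ep)\<bar>))"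
      by (rule ennreal_leI)
    also have "\<dots> = ennreal hf * (ennreal ((h y)\<^sup>2) * eabs (R ((y' - y) /\<^sub>R ep))) + ennreal hf * (ennreal ((h y')\<^sup>2) * eabs (R ((y' - y) /\<^sub>R ep)))"
      by (simp only: ennreal_plus ennreal_mult' mult_nonneg_nonneg zero_le_power2 abs_ge_zero hf)
    finally show "eabs (LINT w|M. h y * qs ep y w * (h y' * qs ep y' w)) \<le> \<dots>" unfolding c .
  next
    have "(\<integral>\<^sup>+y. \<integral>\<^sup>+y'. ennreal hf * (ennreal ((h y)\<^sup>2) * eabs (R ((y' - y) /\<^sub>R ep))) + ennreal hf * (ennreal ((h y')\<^sup>2) * eabs (R ((y' - y) /\<^sub>R ep))) \<partial>lborel \<partial>lborel)
      = (\<integral>\<^sup>+y. ennreal hf * (ennreal ((h y)\<^sup>2) * ennreal ?I) \<partial>lborel) + (\<integral>\<^sup>+y. \<integral>\<^sup>+y'. ennreal hf * (ennreal ((h y')\<^sup>2) * eabs (R ((y' - y) /\<^sub>R ep))) \<partial>lborel \<partial>lborel)"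
      using R_scaled_nn_integral[OF ep] by (simp add: nn_integral_add nn_integral_cmult)
    also have "(\<integral>\<^sup>+y. \<integral>\<^sup>+y'. ennreal hf * (ennreal ((h y')\<^sup>2) * eabs (R ((y' - y) /\<^sub>R ep))) \<partial>lborel \<partial>lborel)
       = (\<integral>\<^sup>+y'. \<integral>\<^sup>+y. ennreal hf * (ennreal ((h y')\<^sup>2) * eabs (R ((y' - y) /\<^sub>R ep))) \<partial>lborel \<partial>lborel)"
      by (rule lborel_pair.Fubini') measurable
    also have "\<dots> = (\<integral>\<^sup>+y. ennreal hf * (ennreal ((h y)\<^sup>2) * ennreal ?I) \<partial>lborel)"
      using R_scaled_nn_integral'[OF ep] by (simp add: nn_integral_cmult)
    also have "(\<integral>\<^sup>+y. ennreal hf * (ennreal ((h y)\<^sup>2) * ennreal ?I) \<partial>lborel) = ennreal hf * nn_sq lborel h * ennreal ?I"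
      by (simp add: nn_integral_cmult nn_integral_multc mult.assoc)
    also have "\<dots> + \<dots> \<le> ennreal hf * ennreal C * ennreal ?I + ennreal hf * ennreal C * ennreal ?I"
      using h2 by (intro add_mono mult_right_mono mult_left_mono) auto
    also have "\<dots> = ennreal (C * ?I)"
    proof -
      have "hf * C * ?I + hf * C * ?I = (hf + hf) * (C * ?I)" by (simp add: algebra_simps)
      then show ?thesis
        using h2(2) I0 hf by (simp add: ennreal_mult[symmetric] ennreal_plus[symmetric] del: ennreal_plus)
    qed
    finally show "(\<integral>\<^sup>+y. \<integral>\<^sup>+y'. ennreal hf * (ennreal ((h y)\<^sup>2) * eabs (R ((y' - y) /\<^sub>R ep))) + ennreal hf * (ennreal ((h y')\<^sup>2) * eabs (R ((y' - y) /\<^sub>R ep))) \<partial>lborel \<partial>lborel) \<le> ennreal (C * ?I)" .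
    show "0 \<le> C * ?I" using h2(2) I0 by simp
  qed
  then show "(LINT w|M. (LINT y|lborel. h y * qs ep y w)\<^sup>2) \<le> C * ?I"
    unfolding F.integral_square_eq by linarith
qed

text \<open>Dominated convergence with majorant B^2 times the indicator of D times |R|. The
  unshifted factor confines the first point to D, so continuity of k at points of D is enough,
  whatever its jump at the boundary.\<close>

lemma autocorrelation_tendsto:
  fixes k :: "'a \<Rightarrow> real" and \<eta> :: "real \<Rightarrow> 'a \<Rightarrow> real" and e :: "real \<Rightarrow> real"
  assumes k[measurable]: "k \<in> borel_measurable borel" and B: "\<And>x. \<bar>k x\<bar> \<le> B * indicator D x" and D: "D \<in> finite_borel"
    and cont: "\<And>x. x \<in> D \<Longrightarrow> isCont k x"
    and \<eta>[measurable]: "\<And>t. \<eta> t \<in> borel_measurable borel" and \<eta>1: "\<And>t z. \<bar>\<eta> t z\<bar> \<le> 1" and \<eta>l: "\<And>z. ((\<lambda>t. \<eta> t z) \<longlongrightarrow> 1) at_top"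
    and e: "(e \<longlongrightarrow> 0) at_top"
  shows "((\<lambda>t. LINT s|lborel2. k (fst s) * k (fst s + e t *\<^sub>R snd s) * \<eta> t (snd s) * R (snd s)) \<longlongrightarrow> (LINT y|lborel. (k y)\<^sup>2) * (LINT z|lborel. R z)) at_top"
proof -
  have [measurable]: "D \<in> sets borel" using D by (simp add: finite_borel_def)
  have B0: "\<bar>k x\<bar> \<le> \<bar>B\<bar>" for x using B[of x] by (cases "x \<in> D") auto
  have iD: "integrable lborel (\<lambda>x. \<bar>B\<bar> * \<bar>B\<bar> * indicator D x :: real)"
    using D by (intro integrable_mult_right integrable_real_indicator) (auto simp: finite_borel_def)
  have w: "integrable lborel2 (\<lambda>s. (\<bar>B\<bar> * \<bar>B\<bar> * indicator D (fst s)) * \<bar>R (snd s)\<bar>)"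
    by (rule lborel_pair.Fubini_integrable) (use iD R_integrable in \<open>auto simp: abs_mult\<close>)
  have kk: "integrable lborel (\<lambda>y. (k y)\<^sup>2)"
  proof (rule Bochner_Integration.integrable_bound[OF iD _ AE_I2])
    fix x
    have "\<bar>k x\<bar> * \<bar>k x\<bar> \<le> \<bar>B\<bar> * \<bar>B\<bar>" using B0 by (intro mult_mono) auto
    then show "norm ((k x)\<^sup>2) \<le> norm (\<bar>B\<bar> * \<bar>B\<bar> * indicator D x)"
      using B[of x] by (cases "x \<in> D") (auto simp: power2_eq_square abs_mult)
  qed measurable
  have lim: "((\<lambda>t. LINT s|lborel2. k (fst s) * k (fst s + e t *\<^sub>R snd s) * \<eta> t (snd s) * R (snd s)) \<longlongrightarrow> (LINT s|lborel2. (k (fst s))\<^sup>2 * R (snd s))) at_top"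
  proof (rule integral_dominated_convergence_at_top[OF _ _ w])
    show "AE s in lborel2. ((\<lambda>t. k (fst s) * k (fst s + e t *\<^sub>R snd s) * \<eta> t (snd s) * R (snd s)) \<longlongrightarrow> (k (fst s))\<^sup>2 * R (snd s)) at_top"
    proof (rule AE_I2)
      fix s :: "'a \<times> 'a"
      show "((\<lambda>t. k (fst s) * k (fst s + e t *\<^sub>R snd s) * \<eta> t (snd s) * R (snd s)) \<longlongrightarrow> (k (fst s))\<^sup>2 * R (snd s)) at_top"
      proof (cases "fst s \<in> D")
        case False
        then have "k (fst s) = 0" using B[of "fst s"] by simp
        then show ?thesis by simp
      next
        case True
        have "((\<lambda>t. fst s + e t *\<^sub>R snd s) \<longlongrightarrow> fst s + 0 *\<^sub>R snd s) at_top" by (intro tendsto_intros e)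
        then have "((\<lambda>t. k (fst s + e t *\<^sub>R snd s)) \<longlongrightarrow> k (fst s)) at_top"
          using isCont_tendsto_compose[OF cont[OF True]] by simp
        then have "((\<lambda>t. k (fst s) * k (fst s + e t *\<^sub>R snd s) * \<eta> t (snd s) * R (snd s)) \<longlongrightarrow> k (fst s) * k (fst s) * 1 * R (snd s)) at_top"
          by (intro tendsto_intros \<eta>l)
        then show ?thesis by (simp add: power2_eq_square)
      qed
    qed
    show "\<forall>\<^sub>F t in at_top. AE s in lborel2. norm (k (fst s) * k (fst s + e t *\<^sub>R snd s) * \<eta> t (snd s) * R (snd s)) \<le> \<bar>B\<bar> * \<bar>B\<bar> * indicator D (fst s) * \<bar>R (snd s)\<bar>"
    proof (intro always_eventually allI AE_I2)
      fix t and s :: "'a \<times> 'a"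
      have "\<bar>k (fst s)\<bar> \<le> \<bar>B\<bar> * indicator D (fst s)"
        using B[of "fst s"] by (auto simp: indicator_def split: if_splits)
      then have "\<bar>k (fst s)\<bar> * \<bar>k (fst s + e t *\<^sub>R snd s)\<bar> * \<bar>\<eta> t (snd s)\<bar> * \<bar>R (snd s)\<bar> \<le> (\<bar>B\<bar> * indicator D (fst s)) * \<bar>B\<bar> * 1 * \<bar>R (snd s)\<bar>"
        using B0 \<eta>1 by (intro mult_mono) auto
      then show "norm (k (fst s) * k (fst s + e t *\<^sub>R snd s) * \<eta> t (snd s) * R (snd s)) \<le> \<bar>B\<bar> * \<bar>B\<bar> * indicator D (fst s) * \<bar>R (snd s)\<bar>"
        by (simp only: real_norm_def abs_mult mult_ac)
    qed
  qed measurable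
  have "integrable lborel2 (\<lambda>s. (k (fst s))\<^sup>2 * R (snd s))"
    by (rule lborel_pair.Fubini_integrable) (use kk R_integrable in \<open>auto simp: abs_mult\<close>)
  from lborel_pair.integral_fst'[OF this] have "(LINT s|lborel2. (k (fst s))\<^sup>2 * R (snd s)) = (LINT y|lborel. (k y)\<^sup>2) * (LINT z|lborel. R z)"
    by simp
  with lim show ?thesis by simp
qed

definition \<sigma>2 :: real where "\<sigma>2 = (LINT z|lborel. R z)"

text \<open>Substitution p = y + ep z; afterwards the correlation no longer depends on
  \<open>ep\<close> and can serve as a fixed integrable weight.\<close>

lemma autocorrelation_change:
  fixes k \<eta> :: "'a \<Rightarrow> real"
  assumes [measurable]: "k \<in> borel_measurable borel" "\<eta> \<in> borel_measurable borel" and B: "\<And>x. \<bar>k x\<bar> \<le> B * indicator D x" and D: "D \<in> finite_borel"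
    and \<eta>1: "\<And>z. \<bar>\<eta> z\<bar> \<le> 1" and ep: "ep > 0"
  shows "(LINT y|lborel. LINT p|lborel. k y * k p * \<eta> ((p - y) /\<^sub>R ep) * R ((p - y) /\<^sub>R ep)) =
     ep ^ DIM('a) * (LINT s|lborel2. k (fst s) * k (fst s + ep *\<^sub>R snd s) * \<eta> (snd s) * R (snd s))"
proof -
  have [measurable]: "D \<in> sets borel" using D by (simp add: finite_borel_def)
  have B0: "\<bar>k x\<bar> \<le> \<bar>B\<bar>" for x using B[of x] by (cases "x \<in> D") auto
  have iD: "integrable lborel (\<lambda>x. \<bar>B\<bar> * \<bar>B\<bar> * indicator D x :: real)"
    using D by (intro integrable_mult_right integrable_real_indicator) (auto simp: finite_borel_def)
  have w: "integrable lborel2 (\<lambda>s. (\<bar>B\<bar> * \<bar>B\<bar> * indicator D (fst s)) * \<bar>R (snd s)\<bar>)"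
    by (rule lborel_pair.Fubini_integrable) (use iD R_integrable in \<open>auto simp: abs_mult\<close>)
  have i: "integrable lborel2 (\<lambda>s. k (fst s) * k (fst s + ep *\<^sub>R snd s) * \<eta> (snd s) * R (snd s))"
  proof (rule Bochner_Integration.integrable_bound[OF w _ AE_I2])
    fix s :: "'a \<times> 'a"
    have "\<bar>k (fst s)\<bar> \<le> \<bar>B\<bar> * indicator D (fst s)"
      using B[of "fst s"] by (auto simp: indicator_def split: if_splits)
    then have "\<bar>k (fst s)\<bar> * \<bar>k (fst s + ep *\<^sub>R snd s)\<bar> * \<bar>\<eta> (snd s)\<bar> * \<bar>R (snd s)\<bar> \<le> (\<bar>B\<bar> * indicator D (fst s)) * \<bar>B\<bar> * 1 * \<bar>R (snd s)\<bar>"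
      using B0 \<eta>1 by (intro mult_mono) auto
    then show "norm (k (fst s) * k (fst s + ep *\<^sub>R snd s) * \<eta> (snd s) * R (snd s)) \<le> norm (\<bar>B\<bar> * \<bar>B\<bar> * indicator D (fst s) * \<bar>R (snd s)\<bar>)"
      by (simp add: abs_mult mult_ac)
  qed measurable
  have "(LINT p|lborel. k y * k p * \<eta> ((p - y) /\<^sub>R ep) * R ((p - y) /\<^sub>R ep)) = ep ^ DIM('a) * (LINT z|lborel. k y * k (y + ep *\<^sub>R z) * \<eta> z * R z)" for y
    using ep by (subst lborel_integral_affine[OF _ ep, of _ y]) auto
  then have "(LINT y|lborel. LINT p|lborel. k y * k p * \<eta> ((p - y) /\<^sub>R ep) * R ((p - y) /\<^sub>R ep)) = ep ^ DIM('a) * (LINT y|lborel. LINT z|lborel. k y * k (y + ep *\<^sub>R z) * \<eta> z * R z)"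
    by simp
  also have "(LINT y|lborel. LINT z|lborel. k y * k (y + ep *\<^sub>R z) * \<eta> z * R z) = (LINT s|lborel2. k (fst s) * k (fst s + ep *\<^sub>R snd s) * \<eta> (snd s) * R (snd s))"
    using lborel_pair.integral_fst'[OF i] by simp
  finally show ?thesis .
qed

text \<open>Up to the positive factor vol(ball), \<sigma>^2 is the limit of ep^(-d) times the
  variance of the integral of the rescaled field over the unit ball.\<close>

lemma \<sigma>2_nonneg: "0 \<le> \<sigma>2"
proof -
  define k :: "'a \<Rightarrow> real" where "k = indicator (ball 0 1)"
  have [measurable]: "k \<in> borel_measurable borel" unfolding k_def by (rule borel_measurable_indicator) simp
  have D: "ball 0 1 \<in> (finite_borel :: 'a set set)" by (simp add: finite_borel_def emeasure_ball)
  have kB: "\<bar>k x\<bar> \<le> 1 * indicator (ball 0 1) x" for x by (simp add: k_def)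
  have cont: "isCont k x" if "x \<in> ball 0 1" for x
  proof -
    have "\<forall>\<^sub>F y in nhds x. k y = 1"
      using eventually_nhds_in_open[OF open_ball that] by eventually_elim (simp add: k_def)
    then show ?thesis by (subst isCont_cong[where g = "\<lambda>_. 1"]) auto
  qed
  have lim: "((\<lambda>t. LINT s|lborel2. k (fst s) * k (fst s + (1 / t) *\<^sub>R snd s) * 1 * R (snd s)) \<longlongrightarrow> (LINT y|lborel. (k y)\<^sup>2) * (LINT z|lborel. R z)) at_top"
    by (rule autocorrelation_tendsto[where \<eta> = "\<lambda>_ _. 1", OF _ kB D cont]) (auto, real_asymp)
  have "0 \<le> (LINT s|lborel2. k (fst s) * k (fst s + (1 / t) *\<^sub>R snd s) * 1 * R (snd s))" if t: "t > 0" for t :: real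
  proof -
    let ?e = "1 / t"
    have e: "?e > 0" using t by simp
    interpret mf: mixing_field M "qs ?e" "\<phi>s ?e" K by (rule scaled_mixing_field[OF e])
    have ki: "integrable lborel k" unfolding k_def by (intro integrable_real_indicator) (auto simp: emeasure_ball)
    interpret F: L2_field M lborel "\<lambda>y w. k y * qs ?e y w" "\<lambda>y. \<bar>k y\<bar> * sqrt (2 * K)"
      by (rule mf.L2_field_weight[OF _ ki]) measurable
    have c: "(LINT w|M. k y * qs ?e y w * (k y' * qs ?e y' w)) = k y * k y' * 1 * R ((y' - y) /\<^sub>R ?e)" for y y'
      unfolding mult_1_right scaled_second_moment[symmetric] integral_mult_right_zero[symmetric] by (simp only: mult_ac)
    have "0 \<le> (LINT w|M. (LINT y|lborel. k y * qs ?e y w)\<^sup>2)" by simp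
    also have "\<dots> = ?e ^ DIM('a) * (LINT s|lborel2. k (fst s) * k (fst s + ?e *\<^sub>R snd s) * 1 * R (snd s))"
      unfolding F.integral_square_eq c by (rule autocorrelation_change[where \<eta> = "\<lambda>_. 1", OF _ _ kB D _ e]) auto
    finally show ?thesis
      using e by (intro mult_le_cancel_left_pos[THEN iffD1, of "?e ^ DIM('a)" 0]) (simp_all del: mult_1_right)
  qed
  note nn = this
  have "\<forall>\<^sub>F t in at_top. 0 \<le> (LINT s|lborel2. k (fst s) * k (fst s + (1 / t) *\<^sub>R snd s) * 1 * R (snd s))"
    using eventually_gt_at_top[of 0] by eventually_elim (rule nn)
  then have "0 \<le> (LINT y|lborel. (k y)\<^sup>2) * (LINT z|lborel. R z)"
    by (rule tendsto_lowerbound[OF lim]) simp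
  moreover have "(LINT y|lborel. (k y)\<^sup>2) > 0"
  proof -
    have "(\<lambda>y. (k y)\<^sup>2) = indicator (ball 0 1)" by (auto simp: k_def indicator_def)
    then show ?thesis by simp
  qed
  ultimately show ?thesis by (simp add: \<sigma>2_def zero_le_mult_iff)
qed

text \<open>Here \<open>ep = t\<^sup>-\<^sup>8\<close>, so that the radius \<open>r = t\<^sup>-\<^sup>6\<close> and the length \<open>s = t\<^sup>-\<^sup>7\<close> in the normal approximation,
  both between \<open>ep\<close> and \<open>1\<close>, are powers with integer exponents.\<close>

lemma normal_limit_rescaled:
  fixes k0 :: "'a \<Rightarrow> real"
  assumes k[measurable]: "k0 \<in> borel_measurable borel" and B: "\<And>x. \<bar>k0 x\<bar> \<le> B * indicator D x" and D: "D \<in> finite_borel"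
    and cont: "\<And>x. x \<in> D \<Longrightarrow> isCont k0 x" and B0: "0 \<le> B"
  shows "((\<lambda>t. CLINT w|M. iexp (LINT y|lborel. ((t ^ DIM('a)) ^ 4 * k0 y) * qs (1 / t ^ 8) y w))
     \<longlongrightarrow> of_real (exp (- (\<sigma>2 * (LINT y|lborel. (k0 y)\<^sup>2) / 2)))) at_top"
proof -
  define d where "d = DIM('a)"
  have d1: "1 \<le> d" using DIM_positive[where 'a = 'a] by (simp add: d_def)
  define c where "c = unit_ball_vol (real DIM('a))"
  define vD where "vD = measure lborel D"
  define V where "V = \<sigma>2 * (LINT y|lborel. (k0 y)\<^sup>2)"
  have V0: "0 \<le> V" using \<sigma>2_nonneg by (simp add: V_def)
  \<comment> \<open>In the scaled variable z = (p - y) / ep the ball of radius r = t^(-6) has radius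
    t^2, which tends to infinity; thus the truncated covariance recovers all of R in the
    limit.\<close>
  define \<eta> where "\<eta> t z = (if norm z < t ^ 2 then 1 else 0 :: real)" for t :: real and z :: 'a
  define A where "A t = (LINT s|lborel2. k0 (fst s) * k0 (fst s + (1 / t ^ 8) *\<^sub>R snd s) * \<eta> t (snd s) * R (snd s))" for t
  have \<eta>m[measurable]: "\<eta> t \<in> borel_measurable borel" for t unfolding \<eta>_def[abs_def] by measurable
  have Alim: "(A \<longlongrightarrow> V) at_top"
    unfolding A_def V_def \<sigma>2_def mult.commute[of "integral\<^sup>L lborel R"]
  proof (rule autocorrelation_tendsto[OF k B D cont])
    show "((\<lambda>t. \<eta> t z) \<longlongrightarrow> 1) at_top" for z
    proof (rule tendsto_eventually)
      have "filterlim (\<lambda>t::real. t ^ 2) at_top at_top" by real_asymp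
      then have "\<forall>\<^sub>F t in at_top. norm z < t ^ 2" by (auto simp: filterlim_at_top_dense)
      then show "\<forall>\<^sub>F t in at_top. \<eta> t z = 1" by eventually_elim (simp add: \<eta>_def)
    qed
    show "((\<lambda>t::real. 1 / t ^ 8) \<longlongrightarrow> 0) at_top" by real_asymp
  qed (auto simp: \<eta>_def)
  \<comment> \<open>With T = t^d the weight is of size T^4, and the volumes of the balls of radius r
    and s are multiples of T^(-6) and T^(-7). In the second summand T^12 cancels two volumes T^(-6),
    leaving \<phi>(t) away from the diagonal and 1 / T near it.\<close>
  define E1 where "E1 t = B * vD * (4 * K * ((t ^ d) ^ 4 * \<phi> (2 * t\<^sup>2)))
     + B * vD * (3 / 2 * (B\<^sup>2 * (4 * K) * (c * (c * \<phi> t + c * (1 / t) ^ d * \<phi> 0))))" for t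
  \<comment> \<open>Here T^16 meets two volumes T^(-6): a factor T^4 remains with \<phi>(4 t^2), and
    the further volume of radius 4 r turns T^4 into T^(-2) near the diagonal.\<close>
  define E2 where "E2 t = B ^ 4 * (2 * K) * (vD * c * (c * (vD * ((t ^ d) ^ 4 * \<phi> (4 * t\<^sup>2)) + c * 4 ^ d * ((1 / t) ^ d)\<^sup>2 * \<phi> 0)))" for t
  have decay: "((\<lambda>l. l ^ (2 * d) * \<phi> l) \<longlongrightarrow> 0) at_top"
    by (rule mixing_rate_decay[OF \<phi>_nonneg \<phi>_anti _ d1]) (use \<phi>_int in \<open>auto simp: d_def\<close>)
  \<comment> \<open>T^4 = (t^2)^(2 d), exactly the power that \<open>mixing_rate_decay\<close>
    controls at an argument proportional to t^2. This fixes the ratio r / ep = t^2.\<close>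
  have decay': "((\<lambda>t. (t ^ d) ^ 4 * \<phi> (b * t\<^sup>2)) \<longlongrightarrow> 0) at_top" if b: "b > 0" for b :: real
  proof -
    have "filterlim (\<lambda>t::real. b * t\<^sup>2) at_top at_top" using b by real_asymp
    from filterlim_compose[OF decay this] have "((\<lambda>t. (1 / b ^ (2 * d)) * ((b * t\<^sup>2) ^ (2 * d) * \<phi> (b * t\<^sup>2))) \<longlongrightarrow> (1 / b ^ (2 * d)) * 0) at_top"
      by (intro tendsto_intros)
    moreover have "(1 / b ^ (2 * d)) * ((b * t\<^sup>2) ^ (2 * d) * \<phi> (b * t\<^sup>2)) = (t ^ d) ^ 4 * \<phi> (b * t\<^sup>2)" for t
    proof -
      have "(t\<^sup>2) ^ (2 * d) = (t ^ d) ^ 4" by (simp add: power_mult[symmetric] mult.commute)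
      then show ?thesis using b by (simp add: power_mult_distrib)
    qed
    ultimately show ?thesis by simp
  qed
  have \<phi>0: "(\<phi> \<longlongrightarrow> 0) at_top"
  proof (rule Lim_null_comparison[OF _ decay])
    show "\<forall>\<^sub>F t in at_top. norm (\<phi> t) \<le> t ^ (2 * d) * \<phi> t"
      using eventually_ge_at_top[of 1]
    proof eventually_elim
      case (elim t)
      have "1 * \<phi> t \<le> t ^ (2 * d) * \<phi> t" using elim \<phi>_nonneg[of t] by (intro mult_right_mono one_le_power) auto
      then show ?case using elim \<phi>_nonneg[of t] by simp
    qed
  qed
  have tinv: "((\<lambda>t::real. (1 / t) ^ d) \<longlongrightarrow> 0) at_top"
  proof -
    have "((\<lambda>t::real. (1 / t) ^ d) \<longlongrightarrow> 0 ^ d) at_top" by (intro tendsto_power) real_asymp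
    then show ?thesis using d1 by (simp add: power_0_left)
  qed
  have "(E1 \<longlongrightarrow> B * vD * (4 * K * 0) + B * vD * (3 / 2 * (B\<^sup>2 * (4 * K) * (c * (c * 0 + c * 0 * \<phi> 0))))) at_top"
    unfolding E1_def by (intro tendsto_intros decay' \<phi>0 tinv) simp
  then have E1: "(E1 \<longlongrightarrow> 0) at_top" by simp
  have "(E2 \<longlongrightarrow> B ^ 4 * (2 * K) * (vD * c * (c * (vD * 0 + c * 4 ^ d * 0\<^sup>2 * \<phi> 0)))) at_top"
    unfolding E2_def by (intro tendsto_intros decay' tinv) simp
  then have E2: "(E2 \<longlongrightarrow> 0) at_top" by simp
  have "((\<lambda>t. E1 t + sqrt (E2 t) + \<bar>A t - V\<bar>) \<longlongrightarrow> 0 + sqrt 0 + \<bar>V - V\<bar>) at_top"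
    by (intro tendsto_intros E1 E2 Alim)
  then have Elim: "((\<lambda>t. E1 t + sqrt (E2 t) + \<bar>A t - V\<bar>) \<longlongrightarrow> 0) at_top" by simp
  have main: "cmod ((CLINT w|M. iexp (LINT y|lborel. ((t ^ DIM('a)) ^ 4 * k0 y) * qs (1 / t ^ 8) y w)) - of_real (exp (- (V / 2)))) \<le> E1 t + sqrt (E2 t) + \<bar>A t - V\<bar>"
    if t: "t > 0" for t
  proof -
    define ep where "ep = 1 / t ^ 8"
    define T where "T = t ^ d"
    have ep: "ep > 0" and T: "T > 0" using t by (auto simp: ep_def T_def)
    interpret mf: mixing_field M "qs ep" "\<phi>s ep" K by (rule scaled_mixing_field[OF ep])
    define k where "k y = T ^ 4 * k0 y" for y
    have kB: "\<bar>k x\<bar> \<le> T ^ 4 * B * indicator D x" for x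
      using B[of x] T by (simp add: k_def abs_mult mult.assoc)
    interpret ff: field_functional M "qs ep" "\<phi>s ep" K k D "T ^ 4 * B" "1 / t ^ 6"
    proof unfold_locales
      show "k \<in> borel_measurable borel" unfolding k_def[abs_def] by measurable
      show "\<bar>k x\<bar> \<le> T ^ 4 * B" for x using kB[of x] T B0 by (cases "x \<in> D") auto
      show "x \<notin> D \<Longrightarrow> k x = 0" for x using kB[of x] by simp
      show "D \<in> finite_borel" by (rule D)
    qed (use t in auto)
    have s: "0 < 1 / t ^ 7" using t by simp
    have pw: "(1 / t ^ n) ^ d = 1 / T ^ n" for n
      by (simp add: T_def power_divide power_mult[symmetric] mult.commute)
    have vol: "ff.vol (1 / t ^ n) = c / T ^ n" for n
      unfolding ff.vol_def c_def d_def[symmetric] pw by simp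
    have vol4: "ff.vol (4 * (1 / t ^ 6)) = c * 4 ^ d / T ^ 6"
      unfolding ff.vol_def c_def d_def[symmetric] power_mult_distrib pw by simp
    have volD: "ff.volD = vD" by (simp add: ff.volD_def vD_def)
    have phis: "\<phi>s ep (1 / t ^ 6) = \<phi> (2 * t\<^sup>2)" "\<phi>s ep (2 * (1 / t ^ 6)) = \<phi> (4 * t\<^sup>2)" "\<phi>s ep (1 / t ^ 7 / 2) = \<phi> t" "\<phi>s ep 0 = \<phi> 0"
    proof -
      have t8: "t ^ 8 = t * t ^ 7" by (simp add: power_Suc[symmetric] del: power_Suc)
      have "2 * (1 / t ^ 6) / ep = 2 * t\<^sup>2" "2 * (2 * (1 / t ^ 6)) / ep = 4 * t\<^sup>2"
      proof -
        have "t ^ 8 / t ^ 6 = t\<^sup>2" using power_diff[of t 6 8] t by simp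
        moreover have "2 * (1 / t ^ 6) / ep = 2 * (t ^ 8 / t ^ 6)" "2 * (2 * (1 / t ^ 6)) / ep = 4 * (t ^ 8 / t ^ 6)"
          by (simp_all add: ep_def)
        ultimately show "2 * (1 / t ^ 6) / ep = 2 * t\<^sup>2" "2 * (2 * (1 / t ^ 6)) / ep = 4 * t\<^sup>2" by simp_all
      qed
      moreover have "2 * (1 / t ^ 7 / 2) / ep = t" "2 * 0 / ep = 0"
        unfolding ep_def t8 using t by simp_all
      ultimately show "\<phi>s ep (1 / t ^ 6) = \<phi> (2 * t\<^sup>2)" "\<phi>s ep (2 * (1 / t ^ 6)) = \<phi> (4 * t\<^sup>2)" "\<phi>s ep (1 / t ^ 7 / 2) = \<phi> t" "\<phi>s ep 0 = \<phi> 0"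
        unfolding \<phi>s_def by (simp_all only:)
    qed
    have b1: "ff.b1 (1 / t ^ 7) = (T ^ 4 * B)\<^sup>2 * (4 * K) * (c / T ^ 6 * (c / T ^ 6 * \<phi> t + c / T ^ 7 * \<phi> 0))"
      unfolding ff.b1_def vol phis ..
    have T1: "(1 / t) ^ d = 1 / T" by (simp add: T_def power_divide)
    have "T ^ 4 * B * vD * (4 * K * \<phi> (2 * t\<^sup>2) + 3 / 2 * ((T ^ 4 * B)\<^sup>2 * (4 * K) * (c / T ^ 6 * (c / T ^ 6 * \<phi> t + c / T ^ 7 * \<phi> 0)))) = E1 t"
    proof -
      have "T ^ 4 * (T ^ 4 * T ^ 4 * (c / T ^ 6 * (c / T ^ 6 * \<phi> t + c / T ^ 7 * \<phi> 0))) = c * (c * \<phi> t + c * (1 / T) * \<phi> 0)"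
        using T by (simp add: field_simps power_add[symmetric]) (simp add: power_Suc[symmetric] power_add[symmetric] algebra_simps eval_nat_numeral)
      note x = this
      have "T ^ 4 * B * vD * (4 * K * \<phi> (2 * t\<^sup>2) + 3 / 2 * ((T ^ 4 * B)\<^sup>2 * (4 * K) * (c / T ^ 6 * (c / T ^ 6 * \<phi> t + c / T ^ 7 * \<phi> 0))))
        = B * vD * (4 * K * (T ^ 4 * \<phi> (2 * t\<^sup>2))) + B * vD * (3 / 2 * (B\<^sup>2 * (4 * K) * (T ^ 4 * (T ^ 4 * T ^ 4 * (c / T ^ 6 * (c / T ^ 6 * \<phi> t + c / T ^ 7 * \<phi> 0))))))"
        by (simp only: power2_eq_square distrib_left mult_ac)
      then show ?thesis unfolding x by (simp add: E1_def T1 T_def[symmetric])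
    qed
    then have e1: "T ^ 4 * B * ff.volD * (4 * K * \<phi>s ep (1 / t ^ 6) + 3 / 2 * ff.b1 (1 / t ^ 7)) = E1 t"
      unfolding b1 phis volD .
    have e2: "ff.b2 = E2 t"
    proof -
      define u where "u = 1 / T ^ 6"
      have ring: "(x * B) ^ 4 * (2 * K) * (vD * (c * u) * (c * u * (vD * p + c * f * u * p0)))
        = B ^ 4 * (2 * K) * (vD * c * (c * (vD * ((x ^ 4 * u * u) * p) + c * f * ((x ^ 4 * u * u) * u) * p0)))" for p f p0 x :: real
        by (simp add: power_mult_distrib algebra_simps)
      have Y: "(T ^ 4) ^ 4 * u * u = T ^ 4"
      proof -
        have "(T ^ 4) ^ 4 * u * u = T ^ 4 * (T ^ 6 * u) * (T ^ 6 * u)" by (simp add: power_mult[symmetric] power_add[symmetric] mult_ac)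
        then show ?thesis using T by (simp add: u_def)
      qed
      have Yu: "T ^ 4 * u = (1 / T)\<^sup>2"
        using T by (simp add: u_def field_simps power_add[symmetric])
      have "ff.b2 = (T ^ 4 * B) ^ 4 * (2 * K) * (vD * (c * u) * (c * u * (vD * \<phi> (4 * t\<^sup>2) + c * 4 ^ d * u * \<phi> 0)))"
        unfolding ff.b2_def volD vol vol4 phis by (simp add: u_def)
      then show ?thesis unfolding ring Y Yu by (simp add: E2_def T1 T_def[symmetric])
    qed
    have ez: "ff.EZ = A t"
    proof -
      \<comment> \<open>The two weights contribute T^8, which the Jacobian ep^d = T^(-8) cancels
        below; so the mean of the random variance is the truncated autocorrelation at scale
        one.\<close>
      have nr: "k y * ff.near y p = T ^ 8 * (k0 y * k0 p * \<eta> t ((p - y) /\<^sub>R ep))" for y p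
      proof -
        have "(dist y p < 1 / t ^ 6) = (norm ((p - y) /\<^sub>R ep) < t\<^sup>2)"
        proof -
          have n: "norm ((p - y) /\<^sub>R ep) = dist y p * t ^ 6 * t\<^sup>2"
            using t by (simp add: ep_def dist_norm norm_minus_commute power_add[symmetric])
          have "(dist y p < 1 / t ^ 6) = (dist y p * t ^ 6 < 1)" using t by (intro pos_less_divide_eq) simp
          also have "\<dots> = (dist y p * t ^ 6 * t\<^sup>2 < 1 * t\<^sup>2)" using t by (intro mult_less_cancel_right_pos[symmetric]) simp
          finally show ?thesis unfolding n by simp
        qed
        moreover have "T ^ 4 * T ^ 4 = T ^ 8" by (simp add: power_add[symmetric])
        ultimately show ?thesis by (simp add: ff.near_def \<eta>_def k_def)
      qed
      have q2: "(LINT w|M. ff.q2 s w) = R ((snd s - fst s) /\<^sub>R ep)" for s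
        by (simp add: ff.q2_def scaled_second_moment)
      have "ff.EZ = (LINT y|lborel. LINT p|lborel. k y * ff.near y p * R ((p - y) /\<^sub>R ep))"
        unfolding ff.EZ_def using lborel_pair.integral_fst'[OF ff.EZ_integrable]
        by (simp add: ff.\<kappa>_def q2)
      also have "\<dots> = (LINT y|lborel. LINT p|lborel. T ^ 8 * (k0 y * k0 p * \<eta> t ((p - y) /\<^sub>R ep) * R ((p - y) /\<^sub>R ep)))"
        unfolding nr by (simp only: mult.assoc)
      also have "\<dots> = T ^ 8 * (LINT y|lborel. LINT p|lborel. k0 y * k0 p * \<eta> t ((p - y) /\<^sub>R ep) * R ((p - y) /\<^sub>R ep))"
        by (simp only: integral_mult_right_zero)
      also have "\<dots> = T ^ 8 * (ep ^ d * A t)"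
        unfolding A_def ep_def[symmetric] d_def
        by (subst autocorrelation_change[OF k \<eta>m B D _ ep]) (auto simp: \<eta>_def)
      also have "\<dots> = A t" using T by (simp add: ep_def pw)
      finally show ?thesis .
    qed
    have "(CLINT w|M. iexp (LINT y|lborel. ((t ^ DIM('a)) ^ 4 * k0 y) * qs (1 / t ^ 8) y w)) = (CLINT w|M. iexp (ff.X w))"
      unfolding ff.X_def by (simp only: k_def T_def d_def ep_def)
    then show ?thesis using ff.normal_approximation[OF s V0] unfolding e1 e2 ez by simp
  qed
  have "((\<lambda>t. (CLINT w|M. iexp (LINT y|lborel. ((t ^ DIM('a)) ^ 4 * k0 y) * qs (1 / t ^ 8) y w)) - of_real (exp (- (V / 2)))) \<longlongrightarrow> 0) at_top"
  proof (rule Lim_null_comparison[OF _ Elim])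
    show "\<forall>\<^sub>F t in at_top. norm ((CLINT w|M. iexp (LINT y|lborel. ((t ^ DIM('a)) ^ 4 * k0 y) * qs (1 / t ^ 8) y w)) - of_real (exp (- (V / 2)))) \<le> E1 t + sqrt (E2 t) + \<bar>A t - V\<bar>"
      using eventually_gt_at_top[of 0] by eventually_elim (rule main)
  qed
  then show ?thesis unfolding V_def by (simp add: LIM_zero_iff)
qed

lemma osc_integral_eq: "osc_integral D q m ep w = (LINT y|lborel. (indicator D y * m y / ep powr (real DIM('a) / 2)) * qs ep y w)"
  unfolding osc_integral_def set_lebesgue_integral_def qs_def by (intro Bochner_Integration.integral_cong refl) simp

lemma osc_char_tendsto:
  assumes D: "open D" "bounded D" and m: "continuous_on D m" and B: "\<And>x. x \<in> D \<Longrightarrow> \<bar>m x\<bar> \<le> B"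
  shows "((\<lambda>ep. CLINT w|M. iexp (osc_integral D q m ep w)) \<longlongrightarrow> of_real (exp (- (\<sigma>2 * (LINT y:D|lborel. (m y)\<^sup>2) / 2)))) (at_right 0)"
proof -
  define k0 where "k0 y = indicator D y * m y" for y
  have Df: "D \<in> finite_borel" using D emeasure_bounded_finite[OF D(2)] by (simp add: finite_borel_def)
  have km: "k0 \<in> borel_measurable borel"
    using borel_measurable_continuous_on_indicator[OF _ m] D(1) by (simp add: k0_def[abs_def])
  have kB: "\<bar>k0 x\<bar> \<le> \<bar>B\<bar> * indicator D x" for x
    using B[of x] by (auto simp: k0_def indicator_def)
  have cont: "isCont k0 x" if "x \<in> D" for x
  proof -
    have "\<forall>\<^sub>F y in nhds x. k0 y = m y"
      using eventually_nhds_in_open[OF D(1) that] by eventually_elim (simp add: k0_def)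
    moreover have "isCont m x" using m D(1) that by (simp add: continuous_on_eq_continuous_at)
    ultimately show ?thesis by (subst isCont_cong[where g = m]) auto
  qed
  note lim = normal_limit_rescaled[OF km kB Df cont abs_ge_zero]
  \<comment> \<open>The parameter t is recovered as ep^(-1/8); then t^(4 d) is the normalisation
    ep^(-d/2).\<close>
  have f: "filterlim (\<lambda>ep::real. ep powr (- (1 / 8))) at_top (at_right 0)" by real_asymp
  have sq: "(LINT y|lborel. (k0 y)\<^sup>2) = (LINT y:D|lborel. (m y)\<^sup>2)"
    unfolding set_lebesgue_integral_def k0_def by (intro Bochner_Integration.integral_cong refl) (auto simp: indicator_def)
  have ev: "\<forall>\<^sub>F ep in at_right 0. (CLINT w|M. iexp (LINT y|lborel. (((ep powr (- (1 / 8))) ^ DIM('a)) ^ 4 * k0 y) * qs (1 / (ep powr (- (1 / 8))) ^ 8) y w))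
      = (CLINT w|M. iexp (osc_integral D q m ep w))"
    using eventually_at_right_less[of "0::real"]
  proof eventually_elim
    case (elim ep)
    have a: "1 / (ep powr (- (1 / 8))) ^ 8 = ep"
    proof -
      have "(ep powr (- (1 / 8))) ^ 8 = ep powr (- 1)" using elim by (subst powr_power) auto
      then show ?thesis using elim by (simp add: powr_neg_one)
    qed
    have b: "((ep powr (- (1 / 8))) ^ DIM('a)) ^ 4 = 1 / ep powr (real DIM('a) / 2)"
    proof -
      have "((ep powr (- (1 / 8))) ^ DIM('a)) ^ 4 = ep powr (- (real DIM('a) / 2))"
        using elim by (subst powr_power, simp, subst powr_power) auto
      then show ?thesis using elim by (simp add: powr_minus_divide)
    qed
    show ?case unfolding a b osc_integral_eq k0_def by simp
  qed
  show ?thesis using Lim_transform_eventually[OF filterlim_compose[OF lim f] ev] by (simp add: sq)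
qed

text \<open>The weight has squared norm at most B^2 vol(D) / ep^d and the Schur test contributes
  ep^d, so the bound is uniform in \<open>ep\<close>. It is the source of tightness.\<close>

lemma osc_second_moment:
  assumes D: "open D" "bounded D" and m: "continuous_on D m" and B: "\<And>x. x \<in> D \<Longrightarrow> \<bar>m x\<bar> \<le> B" and ep: "ep > 0"
  shows "square_integrable M (osc_integral D q m ep)"
    and "(LINT w|M. (osc_integral D q m ep w)\<^sup>2) \<le> B\<^sup>2 * measure lborel D * (LINT z|lborel. \<bar>R z\<bar>)"
proof -
  let ?c = "ep powr (real DIM('a) / 2)"
  define h where "h y = indicator D y * m y / ?c" for y
  have c2: "?c\<^sup>2 = ep ^ DIM('a)" and c0: "?c > 0" using ep by (simp_all add: powr_power powr_realpow)
  have eD: "emeasure lborel D < \<infinity>" using emeasure_bounded_finite[OF D(2)] .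
  have [measurable]: "D \<in> sets borel" using D by simp
  have hm[measurable]: "h \<in> borel_measurable borel"
    using borel_measurable_continuous_on_indicator[OF _ m] D(1) unfolding h_def[abs_def] by (intro borel_measurable_divide) auto
  have hb: "\<bar>h y\<bar> \<le> (\<bar>B\<bar> / ?c) * indicator D y" for y
    using B[of y] c0 by (auto simp: h_def indicator_def abs_mult divide_right_mono)
  have hi: "integrable lborel h"
    by (rule Bochner_Integration.integrable_bound[of _ "\<lambda>y. (\<bar>B\<bar> / ?c) * indicator D y"])
      (use eD hb in \<open>auto intro!: integrable_mult_right integrable_real_indicator AE_I2\<close>)
  have h2: "nn_sq lborel h \<le> ennreal (B\<^sup>2 / ep ^ DIM('a) * measure lborel D)"
  proof -
    have "(\<integral>\<^sup>+y. ennreal ((h y)\<^sup>2) \<partial>lborel) \<le> (\<integral>\<^sup>+y. ennreal (B\<^sup>2 / ep ^ DIM('a)) * indicator D y \<partial>lborel)"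
    proof (rule nn_integral_mono)
      fix y
      have "\<bar>h y\<bar>\<^sup>2 \<le> ((\<bar>B\<bar> / ?c) * indicator D y)\<^sup>2" using hb by (intro power_mono) auto
      also have "\<dots> = B\<^sup>2 / ep ^ DIM('a) * indicator D y" using c2 by (simp add: power_mult_distrib power_divide indicator_def)
      finally show "ennreal ((h y)\<^sup>2) \<le> ennreal (B\<^sup>2 / ep ^ DIM('a)) * indicator D y"
        by (cases "y \<in> D") (auto intro: ennreal_leI)
    qed
    also have "\<dots> = ennreal (B\<^sup>2 / ep ^ DIM('a) * measure lborel D)"
      using eD ep by (simp add: nn_integral_cmult emeasure_eq_ennreal_measure less_top ennreal_mult[symmetric])
    finally show ?thesis .
  qed
  have nn: "0 \<le> B\<^sup>2 / ep ^ DIM('a) * measure lborel D" using ep by simp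
  have eq: "osc_integral D q m ep = (\<lambda>w. LINT y|lborel. h y * qs ep y w)"
    unfolding osc_integral_eq[abs_def] h_def ..
  show "square_integrable M (osc_integral D q m ep)"
    unfolding eq by (rule weighted_integral_variance(1)[OF ep hm hi h2 nn])
  show "(LINT w|M. (osc_integral D q m ep w)\<^sup>2) \<le> B\<^sup>2 * measure lborel D * (LINT z|lborel. \<bar>R z\<bar>)"
    unfolding eq using weighted_integral_variance(2)[OF ep hm hi h2 nn] ep by simp
qed

end

section \<open>Perturbation of the Green operator\<close>

text \<open>Cauchy-Schwarz for the measure with density |v|, applied to f and the constant
  1.\<close>

lemma nn_integral_weighted_square_le:
  assumes [measurable]: "f \<in> borel_measurable M" "v \<in> borel_measurable M"
  shows "(\<integral>\<^sup>+x. eabs (f x) * eabs (v x) \<partial>M)\<^sup>2 \<le> (\<integral>\<^sup>+x. ennreal ((f x)\<^sup>2) * eabs (v x) \<partial>M) * (\<integral>\<^sup>+x. eabs (v x) \<partial>M)"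
proof -
  have "(\<integral>\<^sup>+x. (eabs (f x) * ennreal (sqrt \<bar>v x\<bar>)) * ennreal (sqrt \<bar>v x\<bar>) \<partial>M)\<^sup>2
     \<le> (\<integral>\<^sup>+x. (eabs (f x) * ennreal (sqrt \<bar>v x\<bar>))\<^sup>2 \<partial>M) * (\<integral>\<^sup>+x. (ennreal (sqrt \<bar>v x\<bar>))\<^sup>2 \<partial>M)"
    by (rule Cauchy_Schwarz_nn_integral) measurable
  moreover have "(eabs (f x) * ennreal (sqrt \<bar>v x\<bar>)) * ennreal (sqrt \<bar>v x\<bar>) = eabs (f x) * eabs (v x)" for x
    by (simp add: ennreal_mult[symmetric] mult.assoc)
  moreover have "(eabs (f x) * ennreal (sqrt \<bar>v x\<bar>))\<^sup>2 = ennreal ((f x)\<^sup>2) * eabs (v x)" for x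
    by (simp add: ennreal_mult[symmetric] ennreal_power power_mult_distrib)
  moreover have "(ennreal (sqrt \<bar>v x\<bar>))\<^sup>2 = eabs (v x)" for x
    by (simp add: ennreal_power)
  ultimately show ?thesis by simp
qed

lemma square_integrable_iff_nn:
  "square_integrable M f \<longleftrightarrow> f \<in> borel_measurable M \<and> (nn_sq M f) < \<infinity>"
  unfolding square_integrable_def integrable_iff_bounded by auto

lemma square_integrable_nn_eq:
  "square_integrable M f \<Longrightarrow> (nn_sq M f) = ennreal (LINT x|M. (f x)\<^sup>2)"
  by (intro nn_integral_eq_integral) (auto simp: square_integrable_def)

definition l2norm :: "'x measure \<Rightarrow> ('x \<Rightarrow> real) \<Rightarrow> real" where
  "l2norm M f = sqrt (LINT x|M. (f x)\<^sup>2)"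

lemma l2norm_nonneg[simp]: "0 \<le> l2norm M f" by (simp add: l2norm_def)

lemma l2norm_square: "(l2norm M f)\<^sup>2 = (LINT x|M. (f x)\<^sup>2)" by (simp add: l2norm_def)

lemma abs_integral_mult_le:
  assumes "square_integrable M f" "square_integrable M g"
  shows "\<bar>LINT x|M. f x * g x\<bar> \<le> l2norm M f * l2norm M g"
  using order_trans[OF integral_abs_bound Cauchy_Schwarz_integral_sqrt[OF assms]] by (simp add: l2norm_def)

lemma l2norm_triangle:
  assumes f: "square_integrable M f" and g: "square_integrable M g"
  shows "l2norm M (\<lambda>x. f x + g x) \<le> l2norm M f + l2norm M g"
proof -
  have "(LINT x|M. (f x + g x)\<^sup>2) = (LINT x|M. (f x)\<^sup>2) + (LINT x|M. (g x)\<^sup>2) + 2 * (LINT x|M. f x * g x)"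
  proof -
    have "(f x + g x)\<^sup>2 = (f x)\<^sup>2 + (g x)\<^sup>2 + 2 * (f x * g x)" for x by (simp add: power2_sum)
    then show ?thesis using f g square_integrable_mult[OF f g] by (simp add: square_integrable_def)
  qed
  also have "\<dots> \<le> (l2norm M f)\<^sup>2 + (l2norm M g)\<^sup>2 + 2 * (l2norm M f * l2norm M g)"
    using abs_integral_mult_le[OF f g] by (simp add: l2norm_square)
  also have "\<dots> = (l2norm M f + l2norm M g)\<^sup>2" by (simp add: power2_sum)
  finally show ?thesis unfolding l2norm_def[of M "\<lambda>x. f x + g x"] by (intro real_le_lsqrt) auto
qed

lemma l2norm_cong_AE:
  assumes "f \<in> borel_measurable M" "g \<in> borel_measurable M" "AE x in M. f x = g x"
  shows "l2norm M f = l2norm M g"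
proof -
  have "(LINT x|M. (f x)\<^sup>2) = (LINT x|M. (g x)\<^sup>2)"
    by (rule integral_cong_AE) (use assms in \<open>auto elim: eventually_mono\<close>)
  then show ?thesis by (simp add: l2norm_def)
qed

lemma l2norm_uminus: "l2norm M (\<lambda>x. - f x) = l2norm M f" by (simp add: l2norm_def)

text \<open>The kernel is extended by zero, so that all integrals run over the whole space. Its rows
  are bounded in L^2 uniformly; together with symmetry this makes the operator bounded from L^2 to
  bounded functions and from L^1 to L^2.\<close>

locale green_kernel =
  fixes D :: "'a::euclidean_space set" and \<Gamma> :: "'a \<Rightarrow> 'a \<Rightarrow> real" and C :: real
  assumes D_finite: "D \<in> finite_borel"
    and \<Gamma>_measurable[measurable]: "(\<lambda>(x, y). \<Gamma> x y) \<in> borel_measurable lborel2"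
    and \<Gamma>_sym: "\<And>x y. \<Gamma> x y = \<Gamma> y x" and \<Gamma>_support: "\<And>x y. x \<notin> D \<Longrightarrow> \<Gamma> x y = 0"
    and \<Gamma>_square: "\<And>x. nn_sq lborel (\<lambda>y. \<Gamma> x y) \<le> ennreal C" and C_nonneg: "0 \<le> C"
begin

definition Gop :: "('a \<Rightarrow> real) \<Rightarrow> 'a \<Rightarrow> real" where "Gop v x = (LINT y|lborel. \<Gamma> x y * v y)"

lemma D_sets[measurable]: "D \<in> sets borel" using D_finite by (simp add: finite_borel_def)

lemma \<Gamma>_measurable1[measurable]: "\<Gamma> x \<in> borel_measurable borel"
  using measurable_compose[OF measurable_Pair1', of x lborel "\<lambda>(x, y). \<Gamma> x y" lborel borel] \<Gamma>_measurable
  by simp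

lemma \<Gamma>_sq: "square_integrable lborel (\<Gamma> x)" "l2norm lborel (\<Gamma> x) \<le> sqrt C"
proof -
  show s: "square_integrable lborel (\<Gamma> x)"
    unfolding square_integrable_iff_nn using \<Gamma>_square[of x] by (auto intro: le_less_trans)
  show "l2norm lborel (\<Gamma> x) \<le> sqrt C"
    using \<Gamma>_square[of x] C_nonneg unfolding square_integrable_nn_eq[OF s] by (simp add: l2norm_def)
qed

lemma Gop_measurable[measurable]: "v \<in> borel_measurable borel \<Longrightarrow> Gop v \<in> borel_measurable borel"
proof -
  assume [measurable]: "v \<in> borel_measurable borel"
  have "(\<lambda>x. LINT y|lborel. \<Gamma> x y * v y) \<in> borel_measurable lborel"
    by (rule lborel.borel_measurable_lebesgue_integral) measurable
  then show ?thesis by (simp add: Gop_def[abs_def])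
qed

lemma Gop_support: "x \<notin> D \<Longrightarrow> Gop v x = 0" by (simp add: Gop_def \<Gamma>_support)

lemma Gop_bound:
  assumes "square_integrable lborel v"
  shows "\<bar>Gop v x\<bar> \<le> sqrt C * l2norm lborel v" "integrable lborel (\<lambda>y. \<Gamma> x y * v y)"
proof -
  show "\<bar>Gop v x\<bar> \<le> sqrt C * l2norm lborel v"
    unfolding Gop_def by (rule order_trans[OF abs_integral_mult_le[OF \<Gamma>_sq(1) assms] mult_right_mono[OF \<Gamma>_sq(2)]]) simp
  show "integrable lborel (\<lambda>y. \<Gamma> x y * v y)" by (rule square_integrable_mult[OF \<Gamma>_sq(1) assms])
qed

text \<open>The estimate from L^1 to L^2, needed because a potential times a solution is a product
  of two square integrable functions and no better than integrable. Symmetry exchanges the roles of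
  rows and columns.\<close>

lemma Gop_nn:
  assumes v[measurable]: "v \<in> borel_measurable borel"
  shows "(\<integral>\<^sup>+x. (\<integral>\<^sup>+y. eabs (\<Gamma> x y) * eabs (v y) \<partial>lborel)\<^sup>2 \<partial>lborel) \<le> ennreal C * (\<integral>\<^sup>+y. eabs (v y) \<partial>lborel)\<^sup>2"
proof -
  let ?V = "\<integral>\<^sup>+y. eabs (v y) \<partial>lborel"
  have "(\<integral>\<^sup>+x. (\<integral>\<^sup>+y. eabs (\<Gamma> x y) * eabs (v y) \<partial>lborel)\<^sup>2 \<partial>lborel)
     \<le> (\<integral>\<^sup>+x. (\<integral>\<^sup>+y. ennreal ((\<Gamma> x y)\<^sup>2) * eabs (v y) \<partial>lborel) * ?V \<partial>lborel)"
    by (intro nn_integral_mono nn_integral_weighted_square_le) measurable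
  also have "\<dots> = (\<integral>\<^sup>+x. (\<integral>\<^sup>+y. ennreal ((\<Gamma> x y)\<^sup>2) * eabs (v y) \<partial>lborel) \<partial>lborel) * ?V"
    by (rule nn_integral_multc) measurable
  also have "(\<integral>\<^sup>+x. (\<integral>\<^sup>+y. ennreal ((\<Gamma> x y)\<^sup>2) * eabs (v y) \<partial>lborel) \<partial>lborel) = (\<integral>\<^sup>+y. (\<integral>\<^sup>+x. ennreal ((\<Gamma> x y)\<^sup>2) * eabs (v y) \<partial>lborel) \<partial>lborel)"
    by (rule lborel_pair.Fubini') measurable
  also have "\<dots> = (\<integral>\<^sup>+y. nn_sq lborel (\<lambda>x. \<Gamma> y x) * eabs (v y) \<partial>lborel)"
  proof (rule nn_integral_cong)
    fix y
    have "(\<integral>\<^sup>+x. ennreal ((\<Gamma> x y)\<^sup>2) * eabs (v y) \<partial>lborel) = (\<integral>\<^sup>+x. ennreal ((\<Gamma> y x)\<^sup>2) * eabs (v y) \<partial>lborel)"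
      by (intro nn_integral_cong) (simp add: \<Gamma>_sym[of y])
    also have "\<dots> = nn_sq lborel (\<lambda>x. \<Gamma> y x) * eabs (v y)"
      by (rule nn_integral_multc) measurable
    finally show "(\<integral>\<^sup>+x. ennreal ((\<Gamma> x y)\<^sup>2) * eabs (v y) \<partial>lborel) = nn_sq lborel (\<lambda>x. \<Gamma> y x) * eabs (v y)" .
  qed
  also have "\<dots> \<le> (\<integral>\<^sup>+y. ennreal C * eabs (v y) \<partial>lborel)"
    by (intro nn_integral_mono mult_right_mono \<Gamma>_square) simp
  also have "\<dots> = ennreal C * ?V" by (rule nn_integral_cmult) measurable
  finally show ?thesis by (simp add: power2_eq_square mult.assoc mult_right_mono)
qed

lemma Gop_L1:
  assumes v: "integrable lborel v"
  shows "AE x in lborel. integrable lborel (\<lambda>y. \<Gamma> x y * v y)"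
    and "square_integrable lborel (Gop v)" and "l2norm lborel (Gop v) \<le> sqrt C * (LINT y|lborel. \<bar>v y\<bar>)"
proof -
  have vm[measurable]: "v \<in> borel_measurable borel" using borel_measurable_integrable[OF v] by simp
  let ?V = "\<integral>\<^sup>+y. eabs (v y) \<partial>lborel"
  have V: "?V = ennreal (LINT y|lborel. \<bar>v y\<bar>)" using v by (intro nn_integral_eq_integral) auto
  define I where "I = (LINT y|lborel. \<bar>v y\<bar>)"
  have I0: "0 \<le> I" by (simp add: I_def)
  note nn = Gop_nn[OF vm, unfolded V I_def[symmetric]]
  have b: "ennreal C * (ennreal I)\<^sup>2 = ennreal (C * I\<^sup>2)" using C_nonneg I0 by (simp add: ennreal_power ennreal_mult)
  have "(\<integral>\<^sup>+x. (\<integral>\<^sup>+y. eabs (\<Gamma> x y) * eabs (v y) \<partial>lborel)\<^sup>2 \<partial>lborel) \<noteq> \<infinity>"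
    using nn unfolding b by (auto simp: top_unique)
  then have "AE x in lborel. (\<integral>\<^sup>+y. eabs (\<Gamma> x y) * eabs (v y) \<partial>lborel)\<^sup>2 \<noteq> \<infinity>"
    by (intro nn_integral_PInf_AE) measurable
  then show "AE x in lborel. integrable lborel (\<lambda>y. \<Gamma> x y * v y)"
  proof eventually_elim
    case (elim x)
    then have "(\<integral>\<^sup>+y. eabs (\<Gamma> x y) * eabs (v y) \<partial>lborel) < \<infinity>"
      by (auto simp: less_top[symmetric] power2_eq_square ennreal_mult_eq_top_iff)
    then show ?case by (intro integrableI_bounded) (auto simp: abs_mult ennreal_mult')
  qed
  have "(\<integral>\<^sup>+x. ennreal ((Gop v x)\<^sup>2) \<partial>lborel) \<le> (\<integral>\<^sup>+x. (\<integral>\<^sup>+y. eabs (\<Gamma> x y) * eabs (v y) \<partial>lborel)\<^sup>2 \<partial>lborel)"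
  proof (rule nn_integral_mono)
    fix x
    have "eabs (Gop v x) \<le> (\<integral>\<^sup>+y. eabs (\<Gamma> x y) * eabs (v y) \<partial>lborel)"
      using norm_integral_le_nn_integral[of lborel "\<lambda>y. \<Gamma> x y * v y"] by (simp add: Gop_def abs_mult ennreal_mult')
    then have "(eabs (Gop v x))\<^sup>2 \<le> (\<integral>\<^sup>+y. eabs (\<Gamma> x y) * eabs (v y) \<partial>lborel)\<^sup>2"
      unfolding power2_eq_square by (intro mult_mono) auto
    then show "ennreal ((Gop v x)\<^sup>2) \<le> (\<integral>\<^sup>+y. eabs (\<Gamma> x y) * eabs (v y) \<partial>lborel)\<^sup>2" by (simp add: ennreal_power)
  qed
  then have le: "nn_sq lborel (\<lambda>x. Gop v x) \<le> ennreal (C * I\<^sup>2)" using nn unfolding b by (rule order_trans)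
  show s: "square_integrable lborel (Gop v)"
    unfolding square_integrable_iff_nn using le by (auto intro: le_less_trans)
  have "(LINT x|lborel. (Gop v x)\<^sup>2) \<le> C * I\<^sup>2" using le C_nonneg I0 unfolding square_integrable_nn_eq[OF s] by simp
  then have "l2norm lborel (Gop v) \<le> sqrt (C * I\<^sup>2)" by (simp add: l2norm_def)
  then show "l2norm lborel (Gop v) \<le> sqrt C * (LINT y|lborel. \<bar>v y\<bar>)" using I0 by (simp add: real_sqrt_mult I_def)
qed

text \<open>Fubini with one factor integrable and the other one square integrable: the operator
  applied to the latter, with absolute values, is bounded.\<close>

lemma Gop_symmetric:
  assumes v: "integrable lborel v" and w: "square_integrable lborel w"
  shows "(LINT x|lborel. Gop v x * w x) = (LINT y|lborel. v y * Gop w y)"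
proof -
  have [measurable]: "v \<in> borel_measurable borel" "w \<in> borel_measurable borel"
    using borel_measurable_integrable[OF v] w by (auto simp: square_integrable_def)
  have i: "integrable lborel2 (\<lambda>(y, x). \<Gamma> x y * v y * w x)"
  proof (rule lborel_pair.Fubini_integrable)
    have absi: "(LINT x|lborel. \<bar>\<Gamma> x y * v y * w x\<bar>) \<le> \<bar>v y\<bar> * (sqrt C * l2norm lborel w)" for y
    proof -
      have "(LINT x|lborel. \<bar>\<Gamma> x y * v y * w x\<bar>) = (LINT x|lborel. \<bar>v y\<bar> * \<bar>\<Gamma> y x * w x\<bar>)"
        by (intro Bochner_Integration.integral_cong refl) (simp add: abs_mult \<Gamma>_sym[of y])
      also have "\<dots> = \<bar>v y\<bar> * (LINT x|lborel. \<bar>\<Gamma> y x * w x\<bar>)" by (rule integral_mult_right_zero)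
      also have "\<dots> \<le> \<bar>v y\<bar> * (sqrt C * l2norm lborel w)"
      proof (rule mult_left_mono)
        have "(LINT x|lborel. \<bar>\<Gamma> y x * w x\<bar>) \<le> l2norm lborel (\<Gamma> y) * l2norm lborel w"
          using Cauchy_Schwarz_integral_sqrt[OF \<Gamma>_sq(1)[of y] w] by (simp add: l2norm_def)
        also have "\<dots> \<le> sqrt C * l2norm lborel w" by (intro mult_right_mono \<Gamma>_sq) simp
        finally show "(LINT x|lborel. \<bar>\<Gamma> y x * w x\<bar>) \<le> sqrt C * l2norm lborel w" .
      qed simp
      finally show ?thesis .
    qed
    show "integrable lborel (\<lambda>x. LINT y|lborel. norm (case (x, y) of (y, x) \<Rightarrow> \<Gamma> x y * v y * w x))"
    proof (rule Bochner_Integration.integrable_bound[OF integrable_mult_left[OF integrable_abs[OF v]] _ AE_I2])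
      fix y
      show "norm (LINT ya|lborel. norm (case (y, ya) of (y, x) \<Rightarrow> \<Gamma> x y * v y * w x)) \<le> norm (\<bar>v y\<bar> * (sqrt C * l2norm lborel w))"
        using absi[of y] by (simp add: order_trans[OF _ abs_ge_self])
    qed measurable
    show "AE x in lborel. integrable lborel (\<lambda>y. case (x, y) of (y, x) \<Rightarrow> \<Gamma> x y * v y * w x)"
    proof (rule AE_I2)
      fix y
      have "(\<lambda>x. \<Gamma> x y * v y * w x) = (\<lambda>x. v y * (\<Gamma> y x * w x))" by (auto simp: \<Gamma>_sym[of y])
      then show "integrable lborel (\<lambda>x. case (y, x) of (y, x) \<Rightarrow> \<Gamma> x y * v y * w x)"
        using Gop_bound(2)[OF w, of y] by simp
    qed
  qed measurable
  have "(LINT x|lborel. Gop v x * w x) = (LINT x|lborel. LINT y|lborel. \<Gamma> x y * v y * w x)"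
    unfolding Gop_def by simp
  also have "\<dots> = (LINT y|lborel. LINT x|lborel. \<Gamma> x y * v y * w x)"
    by (rule lborel_pair.Fubini_integral[OF i])
  also have "\<dots> = (LINT y|lborel. v y * Gop w y)"
  proof (rule Bochner_Integration.integral_cong[OF refl])
    fix y
    have "(LINT x|lborel. \<Gamma> x y * v y * w x) = (LINT x|lborel. v y * (\<Gamma> y x * w x))"
      by (intro Bochner_Integration.integral_cong refl) (simp add: \<Gamma>_sym[of y])
    also have "\<dots> = v y * Gop w y" unfolding Gop_def by (rule integral_mult_right_zero)
    finally show "(LINT x|lborel. \<Gamma> x y * v y * w x) = v y * Gop w y" .
  qed
  finally show ?thesis .
qed

lemma Gop_add_AE:
  assumes "integrable lborel v" "integrable lborel w"
  shows "AE x in lborel. Gop (\<lambda>y. v y + w y) x = Gop v x + Gop w x"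
  using Gop_L1(1)[OF assms(1)] Gop_L1(1)[OF assms(2)]
  by eventually_elim (simp add: Gop_def distrib_left)

lemma Gop_cong_AE:
  assumes "v \<in> borel_measurable borel" "w \<in> borel_measurable borel" "AE x in lborel. v x = w x"
  shows "Gop v x = Gop w x"
  unfolding Gop_def by (rule integral_cong_AE) (use assms in \<open>auto elim: eventually_mono\<close>)

text \<open>The square of the Hilbert-Schmidt norm of \<open>\<G>Q\<G>Q\<close>.\<close>

definition HS :: "('a \<Rightarrow> real) \<Rightarrow> ennreal" where
  "HS Q = (\<integral>\<^sup>+x. \<integral>\<^sup>+z. ennreal ((Q z * (LINT y|lborel. \<Gamma> x y * \<Gamma> y z * Q y))\<^sup>2) \<partial>lborel \<partial>lborel)"

lemma square_integrable_mult_L1: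
  "square_integrable lborel f \<Longrightarrow> square_integrable lborel g \<Longrightarrow> (LINT x|lborel. \<bar>f x * g x\<bar>) \<le> l2norm lborel f * l2norm lborel g"
  using Cauchy_Schwarz_integral_sqrt by (auto simp: l2norm_def)

lemma HS_bound:
  assumes Q: "square_integrable lborel Q" and w: "square_integrable lborel w"
  shows "(\<integral>\<^sup>+x. ennreal ((Gop (\<lambda>y. Q y * Gop (\<lambda>z. Q z * w z) y) x)\<^sup>2) \<partial>lborel) \<le> HS Q * ennreal ((l2norm lborel w)\<^sup>2)"
proof -
  have [measurable]: "Q \<in> borel_measurable borel" "w \<in> borel_measurable borel" using Q w by (auto simp: square_integrable_def)
  define v where "v z = Q z * w z" for z
  have [measurable]: "v \<in> borel_measurable borel" unfolding v_def[abs_def] by measurable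
  have vi: "integrable lborel v" unfolding v_def by (rule square_integrable_mult[OF Q w])
  \<comment> \<open>The majorant for exchanging the two integrals. It is square integrable, so Q H
    is integrable, and for almost every x it is integrable against the row of x.\<close>
  define H where "H y = (LINT z|lborel. \<bar>\<Gamma> y z\<bar> * \<bar>v z\<bar>)" for y
  have Hm[measurable]: "H \<in> borel_measurable borel"
  proof -
    have "(\<lambda>y. LINT z|lborel. \<bar>\<Gamma> y z\<bar> * \<bar>v z\<bar>) \<in> borel_measurable lborel"
      by (rule lborel.borel_measurable_lebesgue_integral) measurable
    then show ?thesis by (simp add: H_def[abs_def])
  qed
  have Hs: "square_integrable lborel H"
    unfolding square_integrable_iff_nn
  proof
    have "(\<integral>\<^sup>+y. ennreal ((H y)\<^sup>2) \<partial>lborel) \<le> (\<integral>\<^sup>+x. (\<integral>\<^sup>+y. eabs (\<Gamma> x y) * eabs (v y) \<partial>lborel)\<^sup>2 \<partial>lborel)"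
    proof (rule nn_integral_mono)
      fix x
      have "eabs (H x) \<le> (\<integral>\<^sup>+y. eabs (\<Gamma> x y) * eabs (v y) \<partial>lborel)"
        using norm_integral_le_nn_integral[of lborel "\<lambda>y. \<bar>\<Gamma> x y\<bar> * \<bar>v y\<bar>"] by (simp add: H_def abs_mult ennreal_mult')
      then have "(eabs (H x))\<^sup>2 \<le> (\<integral>\<^sup>+y. eabs (\<Gamma> x y) * eabs (v y) \<partial>lborel)\<^sup>2"
        unfolding power2_eq_square by (intro mult_mono) auto
      then show "ennreal ((H x)\<^sup>2) \<le> (\<integral>\<^sup>+y. eabs (\<Gamma> x y) * eabs (v y) \<partial>lborel)\<^sup>2" by (simp add: ennreal_power)
    qed
    also have "\<dots> \<le> ennreal C * (\<integral>\<^sup>+y. eabs (v y) \<partial>lborel)\<^sup>2" by (rule Gop_nn) measurable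
    also have "(\<integral>\<^sup>+y. eabs (v y) \<partial>lborel) = ennreal (LINT y|lborel. \<bar>v y\<bar>)" using vi by (intro nn_integral_eq_integral) auto
    also have "ennreal C * (ennreal (LINT y|lborel. \<bar>v y\<bar>))\<^sup>2 < \<infinity>" by (simp add: ennreal_power ennreal_mult_less_top)
    finally show "nn_sq lborel H < \<infinity>" .
  qed simp
  have QH: "integrable lborel (\<lambda>y. Q y * H y)" by (rule square_integrable_mult[OF Q Hs])
  let ?T = "\<lambda>x. Gop (\<lambda>y. Q y * Gop v y) x"
  let ?S = "\<lambda>x z. Q z * (LINT y|lborel. \<Gamma> x y * \<Gamma> y z * Q y)"
  have Sm[measurable]: "(\<lambda>s. ?S (fst s) (snd s)) \<in> borel_measurable lborel2" by measurable
  have "AE x in lborel. ennreal ((?T x)\<^sup>2) \<le> nn_sq lborel (\<lambda>z. ?S x z) * ennreal ((l2norm lborel w)\<^sup>2)"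
    using Gop_L1(1)[OF QH]
  proof eventually_elim
    case (elim x)
    have i: "integrable lborel2 (\<lambda>(y, z). \<Gamma> x y * Q y * (\<Gamma> y z * v z))"
    proof (rule lborel_pair.Fubini_integrable)
      show "integrable lborel (\<lambda>xa. LINT y|lborel. norm (case (xa, y) of (y, z) \<Rightarrow> \<Gamma> x y * Q y * (\<Gamma> y z * v z)))"
      proof (rule Bochner_Integration.integrable_bound[OF elim _ AE_I2])
        fix y
        have "(LINT z|lborel. norm (\<Gamma> x y * Q y * (\<Gamma> y z * v z))) = \<bar>\<Gamma> x y * Q y\<bar> * H y"
          unfolding H_def integral_mult_right_zero[symmetric] by (intro Bochner_Integration.integral_cong refl) (simp add: abs_mult)
        moreover have "0 \<le> H y" by (simp add: H_def)
        ultimately show "norm (LINT ya|lborel. norm (case (y, ya) of (y, z) \<Rightarrow> \<Gamma> x y * Q y * (\<Gamma> y z * v z))) \<le> norm (\<Gamma> x y * (Q y * H y))"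
          by (simp add: abs_mult H_def[symmetric] mult.assoc)
      qed measurable
      show "AE y in lborel. integrable lborel (\<lambda>z. case (y, z) of (y, z) \<Rightarrow> \<Gamma> x y * Q y * (\<Gamma> y z * v z))"
        using Gop_L1(1)[OF vi] by eventually_elim simp
    qed measurable
    have "?T x = (LINT y|lborel. LINT z|lborel. \<Gamma> x y * Q y * (\<Gamma> y z * v z))"
      unfolding Gop_def by (simp add: mult.assoc)
    also have "\<dots> = (LINT z|lborel. LINT y|lborel. \<Gamma> x y * Q y * (\<Gamma> y z * v z))"
      by (rule lborel_pair.Fubini_integral[OF i, symmetric])
    also have "\<dots> = (LINT z|lborel. ?S x z * w z)"
    proof (rule Bochner_Integration.integral_cong[OF refl])
      fix z
      have "(LINT y|lborel. \<Gamma> x y * Q y * (\<Gamma> y z * v z)) = (LINT y|lborel. v z * (\<Gamma> x y * \<Gamma> y z * Q y))"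
        by (simp only: mult_ac)
      then show "(LINT y|lborel. \<Gamma> x y * Q y * (\<Gamma> y z * v z)) = ?S x z * w z" by (simp add: v_def)
    qed
    finally have T: "?T x = (LINT z|lborel. ?S x z * w z)" .
    have "eabs (?T x) \<le> (\<integral>\<^sup>+z. eabs (?S x z) * eabs (w z) \<partial>lborel)"
      unfolding T using norm_integral_le_nn_integral[of lborel "\<lambda>z. ?S x z * w z"] by (simp add: abs_mult ennreal_mult')
    then have "(eabs (?T x))\<^sup>2 \<le> (\<integral>\<^sup>+z. eabs (?S x z) * eabs (w z) \<partial>lborel)\<^sup>2"
      unfolding power2_eq_square by (intro mult_mono) auto
    also have "\<dots> \<le> (\<integral>\<^sup>+z. (eabs (?S x z))\<^sup>2 \<partial>lborel) * (\<integral>\<^sup>+z. (eabs (w z))\<^sup>2 \<partial>lborel)"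
      by (rule Cauchy_Schwarz_nn_integral) measurable
    finally show "ennreal ((?T x)\<^sup>2) \<le> nn_sq lborel (\<lambda>z. ?S x z) * ennreal ((l2norm lborel w)\<^sup>2)"
      by (simp add: ennreal_power square_integrable_nn_eq[OF w] l2norm_square)
  qed
  then have "nn_sq lborel ?T \<le> (\<integral>\<^sup>+x. nn_sq lborel (\<lambda>z. ?S x z) * ennreal ((l2norm lborel w)\<^sup>2) \<partial>lborel)"
    by (rule nn_integral_mono_AE)
  also have "\<dots> = HS Q * ennreal ((l2norm lborel w)\<^sup>2)"
    unfolding HS_def by (rule nn_integral_multc) measurable
  finally show ?thesis unfolding v_def[abs_def] .
qed

lemma HS_bound_l2norm:
  assumes Q: "square_integrable lborel Q" and w: "square_integrable lborel w" and h: "HS Q \<le> ennreal (\<rho>\<^sup>2)" and \<rho>: "0 \<le> \<rho>"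
  shows "square_integrable lborel (Gop (\<lambda>y. Q y * Gop (\<lambda>z. Q z * w z) y))"
    "l2norm lborel (Gop (\<lambda>y. Q y * Gop (\<lambda>z. Q z * w z) y)) \<le> \<rho> * l2norm lborel w"
proof -
  let ?T = "Gop (\<lambda>y. Q y * Gop (\<lambda>z. Q z * w z) y)"
  have "(\<integral>\<^sup>+x. ennreal ((?T x)\<^sup>2) \<partial>lborel) \<le> ennreal (\<rho>\<^sup>2) * ennreal ((l2norm lborel w)\<^sup>2)"
    by (rule order_trans[OF HS_bound[OF Q w] mult_right_mono[OF h]]) simp
  also have "\<dots> = ennreal ((\<rho> * l2norm lborel w)\<^sup>2)" by (simp add: power_mult_distrib ennreal_mult)
  finally have le: "nn_sq lborel ?T \<le> ennreal ((\<rho> * l2norm lborel w)\<^sup>2)" .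
  have [measurable]: "Q \<in> borel_measurable borel" "w \<in> borel_measurable borel" using Q w by (auto simp: square_integrable_def)
  show s: "square_integrable lborel ?T"
    unfolding square_integrable_iff_nn using le by (auto intro: le_less_trans)
  have "(LINT x|lborel. (?T x)\<^sup>2) \<le> (\<rho> * l2norm lborel w)\<^sup>2"
    using le unfolding square_integrable_nn_eq[OF s] by simp
  then show "l2norm lborel ?T \<le> \<rho> * l2norm lborel w"
    unfolding l2norm_def[of _ ?T] using \<rho> by (intro real_le_lsqrt) auto
qed

text \<open>The Hilbert-Schmidt bound lets the quadratic term be absorbed: (1 - \<rho>) |w| is at
  most (1 + C^(1/2) |Q|) |p| in L^2 norm, so \<open>w\<close> has the order of \<open>p\<close>.
  Symmetry moves the operators off \<open>w\<close> onto \<open>g\<close>, and the factor paired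
  with \<open>w\<close> is Q G Q g, which is small later on.\<close>

lemma perturbation_expansion:
  assumes Q: "square_integrable lborel Q" and u0: "square_integrable lborel u0" and w: "square_integrable lborel w" and m: "square_integrable lborel m"
    and h: "HS Q \<le> ennreal (\<rho>\<^sup>2)" and \<rho>: "0 \<le> \<rho>" "\<rho> < 1"
    and eq: "AE x in lborel. w x = - Gop (\<lambda>y. Q y * u0 y) x + Gop (\<lambda>y. Q y * Gop (\<lambda>z. Q z * (u0 z + w z)) y) x"
  defines "p \<equiv> Gop (\<lambda>y. Q y * u0 y)" and "g \<equiv> Gop m"
  shows "\<bar>(LINT x|lborel. w x * m x) + (LINT y|lborel. Q y * u0 y * g y)\<bar> \<le>
    \<bar>LINT y|lborel. Q y * g y * p y\<bar> + (1 + sqrt C * l2norm lborel Q) * l2norm lborel p / (1 - \<rho>) * l2norm lborel (\<lambda>y. Q y * Gop (\<lambda>z. Q z * g z) y)"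
proof -
  have [measurable]: "Q \<in> borel_measurable borel" "w \<in> borel_measurable borel" "u0 \<in> borel_measurable borel" "m \<in> borel_measurable borel"
    using Q w u0 m by (auto simp: square_integrable_def)
  have Qu: "integrable lborel (\<lambda>y. Q y * u0 y)" and Qw: "integrable lborel (\<lambda>y. Q y * w y)"
    by (rule square_integrable_mult[OF Q], fact)+
  have p: "square_integrable lborel p" unfolding p_def by (rule Gop_L1(2)[OF Qu])
  \<comment> \<open>With \<open>a\<close> = G Q w, the functions \<open>b\<close> = G Q p and
    \<open>e\<close> = G Q G Q w defined next are the two parts of the quadratic term; only
    \<open>e\<close> contains the unknown twice removed and is estimated by the Hilbert-Schmidt
    norm.\<close>
  define a where "a = Gop (\<lambda>y. Q y * w y)"
  have a: "square_integrable lborel a" unfolding a_def by (rule Gop_L1(2)[OF Qw])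
  have [measurable]: "p \<in> borel_measurable borel" "a \<in> borel_measurable borel" using p a by (auto simp: square_integrable_def)
  have Qp: "integrable lborel (\<lambda>y. Q y * p y)" and Qa: "integrable lborel (\<lambda>y. Q y * a y)"
    by (rule square_integrable_mult[OF Q], fact)+
  define b where "b = Gop (\<lambda>y. Q y * p y)"
  define e where "e = Gop (\<lambda>y. Q y * a y)"
  have b: "square_integrable lborel b" and e: "square_integrable lborel e"
    unfolding b_def e_def by (rule Gop_L1(2), fact)+
  have [measurable]: "b \<in> borel_measurable borel" "e \<in> borel_measurable borel" using b e by (auto simp: square_integrable_def)
  have "AE y in lborel. Gop (\<lambda>z. Q z * (u0 z + w z)) y = p y + a y"
    using Gop_add_AE[OF Qu Qw] by (simp add: distrib_left p_def a_def)
  then have inner: "Gop (\<lambda>y. Q y * Gop (\<lambda>z. Q z * (u0 z + w z)) y) x = Gop (\<lambda>y. Q y * p y + Q y * a y) x" for x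
    by (intro Gop_cong_AE) (auto elim: eventually_mono simp: distrib_left)
  have w_eq: "AE x in lborel. w x = - p x + (b x + e x)"
    using eq Gop_add_AE[OF Qp Qa] unfolding p_def[symmetric] b_def[symmetric] e_def[symmetric]
    by eventually_elim (simp add: inner)
  have en: "l2norm lborel e \<le> \<rho> * l2norm lborel w"
    unfolding e_def a_def by (rule HS_bound_l2norm(2)[OF Q w h \<rho>(1)])
  have bn: "l2norm lborel b \<le> sqrt C * (l2norm lborel Q * l2norm lborel p)"
    unfolding b_def by (rule order_trans[OF Gop_L1(3)[OF Qp] mult_left_mono[OF square_integrable_mult_L1[OF Q p]]]) (simp add: C_nonneg)
  have "l2norm lborel w = l2norm lborel (\<lambda>x. - p x + (b x + e x))" by (rule l2norm_cong_AE[OF _ _ w_eq]) simp_all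
  also have "\<dots> \<le> l2norm lborel (\<lambda>x. - p x) + l2norm lborel (\<lambda>x. b x + e x)"
    using square_integrable_scale[OF p, of "-1"] by (intro l2norm_triangle square_integrable_add b e) simp
  also have "\<dots> \<le> l2norm lborel p + (l2norm lborel b + l2norm lborel e)"
    unfolding l2norm_uminus by (intro add_left_mono l2norm_triangle b e)
  also have "\<dots> \<le> l2norm lborel p + (sqrt C * (l2norm lborel Q * l2norm lborel p) + \<rho> * l2norm lborel w)"
    using bn en by simp
  finally have "(1 - \<rho>) * l2norm lborel w \<le> (1 + sqrt C * l2norm lborel Q) * l2norm lborel p" by (simp add: algebra_simps)
  then have wn: "l2norm lborel w \<le> (1 + sqrt C * l2norm lborel Q) * l2norm lborel p / (1 - \<rho>)"
    using \<rho> by (simp add: pos_le_divide_eq mult.commute)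
  have gb: "\<bar>g x\<bar> \<le> sqrt C * l2norm lborel m" for x unfolding g_def by (rule Gop_bound(1)[OF m])
  have [measurable]: "g \<in> borel_measurable borel" unfolding g_def by measurable
  have bdd: "square_integrable lborel (\<lambda>y. Q y * f y)" if [measurable]: "f \<in> borel_measurable borel" and "\<And>x. \<bar>f x\<bar> \<le> c" for f c
    unfolding square_integrable_def
  proof
    have "(f x)\<^sup>2 \<le> c\<^sup>2" for x using that(2)[of x] by (metis abs_ge_zero power2_abs power_mono)
    then show "integrable lborel (\<lambda>y. (Q y * f y)\<^sup>2)"
      using Q by (intro Bochner_Integration.integrable_bound[of lborel "\<lambda>y. (Q y)\<^sup>2 * c\<^sup>2" "\<lambda>y. (Q y * f y)\<^sup>2"])
        (auto simp: square_integrable_def power_mult_distrib intro!: AE_I2 mult_left_mono)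
  qed simp
  have Qg: "square_integrable lborel (\<lambda>y. Q y * g y)" by (rule bdd[OF _ gb]) simp
  have QGg: "square_integrable lborel (\<lambda>y. Q y * Gop (\<lambda>z. Q z * g z) y)"
    by (rule bdd[OF _ Gop_bound(1)[OF Qg]]) simp
  have 1: "(LINT x|lborel. p x * m x) = (LINT y|lborel. Q y * u0 y * g y)"
    unfolding p_def g_def by (rule Gop_symmetric[OF Qu m])
  have 2: "(LINT x|lborel. b x * m x) = (LINT y|lborel. Q y * g y * p y)"
    unfolding b_def using Gop_symmetric[OF Qp m] by (simp add: g_def mult_ac)
  have 3: "(LINT x|lborel. e x * m x) = (LINT y|lborel. (Q y * Gop (\<lambda>z. Q z * g z) y) * w y)"
  proof -
    have "(LINT x|lborel. e x * m x) = (LINT y|lborel. Q y * a y * g y)"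
      unfolding e_def g_def by (rule Gop_symmetric[OF Qa m])
    also have "\<dots> = (LINT y|lborel. a y * (Q y * g y))" by (simp add: mult_ac)
    also have "\<dots> = (LINT y|lborel. Q y * w y * Gop (\<lambda>z. Q z * g z) y)"
      unfolding a_def by (rule Gop_symmetric[OF Qw Qg])
    finally show ?thesis by (simp add: mult_ac)
  qed
  have "(LINT x|lborel. w x * m x) = (LINT x|lborel. (- p x + (b x + e x)) * m x)"
    by (rule integral_cong_AE) (use w_eq in \<open>auto elim: eventually_mono\<close>)
  also have "\<dots> = - (LINT x|lborel. p x * m x) + ((LINT x|lborel. b x * m x) + (LINT x|lborel. e x * m x))"
    using square_integrable_mult[OF p m] square_integrable_mult[OF b m] square_integrable_mult[OF e m] by (simp add: algebra_simps)
  finally have "(LINT x|lborel. w x * m x) + (LINT y|lborel. Q y * u0 y * g y) = (LINT y|lborel. Q y * g y * p y) + (LINT y|lborel. (Q y * Gop (\<lambda>z. Q z * g z) y) * w y)"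
    unfolding 1 2 3 by simp
  also have "\<bar>\<dots>\<bar> \<le> \<bar>LINT y|lborel. Q y * g y * p y\<bar> + l2norm lborel (\<lambda>y. Q y * Gop (\<lambda>z. Q z * g z) y) * l2norm lborel w"
    using abs_integral_mult_le[OF QGg w] by linarith
  also have "\<dots> \<le> \<bar>LINT y|lborel. Q y * g y * p y\<bar> + l2norm lborel (\<lambda>y. Q y * Gop (\<lambda>z. Q z * g z) y) * ((1 + sqrt C * l2norm lborel Q) * l2norm lborel p / (1 - \<rho>))"
    by (intro add_left_mono mult_left_mono wn) simp
  finally show ?thesis by (simp only: mult.commute[of "l2norm lborel (\<lambda>y. Q y * Gop (\<lambda>z. Q z * g z) y)"])
qed

end

section \<open>Approximation of kernels by rectangles\<close>

inductive rect_step :: "'a::euclidean_space set \<Rightarrow> ('a \<times> 'a \<Rightarrow> real) \<Rightarrow> bool" for D where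
  rect: "A \<in> sets borel \<Longrightarrow> A \<subseteq> D \<Longrightarrow> B \<in> sets borel \<Longrightarrow> B \<subseteq> D \<Longrightarrow>
    rect_step D (\<lambda>s. c * (indicator A (fst s) * indicator B (snd s)))"
| rect_add: "rect_step D F \<Longrightarrow> rect_step D F' \<Longrightarrow> rect_step D (\<lambda>s. F s + F' s)"

lemma rect_step_0: "rect_step D (\<lambda>s. 0)"
  using rect_step.rect[of "{}" D "{}" 0] by simp

lemma rect_step_scale: "rect_step D F \<Longrightarrow> rect_step D (\<lambda>s. c * F s)"
proof (induction rule: rect_step.induct)
  case (rect A B d)
  then show ?case using rect_step.rect[of A D B "c * d"] by (simp add: mult.assoc)
next
  case (rect_add F F')
  then show ?case using rect_step.rect_add by (simp add: distrib_left)
qed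

lemma rect_step_measurable[measurable_dest]: "rect_step D F \<Longrightarrow> F \<in> borel_measurable lborel2"
proof (induction rule: rect_step.induct)
  case (rect A B c)
  note [measurable] = rect(1,3)
  show ?case by measurable
qed simp

lemma rect_step_zero: "rect_step D F \<Longrightarrow> fst s \<notin> D \<or> snd s \<notin> D \<Longrightarrow> F s = 0"
  by (induction rule: rect_step.induct) (auto simp: indicator_def)

lemma rect_step_bounded: "rect_step D F \<Longrightarrow> \<exists>b. \<forall>s. \<bar>F s\<bar> \<le> b"
proof (induction rule: rect_step.induct)
  case (rect A B c)
  show ?case by (rule exI[of _ "\<bar>c\<bar>"]) (auto simp: indicator_def)
next
  case (rect_add F F')
  then obtain b b' where "\<And>s. \<bar>F s\<bar> \<le> b" "\<And>s. \<bar>F' s\<bar> \<le> b'" by auto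
  then have "\<bar>F s + F' s\<bar> \<le> b + b'" for s by (rule order_trans[OF abs_triangle_ineq add_mono])
  then show ?case by blast
qed

definition rect_approx :: "'a::euclidean_space set \<Rightarrow> ('a \<times> 'a \<Rightarrow> real) \<Rightarrow> bool" where
  "rect_approx D H \<longleftrightarrow> (\<forall>e>0. \<exists>F. rect_step D F \<and> (nn_sq lborel2 (\<lambda>s. H s - F s)) \<le> ennreal e)"

lemma rect_approx_step: "rect_step D F \<Longrightarrow> rect_approx D F"
  unfolding rect_approx_def by (intro allI impI exI[of _ F]) simp

lemma nn_integral_square_add:
  fixes f g :: "'x \<Rightarrow> real"
  assumes [measurable]: "f \<in> borel_measurable M" "g \<in> borel_measurable M"
    and "(\<integral>\<^sup>+x. ennreal ((f x)\<^sup>2) \<partial>M) \<le> ennreal a" "nn_sq M g \<le> ennreal b" "0 \<le> a" "0 \<le> b"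
  shows "(\<integral>\<^sup>+x. ennreal ((f x + g x)\<^sup>2) \<partial>M) \<le> ennreal (2 * a + 2 * b)"
proof -
  have "(\<integral>\<^sup>+x. ennreal ((f x + g x)\<^sup>2) \<partial>M) \<le> (\<integral>\<^sup>+x. ennreal 2 * ennreal ((f x)\<^sup>2) + ennreal 2 * ennreal ((g x)\<^sup>2) \<partial>M)"
  proof (rule nn_integral_mono)
    fix x
    have "(f x + g x)\<^sup>2 \<le> 2 * (f x)\<^sup>2 + 2 * (g x)\<^sup>2"
      using sum_squares_bound[of "f x" "g x"] by (simp add: power2_sum)
    then have "ennreal ((f x + g x)\<^sup>2) \<le> ennreal (2 * (f x)\<^sup>2 + 2 * (g x)\<^sup>2)" by (rule ennreal_leI)
    also have "\<dots> = ennreal 2 * ennreal ((f x)\<^sup>2) + ennreal 2 * ennreal ((g x)\<^sup>2)"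
      by (simp add: ennreal_plus ennreal_mult' del: ennreal_numeral)
    finally show "ennreal ((f x + g x)\<^sup>2) \<le> ennreal 2 * ennreal ((f x)\<^sup>2) + ennreal 2 * ennreal ((g x)\<^sup>2)" .
  qed
  also have "\<dots> = ennreal 2 * nn_sq M f + ennreal 2 * nn_sq M g"
    by (subst nn_integral_add) (simp_all add: nn_integral_cmult)
  also have "\<dots> \<le> ennreal 2 * ennreal a + ennreal 2 * ennreal b"
    using assms by (intro add_mono mult_left_mono) auto
  also have "\<dots> = ennreal (2 * a + 2 * b)"
    using assms by (simp add: ennreal_plus ennreal_mult' del: ennreal_numeral)
  finally show ?thesis .
qed

lemma rect_approx_add:
  assumes f: "rect_approx D f" and g: "rect_approx D g"
    and [measurable]: "f \<in> borel_measurable lborel2" "g \<in> borel_measurable lborel2"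
  shows "rect_approx D (\<lambda>s. f s + g s)"
  unfolding rect_approx_def
proof (intro allI impI)
  fix e :: real assume e: "e > 0"
  then have e4: "e / 4 > 0" by simp
  obtain F F' where F: "rect_step D F" "nn_sq lborel2 (\<lambda>s. f s - F s) \<le> ennreal (e / 4)"
    and F': "rect_step D F'" "nn_sq lborel2 (\<lambda>s. g s - F' s) \<le> ennreal (e / 4)"
    using f g e4 unfolding rect_approx_def by blast
  note [measurable] = rect_step_measurable[OF F(1)] rect_step_measurable[OF F'(1)]
  have "(\<integral>\<^sup>+s. ennreal (((f s - F s) + (g s - F' s))\<^sup>2) \<partial>lborel2) \<le> ennreal (2 * (e / 4) + 2 * (e / 4))"
    by (rule nn_integral_square_add) (use F F' e in auto)
  then have "nn_sq lborel2 (\<lambda>s. f s + g s - (F s + F' s)) \<le> ennreal e"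
    by (simp add: algebra_simps)
  then show "\<exists>F. rect_step D F \<and> (nn_sq lborel2 (\<lambda>s. f s + g s - F s)) \<le> ennreal e"
    using rect_add[OF F(1) F'(1)] by blast
qed

lemma rect_approx_scale:
  assumes f: "rect_approx D f" and [measurable]: "f \<in> borel_measurable lborel2"
  shows "rect_approx D (\<lambda>s. c * f s)"
  unfolding rect_approx_def
proof (intro allI impI)
  fix e :: real assume e: "e > 0"
  have c: "c\<^sup>2 + 1 > 0" by (simp add: add_nonneg_pos)
  then have "e / (c\<^sup>2 + 1) > 0" using e by simp
  then obtain F where F: "rect_step D F" "nn_sq lborel2 (\<lambda>s. f s - F s) \<le> ennreal (e / (c\<^sup>2 + 1))"
    using f unfolding rect_approx_def by blast
  note [measurable] = rect_step_measurable[OF F(1)]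
  have "(\<integral>\<^sup>+s. ennreal ((c * f s - c * F s)\<^sup>2) \<partial>lborel2) = ennreal (c\<^sup>2) * nn_sq lborel2 (\<lambda>s. f s - F s)"
    unfolding right_diff_distrib[symmetric] power_mult_distrib by (simp add: ennreal_mult' nn_integral_cmult)
  also have "\<dots> \<le> ennreal (c\<^sup>2) * ennreal (e / (c\<^sup>2 + 1))" by (intro mult_left_mono F) simp
  also have "\<dots> = ennreal (c\<^sup>2 * (e / (c\<^sup>2 + 1)))" using c e by (intro ennreal_mult[symmetric]) auto
  also have "\<dots> \<le> ennreal e" using c e by (intro ennreal_leI) (simp add: field_simps)
  finally show "\<exists>F. rect_step D F \<and> (nn_sq lborel2 (\<lambda>s. c * f s - F s)) \<le> ennreal e"
    using rect_step_scale[OF F(1)] by blast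
qed

lemma rect_approx_limit:
  assumes h: "\<And>n::nat. rect_approx D (h n)" and hm[measurable]: "\<And>n. h n \<in> borel_measurable lborel2"
    and fm[measurable]: "f \<in> borel_measurable lborel2"
    and lim: "(\<lambda>n. \<integral>\<^sup>+s. ennreal ((f s - h n s)\<^sup>2) \<partial>lborel2) \<longlonglongrightarrow> 0"
  shows "rect_approx D f"
  unfolding rect_approx_def
proof (intro allI impI)
  fix e :: real assume e: "e > 0"
  then have e4: "e / 4 > 0" by simp
  have "\<forall>\<^sub>F n in sequentially. nn_sq lborel2 (\<lambda>s. f s - h n s) < ennreal (e / 4)"
    using lim e4 by (intro order_tendstoD) auto
  then obtain n where n: "nn_sq lborel2 (\<lambda>s. f s - h n s) \<le> ennreal (e / 4)"
    by (auto simp: eventually_sequentially intro: less_imp_le)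
  obtain F where F: "rect_step D F" "nn_sq lborel2 (\<lambda>s. h n s - F s) \<le> ennreal (e / 4)"
    using h e4 unfolding rect_approx_def by blast
  note [measurable] = rect_step_measurable[OF F(1)]
  have "(\<integral>\<^sup>+s. ennreal (((f s - h n s) + (h n s - F s))\<^sup>2) \<partial>lborel2) \<le> ennreal (2 * (e / 4) + 2 * (e / 4))"
    by (rule nn_integral_square_add) (use F n e in auto)
  then show "\<exists>F. rect_step D F \<and> (nn_sq lborel2 (\<lambda>s. f s - F s)) \<le> ennreal e"
    using F(1) by (intro exI[of _ F]) simp
qed

lemma nn_square_tendsto_0:
  fixes f :: "'x \<Rightarrow> real" and h :: "nat \<Rightarrow> 'x \<Rightarrow> real"
  assumes [measurable]: "f \<in> borel_measurable M" "\<And>n. h n \<in> borel_measurable M"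
    and fin: "nn_sq M f < \<infinity>"
    and le: "\<And>n x. x \<in> space M \<Longrightarrow> \<bar>f x - h n x\<bar> \<le> \<bar>f x\<bar>" and lim: "\<And>x. x \<in> space M \<Longrightarrow> (\<lambda>n. h n x) \<longlonglongrightarrow> f x"
  shows "(\<lambda>n. \<integral>\<^sup>+x. ennreal ((f x - h n x)\<^sup>2) \<partial>M) \<longlonglongrightarrow> 0"
proof -
  have "(\<lambda>n. \<integral>\<^sup>+x. ennreal ((f x - h n x)\<^sup>2) \<partial>M) \<longlonglongrightarrow> (\<integral>\<^sup>+x. 0 \<partial>M)"
  proof (rule nn_integral_dominated_convergence[OF _ _ _ _ fin])
    show "AE x in M. ennreal ((f x - h j x)\<^sup>2) \<le> ennreal ((f x)\<^sup>2)" for j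
      using power_mono[OF le, of _ j 2] by (auto intro!: AE_I2 ennreal_leI)
    show "AE x in M. (\<lambda>n. ennreal ((f x - h n x)\<^sup>2)) \<longlonglongrightarrow> 0"
    proof (rule AE_I2)
      fix x assume "x \<in> space M"
      from lim[OF this] have "(\<lambda>n. ennreal ((f x - h n x)\<^sup>2)) \<longlonglongrightarrow> ennreal ((f x - f x)\<^sup>2)"
        by (intro tendsto_intros tendsto_ennrealI)
      then show "(\<lambda>n. ennreal ((f x - h n x)\<^sup>2)) \<longlonglongrightarrow> 0" by simp
    qed
  qed measurable
  then show ?thesis by simp
qed

text \<open>A Dynkin argument: rectangles form a generating family stable under intersection, and
  complements within D x D and countable disjoint unions keep the property. Since D x D has finite
  measure, the partial sums of a disjoint union converge in L^2.\<close>

lemma rect_approx_set: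
  fixes D :: "'a::euclidean_space set"
  assumes D: "D \<in> finite_borel" and S: "S \<in> sets lborel2"
  shows "rect_approx D (indicator (S \<inter> D \<times> D))"
proof -
  have Dm[measurable]: "D \<in> sets borel" using D by (simp add: finite_borel_def)
  have DD: "emeasure lborel2 (D \<times> D) < \<infinity>"
    using D by (simp add: lborel.emeasure_pair_measure_Times finite_borel_def ennreal_mult_less_top)
  have DDm[measurable]: "D \<times> D \<in> sets lborel2" by (intro pair_measureI) auto
  have r1: "rect_step D (indicator (A \<times> B \<inter> D \<times> D))" if "A \<in> sets borel" "B \<in> sets borel" for A B
  proof -
    have "rect_step D (\<lambda>s. 1 * (indicator (A \<inter> D) (fst s) * indicator (B \<inter> D) (snd s)))"
      using that by (intro rect_step.rect) auto
    moreover have "(\<lambda>s. 1 * (indicator (A \<inter> D) (fst s) * indicator (B \<inter> D) (snd s)) :: real) = indicator (A \<times> B \<inter> D \<times> D)"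
      by (auto simp: indicator_def)
    ultimately show ?thesis by simp
  qed
  have fin: "nn_sq lborel2 (\<lambda>s. indicator (T \<inter> D \<times> D) s :: real) < \<infinity>" if [measurable]: "T \<in> sets lborel2" for T
  proof -
    have "(\<integral>\<^sup>+s. ennreal ((indicator (T \<inter> D \<times> D) s :: real)\<^sup>2) \<partial>lborel2) \<le> (\<integral>\<^sup>+s. indicator (D \<times> D) s \<partial>lborel2)"
      by (intro nn_integral_mono) (auto simp: indicator_def)
    also have "\<dots> < \<infinity>" using DD by simp
    finally show ?thesis .
  qed
  have "S \<in> sigma_sets (space lborel \<times> space lborel) {a \<times> b | a b. a \<in> sets lborel \<and> b \<in> sets (lborel :: 'a measure)}"
    using S by (simp only: sets_pair_measure)
  with Int_stable_pair_measure_generator pair_measure_closed show ?thesis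
  proof (induction rule: sigma_sets_induct_disjoint)
    case (basic A)
    then show ?case by (auto intro!: rect_approx_step r1)
  next
    case empty
    show ?case using rect_approx_step[OF rect_step_0] by simp
  next
    case (compl A)
    have Am[measurable]: "A \<in> sets lborel2" using compl(1) by (simp only: sets_pair_measure)
    have "rect_approx D (\<lambda>s. indicator (UNIV \<times> UNIV \<inter> D \<times> D) s + (- 1) * indicator (A \<inter> D \<times> D) s)"
      by (intro rect_approx_add rect_approx_scale rect_approx_step r1 compl) measurable
    moreover have "(\<lambda>s. indicator (UNIV \<times> UNIV \<inter> D \<times> D) s + (- 1) * indicator (A \<inter> D \<times> D) s :: real) = indicator ((space lborel \<times> space lborel - A) \<inter> D \<times> D)"
      by (auto simp: indicator_def)
    ultimately show ?case by simp
  next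
    case (union A)
    have Am[measurable]: "A i \<in> sets lborel2" for i using union(2) by (simp only: sets_pair_measure) blast
    define h where "h n s = (\<Sum>i<n. indicator (A i \<inter> D \<times> D) s :: real)" for n s
    have hm[measurable]: "h n \<in> borel_measurable lborel2" for n unfolding h_def[abs_def] by measurable
    have ha: "rect_approx D (h n)" for n
    proof (induction n)
      case 0
      show ?case using rect_approx_step[OF rect_step_0] by (simp add: h_def[abs_def])
    next
      case (Suc n)
      have "rect_approx D (\<lambda>s. h n s + indicator (A n \<inter> D \<times> D) s)"
        by (intro rect_approx_add Suc union) measurable
      then show ?case by (simp add: h_def[abs_def])
    qed
    have hs: "h n s = (if s \<in> (\<Union>i<n. A i) \<inter> D \<times> D then 1 else 0)" for n s
    proof (induction n)
      case (Suc n)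
      have "A i \<inter> A n = {}" if "i < n" for i using union(1) that by (auto simp: disjoint_family_on_def)
      then have d: "s \<in> A n \<Longrightarrow> s \<notin> (\<Union>i<n. A i)" by blast
      have "h (Suc n) s = h n s + indicator (A n \<inter> D \<times> D) s" by (simp add: h_def)
      then show ?case unfolding Suc using d by (auto simp: indicator_def less_Suc_eq)
    qed (simp add: h_def)
    show ?case
    proof (rule rect_approx_limit[OF ha hm])
      show "(\<lambda>n. \<integral>\<^sup>+s. ennreal ((indicator ((\<Union>i. A i) \<inter> D \<times> D) s - h n s)\<^sup>2) \<partial>lborel2) \<longlonglongrightarrow> 0"
      proof (rule nn_square_tendsto_0[OF _ hm fin])
        fix s :: "'a \<times> 'a"
        show "\<bar>indicator ((\<Union>i. A i) \<inter> D \<times> D) s - h n s\<bar> \<le> \<bar>indicator ((\<Union>i. A i) \<inter> D \<times> D) s :: real\<bar>" for n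
          unfolding hs by (auto simp: indicator_def)
        show "(\<lambda>n. h n s) \<longlonglongrightarrow> indicator ((\<Union>i. A i) \<inter> D \<times> D) s"
        proof (cases "s \<in> (\<Union>i. A i) \<inter> D \<times> D")
          case True
          then obtain i where i: "s \<in> A i" by auto
          have "\<forall>\<^sub>F n in sequentially. h n s = 1"
            using eventually_gt_at_top[of i] by eventually_elim (use True i in \<open>auto simp: hs\<close>)
          then show ?thesis using True by (simp add: tendsto_eventually)
        next
          case False
          then have "h n s = 0" for n unfolding hs by auto
          then show ?thesis using False by simp
        qed
      qed measurable
    qed measurable
  qed
qed

text \<open>Nonnegative functions are built from indicators by sums, multiples and increasing
  limits, and rectangle approximation in L^2 survives each operation.\<close>

lemma rect_approx_square_integrable:
  fixes D :: "'a::euclidean_space set"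
  assumes D: "D \<in> finite_borel" and H: "H \<in> borel_measurable lborel2" and H0: "\<And>s. 0 \<le> H s"
    and fin: "nn_sq lborel2 (\<lambda>s. H s * indicator (D \<times> D) s) < \<infinity>"
  shows "rect_approx D (\<lambda>s. H s * indicator (D \<times> D) s)"
proof -
  have Dm[measurable]: "D \<in> sets borel" using D by (simp add: finite_borel_def)
  have DDm[measurable]: "D \<times> D \<in> sets lborel2" by (intro pair_measureI) auto
  \<comment> \<open>Finiteness is carried as a premise inside the induction: it passes from the
    function to the smaller pieces it is composed of.\<close>
  have "(\<integral>\<^sup>+s. ennreal ((H s * indicator (D \<times> D) s)\<^sup>2) \<partial>lborel2) < \<infinity> \<longrightarrow> rect_approx D (\<lambda>s. H s * indicator (D \<times> D) s)"
    using H H0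
  proof (induction rule: borel_measurable_induct_real)
    case (set A)
    have "(\<lambda>s. indicator A s * indicator (D \<times> D) s :: real) = indicator (A \<inter> D \<times> D)" by (auto simp: indicator_def)
    then show ?case using rect_approx_set[OF D set] by simp
  next
    case (mult u c)
    note [measurable] = mult(2)
    show ?case
    proof (cases "c = 0")
      case True
      show ?thesis using True rect_approx_step[OF rect_step_0] by simp
    next
      case False
      have "nn_sq lborel2 (\<lambda>s. c * u s * indicator (D \<times> D) s) = ennreal (c\<^sup>2) * nn_sq lborel2 (\<lambda>s. u s * indicator (D \<times> D) s)"
        unfolding mult.assoc power_mult_distrib[of c] by (simp add: ennreal_mult' nn_integral_cmult)
      then have "rect_approx D (\<lambda>s. c * (u s * indicator (D \<times> D) s))" if "nn_sq lborel2 (\<lambda>s. c * u s * indicator (D \<times> D) s) < \<infinity>"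
        using that mult(4) False by (intro rect_approx_scale) (auto simp: ennreal_mult_less_top)
      then show ?thesis by (simp add: mult.assoc)
    qed
  next
    case (add u v)
    note [measurable] = add.hyps(1,3)
    show ?case
    proof
      assume f: "nn_sq lborel2 (\<lambda>s. (v s + u s) * indicator (D \<times> D) s) < \<infinity>"
      have "nn_sq lborel2 (\<lambda>s. u s * indicator (D \<times> D) s) < \<infinity>"
        by (rule le_less_trans[OF nn_integral_mono f], intro ennreal_leI power_mono mult_right_mono) (use add.hyps(2,4) in auto)
      moreover have "nn_sq lborel2 (\<lambda>s. v s * indicator (D \<times> D) s) < \<infinity>"
        by (rule le_less_trans[OF nn_integral_mono f], intro ennreal_leI power_mono mult_right_mono) (use add.hyps(2,4) in auto)
      ultimately have "rect_approx D (\<lambda>s. v s * indicator (D \<times> D) s + u s * indicator (D \<times> D) s)"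
        using add.IH by (intro rect_approx_add) auto
      then show "rect_approx D (\<lambda>s. (v s + u s) * indicator (D \<times> D) s)" by (simp add: distrib_right)
    qed
  next
    case (seq U)
    note [measurable] = seq.hyps(1)
    have Hm[measurable]: "H \<in> borel_measurable lborel2" by fact
    have le: "U i s \<le> H s" for i s
      by (rule incseq_le[OF _ seq.hyps(4)]) (use seq.hyps(3) in \<open>cases s, auto simp: incseq_def le_fun_def space_pair_measure\<close>)
    show ?case
    proof
      assume f: "nn_sq lborel2 (\<lambda>s. H s * indicator (D \<times> D) s) < \<infinity>"
      have a: "rect_approx D (\<lambda>s. U i s * indicator (D \<times> D) s)" for i
      proof -
        have "nn_sq lborel2 (\<lambda>s. U i s * indicator (D \<times> D) s) < \<infinity>"
          by (rule le_less_trans[OF nn_integral_mono f], intro ennreal_leI power_mono mult_right_mono) (use seq.hyps(2) le in auto)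
        then show ?thesis using seq.IH by blast
      qed
      show "rect_approx D (\<lambda>s. H s * indicator (D \<times> D) s)"
      proof (rule rect_approx_limit[OF a])
        show "(\<lambda>n. \<integral>\<^sup>+s. ennreal ((H s * indicator (D \<times> D) s - U n s * indicator (D \<times> D) s)\<^sup>2) \<partial>lborel2) \<longlonglongrightarrow> 0"
        proof (rule nn_square_tendsto_0[OF _ _ f])
          fix s :: "'a \<times> 'a" assume s: "s \<in> space lborel2"
          show "\<bar>H s * indicator (D \<times> D) s - U n s * indicator (D \<times> D) s\<bar> \<le> \<bar>H s * indicator (D \<times> D) s\<bar>" for n
            using seq.hyps(2)[of n s] le[of n s] by (auto simp: indicator_def)
          show "(\<lambda>n. U n s * indicator (D \<times> D) s) \<longlonglongrightarrow> H s * indicator (D \<times> D) s"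
            by (intro tendsto_intros seq.hyps(4) s)
        qed measurable
      qed measurable
    qed
  qed
  then show ?thesis using fin by blast
qed

section \<open>Green operators with a random potential\<close>

lemma nn_integral_tendsto_0:
  assumes [measurable]: "\<And>i. u i \<in> borel_measurable M" "w \<in> borel_measurable M"
    and "\<And>j. AE x in M. u j x \<le> w x" "(\<integral>\<^sup>+x. w x \<partial>M) < \<infinity>" "AE x in M. (\<lambda>i. u i x) \<longlonglongrightarrow> 0"
  shows "(\<lambda>i. (\<integral>\<^sup>+x. u i x \<partial>M)) \<longlonglongrightarrow> 0"
  using nn_integral_dominated_convergence[of u M "\<lambda>_. 0" w] assms by simp

locale random_green = stationary_field M q \<phi> + green_kernel D \<Gamma> C
  for M :: "'w measure" and q :: "'a::euclidean_space \<Rightarrow> 'w \<Rightarrow> real" and \<phi> and D :: "'a set" and \<Gamma> and C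
begin

lemma qs_measurable[measurable]: "(\<lambda>(y, w). qs ep y w) \<in> borel_measurable (lborel \<Otimes>\<^sub>M M)"
  unfolding qs_def by measurable

lemma qs_measurable1[measurable]: "qs ep y \<in> borel_measurable M" unfolding qs_def[abs_def] by measurable
lemma qs_measurable2[measurable]: "w \<in> space M \<Longrightarrow> (\<lambda>y. qs ep y w) \<in> borel_measurable borel"
  using measurable_compose[OF measurable_Pair2', of w M "\<lambda>(y, w). qs ep y w" lborel borel] qs_measurable by simp

text \<open>The cut-off to \<open>D\<close> makes the potential almost surely square integrable over
  the whole space, see \<open>AE_Qf\<close>.\<close>

definition Qf :: "real \<Rightarrow> 'w \<Rightarrow> 'a \<Rightarrow> real" where "Qf ep w y = indicator D y * qs ep y w"

lemma Qf_measurable[measurable]: "(\<lambda>(y, w). Qf ep w y) \<in> borel_measurable (lborel \<Otimes>\<^sub>M M)"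
  unfolding Qf_def by measurable
lemma Qf_measurable2[measurable]: "w \<in> space M \<Longrightarrow> Qf ep w \<in> borel_measurable borel"
  unfolding Qf_def[abs_def] by measurable

definition vD :: real where "vD = measure lborel D"

lemma emeasure_D: "emeasure lborel D = ennreal vD"
  using D_finite by (simp add: finite_borel_def vD_def emeasure_eq_ennreal_measure less_top)

lemma vD_nonneg: "0 \<le> vD" by (simp add: vD_def)

lemma K_ge_1: "1 \<le> K" by (simp add: K_def)

lemma \<phi>_tendsto_0: "(\<phi> \<longlongrightarrow> 0) at_top"
proof -
  have d1: "1 \<le> DIM('a)" by (simp add: DIM_positive Suc_leI)
  have decay: "((\<lambda>l. l ^ (2 * DIM('a)) * \<phi> l) \<longlongrightarrow> 0) at_top"
    by (rule mixing_rate_decay[OF \<phi>_nonneg \<phi>_anti \<phi>_int d1])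
  show ?thesis
  proof (rule Lim_null_comparison[OF _ decay])
    show "\<forall>\<^sub>F t in at_top. norm (\<phi> t) \<le> t ^ (2 * DIM('a)) * \<phi> t"
      using eventually_ge_at_top[of 1]
    proof eventually_elim
      case (elim t)
      have "1 * \<phi> t \<le> t ^ (2 * DIM('a)) * \<phi> t" using elim \<phi>_nonneg[of t] by (intro mult_right_mono one_le_power) auto
      then show ?case using elim \<phi>_nonneg[of t] by simp
    qed
  qed
qed

sublocale MP: pair_sigma_finite M lborel ..

lemma Qf_second_moment:
  assumes ep: "ep > 0"
  shows "(\<integral>\<^sup>+w. \<integral>\<^sup>+y. ennreal ((Qf ep w y)\<^sup>2) \<partial>lborel \<partial>M) \<le> ennreal (2 * K * vD)"
proof -
  interpret mf: mixing_field M "qs ep" "\<phi>s ep" K by (rule scaled_mixing_field[OF ep])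
  have "(\<integral>\<^sup>+w. \<integral>\<^sup>+y. ennreal ((Qf ep w y)\<^sup>2) \<partial>lborel \<partial>M) = (\<integral>\<^sup>+y. \<integral>\<^sup>+w. ennreal ((Qf ep w y)\<^sup>2) \<partial>M \<partial>lborel)"
    by (rule MP.Fubini'[symmetric]) measurable
  also have "\<dots> \<le> (\<integral>\<^sup>+y. ennreal (2 * K) * indicator D y \<partial>lborel)"
  proof (rule nn_integral_mono)
    fix y
    have "(\<integral>\<^sup>+w. ennreal ((qs ep y w)\<^sup>2) \<partial>M) \<le> ennreal (2 * K)"
      using mf.Q_square[of y] by (simp add: square_integrable_nn_eq ennreal_leI)
    then show "nn_sq M (\<lambda>w. Qf ep w y) \<le> ennreal (2 * K) * indicator D y"
      by (cases "y \<in> D") (auto simp: Qf_def)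
  qed
  also have "\<dots> = ennreal (2 * K * vD)"
    using K_ge_1 vD_nonneg by (simp add: nn_integral_cmult emeasure_D ennreal_mult[symmetric])
  finally show ?thesis .
qed

text \<open>The fixed factor at z enters squared, as a function of one value of the field; the
  three-point bound then gives a decay in y and y' that is uniform in z. The halved distance and the
  2 in the scaled rate cancel.\<close>

lemma three_point_variance:
  assumes ep: "ep > 0" and h[measurable]: "h \<in> borel_measurable borel" and hi: "integrable lborel h"
  shows "(\<integral>\<^sup>+w. ennreal (((LINT y|lborel. h y * qs ep y w) * qs ep z w)\<^sup>2) \<partial>M)
    \<le> (\<integral>\<^sup>+y. \<integral>\<^sup>+y'. ennreal (4 * K) * (eabs (h y) * (eabs (h y') * ennreal (\<phi> (dist y y' / ep)))) \<partial>lborel \<partial>lborel)"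
proof -
  interpret mf: mixing_field M "qs ep" "\<phi>s ep" K by (rule scaled_mixing_field[OF ep])
  let ?F = "\<lambda>y w. h y * (qs ep y w * qs ep z w)"
  interpret F: L2_field M lborel ?F "\<lambda>y. \<bar>h y\<bar> * sqrt (2 * K)"
  proof (intro_locales, unfold_locales)
    show "(\<lambda>(p, w). ?F p w) \<in> borel_measurable (lborel \<Otimes>\<^sub>M M)" by measurable
    show "integrable M (\<lambda>w. (?F p w)\<^sup>2)" for p
      using mf.Q_pair_square(1)[of p z] unfolding power_mult_distrib[of "h p"] by (simp add: square_integrable_def)
    show "(LINT w|M. (?F p w)\<^sup>2) \<le> (\<bar>h p\<bar> * sqrt (2 * K))\<^sup>2" for p
      using mf.Q_pair_square(2)[of p z] K_ge_1 unfolding power_mult_distrib[of "h p"] by (simp add: power_mult_distrib mult_left_mono)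
    show "integrable lborel (\<lambda>y. \<bar>h y\<bar> * sqrt (2 * K))" using hi by simp
  qed (use K_ge_1 in auto)
  have eq: "(LINT y|lborel. ?F y w) = (LINT y|lborel. h y * qs ep y w) * qs ep z w" for w
    unfolding mult.assoc[symmetric] by (rule integral_mult_left_zero)
  have c: "(LINT w|M. ?F y w * ?F y' w) = h y * h y' * (LINT w|M. (qs ep z w)\<^sup>2 * (qs ep y w * qs ep y' w))" for y y'
    unfolding integral_mult_right_zero[symmetric] by (simp only: power2_eq_square mult_ac)
  have "(\<integral>\<^sup>+w. ennreal (((LINT y|lborel. h y * qs ep y w) * qs ep z w)\<^sup>2) \<partial>M) = ennreal (LINT w|M. (LINT y|lborel. ?F y w)\<^sup>2)"
    using square_integrable_nn_eq[OF F.integral_square_integrable] unfolding eq .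
  also have "\<dots> \<le> eabs (LINT y|lborel. LINT y'|lborel. LINT w|M. ?F y w * ?F y' w)"
    unfolding F.integral_square_eq by (intro ennreal_leI abs_ge_self)
  also have "\<dots> \<le> (\<integral>\<^sup>+y. \<integral>\<^sup>+y'. eabs (LINT w|M. ?F y w * ?F y' w) \<partial>lborel \<partial>lborel)"
    by (rule double_integral_le_nn)
  also have "\<dots> \<le> (\<integral>\<^sup>+y. \<integral>\<^sup>+y'. ennreal (4 * K) * (eabs (h y) * (eabs (h y') * ennreal (\<phi> (dist y y' / ep)))) \<partial>lborel \<partial>lborel)"
  proof (intro nn_integral_mono)
    fix y y'
    have "\<bar>LINT w|M. (qs ep z w)\<^sup>2 * (qs ep y w * qs ep y' w)\<bar> \<le> 4 * K * \<phi>s ep (dist y y' / 2)"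
      by (rule mf.three_point) auto
    then have "\<bar>LINT w|M. ?F y w * ?F y' w\<bar> \<le> \<bar>h y\<bar> * \<bar>h y'\<bar> * (4 * K * \<phi> (dist y y' / ep))"
      unfolding c abs_mult by (intro mult_left_mono) (auto simp: \<phi>s_def)
    also have "\<dots> = 4 * K * (\<bar>h y\<bar> * (\<bar>h y'\<bar> * \<phi> (dist y y' / ep)))" by (simp only: mult_ac)
    finally have "eabs (LINT w|M. ?F y w * ?F y' w) \<le> ennreal (4 * K * (\<bar>h y\<bar> * (\<bar>h y'\<bar> * \<phi> (dist y y' / ep))))" by (rule ennreal_leI)
    also have "\<dots> = ennreal (4 * K) * (eabs (h y) * (eabs (h y') * ennreal (\<phi> (dist y y' / ep))))"
      using K_ge_1 by (simp only: ennreal_mult' abs_ge_zero)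
    finally show "eabs (LINT w|M. ?F y w * ?F y' w) \<le> ennreal (4 * K) * (eabs (h y) * (eabs (h y') * ennreal (\<phi> (dist y y' / ep))))" .
  qed
  finally show ?thesis .
qed

text \<open>A monotone function is Borel, but \<phi> is monotone on the nonnegative half line only;
  hence the truncation by max 0, invisible at distances.\<close>

lemma \<phi>_measurable[measurable]: "(\<lambda>s. ennreal (\<phi> (dist (fst s) (snd s) / ep))) \<in> borel_measurable (lborel \<Otimes>\<^sub>M (lborel :: 'a measure))" if "ep > 0"
proof -
  have "(\<lambda>x. \<phi> (max 0 x)) \<in> borel_measurable borel"
  proof -
    have "mono (\<lambda>x. - \<phi> (max 0 x))" by (intro monoI) (auto intro!: \<phi>_anti)
    then have "(\<lambda>x. - \<phi> (max 0 x)) \<in> borel_measurable borel" by (rule borel_measurable_mono)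
    from borel_measurable_uminus[OF this] show ?thesis by simp
  qed
  then have [measurable]: "(\<lambda>x. \<phi> (max 0 x)) \<in> borel_measurable borel" .
  have "(\<lambda>s :: 'a \<times> 'a. ennreal (\<phi> (max 0 (dist (fst s) (snd s) / ep)))) \<in> borel_measurable lborel2" by measurable
  then show ?thesis using that by simp
qed

text \<open>Dominated convergence in each of the three integrals, with \<phi>(0) in place of the
  rate as majorant. Pointwise the integrand vanishes in the limit for y' different from y, because
  dist(y, y') / e n tends to infinity there.\<close>

lemma kernel_decay:
  fixes \<Lambda> :: "'p measure" and h :: "'p \<Rightarrow> 'a \<Rightarrow> real"
  assumes h[measurable]: "(\<lambda>(p, y). h p y) \<in> borel_measurable (\<Lambda> \<Otimes>\<^sub>M lborel)"
    and fin: "(\<integral>\<^sup>+p. (\<integral>\<^sup>+y. eabs (h p y) \<partial>lborel)\<^sup>2 \<partial>\<Lambda>) < \<infinity>"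
    and e: "\<And>n. e n > 0" "e \<longlonglongrightarrow> 0"
  shows "(\<lambda>n. \<integral>\<^sup>+p. \<integral>\<^sup>+y. \<integral>\<^sup>+y'. ennreal (4 * K) * (eabs (h p y) * (eabs (h p y') * ennreal (\<phi> (dist y y' / e n)))) \<partial>lborel \<partial>lborel \<partial>\<Lambda>) \<longlonglongrightarrow> 0"
proof -
  note [measurable] = \<phi>_measurable[OF e(1)]
  have hp[measurable]: "p \<in> space \<Lambda> \<Longrightarrow> h p \<in> borel_measurable borel" for p
    using measurable_compose[OF measurable_Pair1', of p \<Lambda> "\<lambda>(p, y). h p y" lborel borel] h by simp
  define c where "c = ennreal (4 * K) * ennreal (\<phi> 0)"
  define I where "I p = (\<integral>\<^sup>+y. eabs (h p y) \<partial>lborel)" for p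
  have Im[measurable]: "I \<in> borel_measurable \<Lambda>" unfolding I_def[abs_def] by (rule lborel.borel_measurable_nn_integral) measurable
  have c_fin: "c < \<infinity>" by (simp add: c_def ennreal_mult_less_top)
  have le: "ennreal (4 * K) * (a * (b * ennreal (\<phi> (dist y y' / e n)))) \<le> c * (a * b)" for a b and y y' :: 'a and n
  proof -
    have "ennreal (\<phi> (dist y y' / e n)) \<le> ennreal (\<phi> 0)" using e(1)[of n] by (intro ennreal_leI \<phi>_anti) auto
    then have "ennreal (4 * K) * (a * (b * ennreal (\<phi> (dist y y' / e n)))) \<le> ennreal (4 * K) * (a * (b * ennreal (\<phi> 0)))"
      by (intro mult_left_mono) auto
    then show ?thesis by (simp only: c_def mult_ac)
  qed
  have fp: "AE p in \<Lambda>. I p < \<infinity>"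
  proof -
    have "AE p in \<Lambda>. (I p)\<^sup>2 \<noteq> \<infinity>" using fin by (intro nn_integral_PInf_AE) (auto simp: I_def)
    then show ?thesis by eventually_elim (auto simp: power2_eq_square ennreal_mult_eq_top_iff less_top[symmetric])
  qed
  have inner: "(\<lambda>n. \<integral>\<^sup>+y'. ennreal (4 * K) * (eabs (h p y) * (eabs (h p y') * ennreal (\<phi> (dist y y' / e n)))) \<partial>lborel) \<longlonglongrightarrow> 0"
    if p: "p \<in> space \<Lambda>" "I p < \<infinity>" for p y
  proof (rule nn_integral_tendsto_0[where w = "\<lambda>y'. c * (eabs (h p y) * eabs (h p y'))"])
    have [measurable]: "h p \<in> borel_measurable borel" by (rule hp[OF p(1)])
    have ym: "(\<lambda>y'. ennreal (\<phi> (dist y y' / e n))) \<in> borel_measurable lborel" for n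
      using measurable_compose[OF measurable_Pair1', of y lborel "\<lambda>s. ennreal (\<phi> (dist (fst s) (snd s) / e n))" lborel borel] \<phi>_measurable[OF e(1)] by simp
    note [measurable] = ym
    show "(\<lambda>y'. ennreal (4 * K) * (eabs (h p y) * (eabs (h p y') * ennreal (\<phi> (dist y y' / e n))))) \<in> borel_measurable lborel" for n
      using ym[of n] by measurable
    show "(\<lambda>y'. c * (eabs (h p y) * eabs (h p y'))) \<in> borel_measurable lborel" by measurable
    show "AE y' in lborel. ennreal (4 * K) * (eabs (h p y) * (eabs (h p y') * ennreal (\<phi> (dist y y' / e n)))) \<le> c * (eabs (h p y) * eabs (h p y'))" for n
      by (intro AE_I2 le)
    have "(\<integral>\<^sup>+y'. c * (eabs (h p y) * eabs (h p y')) \<partial>lborel) = c * (eabs (h p y) * I p)"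
      by (simp add: nn_integral_cmult I_def)
    then show "(\<integral>\<^sup>+y'. c * (eabs (h p y) * eabs (h p y')) \<partial>lborel) < \<infinity>"
      using p(2) c_fin by (simp add: ennreal_mult_less_top)
    show "AE y' in lborel. (\<lambda>n. ennreal (4 * K) * (eabs (h p y) * (eabs (h p y') * ennreal (\<phi> (dist y y' / e n))))) \<longlonglongrightarrow> 0"
      \<comment> \<open>Only the diagonal point y' = y, a null set, escapes the decay of the
        rate.\<close>
      using AE_lborel_singleton[of y]
    proof eventually_elim
      case (elim y')
      then have d: "dist y y' > 0" by simp
      have "filterlim e (at_right 0) sequentially"
      proof -
        have "e n \<in> {0<..} \<and> e n \<noteq> 0" for n using e(1)[of n] by simp
        then show ?thesis using e(2) unfolding filterlim_at by simp
      qed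
      then have "filterlim (\<lambda>n. inverse (e n)) at_top sequentially"
        by (rule filterlim_compose[OF filterlim_inverse_at_top_right])
      then have "filterlim (\<lambda>n. dist y y' / e n) at_top sequentially"
        unfolding divide_inverse using filterlim_tendsto_pos_mult_at_top[OF tendsto_const d] by blast
      then have "(\<lambda>n. ennreal (\<phi> (dist y y' / e n))) \<longlonglongrightarrow> ennreal 0"
        by (intro tendsto_ennrealI filterlim_compose[OF \<phi>_tendsto_0])
      then have "(\<lambda>n. ennreal (4 * K) * (eabs (h p y) * (eabs (h p y') * ennreal (\<phi> (dist y y' / e n))))) \<longlonglongrightarrow> ennreal (4 * K) * (eabs (h p y) * (eabs (h p y') * ennreal 0))"
        by (intro ennreal_tendsto_cmult) auto
      then show ?case by simp
    qed
  qed
  have m1: "(\<lambda>y. \<integral>\<^sup>+y'. ennreal (4 * K) * (eabs (h p y) * (eabs (h p y') * ennreal (\<phi> (dist y y' / e n)))) \<partial>lborel) \<in> borel_measurable lborel"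
    if p: "p \<in> space \<Lambda>" for p n
  proof (rule lborel.borel_measurable_nn_integral)
    have [measurable]: "h p \<in> borel_measurable borel" by (rule hp[OF p(1)])
    have "(\<lambda>s. ennreal (4 * K) * (eabs (h p (fst s)) * (eabs (h p (snd s)) * ennreal (\<phi> (dist (fst s) (snd s) / e n))))) \<in> borel_measurable lborel2"
      using \<phi>_measurable[OF e(1)] by measurable
    then show "(\<lambda>(y, y'). ennreal (4 * K) * (eabs (h p y) * (eabs (h p y') * ennreal (\<phi> (dist y y' / e n))))) \<in> borel_measurable lborel2"
      by (simp only: case_prod_unfold)
  qed
  have b1: "(\<integral>\<^sup>+y'. ennreal (4 * K) * (eabs (h p y) * (eabs (h p y') * ennreal (\<phi> (dist y y' / e n)))) \<partial>lborel) \<le> c * (eabs (h p y) * I p)"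
    if p: "p \<in> space \<Lambda>" for p y n
  proof -
    have [measurable]: "h p \<in> borel_measurable borel" by (rule hp[OF p(1)])
    have "(\<integral>\<^sup>+y'. ennreal (4 * K) * (eabs (h p y) * (eabs (h p y') * ennreal (\<phi> (dist y y' / e n)))) \<partial>lborel) \<le> (\<integral>\<^sup>+y'. c * (eabs (h p y) * eabs (h p y')) \<partial>lborel)"
      by (intro nn_integral_mono le)
    also have "\<dots> = c * (eabs (h p y) * I p)" by (simp add: nn_integral_cmult I_def)
    finally show ?thesis .
  qed
  have b2: "(\<integral>\<^sup>+y. c * (eabs (h p y) * I p) \<partial>lborel) = c * (I p)\<^sup>2" if p: "p \<in> space \<Lambda>" for p
  proof -
    have [measurable]: "h p \<in> borel_measurable borel" by (rule hp[OF p(1)])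
    show ?thesis by (simp add: nn_integral_cmult nn_integral_multc I_def power2_eq_square)
  qed
  have middle: "(\<lambda>n. \<integral>\<^sup>+y. \<integral>\<^sup>+y'. ennreal (4 * K) * (eabs (h p y) * (eabs (h p y') * ennreal (\<phi> (dist y y' / e n)))) \<partial>lborel \<partial>lborel) \<longlonglongrightarrow> 0"
    if p: "p \<in> space \<Lambda>" "I p < \<infinity>" for p
  proof (rule nn_integral_tendsto_0[where w = "\<lambda>y. c * (eabs (h p y) * I p)"])
    have [measurable]: "h p \<in> borel_measurable borel" by (rule hp[OF p(1)])
    show "(\<lambda>y. c * (eabs (h p y) * I p)) \<in> borel_measurable lborel" by measurable
    show "(\<integral>\<^sup>+y. c * (eabs (h p y) * I p) \<partial>lborel) < \<infinity>"
      unfolding b2[OF p(1)] using p(2) c_fin by (simp add: ennreal_mult_less_top power2_eq_square)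
  qed (use m1 b1 inner p in \<open>auto intro!: AE_I2\<close>)
  show ?thesis
  proof (rule nn_integral_tendsto_0[where w = "\<lambda>p. c * (I p)\<^sup>2"])
    show "(\<lambda>p. \<integral>\<^sup>+y. \<integral>\<^sup>+y'. ennreal (4 * K) * (eabs (h p y) * (eabs (h p y') * ennreal (\<phi> (dist y y' / e n)))) \<partial>lborel \<partial>lborel) \<in> borel_measurable \<Lambda>" for n
    proof -
      have "(\<lambda>x. (snd (fst x), snd x)) \<in> (\<Lambda> \<Otimes>\<^sub>M lborel) \<Otimes>\<^sub>M lborel \<rightarrow>\<^sub>M lborel \<Otimes>\<^sub>M (lborel :: 'a measure)" by measurable
      from measurable_compose[OF this \<phi>_measurable[OF e(1)[of n]]]
      have m: "(\<lambda>x. ennreal (\<phi> (dist (snd (fst x)) (snd x) / e n))) \<in> borel_measurable ((\<Lambda> \<Otimes>\<^sub>M lborel) \<Otimes>\<^sub>M (lborel :: 'a measure))" by simp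
      have "(\<lambda>x. ennreal (4 * K) * (eabs (h (fst (fst x)) (snd (fst x))) * (eabs (h (fst (fst x)) (snd x)) * ennreal (\<phi> (dist (snd (fst x)) (snd x) / e n)))))
        \<in> borel_measurable ((\<Lambda> \<Otimes>\<^sub>M lborel) \<Otimes>\<^sub>M lborel)"
        by (intro borel_measurable_times_ennreal m) measurable
      then have "(\<lambda>s. \<integral>\<^sup>+y'. ennreal (4 * K) * (eabs (h (fst s) (snd s)) * (eabs (h (fst s) y') * ennreal (\<phi> (dist (snd s) y' / e n)))) \<partial>lborel) \<in> borel_measurable (\<Lambda> \<Otimes>\<^sub>M lborel)"
        by (intro lborel.borel_measurable_nn_integral) (simp only: case_prod_unfold)
      then show ?thesis by (intro lborel.borel_measurable_nn_integral) (simp only: case_prod_unfold fst_conv snd_conv)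
    qed
    show "(\<lambda>p. c * (I p)\<^sup>2) \<in> borel_measurable \<Lambda>" by measurable
    show "AE p in \<Lambda>. (\<integral>\<^sup>+y. \<integral>\<^sup>+y'. ennreal (4 * K) * (eabs (h p y) * (eabs (h p y') * ennreal (\<phi> (dist y y' / e n)))) \<partial>lborel \<partial>lborel) \<le> c * (I p)\<^sup>2" for n
    proof (rule AE_I2)
      fix p assume p: "p \<in> space \<Lambda>"
      show "(\<integral>\<^sup>+y. \<integral>\<^sup>+y'. ennreal (4 * K) * (eabs (h p y) * (eabs (h p y') * ennreal (\<phi> (dist y y' / e n)))) \<partial>lborel \<partial>lborel) \<le> c * (I p)\<^sup>2"
        unfolding b2[OF p, symmetric] by (intro nn_integral_mono b1 p)
    qed
    show "(\<integral>\<^sup>+p. c * (I p)\<^sup>2 \<partial>\<Lambda>) < \<infinity>"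
      using fin c_fin by (simp add: nn_integral_cmult ennreal_mult_less_top I_def)
    show "AE p in \<Lambda>. (\<lambda>n. \<integral>\<^sup>+y. \<integral>\<^sup>+y'. ennreal (4 * K) * (eabs (h p y) * (eabs (h p y') * ennreal (\<phi> (dist y y' / e n)))) \<partial>lborel \<partial>lborel) \<longlonglongrightarrow> 0"
      using fp AE_space by eventually_elim (rule middle)
  qed
qed

text \<open>The parameter p and the point \<zeta> p are kept abstract to serve twice: with p a point
  and \<zeta> the identity for Q G Q g, and with p a pair and \<zeta> its second component for the
  Hilbert-Schmidt norm.\<close>

lemma three_point_tendsto_0:
  fixes \<Lambda> :: "'p measure" and h :: "'p \<Rightarrow> 'a \<Rightarrow> real" and \<zeta> :: "'p \<Rightarrow> 'a"
  assumes sf: "sigma_finite_measure \<Lambda>" and h[measurable]: "(\<lambda>(p, y). h p y) \<in> borel_measurable (\<Lambda> \<Otimes>\<^sub>M lborel)"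
    and \<zeta>[measurable]: "\<zeta> \<in> borel_measurable \<Lambda>"
    and hi: "\<And>p. integrable lborel (h p)"
    and fin: "(\<integral>\<^sup>+p. (\<integral>\<^sup>+y. eabs (h p y) \<partial>lborel)\<^sup>2 \<partial>\<Lambda>) < \<infinity>"
    and e: "\<And>n. e n > 0" "e \<longlonglongrightarrow> 0"
  shows "(\<lambda>n. \<integral>\<^sup>+w. \<integral>\<^sup>+p. ennreal (((LINT y|lborel. h p y * qs (e n) y w) * qs (e n) (\<zeta> p) w)\<^sup>2) \<partial>\<Lambda> \<partial>M) \<longlonglongrightarrow> 0"
proof (rule tendsto_sandwich[OF always_eventually always_eventually tendsto_const kernel_decay[OF h fin e]])
  interpret \<Lambda>: sigma_finite_measure \<Lambda> by fact
  interpret P: pair_sigma_finite M \<Lambda> ..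
  show "\<forall>n. (\<integral>\<^sup>+w. \<integral>\<^sup>+p. ennreal (((LINT y|lborel. h p y * qs (e n) y w) * qs (e n) (\<zeta> p) w)\<^sup>2) \<partial>\<Lambda> \<partial>M)
    \<le> (\<integral>\<^sup>+p. \<integral>\<^sup>+y. \<integral>\<^sup>+y'. ennreal (4 * K) * (eabs (h p y) * (eabs (h p y') * ennreal (\<phi> (dist y y' / e n)))) \<partial>lborel \<partial>lborel \<partial>\<Lambda>)"
  proof
    fix n
    have "(\<integral>\<^sup>+w. \<integral>\<^sup>+p. ennreal (((LINT y|lborel. h p y * qs (e n) y w) * qs (e n) (\<zeta> p) w)\<^sup>2) \<partial>\<Lambda> \<partial>M)
      = (\<integral>\<^sup>+p. \<integral>\<^sup>+w. ennreal (((LINT y|lborel. h p y * qs (e n) y w) * qs (e n) (\<zeta> p) w)\<^sup>2) \<partial>M \<partial>\<Lambda>)"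
      by (rule P.Fubini'[symmetric]) measurable
    also have "\<dots> \<le> (\<integral>\<^sup>+p. \<integral>\<^sup>+y. \<integral>\<^sup>+y'. ennreal (4 * K) * (eabs (h p y) * (eabs (h p y') * ennreal (\<phi> (dist y y' / e n)))) \<partial>lborel \<partial>lborel \<partial>\<Lambda>)"
      by (intro nn_integral_mono three_point_variance e hi) (use borel_measurable_integrable[OF hi] in simp)
    finally show "(\<integral>\<^sup>+w. \<integral>\<^sup>+p. ennreal (((LINT y|lborel. h p y * qs (e n) y w) * qs (e n) (\<zeta> p) w)\<^sup>2) \<partial>\<Lambda> \<partial>M)
    \<le> (\<integral>\<^sup>+p. \<integral>\<^sup>+y. \<integral>\<^sup>+y'. ennreal (4 * K) * (eabs (h p y) * (eabs (h p y') * ennreal (\<phi> (dist y y' / e n)))) \<partial>lborel \<partial>lborel \<partial>\<Lambda>)" .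
  qed
qed simp

end

lemma ennreal_tendsto_0I:
  fixes X :: "'i \<Rightarrow> ennreal"
  assumes "\<And>r. r > 0 \<Longrightarrow> \<forall>\<^sub>F i in F. X i \<le> ennreal r"
  shows "(X \<longlongrightarrow> 0) F"
proof (rule order_tendstoI)
  fix a :: ennreal assume "0 < a"
  then obtain b where b: "0 < b" "b < a" using dense by blast
  then have bf: "b < \<infinity>" by (auto intro: less_le_trans)
  define r where "r = enn2real b"
  have r: "b = ennreal r" "r > 0" using b(1) bf by (auto simp: r_def less_top enn2real_positive_iff)
  show "\<forall>\<^sub>F i in F. X i < a" using assms[OF r(2)] by eventually_elim (use r b in \<open>auto intro: le_less_trans\<close>)
qed simp

lemma ennreal_power2_leD: "x\<^sup>2 \<le> (ennreal b)\<^sup>2 \<Longrightarrow> 0 \<le> b \<Longrightarrow> x \<le> ennreal b"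
  by (cases x) (auto simp: ennreal_power top_unique intro: power2_le_imp_le)

lemma nn_integral_times_D_le:
  assumes "\<And>x. f x \<le> c * indicator D x" and [measurable]: "D \<in> sets M"
  shows "(\<integral>\<^sup>+x. f x \<partial>M) \<le> c * emeasure M D"
proof -
  have "(\<integral>\<^sup>+x. f x \<partial>M) \<le> (\<integral>\<^sup>+x. c * indicator D x \<partial>M)" by (intro nn_integral_mono assms(1))
  then show ?thesis by (simp add: nn_integral_cmult)
qed

context random_green
begin

lemma \<Gamma>_support2: "y \<notin> D \<Longrightarrow> \<Gamma> x y = 0" using \<Gamma>_support[of y x] by (simp add: \<Gamma>_sym[of x])

lemma square_integrable_D:
  assumes [measurable]: "g \<in> borel_measurable borel" and "\<And>x. \<bar>g x\<bar> \<le> b"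
  shows "square_integrable lborel (\<lambda>x. indicator D x * g x)" "nn_sq lborel (\<lambda>x. indicator D x * g x) \<le> ennreal (b\<^sup>2 * vD)"
proof -
  have "ennreal ((indicator D x * g x)\<^sup>2) \<le> ennreal (b\<^sup>2) * indicator D x" for x
  proof -
    have "(g x)\<^sup>2 \<le> b\<^sup>2" using assms(2)[of x] by (metis abs_ge_zero power2_abs power_mono)
    then show ?thesis by (auto simp: indicator_def ennreal_leI)
  qed
  from nn_integral_times_D_le[OF this, of lborel]
  show le: "nn_sq lborel (\<lambda>x. indicator D x * g x) \<le> ennreal (b\<^sup>2 * vD)"
    using vD_nonneg by (simp add: emeasure_D ennreal_mult)
  show "square_integrable lborel (\<lambda>x. indicator D x * g x)"
    unfolding square_integrable_iff_nn using le by (auto intro: le_less_trans)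
qed

lemma Qf_Gop_Qf_tendsto_0:
  assumes g[measurable]: "g \<in> borel_measurable borel" and gb: "\<And>x. \<bar>g x\<bar> \<le> Gb" and e: "\<And>n. e n > 0" "e \<longlonglongrightarrow> 0"
  shows "(\<lambda>n. \<integral>\<^sup>+w. \<integral>\<^sup>+x. ennreal ((Qf (e n) w x * Gop (\<lambda>z. Qf (e n) w z * g z) x)\<^sup>2) \<partial>lborel \<partial>M) \<longlonglongrightarrow> 0"
proof -
  note gD = square_integrable_D[OF g gb]
  have r: "\<Gamma> x y * g y = \<Gamma> x y * (indicator D y * g y)" for x y by (cases "y \<in> D") (auto simp: \<Gamma>_support2)
  have eq: "Qf ep w x * Gop (\<lambda>z. Qf ep w z * g z) x = (LINT y|lborel. (\<Gamma> x y * g y) * qs ep y w) * qs ep x w" for ep w x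
  proof (cases "x \<in> D")
    case True
    have i: "(\<lambda>y. \<Gamma> x y * (Qf ep w y * g y)) = (\<lambda>y. (\<Gamma> x y * g y) * qs ep y w)"
      by (rule ext) (auto simp: \<Gamma>_support2 Qf_def indicator_def)
    show ?thesis using True unfolding Gop_def i by (simp add: Qf_def)
  qed (simp add: \<Gamma>_support Qf_def)
  have gi: "integrable lborel (\<lambda>x. indicator D x * g x)"
  proof -
    have "integrable lborel (\<lambda>x. indicator D x * g x * (indicator D x * 1))"
      by (rule square_integrable_mult[OF gD(1) square_integrable_D(1)[of "\<lambda>_. 1" 1]]) auto
    moreover have "indicator D x * g x * (indicator D x * 1) = indicator D x * g x" for x by (simp add: indicator_def)
    ultimately show ?thesis by (simp only:)
  qed
  show ?thesis unfolding eq
  proof (rule three_point_tendsto_0[OF _ _ _ _ _ e])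
    show "sigma_finite_measure lborel" ..
    show "(\<lambda>(x, y). \<Gamma> x y * g y) \<in> borel_measurable lborel2" by measurable
    show "(\<lambda>x. x) \<in> borel_measurable lborel" by measurable
    show "integrable lborel (\<lambda>y. \<Gamma> x y * g y)" for x unfolding r by (rule square_integrable_mult[OF \<Gamma>_sq(1) gD(1)])
    have "(\<integral>\<^sup>+x. (\<integral>\<^sup>+y. eabs (\<Gamma> x y) * eabs (indicator D y * g y) \<partial>lborel)\<^sup>2 \<partial>lborel) \<le> ennreal C * (\<integral>\<^sup>+y. eabs (indicator D y * g y) \<partial>lborel)\<^sup>2"
      by (rule Gop_nn) measurable
    also have "(\<integral>\<^sup>+y. eabs (indicator D y * g y) \<partial>lborel) = ennreal (LINT y|lborel. \<bar>indicator D y * g y\<bar>)" using gi by (intro nn_integral_eq_integral) auto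
    also have "ennreal C * (ennreal (LINT y|lborel. \<bar>indicator D y * g y\<bar>))\<^sup>2 < \<infinity>" by (simp add: ennreal_power ennreal_mult_less_top)
    finally have *: "(\<integral>\<^sup>+x. (\<integral>\<^sup>+y. eabs (\<Gamma> x y) * eabs (indicator D y * g y) \<partial>lborel)\<^sup>2 \<partial>lborel) < \<infinity>" .
    show "(\<integral>\<^sup>+x. (\<integral>\<^sup>+y. eabs (\<Gamma> x y * g y) \<partial>lborel)\<^sup>2 \<partial>lborel) < \<infinity>"
    proof -
      have "eabs (\<Gamma> x y * w) = eabs (\<Gamma> x y) * eabs w" for x y w by (simp add: abs_mult ennreal_mult')
      then show ?thesis using *  unfolding r by (simp only:)
    qed
  qed
qed

text \<open>Apart from the factor Q z, the kernel of G Q G Q at (x, z) is the integral of Q against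
  the product of the rows of x and z. By Cauchy-Schwarz this product has L^1 norm at most C, and it
  vanishes unless the pair lies in D x D, a set of finite measure.\<close>

lemma HS_tendsto_0:
  assumes e: "\<And>n. e n > 0" "e \<longlonglongrightarrow> 0"
  shows "(\<lambda>n. \<integral>\<^sup>+w. HS (Qf (e n) w) \<partial>M) \<longlonglongrightarrow> 0"
proof -
  interpret P: pair_sigma_finite "lborel :: 'a measure" "lborel :: 'a measure" ..
  let ?\<Lambda> = "(lborel :: 'a measure) \<Otimes>\<^sub>M (lborel :: 'a measure)"
  let ?h = "\<lambda>p y. \<Gamma> (fst p) y * \<Gamma> y (snd p)"
  have eq: "(\<integral>\<^sup>+w. HS (Qf ep w) \<partial>M) = (\<integral>\<^sup>+w. \<integral>\<^sup>+p. ennreal (((LINT y|lborel. ?h p y * qs ep y w) * qs ep (snd p) w)\<^sup>2) \<partial>?\<Lambda> \<partial>M)" for ep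
  proof (rule nn_integral_cong)
    fix w assume [measurable]: "w \<in> space M"
    have "(Qf ep w z * (LINT y|lborel. \<Gamma> x y * \<Gamma> y z * Qf ep w y)) = (LINT y|lborel. ?h (x, z) y * qs ep y w) * qs ep z w" for x z
    proof (cases "z \<in> D")
      case True
      have i: "(\<lambda>y. \<Gamma> x y * \<Gamma> y z * Qf ep w y) = (\<lambda>y. ?h (x, z) y * qs ep y w)"
        by (rule ext) (auto simp: \<Gamma>_support2 Qf_def indicator_def)
      show ?thesis using True unfolding i by (simp add: Qf_def)
    qed (simp add: \<Gamma>_support2 Qf_def)
    then have "HS (Qf ep w) = (\<integral>\<^sup>+x. \<integral>\<^sup>+z. ennreal (((LINT y|lborel. ?h (x, z) y * qs ep y w) * qs ep (snd (x, z)) w)\<^sup>2) \<partial>lborel \<partial>lborel)"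
      by (simp add: HS_def)
    also have "\<dots> = (\<integral>\<^sup>+p. ennreal (((LINT y|lborel. ?h p y * qs ep y w) * qs ep (snd p) w)\<^sup>2) \<partial>?\<Lambda>)"
      by (rule lborel.nn_integral_fst) measurable
    finally show "HS (Qf ep w) = (\<integral>\<^sup>+p. ennreal (((LINT y|lborel. ?h p y * qs ep y w) * qs ep (snd p) w)\<^sup>2) \<partial>?\<Lambda>)" .
  qed
  show ?thesis unfolding eq
  proof (rule three_point_tendsto_0[where h = ?h and \<zeta> = snd, OF _ _ _ _ _ e])
    show "sigma_finite_measure ?\<Lambda>" ..
    show "(\<lambda>(p, y). ?h p y) \<in> borel_measurable (?\<Lambda> \<Otimes>\<^sub>M lborel)" by measurable
    show "snd \<in> borel_measurable ?\<Lambda>" by measurable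
    show "integrable lborel (?h p)" for p
      unfolding \<Gamma>_sym[of _ "snd p"] by (rule square_integrable_mult[OF \<Gamma>_sq(1) \<Gamma>_sq(1)])
    have "(\<integral>\<^sup>+y. eabs (?h p y) \<partial>lborel)\<^sup>2 \<le> ennreal C * ennreal C * indicator (D \<times> D) p" for p
    proof (cases "p \<in> D \<times> D")
      case True
      have "(\<integral>\<^sup>+y. eabs (?h p y) \<partial>lborel) = (\<integral>\<^sup>+y. eabs (\<Gamma> (fst p) y) * eabs (\<Gamma> (snd p) y) \<partial>lborel)"
        unfolding \<Gamma>_sym[of _ "snd p"] by (simp only: abs_mult ennreal_mult abs_ge_zero)
      then have "(\<integral>\<^sup>+y. eabs (?h p y) \<partial>lborel)\<^sup>2 \<le> (\<integral>\<^sup>+y. (eabs (\<Gamma> (fst p) y))\<^sup>2 \<partial>lborel) * (\<integral>\<^sup>+y. (eabs (\<Gamma> (snd p) y))\<^sup>2 \<partial>lborel)"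
        using Cauchy_Schwarz_nn_integral[of "\<lambda>y. eabs (\<Gamma> (fst p) y)" lborel "\<lambda>y. eabs (\<Gamma> (snd p) y)"] by simp
      also have "\<dots> \<le> ennreal C * ennreal C"
        using \<Gamma>_square[of "fst p"] \<Gamma>_square[of "snd p"] by (intro mult_mono) (simp_all add: ennreal_power)
      finally show ?thesis using True by simp
    next
      case False
      then have "(\<lambda>y. eabs (?h p y)) = (\<lambda>_. 0)" by (cases p) (auto simp: \<Gamma>_support \<Gamma>_support2)
      then show ?thesis by (simp only:) simp
    qed
    then have "(\<integral>\<^sup>+p. (\<integral>\<^sup>+y. eabs (?h p y) \<partial>lborel)\<^sup>2 \<partial>?\<Lambda>) \<le> ennreal C * ennreal C * emeasure ?\<Lambda> (D \<times> D)"
      by (rule nn_integral_times_D_le) (intro pair_measureI, auto)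
    also have "\<dots> < \<infinity>" by (simp add: lborel.emeasure_pair_measure_Times emeasure_D ennreal_mult_less_top)
    finally show "(\<integral>\<^sup>+p. (\<integral>\<^sup>+y. eabs (?h p y) \<partial>lborel)\<^sup>2 \<partial>?\<Lambda>) < \<infinity>" .
  qed
qed

text \<open>A class of kernels containing \<Gamma> and the rectangle steps, and closed under sums
  and negation, so that it contains the approximation error as well. Symmetry and sign are not
  preserved by that difference.\<close>

definition square_rows :: "('a \<Rightarrow> 'a \<Rightarrow> real) \<Rightarrow> bool" where
  "square_rows H \<longleftrightarrow> (\<lambda>(x, y). H x y) \<in> borel_measurable lborel2 \<and> (\<forall>x y. x \<notin> D \<or> y \<notin> D \<longrightarrow> H x y = 0) \<and>
     (\<exists>c\<ge>0. \<forall>x. nn_sq lborel (\<lambda>y. H x y) \<le> ennreal c)"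

lemma square_rows_measurable: "square_rows H \<Longrightarrow> (\<lambda>(x, y). H x y) \<in> borel_measurable lborel2"
  by (simp add: square_rows_def)

lemma square_rows_row_measurable: "square_rows H \<Longrightarrow> H x \<in> borel_measurable borel"
  using measurable_compose[OF measurable_Pair1', of x lborel "\<lambda>(x, y). H x y" lborel borel] square_rows_measurable by simp

lemma square_rows_row: "square_rows H \<Longrightarrow> square_integrable lborel (H x)"
  unfolding square_integrable_iff_nn using square_rows_row_measurable[of H x] by (auto simp: square_rows_def intro: le_less_trans)

lemma square_rows_\<Gamma>: "square_rows \<Gamma>"
  using C_nonneg by (auto simp: square_rows_def \<Gamma>_support \<Gamma>_support2 \<Gamma>_square)

lemma square_rows_add: 
  assumes H: "square_rows H" and H': "square_rows H'"
  shows "square_rows (\<lambda>x y. H x y + H' x y)"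
proof -
  note [measurable] = square_rows_measurable[OF H] square_rows_measurable[OF H']
  obtain c c' where c: "0 \<le> c" "\<And>x. nn_sq lborel (\<lambda>y. H x y) \<le> ennreal c" "0 \<le> c'" "\<And>x. nn_sq lborel (\<lambda>y. H' x y) \<le> ennreal c'"
    using H H' by (auto simp: square_rows_def)
  have "(\<integral>\<^sup>+y. ennreal ((H x y + H' x y)\<^sup>2) \<partial>lborel) \<le> ennreal (2 * c + 2 * c')" for x
    by (rule nn_integral_square_add) (use c square_rows_row_measurable[OF H] square_rows_row_measurable[OF H'] in auto)
  then have "\<exists>c\<ge>0. \<forall>x. nn_sq lborel (\<lambda>y. H x y + H' x y) \<le> ennreal c"
    using c(1,3) by (intro exI[of _ "2 * c + 2 * c'"]) auto
  moreover have "(\<lambda>(x, y). H x y + H' x y) \<in> borel_measurable lborel2" by measurable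
  ultimately show ?thesis using H H' by (simp add: square_rows_def)
qed

lemma square_rows_uminus: "square_rows H \<Longrightarrow> square_rows (\<lambda>x y. - H x y)"
  by (auto simp: square_rows_def case_prod_unfold)

lemma square_rows_rect_step:
  assumes F: "rect_step D F"
  shows "square_rows (\<lambda>x y. F (x, y))"
proof -
  note [measurable] = rect_step_measurable[OF F]
  obtain b where b: "\<And>s. \<bar>F s\<bar> \<le> b" using rect_step_bounded[OF F] by blast
  have "(\<integral>\<^sup>+y. ennreal ((F (x, y))\<^sup>2) \<partial>lborel) \<le> ennreal (b\<^sup>2 * vD)" for x
  proof -
    have i: "(\<lambda>y. ennreal ((F (x, y))\<^sup>2)) = (\<lambda>y. ennreal ((indicator D y * F (x, y))\<^sup>2))"
      using rect_step_zero[OF F] by (intro ext) (auto simp: indicator_def)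
    have "(\<integral>\<^sup>+y. ennreal ((indicator D y * F (x, y))\<^sup>2) \<partial>lborel) \<le> ennreal (b\<^sup>2 * vD)"
    proof (rule square_integrable_D(2)[OF _ b])
      have "(\<lambda>y. F (x, y)) \<in> borel_measurable lborel" by measurable
      then show "(\<lambda>y. F (x, y)) \<in> borel_measurable borel" by simp
    qed
    then show ?thesis unfolding i .
  qed
  then show ?thesis using vD_nonneg rect_step_zero[OF F] by (auto simp: square_rows_def intro!: exI[of _ "b\<^sup>2 * vD"])
qed

lemma square_rows_integral:
  assumes H: "square_rows H" and v: "square_integrable lborel v"
  shows "square_integrable lborel (\<lambda>x. LINT y|lborel. H x y * v y)"
proof -
  note [measurable] = square_rows_measurable[OF H]
  have [measurable]: "v \<in> borel_measurable borel" using v by (auto simp: square_integrable_def)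
  obtain c where c: "0 \<le> c" "\<And>x. nn_sq lborel (\<lambda>y. H x y) \<le> ennreal c" using H by (auto simp: square_rows_def)
  have b: "\<bar>LINT y|lborel. H x y * v y\<bar> \<le> sqrt c * l2norm lborel v" for x
  proof -
    have "l2norm lborel (H x) \<le> sqrt c"
      using c(2)[of x] c(1) square_integrable_nn_eq[OF square_rows_row[OF H, of x]] by (simp add: l2norm_def)
    then have "l2norm lborel (H x) * l2norm lborel v \<le> sqrt c * l2norm lborel v" by (intro mult_right_mono) auto
    with abs_integral_mult_le[OF square_rows_row[OF H, of x] v] show ?thesis by linarith
  qed
  have "(\<lambda>x. LINT y|lborel. H x y * v y) \<in> borel_measurable lborel" by measurable
  then have "square_integrable lborel (\<lambda>x. indicator D x * (LINT y|lborel. H x y * v y))"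
    using b by (intro square_integrable_D) auto
  moreover have "indicator D x * (LINT y|lborel. H x y * v y) = (LINT y|lborel. H x y * v y)" for x
    using H by (cases "x \<in> D") (auto simp: square_rows_def)
  ultimately show ?thesis by simp
qed

text \<open>The Schur test of \<open>weighted_integral_variance\<close> applied to each row of the
  kernel, then integrated over the rows.\<close>

lemma square_rows_integral_variance:
  assumes ep: "ep > 0" and H: "square_rows H" and u[measurable]: "u \<in> borel_measurable borel" and U: "\<And>x. \<bar>u x\<bar> \<le> U"
  shows "(\<integral>\<^sup>+w. \<integral>\<^sup>+x. ennreal ((LINT y|lborel. H x y * (Qf ep w y * u y))\<^sup>2) \<partial>lborel \<partial>M)
    \<le> ennreal (U\<^sup>2 * (ep ^ DIM('a) * (LINT z|lborel. \<bar>R z\<bar>))) * (\<integral>\<^sup>+x. \<integral>\<^sup>+y. ennreal ((H x y)\<^sup>2) \<partial>lborel \<partial>lborel)"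
proof -
  note [measurable] = square_rows_measurable[OF H]
  let ?I = "ep ^ DIM('a) * (LINT z|lborel. \<bar>R z\<bar>)"
  have I0: "0 \<le> ?I" using ep by simp
  note uD = square_integrable_D[OF u U]
  have U2: "(u y)\<^sup>2 \<le> U\<^sup>2" for y using U[of y] by (metis abs_ge_zero power2_abs power_mono)
  have eq: "H x y * (Qf ep w y * u y) = (H x y * (indicator D y * u y)) * qs ep y w" for x y w by (simp add: Qf_def)
  have "(\<integral>\<^sup>+w. \<integral>\<^sup>+x. ennreal ((LINT y|lborel. H x y * (Qf ep w y * u y))\<^sup>2) \<partial>lborel \<partial>M)
    = (\<integral>\<^sup>+x. \<integral>\<^sup>+w. ennreal ((LINT y|lborel. H x y * (Qf ep w y * u y))\<^sup>2) \<partial>M \<partial>lborel)"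
    by (rule MP.Fubini'[symmetric]) measurable
  also have "\<dots> \<le> (\<integral>\<^sup>+x. ennreal (U\<^sup>2 * ?I) * nn_sq lborel (\<lambda>y. H x y) \<partial>lborel)"
  proof (rule nn_integral_mono)
    fix x
    define h where "h y = H x y * (indicator D y * u y)" for y
    define r where "r = (LINT y|lborel. (H x y)\<^sup>2)"
    have [measurable]: "H x \<in> borel_measurable borel" by (rule square_rows_row_measurable[OF H])
    have r: "nn_sq lborel (\<lambda>y. H x y) = ennreal r" "0 \<le> r"
      using square_integrable_nn_eq[OF square_rows_row[OF H, of x]] by (simp_all add: r_def)
    have hm[measurable]: "h \<in> borel_measurable borel" unfolding h_def[abs_def] by measurable
    have hi: "integrable lborel h" unfolding h_def by (rule square_integrable_mult[OF square_rows_row[OF H] uD(1)])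
    have "(\<integral>\<^sup>+y. ennreal ((h y)\<^sup>2) \<partial>lborel) \<le> (\<integral>\<^sup>+y. ennreal (U\<^sup>2) * ennreal ((H x y)\<^sup>2) \<partial>lborel)"
    proof (rule nn_integral_mono)
      fix y
      have "(h y)\<^sup>2 \<le> U\<^sup>2 * (H x y)\<^sup>2" unfolding h_def power_mult_distrib
        using U2[of y] mult_left_mono[OF U2[of y], of "(H x y)\<^sup>2"] by (cases "y \<in> D") (auto simp: mult.commute)
      then show "ennreal ((h y)\<^sup>2) \<le> ennreal (U\<^sup>2) * ennreal ((H x y)\<^sup>2)" by (simp add: ennreal_mult[symmetric] ennreal_leI)
    qed
    also have "\<dots> = ennreal (U\<^sup>2 * r)" using r by (simp add: nn_integral_cmult ennreal_mult)
    finally have h2: "nn_sq lborel h \<le> ennreal (U\<^sup>2 * r)" .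
    have c0: "0 \<le> U\<^sup>2 * r" using r by simp
    note wv = weighted_integral_variance[OF ep hm hi h2 c0]
    have "(\<integral>\<^sup>+w. ennreal ((LINT y|lborel. h y * qs ep y w)\<^sup>2) \<partial>M) \<le> ennreal (U\<^sup>2 * r * ?I)"
      unfolding square_integrable_nn_eq[OF wv(1)] by (intro ennreal_leI wv(2))
    also have "\<dots> = ennreal (U\<^sup>2 * ?I) * ennreal r" 
      unfolding ennreal_mult[OF mult_nonneg_nonneg[OF zero_le_power2 I0] r(2), symmetric] by (simp only: mult_ac)
    finally show "nn_sq M (\<lambda>w. LINT y|lborel. H x y * (Qf ep w y * u y)) \<le> ennreal (U\<^sup>2 * ?I) * nn_sq lborel (\<lambda>y. H x y)"
      unfolding r(1) eq h_def .
  qed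
  also have "\<dots> = ennreal (U\<^sup>2 * ?I) * (\<integral>\<^sup>+x. \<integral>\<^sup>+y. ennreal ((H x y)\<^sup>2) \<partial>lborel \<partial>lborel)"
    by (rule nn_integral_cmult) measurable
  finally show ?thesis .
qed

lemma AE_Qf:
  assumes ep: "ep > 0"
  shows "AE w in M. square_integrable lborel (Qf ep w)"
proof -
  have "(\<integral>\<^sup>+w. \<integral>\<^sup>+y. ennreal ((Qf ep w y)\<^sup>2) \<partial>lborel \<partial>M) \<noteq> \<infinity>"
    using Qf_second_moment[OF ep] by (auto simp: top_unique)
  then have "AE w in M. nn_sq lborel (\<lambda>y. Qf ep w y) \<noteq> \<infinity>"
    by (intro nn_integral_PInf_AE) measurable
  with AE_space show ?thesis
  proof eventually_elim
    case (elim w)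
    then show ?case unfolding square_integrable_iff_nn using Qf_measurable2[of w ep] by (simp add: less_top)
  qed
qed

lemma square_integrable_mult_bounded:
  assumes f: "square_integrable lborel f" and [measurable]: "g \<in> borel_measurable borel" and b: "\<And>x. \<bar>g x\<bar> \<le> b"
  shows "square_integrable lborel (\<lambda>x. f x * g x)"
  unfolding square_integrable_def
proof
  have [measurable]: "f \<in> borel_measurable borel" using f by (auto simp: square_integrable_def)
  show "(\<lambda>x. f x * g x) \<in> borel_measurable lborel" by measurable
  show "integrable lborel (\<lambda>x. (f x * g x)\<^sup>2)"
  proof (rule Bochner_Integration.integrable_bound)
    show "integrable lborel (\<lambda>x. (f x)\<^sup>2 * b\<^sup>2)" using f by (simp add: square_integrable_def)
    have "(g x)\<^sup>2 \<le> b\<^sup>2" for x using b[of x] by (metis abs_ge_zero power2_abs power_mono)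
    then show "AE x in lborel. norm ((f x * g x)\<^sup>2) \<le> norm ((f x)\<^sup>2 * b\<^sup>2)"
      by (auto simp: power_mult_distrib mult_left_mono)
  qed measurable
qed

section \<open>The double integral over two copies of the potential\<close>

definition double_form :: "('a \<Rightarrow> 'a \<Rightarrow> real) \<Rightarrow> ('a \<Rightarrow> real) \<Rightarrow> ('a \<Rightarrow> real) \<Rightarrow> real \<Rightarrow> 'w \<Rightarrow> real" where
  "double_form H g u ep w = (LINT x|lborel. Qf ep w x * g x * (LINT y|lborel. H x y * (Qf ep w y * u y)))"

lemma double_form_measurable:
  assumes [measurable]: "g \<in> borel_measurable borel" "u \<in> borel_measurable borel" and H: "square_rows H"
  shows "double_form H g u ep \<in> borel_measurable M"
  unfolding double_form_def[abs_def] using square_rows_measurable[OF H] by measurable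

text \<open>Splitting the integrals requires the potential to be square integrable over
  \<open>D\<close>, which holds almost surely.\<close>

lemma double_form_add:
  assumes ep: "ep > 0" and g: "g \<in> borel_measurable borel" "\<And>x. \<bar>g x\<bar> \<le> Gb" and u: "u \<in> borel_measurable borel" "\<And>x. \<bar>u x\<bar> \<le> U"
    and H: "square_rows H" and H': "square_rows H'"
  shows "AE w in M. double_form (\<lambda>x y. H x y + H' x y) g u ep w = double_form H g u ep w + double_form H' g u ep w"
  using AE_Qf[OF ep]
proof eventually_elim
  case (elim w)
  note Qg = square_integrable_mult_bounded[OF elim g] and Qu = square_integrable_mult_bounded[OF elim u]
  have "(LINT y|lborel. (H x y + H' x y) * (Qf ep w y * u y)) = (LINT y|lborel. H x y * (Qf ep w y * u y)) + (LINT y|lborel. H' x y * (Qf ep w y * u y))" for x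
    unfolding distrib_right by (intro Bochner_Integration.integral_add square_integrable_mult square_rows_row H H' Qu)
  then show ?case
    unfolding double_form_def by (simp add: distrib_left square_integrable_mult Qg square_rows_integral H H' Qu)
qed

text \<open>Cauchy-Schwarz over both the probability space and the outer variable: the factor Q g is
  of order one, and the inner integral is of order ep^(d/2) times the L^2 norm of the
  kernel.\<close>

lemma double_form_bound:
  assumes ep: "ep > 0" and g[measurable]: "g \<in> borel_measurable borel" and gb: "\<And>x. \<bar>g x\<bar> \<le> Gb" 
    and u[measurable]: "u \<in> borel_measurable borel" and ub: "\<And>x. \<bar>u x\<bar> \<le> U" and H: "square_rows H"
    and N: "(\<integral>\<^sup>+x. \<integral>\<^sup>+y. ennreal ((H x y)\<^sup>2) \<partial>lborel \<partial>lborel) \<le> ennreal r" "0 \<le> r"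
  shows "(\<integral>\<^sup>+w. eabs (double_form H g u ep w) \<partial>M) \<le> ennreal (sqrt (Gb\<^sup>2 * (2 * K * vD) * (U\<^sup>2 * (LINT z|lborel. \<bar>R z\<bar>) * r)) * ep powr (real DIM('a) / 2))"
proof -
  note [measurable] = square_rows_measurable[OF H]
  let ?I = "LINT z|lborel. \<bar>R z\<bar>"
  let ?T = "\<lambda>w x. LINT y|lborel. H x y * (Qf ep w y * u y)"
  let ?P = "M \<Otimes>\<^sub>M lborel"
  have I0: "0 \<le> ?I" by simp
  have m1[measurable]: "(\<lambda>s. Qf ep (fst s) (snd s) * g (snd s)) \<in> borel_measurable ?P" by measurable
  have m2[measurable]: "(\<lambda>s. ?T (fst s) (snd s)) \<in> borel_measurable ?P" by measurable
  have "(\<integral>\<^sup>+w. eabs (double_form H g u ep w) \<partial>M) \<le> (\<integral>\<^sup>+w. \<integral>\<^sup>+x. eabs (Qf ep w x * g x) * eabs (?T w x) \<partial>lborel \<partial>M)"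
  proof (rule nn_integral_mono)
    fix w
    show "eabs (double_form H g u ep w) \<le> (\<integral>\<^sup>+x. eabs (Qf ep w x * g x) * eabs (?T w x) \<partial>lborel)"
      using norm_integral_le_nn_integral[of lborel "\<lambda>x. Qf ep w x * g x * ?T w x"]
      unfolding double_form_def real_norm_def abs_mult[of "_ * _" "LINT y|lborel. _ y"] ennreal_mult[OF abs_ge_zero abs_ge_zero] .
  qed
  also have "\<dots> = (\<integral>\<^sup>+s. eabs (Qf ep (fst s) (snd s) * g (snd s)) * eabs (?T (fst s) (snd s)) \<partial>?P)"
    by (subst lborel.nn_integral_fst[symmetric]) simp_all
  finally have 1: "(\<integral>\<^sup>+w. eabs (double_form H g u ep w) \<partial>M) \<le> \<dots>" .
  have 2: "(\<integral>\<^sup>+s. eabs (Qf ep (fst s) (snd s) * g (snd s)) * eabs (?T (fst s) (snd s)) \<partial>?P)\<^sup>2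
    \<le> (\<integral>\<^sup>+s. (eabs (Qf ep (fst s) (snd s) * g (snd s)))\<^sup>2 \<partial>?P) * (\<integral>\<^sup>+s. (eabs (?T (fst s) (snd s)))\<^sup>2 \<partial>?P)"
    by (rule Cauchy_Schwarz_nn_integral) measurable
  have g2: "(g y)\<^sup>2 \<le> Gb\<^sup>2" for y using gb[of y] by (metis abs_ge_zero power2_abs power_mono)
  have 3: "(\<integral>\<^sup>+s. (eabs (Qf ep (fst s) (snd s) * g (snd s)))\<^sup>2 \<partial>?P) \<le> ennreal (Gb\<^sup>2 * (2 * K * vD))"
  proof -
    have "(\<integral>\<^sup>+s. (eabs (Qf ep (fst s) (snd s) * g (snd s)))\<^sup>2 \<partial>?P) \<le> (\<integral>\<^sup>+s. ennreal (Gb\<^sup>2) * ennreal ((Qf ep (fst s) (snd s))\<^sup>2) \<partial>?P)"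
    proof (rule nn_integral_mono)
      fix s
      have "(Qf ep (fst s) (snd s) * g (snd s))\<^sup>2 \<le> Gb\<^sup>2 * (Qf ep (fst s) (snd s))\<^sup>2"
        using mult_right_mono[OF g2[of "snd s"], of "(Qf ep (fst s) (snd s))\<^sup>2"] by (simp add: power_mult_distrib mult.commute)
      then show "(eabs (Qf ep (fst s) (snd s) * g (snd s)))\<^sup>2 \<le> ennreal (Gb\<^sup>2) * ennreal ((Qf ep (fst s) (snd s))\<^sup>2)"
        by (simp add: ennreal_power ennreal_mult[symmetric] ennreal_leI del: abs_mult)
    qed
    also have "\<dots> = ennreal (Gb\<^sup>2) * (\<integral>\<^sup>+s. ennreal ((Qf ep (fst s) (snd s))\<^sup>2) \<partial>?P)" by (rule nn_integral_cmult) measurable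
    also have "(\<integral>\<^sup>+s. ennreal ((Qf ep (fst s) (snd s))\<^sup>2) \<partial>?P) = (\<integral>\<^sup>+w. \<integral>\<^sup>+y. ennreal ((Qf ep w y)\<^sup>2) \<partial>lborel \<partial>M)"
      by (subst lborel.nn_integral_fst[symmetric]) simp_all
    also have "ennreal (Gb\<^sup>2) * \<dots> \<le> ennreal (Gb\<^sup>2) * ennreal (2 * K * vD)"
      by (intro mult_left_mono Qf_second_moment ep) simp
    also have "\<dots> = ennreal (Gb\<^sup>2 * (2 * K * vD))" using K_ge_1 vD_nonneg by (simp add: ennreal_mult)
    finally show ?thesis .
  qed
  have 4: "(\<integral>\<^sup>+s. (eabs (?T (fst s) (snd s)))\<^sup>2 \<partial>?P) \<le> ennreal (U\<^sup>2 * (ep ^ DIM('a) * ?I) * r)"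
  proof -
    have "(\<integral>\<^sup>+s. (eabs (?T (fst s) (snd s)))\<^sup>2 \<partial>?P) = (\<integral>\<^sup>+w. \<integral>\<^sup>+x. ennreal ((?T w x)\<^sup>2) \<partial>lborel \<partial>M)"
      by (subst lborel.nn_integral_fst[symmetric]) (simp_all add: ennreal_power)
    also have "\<dots> \<le> ennreal (U\<^sup>2 * (ep ^ DIM('a) * ?I)) * ennreal r"
      by (rule order_trans[OF square_rows_integral_variance[OF ep H u ub] mult_left_mono[OF N(1)]]) simp
    also have "\<dots> = ennreal (U\<^sup>2 * (ep ^ DIM('a) * ?I) * r)" using N(2) ep I0 by (intro ennreal_mult[symmetric]) auto
    finally show ?thesis .
  qed
  let ?B = "Gb\<^sup>2 * (2 * K * vD) * (U\<^sup>2 * ?I * r)"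
  have B0: "0 \<le> ?B" using K_ge_1 vD_nonneg I0 N(2) by simp
  have "(\<integral>\<^sup>+w. eabs (double_form H g u ep w) \<partial>M)\<^sup>2 \<le> ennreal (Gb\<^sup>2 * (2 * K * vD)) * ennreal (U\<^sup>2 * (ep ^ DIM('a) * ?I) * r)"
    by (rule order_trans[OF order_trans[OF power_mono[OF 1] 2] mult_mono[OF 3 4]]) simp_all
  also have "\<dots> = ennreal (?B * ep ^ DIM('a))"
    using N(2) ep I0 K_ge_1 vD_nonneg by (subst ennreal_mult[symmetric]) (simp_all add: mult_ac)
  also have "?B * ep ^ DIM('a) = (sqrt ?B * ep powr (real DIM('a) / 2))\<^sup>2"
    using B0 ep by (simp add: power_mult_distrib powr_power powr_realpow)
  also have "ennreal \<dots> = (ennreal (sqrt ?B * ep powr (real DIM('a) / 2)))\<^sup>2"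
    using B0 by (simp add: ennreal_power)
  finally show ?thesis using B0 by (intro ennreal_power2_leD) auto
qed

lemma rect_factor:
  assumes ep: "ep > 0" and g[measurable]: "g \<in> borel_measurable borel" and gb: "\<And>x. \<bar>g x\<bar> \<le> Gb" and A[measurable]: "A \<in> sets borel"
  shows "(\<integral>\<^sup>+w. (eabs (LINT x|lborel. indicator A x * (Qf ep w x * g x)))\<^sup>2 \<partial>M) \<le> ennreal (Gb\<^sup>2 * vD * (ep ^ DIM('a) * (LINT z|lborel. \<bar>R z\<bar>)))"
proof -
  define h where "h x = indicator D x * (indicator A x * g x)" for x
  have b: "\<bar>indicator A x * g x\<bar> \<le> Gb" for x using gb[of x] by (auto simp: indicator_def)
  have hm[measurable]: "h \<in> borel_measurable borel" unfolding h_def[abs_def] by measurable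
  have h2: "nn_sq lborel h \<le> ennreal (Gb\<^sup>2 * vD)" and hs: "square_integrable lborel h"
    unfolding h_def using square_integrable_D[of "\<lambda>x. indicator A x * g x" Gb] b by auto
  have hi: "integrable lborel h"
  proof -
    have "integrable lborel (\<lambda>x. h x * (indicator D x * 1))"
      by (rule square_integrable_mult[OF hs square_integrable_D(1)[of "\<lambda>_. 1" 1]]) auto
    moreover have "h x * (indicator D x * 1) = h x" for x by (simp add: indicator_def h_def)
    ultimately show ?thesis by (simp only:)
  qed
  have c0: "0 \<le> Gb\<^sup>2 * vD" using vD_nonneg by simp
  note wv = weighted_integral_variance[OF ep hm hi h2 c0]
  have eq: "indicator A x * (Qf ep w x * g x) = h x * qs ep x w" for x w by (simp add: Qf_def h_def)
  show ?thesis
    unfolding eq using square_integrable_nn_eq[OF wv(1)] wv(2) by (simp add: ennreal_power ennreal_leI)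
qed

text \<open>The bound \<open>double_form_bound\<close> is of order \<open>ep powr (d / 2)\<close> only, with a constant that is small
  for kernels close to a combination of rectangles.\<close>

lemma double_form_rect_step:
  assumes F: "rect_step D F" and g[measurable]: "g \<in> borel_measurable borel" and gb: "\<And>x. \<bar>g x\<bar> \<le> Gb"
    and u[measurable]: "u \<in> borel_measurable borel" and ub: "\<And>x. \<bar>u x\<bar> \<le> U"
  shows "\<exists>b\<ge>0. \<forall>ep>0. (\<integral>\<^sup>+w. eabs (double_form (\<lambda>x y. F (x, y)) g u ep w) \<partial>M) \<le> ennreal (b * ep ^ DIM('a))"
  using F
proof (induction rule: rect_step.induct)
  case (rect A B c)
  note [measurable] = rect(1,3)
  let ?I = "LINT z|lborel. \<bar>R z\<bar>"
  have I0: "0 \<le> ?I" by simp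
  have G0: "0 \<le> Gb" "0 \<le> U" using gb[of 0] ub[of 0] by auto
  let ?b = "\<bar>c\<bar> * (Gb * U * vD * ?I)"
  have "(\<integral>\<^sup>+w. eabs (double_form (\<lambda>x y. c * (indicator A (fst (x, y)) * indicator B (snd (x, y)))) g u ep w) \<partial>M) \<le> ennreal (?b * ep ^ DIM('a))"
    if ep: "ep > 0" for ep
  proof -
    let ?X = "\<lambda>w. LINT x|lborel. indicator A x * (Qf ep w x * g x)" and ?Y = "\<lambda>w. LINT x|lborel. indicator B x * (Qf ep w x * u x)"
    have [measurable]: "?X \<in> borel_measurable M" "?Y \<in> borel_measurable M" by measurable
    \<comment> \<open>For a rectangle the double integral factors into \<open>?X\<close> and
      \<open>?Y\<close>, each with mean square of order ep^d; Cauchy-Schwarz then gives the full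
      order ep^d for the product.\<close>
    have "double_form (\<lambda>x y. c * (indicator A (fst (x, y)) * indicator B (snd (x, y)))) g u ep w = c * (?X w * ?Y w)" for w
    proof -
      have "(LINT y|lborel. c * (indicator A x * indicator B y) * (Qf ep w y * u y)) = c * indicator A x * ?Y w" for x
        unfolding integral_mult_right_zero[symmetric] by (simp only: mult_ac)
      then have "double_form (\<lambda>x y. c * (indicator A (fst (x, y)) * indicator B (snd (x, y)))) g u ep w = (LINT x|lborel. c * ((indicator A x * (Qf ep w x * g x)) * ?Y w))"
        unfolding double_form_def fst_conv snd_conv by (simp only: mult_ac)
      then show ?thesis by (simp only: integral_mult_right_zero integral_mult_left_zero)
    qed
    then have "(\<integral>\<^sup>+w. eabs (double_form (\<lambda>x y. c * (indicator A (fst (x, y)) * indicator B (snd (x, y)))) g u ep w) \<partial>M)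
      = (\<integral>\<^sup>+w. eabs c * (eabs (?X w) * eabs (?Y w)) \<partial>M)"
      by (simp only: abs_mult ennreal_mult abs_ge_zero mult_nonneg_nonneg)
    also have "\<dots> = eabs c * (\<integral>\<^sup>+w. eabs (?X w) * eabs (?Y w) \<partial>M)"
      by (rule nn_integral_cmult) measurable
    finally have 1: "(\<integral>\<^sup>+w. eabs (double_form (\<lambda>x y. c * (indicator A (fst (x, y)) * indicator B (snd (x, y)))) g u ep w) \<partial>M) = \<dots>" .
    have "(\<integral>\<^sup>+w. eabs (?X w) * eabs (?Y w) \<partial>M)\<^sup>2 \<le> (\<integral>\<^sup>+w. (eabs (?X w))\<^sup>2 \<partial>M) * (\<integral>\<^sup>+w. (eabs (?Y w))\<^sup>2 \<partial>M)"
      by (rule Cauchy_Schwarz_nn_integral) measurable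
    also have "\<dots> \<le> ennreal (Gb\<^sup>2 * vD * (ep ^ DIM('a) * ?I)) * ennreal (U\<^sup>2 * vD * (ep ^ DIM('a) * ?I))"
      by (intro mult_mono rect_factor ep g gb u ub rect) simp_all
    also have "\<dots> = ennreal ((Gb * U * vD * ?I * ep ^ DIM('a))\<^sup>2)"
      using ep I0 vD_nonneg G0 by (subst ennreal_mult[symmetric]) (simp_all add: power_mult_distrib power2_eq_square mult_ac)
    also have "\<dots> = (ennreal (Gb * U * vD * ?I * ep ^ DIM('a)))\<^sup>2"
      using ep I0 vD_nonneg G0 by (simp add: ennreal_power)
    finally have "(\<integral>\<^sup>+w. eabs (?X w) * eabs (?Y w) \<partial>M) \<le> ennreal (Gb * U * vD * ?I * ep ^ DIM('a))"
      using ep I0 vD_nonneg G0 by (intro ennreal_power2_leD) auto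
    then have "eabs c * (\<integral>\<^sup>+w. eabs (?X w) * eabs (?Y w) \<partial>M) \<le> eabs c * ennreal (Gb * U * vD * ?I * ep ^ DIM('a))"
      by (intro mult_left_mono) auto
    also have "\<dots> = ennreal (?b * ep ^ DIM('a))"
      by (subst ennreal_mult'[symmetric]) (simp_all only: abs_ge_zero mult.assoc)
    finally show ?thesis unfolding 1 .
  qed
  moreover have "0 \<le> ?b" using I0 vD_nonneg G0 by simp
  ultimately show ?case by blast
next
  case (rect_add F F')
  obtain b b' where b: "0 \<le> b" "\<And>ep. ep > 0 \<Longrightarrow> (\<integral>\<^sup>+w. eabs (double_form (\<lambda>x y. F (x, y)) g u ep w) \<partial>M) \<le> ennreal (b * ep ^ DIM('a))"
    and b': "0 \<le> b'" "\<And>ep. ep > 0 \<Longrightarrow> (\<integral>\<^sup>+w. eabs (double_form (\<lambda>x y. F' (x, y)) g u ep w) \<partial>M) \<le> ennreal (b' * ep ^ DIM('a))"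
    using rect_add.IH by blast
  note gF = square_rows_rect_step[OF rect_add.hyps(1)] square_rows_rect_step[OF rect_add.hyps(2)]
  note [measurable] = double_form_measurable[OF g u gF(1)] double_form_measurable[OF g u gF(2)]
  have "(\<integral>\<^sup>+w. eabs (double_form (\<lambda>x y. F (x, y) + F' (x, y)) g u ep w) \<partial>M) \<le> ennreal ((b + b') * ep ^ DIM('a))" if ep: "ep > 0" for ep
  proof -
    have "(\<integral>\<^sup>+w. eabs (double_form (\<lambda>x y. F (x, y) + F' (x, y)) g u ep w) \<partial>M)
      \<le> (\<integral>\<^sup>+w. eabs (double_form (\<lambda>x y. F (x, y)) g u ep w) + eabs (double_form (\<lambda>x y. F' (x, y)) g u ep w) \<partial>M)"
      by (rule nn_integral_mono_AE, use double_form_add[OF ep g gb u ub gF] in eventually_elim)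
        (simp add: ennreal_plus[symmetric] ennreal_leI del: ennreal_plus)
    also have "\<dots> \<le> ennreal (b * ep ^ DIM('a)) + ennreal (b' * ep ^ DIM('a))"
      by (subst nn_integral_add) (use b(2)[OF ep] b'(2)[OF ep] in \<open>auto intro: add_mono\<close>)
    also have "\<dots> = ennreal ((b + b') * ep ^ DIM('a))"
      using b(1) b'(1) ep by (simp add: ennreal_plus[symmetric] distrib_right del: ennreal_plus)
    finally show ?thesis .
  qed
  then show ?case using b(1) b'(1) by (intro exI[of _ "b + b'"]) auto
qed

text \<open>The kernel is split into a rectangle step and an L^2-small rest. After division by
  ep^(d/2) the rest stays below r / 2 for every \<open>ep\<close>, and the step contributes a
  multiple of ep^(d/2).\<close>

lemma double_form_tendsto_0:
  assumes pos: "\<And>x y. 0 \<le> \<Gamma> x y" and g[measurable]: "g \<in> borel_measurable borel" and gb: "\<And>x. \<bar>g x\<bar> \<le> Gb"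
    and u[measurable]: "u \<in> borel_measurable borel" and ub: "\<And>x. \<bar>u x\<bar> \<le> U" and e: "\<And>n. e n > 0" "e \<longlonglongrightarrow> 0"
  shows "(\<lambda>n. \<integral>\<^sup>+w. ennreal (\<bar>double_form \<Gamma> g u (e n) w\<bar> / e n powr (real DIM('a) / 2)) \<partial>M) \<longlonglongrightarrow> 0"
proof (rule ennreal_tendsto_0I)
  fix r :: real assume r: "r > 0"
  let ?I = "LINT z|lborel. \<bar>R z\<bar>"
  define c0 where "c0 = Gb\<^sup>2 * (2 * K * vD) * (U\<^sup>2 * ?I)"
  have c0: "0 \<le> c0" using K_ge_1 vD_nonneg by (simp add: c0_def)
  \<comment> \<open>Admissible squared L^2 error of the approximation: the constant of
    \<open>double_form_bound\<close> is the root of c0 s, at most r / 2. Dividing by c0 + 1 avoids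
    the case c0 = 0.\<close>
  define s where "s = (r / 2)\<^sup>2 / (c0 + 1)"
  have s: "s > 0" "c0 * s \<le> (r / 2)\<^sup>2"
  proof -
    show "s > 0" using r c0 by (simp add: s_def)
    have "c0 * s \<le> (c0 + 1) * s" using \<open>s > 0\<close> by (intro mult_right_mono) auto
    also have "\<dots> = (r / 2)\<^sup>2" using c0 by (simp add: s_def)
    finally show "c0 * s \<le> (r / 2)\<^sup>2" .
  qed
  let ?\<Lambda> = "(lborel :: 'a measure) \<Otimes>\<^sub>M (lborel :: 'a measure)"
  have \<Gamma>i: "\<Gamma> (fst p) (snd p) * indicator (D \<times> D) p = \<Gamma> (fst p) (snd p)" for p
    using \<Gamma>_support[of "fst p" "snd p"] \<Gamma>_support2[of "snd p" "fst p"] by (cases p) (auto simp: indicator_def)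
  have "rect_approx D (\<lambda>p. \<Gamma> (fst p) (snd p) * indicator (D \<times> D) p)"
  proof (rule rect_approx_square_integrable[OF D_finite])
    show "(\<lambda>p. \<Gamma> (fst p) (snd p)) \<in> borel_measurable ?\<Lambda>" by measurable
    show "0 \<le> \<Gamma> (fst p) (snd p)" for p by (rule pos)
    have "(\<integral>\<^sup>+p. ennreal ((\<Gamma> (fst p) (snd p))\<^sup>2) \<partial>?\<Lambda>) = (\<integral>\<^sup>+x. \<integral>\<^sup>+y. ennreal ((\<Gamma> x y)\<^sup>2) \<partial>lborel \<partial>lborel)"
      by (subst lborel.nn_integral_fst[symmetric]) simp_all
    also have "\<dots> \<le> ennreal C * emeasure lborel D"
    proof (rule nn_integral_times_D_le)
      show "nn_sq lborel (\<lambda>y. \<Gamma> x y) \<le> ennreal C * indicator D x" for x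
        using \<Gamma>_square[of x] by (cases "x \<in> D") (auto simp: \<Gamma>_support)
    qed simp
    also have "\<dots> < \<infinity>" by (simp add: emeasure_D ennreal_mult_less_top)
    finally show "(\<integral>\<^sup>+p. ennreal ((\<Gamma> (fst p) (snd p) * indicator (D \<times> D) p)\<^sup>2) \<partial>?\<Lambda>) < \<infinity>" unfolding \<Gamma>i .
  qed
  then have "rect_approx D (\<lambda>p. \<Gamma> (fst p) (snd p))" unfolding \<Gamma>i .
  then obtain F where F: "rect_step D F" and Fs: "(\<integral>\<^sup>+p. ennreal ((\<Gamma> (fst p) (snd p) - F p)\<^sup>2) \<partial>?\<Lambda>) \<le> ennreal s"
    using s(1) unfolding rect_approx_def by blast
  obtain b where b: "0 \<le> b" "\<And>ep. ep > 0 \<Longrightarrow> (\<integral>\<^sup>+w. eabs (double_form (\<lambda>x y. F (x, y)) g u ep w) \<partial>M) \<le> ennreal (b * ep ^ DIM('a))"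
    using double_form_rect_step[OF F g gb u ub] by blast
  note gF = square_rows_rect_step[OF F] and [measurable] = rect_step_measurable[OF F]
  let ?H = "\<lambda>x y. \<Gamma> x y + - F (x, y)"
  have gH: "square_rows ?H" by (rule square_rows_add[OF square_rows_\<Gamma> square_rows_uminus[OF gF]])
  note [measurable] = double_form_measurable[OF g u gF] double_form_measurable[OF g u gH] double_form_measurable[OF g u square_rows_\<Gamma>]
  have Hs: "(\<integral>\<^sup>+x. \<integral>\<^sup>+y. ennreal ((?H x y)\<^sup>2) \<partial>lborel \<partial>lborel) \<le> ennreal s"
    using Fs by (subst (asm) lborel.nn_integral_fst[symmetric]) simp_all
  have le: "(\<integral>\<^sup>+w. ennreal (\<bar>double_form \<Gamma> g u ep w\<bar> / ep powr (real DIM('a) / 2)) \<partial>M) \<le> ennreal (r / 2 + b * ep powr (real DIM('a) / 2))" if ep: "ep > 0" for ep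
  proof -
    let ?d = "ep powr (real DIM('a) / 2)"
    have d0: "?d > 0" and d2: "ep ^ DIM('a) = ?d * ?d" using ep by (simp_all add: powr_add[symmetric] powr_realpow)
    have "AE w in M. double_form (\<lambda>x y. ?H x y + F (x, y)) g u ep w = double_form ?H g u ep w + double_form (\<lambda>x y. F (x, y)) g u ep w"
      by (rule double_form_add[OF ep g gb u ub gH gF])
    then have "(\<integral>\<^sup>+w. eabs (double_form \<Gamma> g u ep w) \<partial>M) \<le> (\<integral>\<^sup>+w. eabs (double_form ?H g u ep w) + eabs (double_form (\<lambda>x y. F (x, y)) g u ep w) \<partial>M)"
      by (intro nn_integral_mono_AE, elim eventually_mono) (simp add: ennreal_plus[symmetric] ennreal_leI del: ennreal_plus)
    also have "\<dots> = (\<integral>\<^sup>+w. eabs (double_form ?H g u ep w) \<partial>M) + (\<integral>\<^sup>+w. eabs (double_form (\<lambda>x y. F (x, y)) g u ep w) \<partial>M)"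
      by (rule nn_integral_add) measurable
    also have "\<dots> \<le> ennreal (sqrt (Gb\<^sup>2 * (2 * K * vD) * (U\<^sup>2 * ?I * s)) * ?d) + ennreal (b * ep ^ DIM('a))"
      by (intro add_mono double_form_bound[OF ep g gb u ub gH Hs] b(2) ep) (use s in simp)
    also have "\<dots> \<le> ennreal (r / 2 * ?d) + ennreal (b * ?d * ?d)"
    proof (intro add_mono ennreal_leI mult_right_mono)
      have "Gb\<^sup>2 * (2 * K * vD) * (U\<^sup>2 * ?I * s) = c0 * s" by (simp add: c0_def)
      then show "sqrt (Gb\<^sup>2 * (2 * K * vD) * (U\<^sup>2 * ?I * s)) \<le> r / 2" using s(2) r by (simp only:) (intro real_le_lsqrt, auto)
    qed (use d0 d2 in auto)
    also have "\<dots> = ennreal ((r / 2 + b * ?d) * ?d)" using r b(1) d0 by (simp add: ennreal_plus[symmetric] distrib_right del: ennreal_plus)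
    finally have bd: "(\<integral>\<^sup>+w. eabs (double_form \<Gamma> g u ep w) \<partial>M) \<le> ennreal ((r / 2 + b * ?d) * ?d)" .
    have "(\<integral>\<^sup>+w. ennreal (\<bar>double_form \<Gamma> g u ep w\<bar> / ?d) \<partial>M) = (\<integral>\<^sup>+w. eabs (double_form \<Gamma> g u ep w) * ennreal (1 / ?d) \<partial>M)"
      using d0 by (simp add: ennreal_mult[symmetric])
    also have "\<dots> = (\<integral>\<^sup>+w. eabs (double_form \<Gamma> g u ep w) \<partial>M) * ennreal (1 / ?d)" by (rule nn_integral_multc) measurable
    also have "\<dots> \<le> ennreal ((r / 2 + b * ?d) * ?d) * ennreal (1 / ?d)" by (intro mult_right_mono bd) simp
    also have "\<dots> = ennreal (r / 2 + b * ?d)" using d0 r b(1) by (subst ennreal_mult[symmetric]) simp_all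
    finally show ?thesis .
  qed
  have "(\<lambda>n. b * e n powr (real DIM('a) / 2)) \<longlonglongrightarrow> b * 0"
  proof (intro tendsto_mult tendsto_const)
    have "(\<lambda>n. e n powr (real DIM('a) / 2)) \<longlonglongrightarrow> 0 powr (real DIM('a) / 2)"
      by (rule tendsto_powr'[OF e(2) tendsto_const]) (use e(1) in \<open>auto intro!: always_eventually less_imp_le\<close>)
    then show "(\<lambda>n. e n powr (real DIM('a) / 2)) \<longlonglongrightarrow> 0" by simp
  qed
  then have "\<forall>\<^sub>F n in sequentially. b * e n powr (real DIM('a) / 2) < r / 2" by (rule order_tendstoD) (use r in simp)
  then show "\<forall>\<^sub>F n in sequentially. (\<integral>\<^sup>+w. ennreal (\<bar>double_form \<Gamma> g u (e n) w\<bar> / e n powr (real DIM('a) / 2)) \<partial>M) \<le> ennreal r"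
  proof eventually_elim
    case (elim n)
    then have "ennreal (r / 2 + b * e n powr (real DIM('a) / 2)) \<le> ennreal r" by (intro ennreal_leI) simp
    with le[OF e(1)[of n]] show ?case by (rule order_trans)
  qed
qed

end

section \<open>The perturbed problem\<close>

text \<open>Slutsky's argument: where the variables differ by at most \<eta> the exponentials differ
  by at most |t| \<eta>, and elsewhere by at most 2.\<close>

lemma (in prob_space) char_tendsto_perturbed:
  fixes X Y :: "real \<Rightarrow> 'a \<Rightarrow> real"
  assumes X: "\<And>ep. ep > 0 \<Longrightarrow> X ep \<in> borel_measurable M" and Y: "\<And>ep. ep > 0 \<Longrightarrow> Y ep \<in> borel_measurable M"
    and cX: "((\<lambda>ep. CLINT w|M. iexp (t * X ep w)) \<longlongrightarrow> L) (at_right 0)"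
    and P: "\<And>\<eta>. \<eta> > 0 \<Longrightarrow> ((\<lambda>ep. \<P>(w in M. \<eta> < \<bar>Y ep w - X ep w\<bar>)) \<longlongrightarrow> 0) (at_right 0)"
  shows "((\<lambda>ep. CLINT w|M. iexp (t * Y ep w)) \<longlongrightarrow> L) (at_right 0)"
proof (rule Lim_transform2[OF cX])
  have *: "cmod ((CLINT w|M. iexp (t * X ep w)) - (CLINT w|M. iexp (t * Y ep w))) \<le> \<bar>t\<bar> * \<eta> + 2 * \<P>(w in M. \<eta> < \<bar>Y ep w - X ep w\<bar>)"
    if ep: "ep > 0" and \<eta>: "\<eta> > 0" for ep \<eta>
  proof -
    note [measurable] = X[OF ep] Y[OF ep]
    let ?A = "{w \<in> space M. \<eta> < \<bar>Y ep w - X ep w\<bar>}"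
    have I: "integrable M (\<lambda>w. iexp (t * X ep w))" "integrable M (\<lambda>w. iexp (t * Y ep w))"
      by (auto intro!: integrable_const_bound[of _ 1])
    have "cmod ((CLINT w|M. iexp (t * X ep w)) - (CLINT w|M. iexp (t * Y ep w))) = cmod (CLINT w|M. iexp (t * X ep w) - iexp (t * Y ep w))"
      using I by simp
    also have "\<dots> \<le> (LINT w|M. cmod (iexp (t * X ep w) - iexp (t * Y ep w)))" by (rule integral_norm_bound)
    also have "\<dots> \<le> (LINT w|M. \<bar>t\<bar> * \<eta> + 2 * indicator ?A w)"
    proof (rule integral_mono)
      fix w assume w: "w \<in> space M"
      show "cmod (iexp (t * X ep w) - iexp (t * Y ep w)) \<le> \<bar>t\<bar> * \<eta> + 2 * indicator ?A w"
      proof (cases "w \<in> ?A")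
        case True
        have "cmod (iexp (t * X ep w) - iexp (t * Y ep w)) \<le> 2" using norm_triangle_ineq4[of "iexp (t * X ep w)" "iexp (t * Y ep w)"] by simp
        then show ?thesis using True \<eta> by (simp add: add_increasing)
      next
        case False
        have "cmod (iexp (t * X ep w) - iexp (t * Y ep w)) \<le> \<bar>t * X ep w - t * Y ep w\<bar>" by (rule norm_iexp_diff)
        also have "\<dots> = \<bar>t\<bar> * \<bar>Y ep w - X ep w\<bar>" by (simp add: abs_mult[symmetric] right_diff_distrib[symmetric] abs_minus_commute)
        also have "\<dots> \<le> \<bar>t\<bar> * \<eta>" using False w by (intro mult_left_mono) auto
        finally show ?thesis using False by simp
      qed
    qed (use I in \<open>auto intro!: integrable_real_indicator simp: emeasure_eq_measure\<close>)
    also have "\<dots> = \<bar>t\<bar> * \<eta> + 2 * prob ?A" by (simp add: prob_space emeasure_eq_measure)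
    finally show ?thesis .
  qed
  show "((\<lambda>ep. (CLINT w|M. iexp (t * X ep w)) - (CLINT w|M. iexp (t * Y ep w))) \<longlongrightarrow> 0) (at_right 0)"
  proof (rule tendstoI)
    fix e :: real assume e: "e > 0"
    \<comment> \<open>The denominator contains |t| + 1 so that the choice is valid for t = 0 and
      gives |t| \<eta> \<le> e / 2.\<close>
    define \<eta> where "\<eta> = e / (2 * (\<bar>t\<bar> + 1))"
    have \<eta>: "\<eta> > 0" "\<bar>t\<bar> * \<eta> \<le> e / 2"
      using e by (simp_all add: \<eta>_def field_simps)
    have "\<forall>\<^sub>F ep in at_right 0. \<P>(w in M. \<eta> < \<bar>Y ep w - X ep w\<bar>) < e / 4"
      using P[OF \<eta>(1)] by (rule order_tendstoD) (use e in simp)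
    moreover have "\<forall>\<^sub>F ep in at_right (0::real). ep > 0" by (rule eventually_at_right_less)
    ultimately show "\<forall>\<^sub>F ep in at_right 0. dist ((CLINT w|M. iexp (t * X ep w)) - (CLINT w|M. iexp (t * Y ep w))) 0 < e"
    proof eventually_elim
      case (elim ep)
      from *[OF elim(2) \<eta>(1)] elim(1) \<eta>(2) show ?case unfolding dist_norm diff_zero by linarith
    qed
  qed
qed

text \<open>If \<open>Y\<close> exceeds L + 1, then either \<open>X\<close> reaches L or the two
  differ by more than 1; the first event is bounded by Chebyshev, the second by convergence in
  probability.\<close>

lemma (in prob_space) tight_perturbed:
  fixes X Y :: "real \<Rightarrow> 'a \<Rightarrow> real"
  assumes X: "\<And>ep. ep > 0 \<Longrightarrow> square_integrable M (X ep)" and Y: "\<And>ep. ep > 0 \<Longrightarrow> Y ep \<in> borel_measurable M"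
    and B: "\<And>ep. ep > 0 \<Longrightarrow> (LINT w|M. (X ep w)\<^sup>2) \<le> B"
    and P: "((\<lambda>ep. \<P>(w in M. 1 < \<bar>Y ep w - X ep w\<bar>)) \<longlongrightarrow> 0) (at_right 0)" and e: "e > 0"
  shows "\<exists>L. \<forall>\<^sub>F ep in at_right 0. \<P>(w in M. norm (Y ep w) > L) \<le> e"
proof -
  \<comment> \<open>Chosen so that the Chebyshev bound |B| / L^2 is at most e / 2; the added 1 keeps
    L positive.\<close>
  define L where "L = sqrt (2 * (\<bar>B\<bar> + 1) / e)"
  have L: "L > 0" "L\<^sup>2 = 2 * (\<bar>B\<bar> + 1) / e" using e by (simp_all add: L_def)
  have "\<forall>\<^sub>F ep in at_right 0. \<P>(w in M. 1 < \<bar>Y ep w - X ep w\<bar>) < e / 2"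
    using P by (rule order_tendstoD) (use e in simp)
  moreover have "\<forall>\<^sub>F ep in at_right (0::real). ep > 0" by (rule eventually_at_right_less)
  ultimately have "\<forall>\<^sub>F ep in at_right 0. \<P>(w in M. norm (Y ep w) > L + 1) \<le> e"
  proof eventually_elim
    case (elim ep)
    note [measurable] = Y[OF elim(2)] square_integrableD[OF X[OF elim(2)]]
    have "\<P>(w in M. norm (Y ep w) > L + 1) \<le> prob ({w\<in>space M. L\<^sup>2 \<le> (X ep w)\<^sup>2} \<union> {w\<in>space M. 1 < \<bar>Y ep w - X ep w\<bar>})"
    proof (intro finite_measure_mono subsetI)
      fix w assume w: "w \<in> {w \<in> space M. norm (Y ep w) > L + 1}"
      show "w \<in> {w\<in>space M. L\<^sup>2 \<le> (X ep w)\<^sup>2} \<union> {w\<in>space M. 1 < \<bar>Y ep w - X ep w\<bar>}"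
      proof (cases "1 < \<bar>Y ep w - X ep w\<bar>")
        case False
        then have "L \<le> \<bar>X ep w\<bar>" using w by auto
        then have "L\<^sup>2 \<le> \<bar>X ep w\<bar>\<^sup>2" using L(1) by (intro power_mono) auto
        then show ?thesis using w by simp
      qed (use w in simp)
    qed measurable
    also have "\<dots> \<le> \<P>(w in M. L\<^sup>2 \<le> (X ep w)\<^sup>2) + \<P>(w in M. 1 < \<bar>Y ep w - X ep w\<bar>)"
      by (intro measure_Un_le) measurable
    also have "\<P>(w in M. L\<^sup>2 \<le> (X ep w)\<^sup>2) \<le> (LINT w|M. (X ep w)\<^sup>2) / L\<^sup>2"
      using X[OF elim(2)] L(1) by (intro integral_Markov_inequality_measure[where A = "{}"]) (auto simp: square_integrable_def)
    also have "\<dots> \<le> \<bar>B\<bar> / L\<^sup>2" using B[OF elim(2)] by (intro divide_right_mono) auto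
    also have "\<dots> \<le> e / 2" using e unfolding L(2) by (simp add: field_simps)
    finally show ?case using elim(1) by simp
  qed
  then show ?thesis by blast
qed

context random_green
begin

lemma HS_measurable: "(\<lambda>w. HS (Qf ep w)) \<in> borel_measurable M"
  unfolding HS_def by measurable

lemma Gop_Qf_measurable:
  assumes [measurable]: "g \<in> borel_measurable borel"
  shows "(\<lambda>(w, x). Gop (\<lambda>z. Qf ep w z * g z) x) \<in> borel_measurable (M \<Otimes>\<^sub>M lborel)"
  unfolding Gop_def by measurable

lemma Gop_Qf_second_moment:
  assumes ep: "ep > 0" and u[measurable]: "u \<in> borel_measurable borel" and U: "\<And>x. \<bar>u x\<bar> \<le> U"
  shows "(\<integral>\<^sup>+w. \<integral>\<^sup>+x. ennreal ((Gop (\<lambda>y. Qf ep w y * u y) x)\<^sup>2) \<partial>lborel \<partial>M)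
    \<le> ennreal (ep ^ DIM('a)) * ennreal (U\<^sup>2 * (LINT z|lborel. \<bar>R z\<bar>) * (C * vD))"
proof -
  let ?I = "LINT z|lborel. \<bar>R z\<bar>"
  have I0: "0 \<le> ?I" by simp
  have "(\<integral>\<^sup>+x. \<integral>\<^sup>+y. ennreal ((\<Gamma> x y)\<^sup>2) \<partial>lborel \<partial>lborel) \<le> ennreal C * emeasure lborel D"
  proof (rule nn_integral_times_D_le)
    show "(\<integral>\<^sup>+y. ennreal ((\<Gamma> x y)\<^sup>2) \<partial>lborel) \<le> ennreal C * indicator D x" for x
      using \<Gamma>_square[of x] by (cases "x \<in> D") (auto simp: \<Gamma>_support)
  qed simp
  then have N: "(\<integral>\<^sup>+x. \<integral>\<^sup>+y. ennreal ((\<Gamma> x y)\<^sup>2) \<partial>lborel \<partial>lborel) \<le> ennreal (C * vD)"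
    using C_nonneg vD_nonneg by (simp add: emeasure_D ennreal_mult)
  have "(\<integral>\<^sup>+w. \<integral>\<^sup>+x. ennreal ((Gop (\<lambda>y. Qf ep w y * u y) x)\<^sup>2) \<partial>lborel \<partial>M)
    \<le> ennreal (U\<^sup>2 * (ep ^ DIM('a) * ?I)) * (\<integral>\<^sup>+x. \<integral>\<^sup>+y. ennreal ((\<Gamma> x y)\<^sup>2) \<partial>lborel \<partial>lborel)"
    unfolding Gop_def by (rule square_rows_integral_variance[OF ep square_rows_\<Gamma> u U])
  also have "\<dots> \<le> ennreal (U\<^sup>2 * (ep ^ DIM('a) * ?I)) * ennreal (C * vD)" by (intro mult_left_mono N) simp
  also have "\<dots> = ennreal ((U\<^sup>2 * (ep ^ DIM('a) * ?I)) * (C * vD))"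
    using I0 ep C_nonneg vD_nonneg by (intro ennreal_mult[symmetric]) auto
  also have "(U\<^sup>2 * (ep ^ DIM('a) * ?I)) * (C * vD) = ep ^ DIM('a) * (U\<^sup>2 * ?I * (C * vD))" by (simp only: mult_ac)
  also have "ennreal \<dots> = ennreal (ep ^ DIM('a)) * ennreal (U\<^sup>2 * ?I * (C * vD))"
    using I0 ep C_nonneg vD_nonneg by (intro ennreal_mult) auto
  finally show ?thesis .
qed

text \<open>A union bound in pointwise form. If the sum is below 1, so is every summand, and each
  then states one of the estimates under which \<open>perturbation_expansion\<close> keeps the
  normalised remainder within \<eta>. Written as 1 \<le> sum, it bounds the probability of a large
  remainder by expectations.\<close>

lemma remainder_small:
  assumes m: "square_integrable lborel m" and u0: "square_integrable lborel u0" 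
    and \<rho>: "0 < \<rho>" "\<rho> < 1" and \<eta>: "\<eta> > 0" and T: "T > 0" and ep: "ep > 0" and \<delta>: "\<delta> > 0"
    and \<delta>s: "(1 + sqrt C * sqrt T) * sqrt T / (1 - \<rho>) * sqrt \<delta> \<le> \<eta> / 2"
    and Q: "square_integrable lborel (Qf ep w)"
    and ud: "HS (Qf ep w) \<le> ennreal (\<rho>\<^sup>2) \<Longrightarrow> square_integrable lborel ud"
      "HS (Qf ep w) \<le> ennreal (\<rho>\<^sup>2) \<Longrightarrow> AE x in lborel. ud x = - Gop (\<lambda>y. Qf ep w y * u0 y) x + Gop (\<lambda>y. Qf ep w y * Gop (\<lambda>z. Qf ep w z * (u0 z + ud z)) y) x"
    and large: "\<eta> < \<bar>((LINT x|lborel. ud x * m x) + (LINT y|lborel. Qf ep w y * u0 y * Gop m y)) / ep powr (real DIM('a) / 2)\<bar>"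
  shows "1 \<le> HS (Qf ep w) * ennreal (1 / \<rho>\<^sup>2) + (nn_sq lborel (\<lambda>y. Qf ep w y) * ennreal (1 / T)
    + ((\<integral>\<^sup>+x. ennreal ((Gop (\<lambda>y. Qf ep w y * u0 y) x)\<^sup>2) \<partial>lborel) * ennreal (1 / (ep ^ DIM('a) * T))
    + ((\<integral>\<^sup>+x. ennreal ((Qf ep w x * Gop (\<lambda>z. Qf ep w z * Gop m z) x)\<^sup>2) \<partial>lborel) * ennreal (1 / \<delta>)
    + ennreal (\<bar>double_form \<Gamma> (Gop m) u0 ep w\<bar> / ep powr (real DIM('a) / 2)) * ennreal (2 / \<eta>))))"
  (is "1 \<le> ?H * _ + (?s * _ + (?p * _ + (?k * _ + ?a * _)))")
proof (rule ccontr)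
  assume "\<not> ?thesis"
  then have lt: "?H * ennreal (1 / \<rho>\<^sup>2) + (?s * ennreal (1 / T) + (?p * ennreal (1 / (ep ^ DIM('a) * T)) + (?k * ennreal (1 / \<delta>) + ?a * ennreal (2 / \<eta>)))) < 1"
    by (simp only: not_le)
  have split: "x < 1 \<and> y < 1" if "x + y < 1" for x y :: ennreal
    using that by (meson le_less_trans add_increasing add_increasing2 order_refl zero_le)
  have cancel: "x \<le> ennreal c" if "x * ennreal (1 / c) < 1" "c > 0" for x c
  proof (rule ccontr)
    assume "\<not> x \<le> ennreal c"
    then have "ennreal c * ennreal (1 / c) \<le> x * ennreal (1 / c)" by (intro mult_right_mono) auto
    moreover have "ennreal c * ennreal (1 / c) = 1" using that(2) by (simp add: ennreal_mult[symmetric])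
    ultimately show False using that(1) by simp
  qed
  let ?d = "ep powr (real DIM('a) / 2)"
  have d0: "?d > 0" and d2: "ep ^ DIM('a) = ?d\<^sup>2" using ep by (simp_all add: powr_power powr_realpow)
  have c0: "0 < \<rho>\<^sup>2" "0 < ep ^ DIM('a) * T" using \<rho> ep T by auto
  \<comment> \<open>The thresholds reflect the orders: T for the norm of the potential, ep^d T for
    the squared norm of G Q u0, and \<delta> for the squared norm of Q G Q g.\<close>
  have H: "?H \<le> ennreal (\<rho>\<^sup>2)" and s: "?s \<le> ennreal T" and p: "?p \<le> ennreal (ep ^ DIM('a) * T)" and k: "?k \<le> ennreal \<delta>"
    using split[OF lt] split[OF conjunct2[OF split[OF lt]]] split[OF conjunct2[OF split[OF conjunct2[OF split[OF lt]]]]]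
      split[OF conjunct2[OF split[OF conjunct2[OF split[OF conjunct2[OF split[OF lt]]]]]]] c0 T \<delta> by (auto intro!: cancel)
  have "?a * ennreal (1 / (\<eta> / 2)) < 1"
    using split[OF conjunct2[OF split[OF conjunct2[OF split[OF conjunct2[OF split[OF lt]]]]]]] by simp
  then have "?a \<le> ennreal (\<eta> / 2)" using \<eta> by (intro cancel) auto
  then have a: "\<bar>double_form \<Gamma> (Gop m) u0 ep w\<bar> / ?d \<le> \<eta> / 2" using \<eta> by simp
  note W = ud(1)[OF H] and eq = ud(2)[OF H]
  have gm: "Gop m \<in> borel_measurable borel" using m by (intro Gop_measurable) (auto simp: square_integrable_def)
  note gb = Gop_bound(1)[OF m]
  have Qu: "integrable lborel (\<lambda>y. Qf ep w y * u0 y)" by (rule square_integrable_mult[OF Q u0])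
  have ps: "square_integrable lborel (Gop (\<lambda>y. Qf ep w y * u0 y))" by (rule Gop_L1(2)[OF Qu])
  note Qg = square_integrable_mult_bounded[OF Q gm gb]
  have ks: "square_integrable lborel (\<lambda>x. Qf ep w x * Gop (\<lambda>z. Qf ep w z * Gop m z) x)"
    using Qg by (intro square_integrable_mult_bounded[OF Q _ Gop_bound(1)[OF Qg]] Gop_measurable) (auto simp: square_integrable_def)
  have norm_le: "l2norm lborel f \<le> sqrt c" if "square_integrable lborel f" "nn_sq lborel f \<le> ennreal c" "0 \<le> c" for f c
    using that square_integrable_nn_eq[OF that(1)] by (simp add: l2norm_def)
  have nQ: "l2norm lborel (Qf ep w) \<le> sqrt T" by (rule norm_le[OF Q s]) (use T in simp)
  have np: "l2norm lborel (Gop (\<lambda>y. Qf ep w y * u0 y)) \<le> ?d * sqrt T"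
    using norm_le[OF ps p] c0 d0 by (simp add: d2 real_sqrt_mult)
  have nk: "l2norm lborel (\<lambda>x. Qf ep w x * Gop (\<lambda>z. Qf ep w z * Gop m z) x) \<le> sqrt \<delta>" by (rule norm_le[OF ks k]) (use \<delta> in simp)
  let ?E = "(LINT x|lborel. ud x * m x) + (LINT y|lborel. Qf ep w y * u0 y * Gop m y)"
  have "\<bar>?E\<bar> \<le> \<bar>double_form \<Gamma> (Gop m) u0 ep w\<bar> + (1 + sqrt C * l2norm lborel (Qf ep w)) * l2norm lborel (Gop (\<lambda>y. Qf ep w y * u0 y)) / (1 - \<rho>)
      * l2norm lborel (\<lambda>y. Qf ep w y * Gop (\<lambda>z. Qf ep w z * Gop m z) y)"
    using perturbation_expansion[OF Q u0 W m H _ \<rho>(2) eq] \<rho> by (simp add: double_form_def Gop_def)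
  also have "(1 + sqrt C * l2norm lborel (Qf ep w)) * l2norm lborel (Gop (\<lambda>y. Qf ep w y * u0 y)) / (1 - \<rho>)
      * l2norm lborel (\<lambda>y. Qf ep w y * Gop (\<lambda>z. Qf ep w z * Gop m z) y) \<le> (1 + sqrt C * sqrt T) * (?d * sqrt T) / (1 - \<rho>) * sqrt \<delta>"
    using C_nonneg T \<delta> \<rho> d0 by (intro mult_mono divide_right_mono add_left_mono mult_left_mono nQ np nk) auto
  also have "\<dots> = ((1 + sqrt C * sqrt T) * sqrt T / (1 - \<rho>) * sqrt \<delta>) * ?d" by simp
  also have "\<dots> \<le> \<eta> / 2 * ?d" using \<delta>s d0 by (intro mult_right_mono) auto
  finally have "\<bar>?E\<bar> \<le> \<bar>double_form \<Gamma> (Gop m) u0 ep w\<bar> + \<eta> / 2 * ?d" by simp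
  also have "\<dots> \<le> \<eta> / 2 * ?d + \<eta> / 2 * ?d" using a d0 by (simp add: pos_divide_le_eq)
  finally have "\<bar>?E / ?d\<bar> \<le> \<eta>" using d0 by (simp add: pos_divide_le_eq)
  with large show False by simp
qed

text \<open>Of the five expectations in the bound, three tend to 0 and two are merely bounded. The
  bounded ones are made small by a large threshold T, the price being paid by \<delta>. The lower
  integral of the indicator is monotone, so the event itself may be compared directly with the
  measurable bound.\<close>

lemma remainder_in_probability:
  assumes pos: "\<And>x y. 0 \<le> \<Gamma> x y" and m: "square_integrable lborel m"
    and u0: "square_integrable lborel u0" "u0 \<in> borel_measurable borel" "\<And>x. \<bar>u0 x\<bar> \<le> U" and \<rho>: "0 < \<rho>" "\<rho> < 1"
    and ud: "\<And>ep. ep > 0 \<Longrightarrow> AE w in M. HS (Qf ep w) \<le> ennreal (\<rho>\<^sup>2) \<longrightarrow> square_integrable lborel (ud ep w) \<and>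
      (AE x in lborel. ud ep w x = - Gop (\<lambda>y. Qf ep w y * u0 y) x + Gop (\<lambda>y. Qf ep w y * Gop (\<lambda>z. Qf ep w z * (u0 z + ud ep w z)) y) x)"
    and \<eta>: "\<eta> > 0"
  shows "((\<lambda>ep. \<integral>\<^sup>+w. indicator {w. \<eta> < \<bar>((LINT x|lborel. ud ep w x * m x) + (LINT y|lborel. Qf ep w y * u0 y * Gop m y)) / ep powr (real DIM('a) / 2)\<bar>} w \<partial>M)
    \<longlongrightarrow> 0) (at_right 0)" (is "(?F \<longlongrightarrow> 0) _")
proof (rule tendsto_at_right_sequentially[of 0 1])
  \<comment> \<open>Sequences suffice for a limit at 0 from the right, and they are what dominated
    convergence was used for.\<close>
  fix e :: "nat \<Rightarrow> real" assume e: "\<And>n. 0 < e n" "e \<longlonglongrightarrow> 0"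
  have gm[measurable]: "Gop m \<in> borel_measurable borel" using m by (intro Gop_measurable) (auto simp: square_integrable_def)
  note gb = Gop_bound(1)[OF m] and [measurable] = u0(2)
  let ?I = "LINT z|lborel. \<bar>R z\<bar>"
  \<comment> \<open>The sum of the bounds for the mean squared norms of Q and of ep^(-d/2) G Q
    u0.\<close>
  define c where "c = 2 * K * vD + U\<^sup>2 * ?I * (C * vD)"
  have c0: "0 \<le> 2 * K * vD" "0 \<le> U\<^sup>2 * ?I * (C * vD)" using K_ge_1 vD_nonneg C_nonneg by auto
  show "(\<lambda>n. ?F (e n)) \<longlonglongrightarrow> 0"
  proof (rule ennreal_tendsto_0I)
    fix r :: real assume r: "r > 0"
    \<comment> \<open>Makes the two bounded contributions together at most r / 2, whatever
      n.\<close>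
    define T where "T = (c + 1) / (r / 2)"
    have T: "T > 0" "c / T \<le> r / 2" using r c0 by (simp_all add: T_def c_def field_simps add_nonneg_pos)
    define b where "b = (1 + sqrt C * sqrt T) * sqrt T / (1 - \<rho>)"
    have b: "b > 0" using T \<rho> C_nonneg by (simp add: b_def add_pos_nonneg)
    \<comment> \<open>Depends on T through b: the factor multiplying the norm of Q G Q g in the
      expansion is at most b ep^(d/2), so b times the root of \<delta> may be at most \<eta> /
      2.\<close>
    define \<delta> where "\<delta> = (\<eta> / (2 * b))\<^sup>2"
    have \<delta>: "\<delta> > 0" "b * sqrt \<delta> \<le> \<eta> / 2" using b \<eta> by (simp_all add: \<delta>_def)
    let ?H = "\<lambda>n w. HS (Qf (e n) w)" and ?s = "\<lambda>n w. \<integral>\<^sup>+y. ennreal ((Qf (e n) w y)\<^sup>2) \<partial>lborel"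
      and ?p = "\<lambda>n w. \<integral>\<^sup>+x. ennreal ((Gop (\<lambda>y. Qf (e n) w y * u0 y) x)\<^sup>2) \<partial>lborel"
      and ?k = "\<lambda>n w. \<integral>\<^sup>+x. ennreal ((Qf (e n) w x * Gop (\<lambda>z. Qf (e n) w z * Gop m z) x)\<^sup>2) \<partial>lborel"
      and ?a = "\<lambda>n w. ennreal (\<bar>double_form \<Gamma> (Gop m) u0 (e n) w\<bar> / e n powr (real DIM('a) / 2))"
    note [measurable] = HS_measurable Gop_Qf_measurable[OF u0(2)] Gop_Qf_measurable[OF gm] double_form_measurable[OF gm u0(2) square_rows_\<Gamma>]
    have sm[measurable]: "?s n \<in> borel_measurable M" "?p n \<in> borel_measurable M" "?k n \<in> borel_measurable M" for n
      by measurable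
    have F_le: "?F (e n) \<le> (\<integral>\<^sup>+w. ?H n w \<partial>M) * ennreal (1 / \<rho>\<^sup>2) + (ennreal c * ennreal (1 / T) + ((\<integral>\<^sup>+w. ?k n w \<partial>M) * ennreal (1 / \<delta>) + (\<integral>\<^sup>+w. ?a n w \<partial>M) * ennreal (2 / \<eta>)))" for n
    proof -
      have "?F (e n) \<le> (\<integral>\<^sup>+w. ?H n w * ennreal (1 / \<rho>\<^sup>2) + (?s n w * ennreal (1 / T) + (?p n w * ennreal (1 / (e n ^ DIM('a) * T)) + (?k n w * ennreal (1 / \<delta>) + ?a n w * ennreal (2 / \<eta>)))) \<partial>M)"
      proof (rule nn_integral_mono_AE, use AE_Qf[OF e(1)[of n]] ud[OF e(1)[of n]] in eventually_elim)
        case (elim w)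
        show ?case
        proof (cases "\<eta> < \<bar>((LINT x|lborel. ud (e n) w x * m x) + (LINT y|lborel. Qf (e n) w y * u0 y * Gop m y)) / e n powr (real DIM('a) / 2)\<bar>")
          case True
          have "1 \<le> ?H n w * ennreal (1 / \<rho>\<^sup>2) + (?s n w * ennreal (1 / T) + (?p n w * ennreal (1 / (e n ^ DIM('a) * T)) + (?k n w * ennreal (1 / \<delta>) + ?a n w * ennreal (2 / \<eta>))))"
            by (rule remainder_small[OF m u0(1) \<rho> \<eta> T(1) e(1) \<delta>(1) \<delta>(2)[unfolded b_def] elim(1) _ _ True]) (use elim(2) in auto)
          then show ?thesis using True by simp
        qed simp
      qed
      also have "\<dots> = (\<integral>\<^sup>+w. ?H n w \<partial>M) * ennreal (1 / \<rho>\<^sup>2) + ((\<integral>\<^sup>+w. ?s n w \<partial>M) * ennreal (1 / T) + ((\<integral>\<^sup>+w. ?p n w \<partial>M) * ennreal (1 / (e n ^ DIM('a) * T))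
          + ((\<integral>\<^sup>+w. ?k n w \<partial>M) * ennreal (1 / \<delta>) + (\<integral>\<^sup>+w. ?a n w \<partial>M) * ennreal (2 / \<eta>))))"
        by (simp add: nn_integral_add nn_integral_multc)
      also have "\<dots> \<le> (\<integral>\<^sup>+w. ?H n w \<partial>M) * ennreal (1 / \<rho>\<^sup>2) + (ennreal (2 * K * vD) * ennreal (1 / T) + (ennreal (U\<^sup>2 * ?I * (C * vD)) * ennreal (1 / T)
          + ((\<integral>\<^sup>+w. ?k n w \<partial>M) * ennreal (1 / \<delta>) + (\<integral>\<^sup>+w. ?a n w \<partial>M) * ennreal (2 / \<eta>))))"
      proof (intro add_mono order_refl mult_right_mono Qf_second_moment e)
        have "(\<integral>\<^sup>+w. ?p n w \<partial>M) * ennreal (1 / (e n ^ DIM('a) * T)) \<le> (ennreal (e n ^ DIM('a)) * ennreal (U\<^sup>2 * ?I * (C * vD))) * ennreal (1 / (e n ^ DIM('a) * T))"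
          by (intro mult_right_mono Gop_Qf_second_moment e u0) simp
        also have "\<dots> = ennreal (U\<^sup>2 * ?I * (C * vD)) * (ennreal (e n ^ DIM('a)) * ennreal (1 / (e n ^ DIM('a) * T)))" by (simp only: mult_ac)
        also have "ennreal (e n ^ DIM('a)) * ennreal (1 / (e n ^ DIM('a) * T)) = ennreal (1 / T)"
          using e(1)[of n] T(1) by (subst ennreal_mult[symmetric]) auto
        finally show "(\<integral>\<^sup>+w. ?p n w \<partial>M) * ennreal (1 / (e n ^ DIM('a) * T)) \<le> ennreal (U\<^sup>2 * ?I * (C * vD)) * ennreal (1 / T)" .
      qed simp
      also have "\<dots> = (\<integral>\<^sup>+w. ?H n w \<partial>M) * ennreal (1 / \<rho>\<^sup>2) + (ennreal c * ennreal (1 / T) + ((\<integral>\<^sup>+w. ?k n w \<partial>M) * ennreal (1 / \<delta>) + (\<integral>\<^sup>+w. ?a n w \<partial>M) * ennreal (2 / \<eta>)))"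
        unfolding c_def ennreal_plus[OF c0] distrib_right by (simp only: add.assoc)
      finally show ?thesis .
    qed
    have cT: "ennreal c * ennreal (1 / T) \<le> ennreal (r / 2)"
      using T c0 by (subst ennreal_mult[symmetric]) (auto simp: c_def ennreal_leI)
    have multc: "(\<lambda>n. f n * ennreal d) \<longlonglongrightarrow> 0 * ennreal d" if "f \<longlonglongrightarrow> 0" for f :: "nat \<Rightarrow> ennreal" and d
      using ennreal_tendsto_cmult[OF _ that, of "ennreal d"] by (simp add: mult.commute)
    have "(\<lambda>n. (\<integral>\<^sup>+w. ?H n w \<partial>M) * ennreal (1 / \<rho>\<^sup>2) + ((\<integral>\<^sup>+w. ?k n w \<partial>M) * ennreal (1 / \<delta>) + (\<integral>\<^sup>+w. ?a n w \<partial>M) * ennreal (2 / \<eta>)))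
      \<longlonglongrightarrow> 0 * ennreal (1 / \<rho>\<^sup>2) + (0 * ennreal (1 / \<delta>) + 0 * ennreal (2 / \<eta>))"
      by (intro tendsto_add multc HS_tendsto_0[OF e] Qf_Gop_Qf_tendsto_0[OF gm gb e] double_form_tendsto_0[OF pos gm gb u0(2,3) e])
    then have "\<forall>\<^sub>F n in sequentially. (\<integral>\<^sup>+w. ?H n w \<partial>M) * ennreal (1 / \<rho>\<^sup>2) + ((\<integral>\<^sup>+w. ?k n w \<partial>M) * ennreal (1 / \<delta>) + (\<integral>\<^sup>+w. ?a n w \<partial>M) * ennreal (2 / \<eta>)) < ennreal (r / 2)"
      by (rule order_tendstoD) (use r in simp)
    then show "\<forall>\<^sub>F n in sequentially. ?F (e n) \<le> ennreal r"
    proof eventually_elim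
      case (elim n)
      have "?F (e n) \<le> ennreal c * ennreal (1 / T) + ((\<integral>\<^sup>+w. ?H n w \<partial>M) * ennreal (1 / \<rho>\<^sup>2) + ((\<integral>\<^sup>+w. ?k n w \<partial>M) * ennreal (1 / \<delta>) + (\<integral>\<^sup>+w. ?a n w \<partial>M) * ennreal (2 / \<eta>)))"
        using F_le[of n] by (simp only: add_ac)
      also have "\<dots> \<le> ennreal (r / 2) + ennreal (r / 2)" using elim by (intro add_mono cT less_imp_le)
      also have "\<dots> = ennreal r" using r by (simp add: ennreal_plus[symmetric] del: ennreal_plus)
      finally show ?case .
    qed
  qed
qed simp

end

text \<open>From t^2 \<le> 1 + t^(2 + \<eta>) for t \<ge> 0 and the finite volume of D, the rows of
  the kernel are bounded in L^2 by the volume plus the given supremum.\<close>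

lemma green_kernel_exists:
  fixes D :: "'a::euclidean_space set" and G :: "'a \<Rightarrow> 'a \<Rightarrow> real"
  assumes D: "D \<in> finite_borel" and G: "admissible_kernel D G"
  shows "\<exists>C. green_kernel D (\<lambda>x y. indicator D x * indicator D y * G x y) C"
proof -
  let ?\<Gamma> = "\<lambda>x y. indicator D x * indicator D y * G x y"
  have m: "(\<lambda>(x, y). ?\<Gamma> x y) \<in> borel_measurable lborel2"
  proof -
    have "(\<lambda>s. indicat_real (D \<times> D) s *\<^sub>R (case s of (x, y) \<Rightarrow> G x y)) = (\<lambda>(x, y). ?\<Gamma> x y)"
      by (auto simp: indicator_def)
    then show ?thesis using G by (simp add: admissible_kernel_def set_borel_measurable_def)
  qed
  have Dm[measurable]: "D \<in> sets borel" using D by (simp add: finite_borel_def)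
  from G obtain \<eta> where \<eta>: "\<eta> > 0" and S: "(SUP x\<in>D. \<integral>\<^sup>+y\<in>D. ennreal (\<bar>G x y\<bar> powr (2 + \<eta>)) \<partial>lborel) < \<infinity>" (is "?S < _")
    by (auto simp: admissible_kernel_def)
  define c where "c = emeasure lborel D + ?S"
  have c: "c < \<infinity>" using D S by (simp add: c_def finite_borel_def)
  have row: "nn_sq lborel (\<lambda>y. ?\<Gamma> x y) \<le> c" for x
  proof (cases "x \<in> D")
    case True
    have rm: "(\<lambda>y. indicator D y * G x y) \<in> borel_measurable borel"
      using measurable_compose[OF measurable_Pair1', of x lborel "\<lambda>(x, y). ?\<Gamma> x y" lborel borel] m True by simp
    have "(\<integral>\<^sup>+y. ennreal ((?\<Gamma> x y)\<^sup>2) \<partial>lborel) \<le> (\<integral>\<^sup>+y. indicator D y + ennreal (\<bar>indicator D y * G x y\<bar> powr (2 + \<eta>)) \<partial>lborel)"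
    proof (rule nn_integral_mono)
      fix y
      show "ennreal ((?\<Gamma> x y)\<^sup>2) \<le> indicator D y + ennreal (\<bar>indicator D y * G x y\<bar> powr (2 + \<eta>))"
      proof (cases "y \<in> D")
        case y: True
        have "(G x y)\<^sup>2 \<le> 1 + \<bar>G x y\<bar> powr (2 + \<eta>)"
        proof (cases "\<bar>G x y\<bar> \<le> 1")
          case True
          then have "(G x y)\<^sup>2 \<le> 1" by (simp add: abs_square_le_1)
          then show ?thesis by (simp add: add_increasing2)
        next
          case False
          then have "\<bar>G x y\<bar> powr 2 \<le> \<bar>G x y\<bar> powr (2 + \<eta>)" using \<eta> by (intro powr_mono) auto
          then show ?thesis using False by (simp add: powr_numeral)
        qed
        then have "ennreal ((G x y)\<^sup>2) \<le> ennreal (1 + \<bar>G x y\<bar> powr (2 + \<eta>))" by (rule ennreal_leI)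
        then show ?thesis using y True by (simp add: ennreal_plus)
      qed simp
    qed
    also have "\<dots> = emeasure lborel D + (\<integral>\<^sup>+y. ennreal (\<bar>indicator D y * G x y\<bar> powr (2 + \<eta>)) \<partial>lborel)"
      using rm by (subst nn_integral_add) auto
    also have "(\<integral>\<^sup>+y. ennreal (\<bar>indicator D y * G x y\<bar> powr (2 + \<eta>)) \<partial>lborel) = (\<integral>\<^sup>+y\<in>D. ennreal (\<bar>G x y\<bar> powr (2 + \<eta>)) \<partial>lborel)"
      by (intro nn_integral_cong) (auto simp: indicator_def)
    also have "\<dots> \<le> ?S" by (rule SUP_upper[OF True])
    finally show ?thesis by (simp add: c_def)
  qed simp
  have "green_kernel D ?\<Gamma> (enn2real c)"
  proof
    show "D \<in> finite_borel" by fact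
    show "(\<lambda>(x, y). ?\<Gamma> x y) \<in> borel_measurable lborel2" by fact
    show "?\<Gamma> x y = ?\<Gamma> y x" for x y using G by (auto simp: admissible_kernel_def indicator_def)
    show "x \<notin> D \<Longrightarrow> ?\<Gamma> x y = 0" for x y by simp
    show "(\<integral>\<^sup>+y. ennreal ((?\<Gamma> x y)\<^sup>2) \<partial>lborel) \<le> ennreal (enn2real c)" for x
      using row[of x] c by (simp add: less_top)
  qed simp
  then show ?thesis by blast
qed

lemma square_integrable_L2:
  "u \<in> L2 D \<longleftrightarrow> square_integrable lborel (\<lambda>x. indicator D x * u x)"
proof -
  have "(\<lambda>x. (indicator D x * u x)\<^sup>2) = (\<lambda>x. indicator D x * (u x)\<^sup>2)" by (auto simp: indicator_def)
  then show ?thesis by (simp add: L2_def set_borel_measurable_def set_integrable_def square_integrable_def)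
qed

section \<open>Transfer to the perturbed problem on the domain\<close>

locale perturbed_problem = random_green M q \<phi> D \<Gamma> C
  for M :: "'w measure" and q :: "'a::euclidean_space \<Rightarrow> 'w \<Rightarrow> real" and \<phi> and D :: "'a set" and \<Gamma> and C +
  fixes G :: "'a \<Rightarrow> 'a \<Rightarrow> real"
  assumes D_open: "open D" and D_bounded: "bounded D"
    and \<Gamma>_eq: "\<And>x y. \<Gamma> x y = indicator D x * indicator D y * G x y"
    and G_sym: "\<And>x y. x \<in> D \<Longrightarrow> y \<in> D \<Longrightarrow> G x y = G y x"
    and G_nonneg: "\<And>x y. x \<in> D \<Longrightarrow> y \<in> D \<Longrightarrow> 0 \<le> G x y"
begin

lemma green_eq: "x \<in> D \<Longrightarrow> green D G v x = Gop v x"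
  by (simp add: green_def set_lebesgue_integral_def Gop_def \<Gamma>_eq mult.assoc)

lemma Gop_cong: "(\<And>y. y \<in> D \<Longrightarrow> v y = v' y) \<Longrightarrow> Gop v x = Gop v' x"
  unfolding Gop_def \<Gamma>_eq by (intro Bochner_Integration.integral_cong refl) (auto simp: indicator_def)

lemma GqGq_eq:
  assumes "x \<in> D" "\<And>y. y \<in> D \<Longrightarrow> V y = Q y" "\<And>y. y \<in> D \<Longrightarrow> u y = v y"
  shows "GqGq D G V u x = Gop (\<lambda>y. Q y * Gop (\<lambda>z. Q z * v z) y) x"
proof -
  have "Gop (\<lambda>y. V y * green D G (\<lambda>z. V z * u z) y) x = Gop (\<lambda>y. Q y * Gop (\<lambda>z. Q z * v z) y) x"
  proof (rule Gop_cong)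
    fix y assume y: "y \<in> D"
    have "Gop (\<lambda>z. V z * u z) y = Gop (\<lambda>z. Q z * v z) y" by (rule Gop_cong) (simp add: assms)
    then show "V y * green D G (\<lambda>z. V z * u z) y = Q y * Gop (\<lambda>z. Q z * v z) y" using y by (simp add: green_eq assms)
  qed
  then show ?thesis using assms(1) by (simp add: GqGq_def green_eq)
qed

lemma q_scaled_D: "y \<in> D \<Longrightarrow> q_scaled q ep y w = Qf ep w y"
  by (simp add: q_scaled_def Qf_def qs_def)

text \<open>The operator norm is at most the Hilbert-Schmidt norm. This bounds the bad event by a
  quantity whose expectation has already been shown to vanish.\<close>

lemma not_bad_event:
  assumes Q: "square_integrable lborel (Qf ep w)" and h: "HS (Qf ep w) \<le> ennreal (\<rho>\<^sup>2)" and \<rho>: "0 \<le> \<rho>"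
  shows "w \<notin> bad_event M D G q \<rho> ep"
proof -
  have "norm_L2 D (GqGq D G (\<lambda>x. q_scaled q ep x w) v) \<le> ennreal \<rho>" if v: "v \<in> L2 D" "norm_L2 D v \<le> 1" for v
  proof -
    let ?v = "\<lambda>x. indicator D x * v x" and ?T = "\<lambda>x. GqGq D G (\<lambda>x. q_scaled q ep x w) v x"
    have vs: "square_integrable lborel ?v" using v(1) by (simp add: square_integrable_L2)
    have N: "(\<integral>\<^sup>+x\<in>D. ennreal ((u x)\<^sup>2) \<partial>lborel) = nn_sq lborel (\<lambda>x. indicator D x * u x)" for u :: "'a \<Rightarrow> real"
      by (intro nn_integral_cong) (auto simp: indicator_def)
    have "l2norm lborel ?v \<le> 1"
      using v(2) unfolding norm_L2_def N square_integrable_nn_eq[OF vs] by (simp add: l2norm_def)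
    have T: "(indicator D x * ?T x)\<^sup>2 = (Gop (\<lambda>y. Qf ep w y * Gop (\<lambda>z. Qf ep w z * ?v z) y) x)\<^sup>2" for x
      proof (cases "x \<in> D")
        case True
        have "?T x = Gop (\<lambda>y. Qf ep w y * Gop (\<lambda>z. Qf ep w z * ?v z) y) x"
          by (rule GqGq_eq[OF True q_scaled_D]) simp_all
        then show ?thesis using True by simp
      qed (simp add: Gop_support)
    note b = HS_bound_l2norm[OF Q vs h \<rho>]
    have "l2norm lborel (Gop (\<lambda>y. Qf ep w y * Gop (\<lambda>z. Qf ep w z * ?v z) y)) \<le> \<rho>"
      using order_trans[OF b(2) mult_left_mono[OF \<open>l2norm lborel ?v \<le> 1\<close> \<rho>]] by simp
    then show ?thesis
      unfolding norm_L2_def N T square_integrable_nn_eq[OF b(1)] using \<rho> by (simp add: l2norm_def ennreal_leI)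
  qed
  then have "opnorm_L2 D (GqGq D G (\<lambda>x. q_scaled q ep x w)) \<le> ennreal \<rho>"
    unfolding opnorm_L2_def by (intro SUP_least) auto
  then show ?thesis by (simp add: bad_event_def not_less)
qed

text \<open>Under the Hilbert-Schmidt bound the realisation lies outside the bad event, so the
  modified potential is the rescaled one on \<open>D\<close>. Subtracting u0 from the integral
  equation gives the equation assumed in \<open>perturbation_expansion\<close>; both unknowns are
  extended by zero.\<close>

lemma perturbed_solution_expansion:
  assumes sol: "perturbed_solution M D G q \<rho> f ep u" and f: "f \<in> L2 D" and \<rho>: "0 \<le> \<rho>" and ep: "ep > 0"
  defines "u0 \<equiv> Gop f" and "ud \<equiv> \<lambda>w x. indicator D x * (u x w - green D G f x)"
  shows "AE w in M. HS (Qf ep w) \<le> ennreal (\<rho>\<^sup>2) \<longrightarrow> square_integrable lborel (ud w) \<and>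
      (AE x in lborel. ud w x = - Gop (\<lambda>y. Qf ep w y * u0 y) x + Gop (\<lambda>y. Qf ep w y * Gop (\<lambda>z. Qf ep w z * (u0 z + ud w z)) y) x)"
proof -
  have f': "square_integrable lborel (\<lambda>x. indicator D x * f x)" using f by (simp add: square_integrable_L2)
  have u0: "u0 = Gop (\<lambda>x. indicator D x * f x)" unfolding u0_def by (intro ext Gop_cong) simp
  have u0s: "square_integrable lborel (\<lambda>x. indicator D x * u0 x)"
    unfolding u0 using f' by (intro square_integrable_D(1)[OF _ Gop_bound(1)[OF f']] Gop_measurable) (auto simp: square_integrable_def)
  have "AE w in M. (\<lambda>x. u x w) \<in> L2 D \<and>
        ae_eq D (\<lambda>x. u x w)
          (\<lambda>x. green D G f x - green D G (\<lambda>y. q_mod M D G q \<rho> ep y w * green D G f y) x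
             + GqGq D G (\<lambda>y. q_mod M D G q \<rho> ep y w) (\<lambda>y. u y w) x)"
    using sol by (simp add: perturbed_solution_def)
  with AE_Qf[OF ep] show ?thesis
  proof eventually_elim
    case (elim w)
    show ?case
    proof (intro impI conjI)
      assume h: "HS (Qf ep w) \<le> ennreal (\<rho>\<^sup>2)"
      have us: "square_integrable lborel (\<lambda>x. indicator D x * u x w)" using elim(2) by (simp add: square_integrable_L2)
      have ud: "ud w x = indicator D x * u x w - indicator D x * u0 x" for x
        by (cases "x \<in> D") (simp_all add: ud_def green_eq u0_def)
      show "square_integrable lborel (ud w)"
        unfolding ud by (rule square_integrable_diff[OF us u0s])
      have qm: "y \<in> D \<Longrightarrow> q_mod M D G q \<rho> ep y w = Qf ep w y" for y
        using not_bad_event[OF elim(1) h \<rho>] by (simp add: q_mod_def q_scaled_D)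
      have "AE x in lborel. x \<in> D \<longrightarrow> u x w = green D G f x - green D G (\<lambda>y. q_mod M D G q \<rho> ep y w * green D G f y) x
             + GqGq D G (\<lambda>y. q_mod M D G q \<rho> ep y w) (\<lambda>y. u y w) x"
        using elim(2) by (simp add: ae_eq_def)
      then show "AE x in lborel. ud w x = - Gop (\<lambda>y. Qf ep w y * u0 y) x + Gop (\<lambda>y. Qf ep w y * Gop (\<lambda>z. Qf ep w z * (u0 z + ud w z)) y) x"
      proof eventually_elim
        case (elim x)
        show ?case
        proof (cases "x \<in> D")
          case True
          have 1: "green D G (\<lambda>y. q_mod M D G q \<rho> ep y w * green D G f y) x = Gop (\<lambda>y. Qf ep w y * u0 y) x"
            unfolding green_eq[OF True] by (rule Gop_cong) (simp add: qm green_eq u0_def)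
          have 2: "GqGq D G (\<lambda>y. q_mod M D G q \<rho> ep y w) (\<lambda>y. u y w) x = Gop (\<lambda>y. Qf ep w y * Gop (\<lambda>z. Qf ep w z * (u0 z + ud w z)) y) x"
            by (rule GqGq_eq[OF True qm]) (simp_all add: ud)
          show ?thesis using elim True unfolding 1 2 by (simp add: ud green_eq u0_def)
        qed (simp add: ud_def Gop_support)
      qed
    qed
  qed
qed

text \<open>Linearity of the integral is valid for realisations that are square integrable over
  \<open>D\<close>, hence almost surely.\<close>

lemma osc_linear_AE:
  fixes m :: "'k::finite \<Rightarrow> 'a \<Rightarrow> real"
  assumes ep: "ep > 0" and m: "\<And>k. continuous_on D (m k)" and B: "\<And>k x. x \<in> D \<Longrightarrow> \<bar>m k x\<bar> \<le> B"
  shows "AE w in M. (\<Sum>k\<in>UNIV. t k * osc_integral D q (m k) ep w) = osc_integral D q (\<lambda>y. \<Sum>k\<in>UNIV. t k * m k y) ep w"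
  using AE_Qf[OF ep]
proof eventually_elim
  case (elim w)
  let ?d = "ep powr (real DIM('a) / 2)"
  have i: "integrable lborel (\<lambda>y. (indicator D y * m k y / ?d) * qs ep y w)" for k
  proof -
    have km: "(\<lambda>y. indicator D y * m k y) \<in> borel_measurable borel"
      using borel_measurable_continuous_on_indicator[OF _ m[of k]] D_open by simp
    have "square_integrable lborel (\<lambda>y. indicator D y * (indicator D y * m k y))"
      by (rule square_integrable_D(1)[OF km, where b = "\<bar>B\<bar>"]) (use B[of _ k] in \<open>auto simp: indicator_def intro: order_trans[OF _ abs_ge_self]\<close>)
    then have "integrable lborel (\<lambda>y. (indicator D y * (indicator D y * m k y)) * Qf ep w y * (1 / ?d))"
      using square_integrable_mult[OF _ elim] by (intro integrable_mult_left) auto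
    moreover have "(indicator D y * (indicator D y * m k y)) * Qf ep w y * (1 / ?d) = (indicator D y * m k y / ?d) * qs ep y w" for y
      by (auto simp: indicator_def Qf_def)
    ultimately show ?thesis by (simp only:)
  qed
  have "(\<Sum>k\<in>UNIV. t k * osc_integral D q (m k) ep w) = (\<Sum>k\<in>UNIV. LINT y|lborel. t k * ((indicator D y * m k y / ?d) * qs ep y w))"
    unfolding osc_integral_eq by simp
  also have "\<dots> = (LINT y|lborel. (\<Sum>k\<in>UNIV. t k * ((indicator D y * m k y / ?d) * qs ep y w)))"
    by (intro Bochner_Integration.integral_sum[symmetric] integrable_mult_right i)
  also have "\<dots> = osc_integral D q (\<lambda>y. \<Sum>k\<in>UNIV. t k * m k y) ep w"
    unfolding osc_integral_eq by (intro Bochner_Integration.integral_cong refl) (simp add: sum_distrib_left sum_distrib_right sum_divide_distrib mult_ac)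
  finally show ?case .
qed

lemma combination_bound:
  fixes m :: "'k::finite \<Rightarrow> 'a \<Rightarrow> real"
  assumes "\<And>k. \<bar>m k x\<bar> \<le> B"
  shows "\<bar>\<Sum>k\<in>UNIV. t k * m k x\<bar> \<le> (\<Sum>k\<in>UNIV. \<bar>t k\<bar> * B)"
  by (rule order_trans[OF sum_abs sum_mono]) (auto simp: abs_mult intro!: mult_left_mono assms)

text \<open>The Cramer-Wold device: a linear combination of the oscillatory integrals is the
  oscillatory integral of the combined weight, so the scalar limit determines all characteristic
  functions. The Gaussian measure is the one whose quadratic form is \<sigma>^2 times the integral
  of the squared combination, which also shows that matrix semidefinite.\<close>

lemma osc_vector_converges:
  fixes m :: "'k::finite \<Rightarrow> 'a \<Rightarrow> real"
  assumes m: "\<And>k. continuous_on D (m k)" and B: "\<And>k x. x \<in> D \<Longrightarrow> \<bar>m k x\<bar> \<le> B"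
  shows "\<exists>\<mu> :: (real ^ 'k) measure. centered_gaussian \<mu> \<and>
       (\<forall>j k. (LINT z|\<mu>. z $ j * z $ k) = \<sigma>2 * (LINT y:D|lborel. m j y * m k y)) \<and>
       converges_in_distribution (at_right 0) M (\<lambda>ep w. \<chi> k. osc_integral D q (m k) ep w) \<mu> (\<lambda>z. z) \<and>
       (\<forall>(N :: 'v measure) W. white_noise N W \<longrightarrow>
          distr N borel (\<lambda>w. \<chi> k. wiener_integral N W D (\<lambda>y. m k y * sqrt \<sigma>2) w) = \<mu>)"
proof -
  define S where "S j k = \<sigma>2 * (LINT y:D|lborel. m j y * m k y)" for j k
  have km: "(\<lambda>y. indicator D y * m k y) \<in> borel_measurable borel" for k
    using borel_measurable_continuous_on_indicator[OF _ m[of k]] D_open by simp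
  have sq: "square_integrable lborel (\<lambda>y. indicator D y * (indicator D y * m k y))" for k
    by (rule square_integrable_D(1)[OF km, where b = "\<bar>B\<bar>"]) (use B[of _ k] in \<open>auto simp: indicator_def intro: order_trans[OF _ abs_ge_self]\<close>)
  have mi: "integrable lborel (\<lambda>y. indicator D y * (m j y * m k y))" for j k
  proof -
    have "(indicator D y * (indicator D y * m j y)) * (indicator D y * (indicator D y * m k y)) = indicator D y * (m j y * m k y)" for y
      by (auto simp: indicator_def)
    with square_integrable_mult[OF sq[of j] sq[of k]] show ?thesis by (simp only:)
  qed
  have q: "quad_form S t t = \<sigma>2 * (LINT y:D|lborel. (\<Sum>k\<in>UNIV. t $ k * m k y)\<^sup>2)" for t
  proof -
    have "(LINT y:D|lborel. (\<Sum>k\<in>UNIV. t $ k * m k y)\<^sup>2) = (LINT y|lborel. (\<Sum>j\<in>UNIV. \<Sum>k\<in>UNIV. t $ j * t $ k * (indicator D y * (m j y * m k y))))"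
      unfolding set_lebesgue_integral_def power2_eq_square sum_product
      by (intro Bochner_Integration.integral_cong refl) (simp add: sum_distrib_left mult_ac)
    also have "\<dots> = (\<Sum>j\<in>UNIV. \<Sum>k\<in>UNIV. t $ j * t $ k * (LINT y|lborel. indicator D y * (m j y * m k y)))"
      using mi by simp
    finally show ?thesis
      by (simp add: quad_form_def S_def set_lebesgue_integral_def sum_distrib_left mult_ac)
  qed
  have S: "psd S"
    unfolding psd_def q
  proof (intro conjI allI)
    show "S j k = S k j" for j k by (simp add: S_def mult.commute)
    show "0 \<le> \<sigma>2 * (LINT y:D|lborel. (\<Sum>k\<in>UNIV. t $ k * m k y)\<^sup>2)" for t :: "real ^ 'k"
      using \<sigma>2_nonneg unfolding set_lebesgue_integral_def by (intro mult_nonneg_nonneg Bochner_Integration.integral_nonneg) auto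
  qed
  obtain \<mu> :: "(real ^ 'k) measure" where \<mu>: "prob_space \<mu>" "sets \<mu> = sets borel"
    and ch: "\<And>t. (CLINT z|\<mu>. iexp (t \<bullet> z)) = of_real (exp (- (quad_form S t t / 2)))"
    using gaussian_measure_exists[OF S] by blast
  note mom = gaussian_measure_moments[OF S \<mu> ch]
  note om = osc_second_moment[OF D_open D_bounded m B]
  let ?V = "\<lambda>ep w. \<chi> k. osc_integral D q (m k) ep w"
  have ip: "t \<bullet> ?V ep w = (\<Sum>k\<in>UNIV. t $ k * osc_integral D q (m k) ep w)" for t ep w by (simp add: inner_vec_def)
  have vec_measurable: "(\<lambda>w. \<chi> k. X k w) \<in> borel_measurable M'" if "\<And>k. X k \<in> borel_measurable M'" for X :: "'k \<Rightarrow> 'z \<Rightarrow> real" and M' :: "'z measure"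
    unfolding borel_measurable_euclidean_space[where 'c = "real ^ 'k"] using that by (auto simp: Basis_vec_def inner_axis)
  have Vm: "?V ep \<in> borel_measurable M" if "ep > 0" for ep
    by (rule vec_measurable) (use om(1)[OF _ that] in \<open>auto simp: square_integrable_def\<close>)
  have pos: "\<forall>\<^sub>F ep in at_right (0::real). ep > 0" by (rule eventually_at_right_less)
  have conv: "converges_in_distribution (at_right 0) M ?V \<mu> (\<lambda>z. z)"
  proof (rule converges_in_distributionI_char[OF _ \<mu>(1)])
    show "prob_space M" by (rule prob_space_axioms)
    show "(\<lambda>z. z) \<in> borel_measurable \<mu>" using \<mu>(2) by (simp add: measurable_ident_sets)
    show "\<forall>\<^sub>F ep in at_right 0. ?V ep \<in> borel_measurable M" using pos by eventually_elim (rule Vm)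
    fix t :: "real ^ 'k"
    let ?T = "\<lambda>y. \<Sum>k\<in>UNIV. t $ k * m k y"
    have Tc: "continuous_on D ?T" by (intro continuous_intros m)
    have Tb: "\<bar>?T x\<bar> \<le> (\<Sum>k\<in>UNIV. \<bar>t $ k\<bar> * B)" if "x \<in> D" for x
      by (rule combination_bound) (use B that in auto)
    have "((\<lambda>ep. CLINT w|M. iexp (osc_integral D q ?T ep w)) \<longlongrightarrow> of_real (exp (- (\<sigma>2 * (LINT y:D|lborel. (?T y)\<^sup>2) / 2)))) (at_right 0)"
      by (rule osc_char_tendsto[OF D_open D_bounded Tc Tb])
    then show "((\<lambda>ep. CLINT w|M. iexp (t \<bullet> ?V ep w)) \<longlongrightarrow> (CLINT z|\<mu>. iexp (t \<bullet> z))) (at_right 0)"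
      unfolding ch q
    proof (rule Lim_transform_eventually)
      show "\<forall>\<^sub>F ep in at_right 0. (CLINT w|M. iexp (osc_integral D q ?T ep w)) = (CLINT w|M. iexp (t \<bullet> ?V ep w))"
        using pos
      proof eventually_elim
        case (elim ep)
        note [measurable] = Vm[OF elim]
        have [measurable]: "osc_integral D q ?T ep \<in> borel_measurable M"
          using osc_second_moment(1)[OF D_open D_bounded Tc Tb elim] by (simp add: square_integrable_def)
        have ae: "AE w in M. t \<bullet> ?V ep w = osc_integral D q ?T ep w"
          unfolding ip by (rule osc_linear_AE[OF elim m B])
        show ?case
        proof (rule integral_cong_AE)
          show "AE w in M. iexp (osc_integral D q ?T ep w) = iexp (t \<bullet> ?V ep w)" using ae by eventually_elim simp
        qed measurable
      qed
    qed
  next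
    fix e :: real assume e: "e > 0"
    have n2: "(norm (?V ep w))\<^sup>2 = (\<Sum>k\<in>UNIV. (osc_integral D q (m k) ep w)\<^sup>2)" for ep w
      unfolding power2_norm_eq_inner inner_vec_def by (simp add: power2_eq_square)
    have si: "integrable M (\<lambda>w. (osc_integral D q (m k) ep w)\<^sup>2)" if "ep > 0" for ep k
      using om(1)[OF _ that] by (simp add: square_integrable_def)
    have ns: "square_integrable M (\<lambda>w. norm (?V ep w))" if "ep > 0" for ep
      unfolding square_integrable_def n2 using Vm[OF that] si[OF that] by auto
    have "\<exists>L. \<forall>\<^sub>F ep in at_right 0. \<P>(w in M. norm (norm (?V ep w)) > L) \<le> e"
    \<comment> \<open>The comparison variable is the norm itself, so the perturbation is zero and
      only the second moment bound is used.\<close>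
    proof (rule tight_perturbed[where X = "\<lambda>ep w. norm (?V ep w)" and B = "\<Sum>k\<in>(UNIV::'k set). B\<^sup>2 * measure lborel D * (LINT z|lborel. \<bar>R z\<bar>)"])
      show "(LINT w|M. (norm (?V ep w))\<^sup>2) \<le> (\<Sum>k\<in>(UNIV::'k set). B\<^sup>2 * measure lborel D * (LINT z|lborel. \<bar>R z\<bar>))" if "ep > 0" for ep
        unfolding n2 using si[OF that] om(2)[OF _ that] by (subst Bochner_Integration.integral_sum) (auto intro!: sum_mono simp del: sum_constant)
    qed (use ns e in \<open>auto simp: square_integrable_def\<close>)
    then show "\<exists>L. \<forall>\<^sub>F ep in at_right 0. \<P>(w in M. norm (?V ep w) > L) \<le> e" by simp
  qed
  \<comment> \<open>The factor \<sigma> in each integrand makes the variance of every linear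
    combination of Wiener integrals equal to the same quadratic form; uniqueness of characteristic
    functions identifies the laws.\<close>
  have repr: "distr N borel (\<lambda>w. \<chi> k. wiener_integral N W D (\<lambda>y. m k y * sqrt \<sigma>2) w) = \<mu>" if "white_noise N W" for N :: "'v measure" and W
  proof -
    interpret N: white_noise_space N W by unfold_locales fact
    let ?h = "\<lambda>k y. m k y * sqrt \<sigma>2"
    let ?X = "\<lambda>w. \<chi> k. wiener_integral N W D (?h k) w"
    have hm: "(\<lambda>x. indicator D x * ?h k x) \<in> borel_measurable borel" for k
      using borel_measurable_times[OF km[of k] borel_measurable_const[of "sqrt \<sigma>2"]] by (simp add: mult.assoc)
    have hB: "\<bar>?h k x\<bar> \<le> B * sqrt \<sigma>2" if "x \<in> D" for k x
      using B[OF that, of k] \<sigma>2_nonneg by (simp add: abs_mult mult_right_mono)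
    note wi = N.wiener_integral_char[of D ?h, OF hm hB D_finite]
    have [measurable]: "?X \<in> borel_measurable N" by (rule vec_measurable) (rule wi(1))
    show ?thesis
    proof (rule prob_measure_eqI_char[OF _ \<mu>(1) _ \<mu>(2)])
      show "prob_space (distr N borel ?X)" by (rule N.prob_space_distr) measurable
      fix t :: "real ^ 'k"
      have "(CLINT x|distr N borel ?X. iexp (t \<bullet> x)) = (CLINT w|N. iexp (t \<bullet> ?X w))" by (rule integral_distr) measurable
      also have "\<dots> = (CLINT w|N. iexp (\<Sum>k\<in>UNIV. t $ k * wiener_integral N W D (?h k) w))" by (simp add: inner_vec_def)
      also have "\<dots> = of_real (exp (- ((LINT x:D|lborel. (\<Sum>k\<in>UNIV. t $ k * ?h k x)\<^sup>2) / 2)))" by (rule wi(2))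
      also have "(LINT x:D|lborel. (\<Sum>k\<in>UNIV. t $ k * ?h k x)\<^sup>2) = quad_form S t t"
      proof -
        have "(\<Sum>k\<in>UNIV. t $ k * ?h k x)\<^sup>2 = \<sigma>2 * (\<Sum>k\<in>UNIV. t $ k * m k x)\<^sup>2" for x
          using \<sigma>2_nonneg by (simp add: mult.assoc[symmetric] sum_distrib_right[symmetric] power_mult_distrib)
        then show ?thesis by (simp add: q)
      qed
      finally show "(CLINT x|distr N borel ?X. iexp (t \<bullet> x)) = (CLINT x|\<mu>. iexp (t \<bullet> x))" unfolding ch .
    qed simp
  qed
  show ?thesis using mom conv repr by (intro exI[of _ \<mu>]) (auto simp: S_def)
qed

text \<open>\<open>X\<close> is the oscillatory integral with weight -G M' u0, \<open>Y\<close> the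
  tested and normalised correction, and \<open>Y - X\<close> is the remainder of the expansion.
  Convergence in probability of the remainder carries both the characteristic function and tightness
  from \<open>X\<close> to \<open>Y\<close>.\<close>

lemma perturbed_solution_converges:
  assumes \<rho>: "0 < \<rho>" "\<rho> < 1" and f: "f \<in> L2 D"
    and sol: "\<And>ep. ep > 0 \<Longrightarrow> perturbed_solution M D G q \<rho> f ep (u ep)"
    and M': "M' \<in> L2 D" and cont: "continuous_on D (\<lambda>y. green D G M' y * green D G f y)"
    and wn: "white_noise (N :: 'v measure) W"
  shows "converges_in_distribution (at_right 0)
      M (\<lambda>ep w. inner_L2 D (\<lambda>x. (u ep x w - green D G f x) / ep powr (real DIM('a) / 2)) M')
      N (\<lambda>w. - sqrt \<sigma>2 * wiener_integral N W D (\<lambda>y. green D G M' y * green D G f y) w)"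
proof -
  interpret N: white_noise_space N W by unfold_locales fact
  define u0 where "u0 = Gop f"
  define m' where "m' x = indicator D x * M' x" for x
  define g where "g = Gop m'"
  define ud where "ud ep w x = indicator D x * (u ep x w - green D G f x)" for ep w x
  define h where "h y = green D G M' y * green D G f y" for y
  define X where "X ep w = osc_integral D q (\<lambda>y. - h y) ep w" for ep w
  define Y where "Y ep w = inner_L2 D (\<lambda>x. (u ep x w - green D G f x) / ep powr (real DIM('a) / 2)) M'" for ep w
  have f': "square_integrable lborel (\<lambda>x. indicator D x * f x)" using f by (simp add: square_integrable_L2)
  have u0f: "u0 = Gop (\<lambda>x. indicator D x * f x)" unfolding u0_def by (intro ext Gop_cong) simp
  have u0m: "u0 \<in> borel_measurable borel" unfolding u0f using f' by (intro Gop_measurable) (auto simp: square_integrable_def)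
  have u0b: "\<bar>u0 x\<bar> \<le> sqrt C * l2norm lborel (\<lambda>x. indicator D x * f x)" for x unfolding u0f by (rule Gop_bound(1)[OF f'])
  have u0D: "indicator D x * u0 x = u0 x" for x by (cases "x \<in> D") (simp_all add: u0_def Gop_support)
  have u0s: "square_integrable lborel u0" using square_integrable_D(1)[OF u0m u0b] unfolding u0D .
  have ms: "square_integrable lborel m'" using M' by (simp add: square_integrable_L2 m'_def[abs_def])
  have gb: "\<bar>g x\<bar> \<le> sqrt C * l2norm lborel m'" for x unfolding g_def by (rule Gop_bound(1)[OF ms])
  have h_eq: "h y = g y * u0 y" if "y \<in> D" for y
    using that Gop_cong[of M' m' y] by (simp add: h_def green_eq u0_def g_def m'_def)
  define B where "B = (sqrt C * l2norm lborel m') * (sqrt C * l2norm lborel (\<lambda>x. indicator D x * f x))"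
  have hB: "\<bar>h y\<bar> \<le> B" if "y \<in> D" for y
    unfolding h_eq[OF that] abs_mult B_def using gb[of y] u0b[of y] by (intro mult_mono) auto
  have hc: "continuous_on D h" using cont by (simp add: h_def[abs_def])
  have X_eq: "X ep w = - (LINT y|lborel. Qf ep w y * u0 y * g y) / ep powr (real DIM('a) / 2)" for ep w
  proof -
    have "X ep w = (LINT y|lborel. (- (1 / ep powr (real DIM('a) / 2))) * (Qf ep w y * u0 y * g y))"
      unfolding X_def osc_integral_eq
      by (intro Bochner_Integration.integral_cong refl) (auto simp: Qf_def indicator_def h_eq)
    then show ?thesis by simp
  qed
  have Y_eq: "Y ep w = (LINT x|lborel. ud ep w x * m' x) / ep powr (real DIM('a) / 2)" for ep w
  proof -
    have "Y ep w = (LINT x|lborel. (1 / ep powr (real DIM('a) / 2)) * (ud ep w x * m' x))"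
      unfolding Y_def inner_L2_def set_lebesgue_integral_def
      by (intro Bochner_Integration.integral_cong refl) (auto simp: ud_def m'_def indicator_def)
    then show ?thesis by simp
  qed
  have Xs: "square_integrable M (X ep)" and Xb: "(LINT w|M. (X ep w)\<^sup>2) \<le> B\<^sup>2 * measure lborel D * (LINT z|lborel. \<bar>R z\<bar>)" if "ep > 0" for ep
    unfolding X_def using osc_second_moment[of D "\<lambda>y. - h y" B ep] D_open D_bounded hc hB that by (auto intro!: continuous_intros)
  \<comment> \<open>Joint measurability of the solution is given on D times the sample space, so the
    solution is first extended by zero; then the inner product is a parameter integral of a jointly
    measurable function.\<close>
  have Ym: "Y ep \<in> borel_measurable M" if ep: "ep > 0" for ep
  proof -
    have [measurable]: "(\<lambda>s. indicator (D \<times> space M) s *\<^sub>R (case s of (x, w) \<Rightarrow> u ep x w)) \<in> borel_measurable (lborel \<Otimes>\<^sub>M M)"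
      using sol[OF ep] by (simp add: perturbed_solution_def set_borel_measurable_def)
    have [measurable]: "m' \<in> borel_measurable borel" "u0 \<in> borel_measurable borel" using ms u0m by (auto simp: square_integrable_def)
    let ?F = "\<lambda>w x. (indicator (D \<times> space M) (x, w) *\<^sub>R (case (x, w) of (x, w) \<Rightarrow> u ep x w) - u0 x) * m' x"
    have "(\<lambda>w. (LINT x|lborel. ?F w x) / ep powr (real DIM('a) / 2)) \<in> borel_measurable M" by measurable
    moreover have "Y ep w = (LINT x|lborel. ?F w x) / ep powr (real DIM('a) / 2)" if "w \<in> space M" for w
    proof -
      have "ud ep w x * m' x = ?F w x" for x using that by (cases "x \<in> D") (simp_all add: ud_def m'_def green_eq u0_def)
      then show ?thesis by (simp only: Y_eq)
    qed
    ultimately show ?thesis by (subst measurable_cong) auto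
  qed
  have P: "((\<lambda>ep. \<P>(w in M. \<eta> < \<bar>Y ep w - X ep w\<bar>)) \<longlongrightarrow> 0) (at_right 0)" if \<eta>: "\<eta> > 0" for \<eta>
  proof -
    have "((\<lambda>ep. \<integral>\<^sup>+w. indicator {w. \<eta> < \<bar>((LINT x|lborel. ud ep w x * m' x) + (LINT y|lborel. Qf ep w y * u0 y * Gop m' y)) / ep powr (real DIM('a) / 2)\<bar>} w \<partial>M)
      \<longlongrightarrow> 0) (at_right 0)"
    proof (rule remainder_in_probability[OF _ ms u0s u0m u0b \<rho> _ \<eta>])
      show "0 \<le> \<Gamma> x y" for x y by (auto simp: \<Gamma>_eq G_nonneg indicator_def)
      show "AE w in M. HS (Qf ep w) \<le> ennreal (\<rho>\<^sup>2) \<longrightarrow> square_integrable lborel (ud ep w) \<and>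
        (AE x in lborel. ud ep w x = - Gop (\<lambda>y. Qf ep w y * u0 y) x + Gop (\<lambda>y. Qf ep w y * Gop (\<lambda>z. Qf ep w z * (u0 z + ud ep w z)) y) x)"
        if "ep > 0" for ep
        using perturbed_solution_expansion[OF sol[OF that] f less_imp_le[OF \<rho>(1)] that] unfolding ud_def u0_def .
    qed
    moreover have "\<forall>\<^sub>F ep in at_right 0. (\<integral>\<^sup>+w. indicator {w. \<eta> < \<bar>((LINT x|lborel. ud ep w x * m' x) + (LINT y|lborel. Qf ep w y * u0 y * Gop m' y)) / ep powr (real DIM('a) / 2)\<bar>} w \<partial>M)
      = ennreal (\<P>(w in M. \<eta> < \<bar>Y ep w - X ep w\<bar>))"
      using eventually_at_right_less[of "0::real"]
    proof eventually_elim
      case (elim ep)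
      note [measurable] = Ym[OF elim] square_integrableD[OF Xs[OF elim]]
      have d: "((LINT x|lborel. ud ep w x * m' x) + (LINT y|lborel. Qf ep w y * u0 y * Gop m' y)) / ep powr (real DIM('a) / 2) = Y ep w - X ep w" for w
        unfolding X_eq Y_eq g_def by (simp add: add_divide_distrib)
      have "(\<integral>\<^sup>+w. indicator {w. \<eta> < \<bar>Y ep w - X ep w\<bar>} w \<partial>M) = (\<integral>\<^sup>+w. indicator {w \<in> space M. \<eta> < \<bar>Y ep w - X ep w\<bar>} w \<partial>M)"
        by (intro nn_integral_cong) (simp add: indicator_def)
      also have "\<dots> = ennreal (\<P>(w in M. \<eta> < \<bar>Y ep w - X ep w\<bar>))"
        by (subst nn_integral_indicator) (auto simp: emeasure_eq_measure)
      finally show ?case unfolding d .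
    qed
    ultimately have "((\<lambda>ep. ennreal (\<P>(w in M. \<eta> < \<bar>Y ep w - X ep w\<bar>))) \<longlongrightarrow> ennreal 0) (at_right 0)"
      by (simp add: tendsto_cong)
    then show ?thesis by (subst (asm) tendsto_ennreal_iff) auto
  qed
  have Xc: "((\<lambda>ep. CLINT w|M. iexp (t * X ep w)) \<longlongrightarrow> of_real (exp (- (\<sigma>2 * (LINT y:D|lborel. (t * h y)\<^sup>2) / 2)))) (at_right 0)" for t
  proof -
    have "((\<lambda>ep. CLINT w|M. iexp (osc_integral D q (\<lambda>y. - t * h y) ep w)) \<longlongrightarrow> of_real (exp (- (\<sigma>2 * (LINT y:D|lborel. (- t * h y)\<^sup>2) / 2)))) (at_right 0)"
      by (rule osc_char_tendsto[OF D_open D_bounded, where B = "\<bar>t\<bar> * B"])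
        (auto simp: abs_mult intro!: continuous_intros hc mult_left_mono hB)
    moreover have "osc_integral D q (\<lambda>y. - t * h y) ep w = t * X ep w" for ep w
      unfolding X_def osc_integral_eq integral_mult_right_zero[symmetric] by (intro Bochner_Integration.integral_cong refl) simp
    ultimately show ?thesis by simp
  qed
  have hm: "(\<lambda>x. indicator D x * h x) \<in> borel_measurable borel"
    using borel_measurable_continuous_on_indicator[OF _ hc] D_open by simp
  \<comment> \<open>A single integrand is treated as a family over the one-element type.\<close>
  note wi = N.wiener_integral_char[of D "\<lambda>_::unit. h" B, OF hm hB D_finite]
  have Wc: "(CLINT w|N. iexp (t * (- sqrt \<sigma>2 * wiener_integral N W D h w))) = of_real (exp (- (\<sigma>2 * (LINT y:D|lborel. (t * h y)\<^sup>2) / 2)))" for t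
  proof -
    have "(CLINT w|N. iexp ((t * - sqrt \<sigma>2) * wiener_integral N W D h w)) = of_real (exp (- ((LINT x:D|lborel. ((t * - sqrt \<sigma>2) * h x)\<^sup>2) / 2)))"
      using wi(2)[of "\<lambda>_. t * - sqrt \<sigma>2"] by (simp add: UNIV_unit)
    moreover have "((t * - sqrt \<sigma>2) * h x)\<^sup>2 = \<sigma>2 * (t * h x)\<^sup>2" for x using \<sigma>2_nonneg by (simp add: power_mult_distrib)
    ultimately show ?thesis by (simp add: mult.assoc)
  qed
  have "converges_in_distribution (at_right 0) M Y N (\<lambda>w. - sqrt \<sigma>2 * wiener_integral N W D h w)"
  proof (rule converges_in_distributionI_char)
    show "prob_space M" "prob_space N" by (rule prob_space_axioms N.prob_space_axioms)+
    show "(\<lambda>w. - sqrt \<sigma>2 * wiener_integral N W D h w) \<in> borel_measurable N" using wi(1) by measurable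
    show "\<forall>\<^sub>F ep in at_right 0. Y ep \<in> borel_measurable M"
      using eventually_at_right_less[of "0::real"] by eventually_elim (rule Ym)
    show "((\<lambda>ep. CLINT w|M. iexp (t \<bullet> Y ep w)) \<longlongrightarrow> (CLINT w|N. iexp (t \<bullet> (- sqrt \<sigma>2 * wiener_integral N W D h w)))) (at_right 0)" for t
      unfolding inner_real_def Wc by (rule char_tendsto_perturbed[OF _ Ym Xc P]) (use Xs in \<open>auto simp: square_integrable_def\<close>)
    show "\<exists>L. \<forall>\<^sub>F ep in at_right 0. \<P>(w in M. norm (Y ep w) > L) \<le> e" if "e > 0" for e
      by (rule tight_perturbed[OF Xs Ym Xb P that]) simp_all
  qed
  then show ?thesis unfolding Y_def[abs_def] h_def[abs_def] .
qed

end

theorem theorem2p10: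
  fixes D :: "'a::euclidean_space set"
    and domP :: "('a \<Rightarrow> real) set"
    and P :: "('a \<Rightarrow> real) \<Rightarrow> ('a \<Rightarrow> real)"
    and G :: "'a \<Rightarrow> 'a \<Rightarrow> real"
    and M :: "'w measure"
    and q :: "'a \<Rightarrow> 'w \<Rightarrow> real"
    and \<rho> :: real
    and f :: "'a \<Rightarrow> real"
    and u :: "real \<Rightarrow> 'a \<Rightarrow> 'w \<Rightarrow> real"
    and Mk :: "'k::finite \<Rightarrow> 'a \<Rightarrow> real"
    and u0 :: "'a \<Rightarrow> real"
    and m :: "'k \<Rightarrow> 'a \<Rightarrow> real"
  assumes dim: "1 \<le> DIM('a)" "DIM('a) \<le> 3"
    and domain: "open D" "bounded D" "Ck_boundary 1 D"
    and operator: "elliptic_psido D domP P" "self_adjoint D domP P" "dirichlet_domain D domP"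
    and kernel: "green_function D domP P G" "admissible_kernel D G"
    and field: "random_field M q" "H2 M q"
    and rho: "0 < \<rho>" "\<rho> < 1"
    and event: "H3 M D G q \<rho>"
    and source: "f \<in> L2 D" "u0 = green D G f" "continuous_on D u0"
    and solution: "\<And>\<epsilon>. \<epsilon> > 0 \<Longrightarrow> perturbed_solution M D G q \<rho> f \<epsilon> (u \<epsilon>)"
    and test: "\<And>k. Mk k \<in> L2 D" "\<And>k. m k = m_fun D G u0 (Mk k)" "\<And>k. continuous_on D (m k)"
  shows "\<exists>\<sigma>::real. \<sigma> \<ge> 0 \<and> \<sigma>\<^sup>2 = (LINT y|lborel. correlation M q y) \<and>
    (\<exists>\<mu> :: (real ^ 'k) measure. centered_gaussian \<mu> \<and>
       (\<forall>j k. (LINT z|\<mu>. z $ j * z $ k) = \<sigma>\<^sup>2 * (LINT y:D|lborel. m j y * m k y)) \<and>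
       converges_in_distribution (at_right 0)
         M (\<lambda>\<epsilon> \<omega>. \<chi> k. osc_integral D q (m k) \<epsilon> \<omega>) \<mu> (\<lambda>z. z) \<and>
       (\<forall>(N :: 'v measure) W. white_noise N W \<longrightarrow>
          distr N borel (\<lambda>\<omega>. \<chi> k. wiener_integral N W D (\<lambda>y. m k y * \<sigma>) \<omega>) = \<mu>)) \<and>
    (\<forall>M'\<in>L2 D. continuous_on D (\<lambda>y. green D G M' y * u0 y) \<longrightarrow>
       (\<forall>(N :: 'v measure) W. white_noise N W \<longrightarrow>
          converges_in_distribution (at_right 0)
            M (\<lambda>\<epsilon> \<omega>. inner_L2 D (\<lambda>x. (u \<epsilon> x \<omega> - u0 x) / \<epsilon> powr (real DIM('a) / 2)) M')
            N (\<lambda>\<omega>. - \<sigma> * wiener_integral N W D (\<lambda>y. green D G M' y * green D G f y) \<omega>)))"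
proof -
  have Df: "D \<in> finite_borel" using domain emeasure_bounded_finite[OF domain(2)] by (simp add: finite_borel_def)
  obtain \<phi> where "stationary_field M q \<phi>" using stationary_field_exists[OF field] by blast
  then interpret stationary_field M q \<phi> .
  define \<Gamma> where "\<Gamma> x y = indicator D x * indicator D y * G x y" for x y
  obtain C where "green_kernel D \<Gamma> C" using green_kernel_exists[OF Df kernel(2)] unfolding \<Gamma>_def[abs_def] by blast
  then interpret green_kernel D \<Gamma> C .
  interpret perturbed_problem M q \<phi> D \<Gamma> C G
    by unfold_locales (use domain kernel(2) in \<open>auto simp: \<Gamma>_def admissible_kernel_def\<close>)
  \<comment> \<open>By symmetry of the kernel the weight is a product of two images of the Green
    operator, which turns its boundedness into that of the two factors.\<close>
  have mk: "m k y = - (Gop (Mk k) y * Gop f y)" if y: "y \<in> D" for k y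
  proof -
    have "(LINT x:D|lborel. Mk k x * G x y * u0 y) = (LINT x|lborel. u0 y * (\<Gamma> y x * Mk k x))"
      unfolding set_lebesgue_integral_def using y
      by (intro Bochner_Integration.integral_cong refl) (auto simp: \<Gamma>_def indicator_def G_sym)
    then show ?thesis using y by (simp add: test(2) m_fun_def source(2) green_eq Gop_def)
  qed
  \<comment> \<open>Continuity on the open set D does not bound the weights; the L^2 bound on the
    rows of the kernel does, and it is uniform up to the boundary.\<close>
  have Gb: "\<exists>b. \<forall>x. \<bar>Gop v x\<bar> \<le> b" if "v \<in> L2 D" for v
  proof -
    have "Gop v x = Gop (\<lambda>x. indicator D x * v x) x" for x by (rule Gop_cong) simp
    then show ?thesis using Gop_bound(1)[of "\<lambda>x. indicator D x * v x"] that by (auto simp: square_integrable_L2)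
  qed
  obtain b where b: "\<And>k x. \<bar>Gop (Mk k) x\<bar> \<le> b k" using Gb[OF test(1)] by metis
  obtain c where c: "\<And>x. \<bar>Gop f x\<bar> \<le> c" using Gb[OF source(1)] by metis
  have mB: "\<bar>m k y\<bar> \<le> (\<Sum>k\<in>UNIV. \<bar>b k\<bar> * \<bar>c\<bar>)" if y: "y \<in> D" for k y
  proof -
    have "\<bar>m k y\<bar> \<le> \<bar>b k\<bar> * \<bar>c\<bar>"
      unfolding mk[OF y] abs_minus_cancel abs_mult using b[of k y] c[of y] by (intro mult_mono) auto
    also have "\<dots> \<le> (\<Sum>k\<in>UNIV. \<bar>b k\<bar> * \<bar>c\<bar>)" by (rule member_le_sum) auto
    finally show ?thesis .
  qed
  have s: "(sqrt \<sigma>2)\<^sup>2 = \<sigma>2" using \<sigma>2_nonneg by simp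
  show ?thesis
  proof (intro exI[of _ "sqrt \<sigma>2"] conjI ballI impI allI)
    show "0 \<le> sqrt \<sigma>2" using \<sigma>2_nonneg by simp
    show "(sqrt \<sigma>2)\<^sup>2 = (LINT y|lborel. correlation M q y)" unfolding s by (simp add: \<sigma>2_def R_def)
    show "\<exists>\<mu> :: (real ^ 'k) measure. centered_gaussian \<mu> \<and>
       (\<forall>j k. (LINT z|\<mu>. z $ j * z $ k) = (sqrt \<sigma>2)\<^sup>2 * (LINT y:D|lborel. m j y * m k y)) \<and>
       converges_in_distribution (at_right 0)
         M (\<lambda>\<epsilon> \<omega>. \<chi> k. osc_integral D q (m k) \<epsilon> \<omega>) \<mu> (\<lambda>z. z) \<and>
       (\<forall>(N :: 'v measure) W. white_noise N W \<longrightarrow>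
          distr N borel (\<lambda>\<omega>. \<chi> k. wiener_integral N W D (\<lambda>y. m k y * sqrt \<sigma>2) \<omega>) = \<mu>)"
      unfolding s by (rule osc_vector_converges[OF test(3) mB])
    fix M' and N :: "'v measure" and W :: "'a set \<Rightarrow> 'v \<Rightarrow> real"
    assume M': "M' \<in> L2 D" and cont: "continuous_on D (\<lambda>y. green D G M' y * u0 y)" and wn: "white_noise N W"
    show "converges_in_distribution (at_right 0)
            M (\<lambda>\<epsilon> \<omega>. inner_L2 D (\<lambda>x. (u \<epsilon> x \<omega> - u0 x) / \<epsilon> powr (real DIM('a) / 2)) M')
            N (\<lambda>\<omega>. - sqrt \<sigma>2 * wiener_integral N W D (\<lambda>y. green D G M' y * green D G f y) \<omega>)"
      using cont unfolding source(2) by (intro perturbed_solution_converges[OF rho source(1) solution M' _ wn])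
  qed
qed
end
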